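(* Let $h:[-1,1]\to[0,+\infty]$ be absolutely monotone on $[-1,1]$ (continuous, finite on $[-1,1)$, with $h^{(j)}\ge0$ on $[-1,1)$ for all $j\ge 0$). For each code $C\subset\mathbb{S}^{n-1}$ below there exists $\widetilde{x}\in\mathbb{S}^{n-1}$ such that the inner products $\widetilde{x}\cdot y$, $y\in C$, take exactly the listed values with the listed multiplicities, and $\inf_{x\in\mathbb{S}^{n-1}}\sum_{y\in C}h(x\cdot y)=\sum_{y\in C}h(\widetilde{x}\cdot y)$, i.e. equals the corresponding sum: (a) $C$ = the 12 vertices of a regular icosahedron inscribed in $\mathbb{S}^2$: the values $\pm\sqrt{(1+2/\sqrt5)/3}$, $\pm\sqrt{(1-2/\sqrt5)/3}$, each with multiplicity $3$; (b) $C$ = the 20 vertices of a regular dodecahedron inscribed in $\mathbb{S}^2$: the same four values, each with multiplicity $5$; (c) $C\subset\mathbb{S}^7$ the 240 points consisting of all $(\pm1/\sqrt8,\dots,\pm1/\sqrt8)$ with an even number of minus signs and all vectors with exactly two nonzero coordinates, each equal to $\pm1/\sqrt2$: the values $-\sqrt2/2,-\sqrt2/4,0,\sqrt2/4,\sqrt2/2$ with multiplicities $14,64,84,64,14$; (d) $C\subset\mathbb{S}^{23}$ the 196560 minimal vectors of the Leech lattice scaled to unit length: the values $-\sqrt6/4,-\sqrt6/6,-\sqrt6/12,0,\sqrt6/12,\sqrt6/6,\sqrt6/4$ with multiplicities $552,11178,48600,75900,48600,11178,552$. *)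

theory Defs
  imports "HOL-Analysis.Analysis" "HOL-Library.Multiset"
begin

definition absolutely_monotone :: "(real \<Rightarrow> ereal) \<Rightarrow> bool" where
  "absolutely_monotone h \<longleftrightarrow>
     continuous_on {-1..1} h \<and>
     (\<forall>t\<in>{-1..1}. 0 \<le> h t) \<and>
     (\<forall>t\<in>{-1..<1}. h t \<noteq> \<infinity>) \<and>
     (\<exists>D :: nat \<Rightarrow> real \<Rightarrow> real.
        (\<forall>t\<in>{-1..<1}. D 0 t = real_of_ereal (h t)) \<and>
        (\<forall>j. \<forall>t\<in>{-1..<1}.
            (D j has_real_derivative D (Suc j) t) (at t within {-1..<1}) \<and> 0 \<le> D j t))"

definition min_at_listed_point ::
  "(real \<Rightarrow> ereal) \<Rightarrow> ('a::real_inner) set \<Rightarrow> real multiset \<Rightarrow> bool" where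
  "min_at_listed_point h C M \<longleftrightarrow>
     (\<exists>xt\<in>sphere 0 1.
        image_mset (\<lambda>y. xt \<bullet> y) (mset_set C) = M \<and>
        (INF x\<in>sphere 0 1. \<Sum>y\<in>C. h (x \<bullet> y)) = (\<Sum>y\<in>C. h (xt \<bullet> y)))"

definition golden :: real where "golden = (1 + sqrt 5) / 2"

definition icosahedron_std :: "(real^3) set" where
  "icosahedron_std = (\<lambda>v. (1 / sqrt (1 + golden\<^sup>2)) *\<^sub>R v) `
     ({vector [0, a, b * golden] | a b. a \<in> {-1, 1} \<and> b \<in> {-1, 1}} \<union>
      {vector [a, b * golden, 0] | a b. a \<in> {-1, 1} \<and> b \<in> {-1, 1}} \<union>
      {vector [b * golden, 0, a] | a b. a \<in> {-1, 1} \<and> b \<in> {-1, 1}})"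

definition dodecahedron_std :: "(real^3) set" where
  "dodecahedron_std = (\<lambda>v. (1 / sqrt 3) *\<^sub>R v) `
     ({vector [a, b, c] | a b c. a \<in> {-1, 1} \<and> b \<in> {-1, 1} \<and> c \<in> {-1, 1}} \<union>
      {vector [0, a / golden, b * golden] | a b. a \<in> {-1, 1} \<and> b \<in> {-1, 1}} \<union>
      {vector [a / golden, b * golden, 0] | a b. a \<in> {-1, 1} \<and> b \<in> {-1, 1}} \<union>
      {vector [b * golden, 0, a / golden] | a b. a \<in> {-1, 1} \<and> b \<in> {-1, 1}})"

definition E8_code :: "(real^8) set" where
  "E8_code =
     {v. (\<forall>i. v $ i = 1 / sqrt 8 \<or> v $ i = - 1 / sqrt 8) \<and> even (card {i. v $ i < 0})} \<union>
     {v. card {i. v $ i \<noteq> 0} = 2 \<and>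
         (\<forall>i. v $ i = 0 \<or> v $ i = 1 / sqrt 2 \<or> v $ i = - 1 / sqrt 2)}"

text \<open>The Leech lattice is characterised (up to isometry) as the even unimodular lattice in
  R^24 without vectors of norm 2. A lattice is given by a basis b; unimodular means that the
  Gram matrix has determinant 1.\<close>
definition lattice_of :: "('n::finite \<Rightarrow> real^'n) \<Rightarrow> (real^'n) set" where
  "lattice_of b = {\<Sum>i\<in>UNIV. of_int (k i) *\<^sub>R b i | k :: 'n \<Rightarrow> int. True}"

definition leech_basis :: "(24 \<Rightarrow> real^24) \<Rightarrow> bool" where
  "leech_basis b \<longleftrightarrow>
     det (\<chi> i j. b i \<bullet> b j) = 1 \<and>
     (\<forall>v\<in>lattice_of b. \<exists>m::int. v \<bullet> v = 2 * of_int m) \<and>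
     (\<forall>v\<in>lattice_of b. v \<bullet> v \<noteq> 2)"

text \<open>Minimal vectors (norm 4) of the lattice, scaled to unit length.\<close>
definition leech_code :: "(24 \<Rightarrow> real^24) \<Rightarrow> (real^24) set" where
  "leech_code b = (\<lambda>v. (1/2) *\<^sub>R v) ` {v \<in> lattice_of b. v \<bullet> v = 4}"

end

(* An absolutely monotone h is a power series with nonnegative coefficients, so for an antipodal
   code it suffices that every even power sum x |-> sum_y (x . y)^(2k) is minimal at the listed
   point.  These sums are compared by Hermite interpolation of u^k (u = (x . y)^2) at the listed
   squared inner products, which only needs the first few power sums to be constant (design property)
   and one further inequality.

   For the icosahedron and the dodecahedron this is a computation with degree six polynomials.
   The E8 and Leech codes are shells of an even unimodular lattice L.  Poisson summation gives the
   theta function of L with a plane wave inserted; comparing its expansions for two directions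
   yields modular forms which vanish to order r at the cusp, hence vanish.  This is Venkov's
   theorem on the design strength of shells, and in the first degree beyond the strength
   (a quasimodular situation of weight 12 r + 2) it still determines the missing moment up to an
   affine relation, which is exactly what the interpolation needs.  The multiplicities follow by
   solving the linear moment equations for the inner products with a vector of the next shell. *)
theory Submission
  imports Defs "HOL-Probability.Probability" "HOL-Complex_Analysis.Complex_Analysis"
    "HOL-Real_Asymp.Real_Asymp"
begin

no_notation fps_nth (infixl "$" 75)

subsection \<open>Power series of absolutely monotone functions\<close>

text \<open>Nodes are double at each positive squared inner product and, where 0 occurs, simple at
  0, since u >= 0 makes a sign change there harmless. The interpolant of \<open>u ^ k\<close> then
  has one degree in u more than the design property controls. Its top coefficient is nonnegative, so
  a single moment has to be minimal at the listed point. For the solids this is the sixth moment.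
  For the lattices, the node polynomial has nonnegative sum in every direction and sum zero at the
  listed point; the affine relation between the two top moments turns this into the wanted
  inequality, provided the nodes add up to less than the constant of that relation. Modularity comes
  from comparing two directions: in the lowest degree where their moments could differ, the
  difference transforms like a modular form, since the Gaussian factor of Poisson summation acts
  only two degrees higher. The Leech lattice is given as even, unimodular and without vectors of
  norm 2, so the existence of vectors of norms 4 and 6 and the number 196560 have to come out of
  moment computations too.\<close>

lemma taylor_remainder_bounds:
  fixes D :: "nat \<Rightarrow> real \<Rightarrow> real"
  defines "R \<equiv> (\<lambda>n j t. D j t - (\<Sum>i<n. D (j + i) 0 * t ^ i / fact i))"
  assumes der: "\<And>j t. \<bar>t\<bar> < 1 \<Longrightarrow> (D j has_real_derivative D (Suc j) t) (at t)"
    and nonneg: "\<And>j t. \<bar>t\<bar> < 1 \<Longrightarrow> 0 \<le> D j t"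
    and s: "0 \<le> s" "s < 1"
  shows "0 \<le> l \<Longrightarrow> l \<le> 1 \<Longrightarrow> R n j (l * s) \<le> l ^ n * R n j s"
    and "\<bar>R n j (- s)\<bar> \<le> R n j s"
proof -
  have der_poly: "((\<lambda>t. \<Sum>i<Suc n. D (j + i) 0 * t ^ i / fact i) has_real_derivative (\<Sum>i<n. D (Suc j + i) 0 * t ^ i / fact i)) (at t)" for n j t
  proof -
    have "((\<lambda>t. D (j + Suc i) 0 * t ^ Suc i / fact (Suc i)) has_real_derivative D (Suc j + i) 0 * t ^ i / fact i) (at t)" for i
    proof -
      have "((\<lambda>t. D (j + Suc i) 0 * t ^ Suc i / fact (Suc i)) has_real_derivative D (j + Suc i) 0 * (real (Suc i) * t ^ i) / fact (Suc i)) (at t)"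
      proof -
        have "((\<lambda>t. t ^ Suc i) has_real_derivative real (Suc i) * t ^ i) (at t)"
          using DERIV_pow[of "Suc i" t UNIV] by (simp del: of_nat_Suc power_Suc)
        thus ?thesis by (intro DERIV_cdivide DERIV_cmult)
      qed
      moreover have "D (j + Suc i) 0 * (real (Suc i) * t ^ i) / fact (Suc i) = D (Suc j + i) 0 * t ^ i / fact i"
      proof -
        have "D (j + Suc i) 0 * (real (Suc i) * t ^ i) / (real (Suc i) * fact i) = D (j + Suc i) 0 * t ^ i / fact i"
          by (simp del: of_nat_Suc)
        thus ?thesis by (simp only: fact_Suc of_nat_mult of_nat_fact add_Suc add_Suc_right)
      qed
      ultimately show ?thesis by simp
    qed
    hence "((\<lambda>t. D j 0 + (\<Sum>i<n. D (j + Suc i) 0 * t ^ Suc i / fact (Suc i))) has_real_derivative 0 + (\<Sum>i<n. D (Suc j + i) 0 * t ^ i / fact i)) (at t)"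
      by (intro DERIV_add DERIV_const DERIV_sum)
    thus ?thesis by (simp add: sum.lessThan_Suc_shift del: sum.lessThan_Suc)
  qed
  have derR: "(R (Suc n) j has_real_derivative R n (Suc j) t) (at t)" if "\<bar>t\<bar> < 1" for n j t
    unfolding R_def by (intro DERIV_diff der that der_poly)
  have R0: "R (Suc n) j 0 = 0" for n j
    by (simp add: R_def sum.lessThan_Suc_shift del: sum.lessThan_Suc)
  have mono: "D j a \<le> D j b" if "a \<le> b" "\<bar>a\<bar> < 1" "\<bar>b\<bar> < 1" for a b j
  proof (rule DERIV_nonneg_imp_nondecreasing[OF that(1)])
    fix x assume "a \<le> x" "x \<le> b"
    hence "\<bar>x\<bar> < 1" using that by auto
    thus "\<exists>y. (D j has_real_derivative y) (at x) \<and> 0 \<le> y" using der nonneg by blast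
  qed
  \<comment> \<open>Induction on the order: a remainder of order \<open>Suc n\<close> vanishes at 0
    and its derivative is the remainder of order \<open>n\<close> of the next derivative, so the
    inequality is inherited by monotonicity. The chain rule supplies the additional factor
    \<open>l\<close>.\<close>
  have A: "R n j (l * s) \<le> l ^ n * R n j s" if l: "0 \<le> l" "l \<le> 1" and "0 \<le> s" "s < 1" for n j l s
    using that(3,4)
  proof (induction n arbitrary: j s)
    case 0
    have "l * s \<le> 1 * s" using l 0 by (intro mult_right_mono) auto
    moreover have "l * s \<ge> 0" using l 0 by simp
    ultimately show ?case using mono[of "l * s" s j] 0 by (simp add: R_def)
  next
    case (Suc n)
    let ?g = "\<lambda>x. l ^ Suc n * R (Suc n) j x - R (Suc n) j (l * x)"
    have "?g 0 \<le> ?g s"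
    proof (rule DERIV_nonneg_imp_nondecreasing[OF Suc.prems(1)])
      fix x assume x: "0 \<le> x" "x \<le> s"
      have x1: "\<bar>x\<bar> < 1" using x Suc.prems by auto
      have "l * x \<le> 1 * x" using l x by (intro mult_right_mono) auto
      hence lx: "\<bar>l * x\<bar> < 1" using l x x1 by (simp add: abs_mult)
      have "((\<lambda>x. R (Suc n) j (l * x)) has_real_derivative R n (Suc j) (l * x) * l) (at x)"
        by (rule DERIV_chain2[where f = "R (Suc n) j" and g = "\<lambda>x. l * x", OF derR[OF lx]]) (auto intro!: derivative_eq_intros)
      hence "(?g has_real_derivative l ^ Suc n * R n (Suc j) x - R n (Suc j) (l * x) * l) (at x)"
        by (intro DERIV_diff DERIV_cmult derR x1)
      moreover have "l ^ Suc n * R n (Suc j) x - R n (Suc j) (l * x) * l = l * (l ^ n * R n (Suc j) x - R n (Suc j) (l * x))"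
        by (simp add: algebra_simps)
      moreover have "\<dots> \<ge> 0" using Suc.IH[of x "Suc j"] x Suc.prems l by simp
      ultimately show "\<exists>y. (?g has_real_derivative y) (at x) \<and> 0 \<le> y" by metis
    qed
    thus ?case by (simp add: R0)
  qed
  show "0 \<le> l \<Longrightarrow> l \<le> 1 \<Longrightarrow> R n j (l * s) \<le> l ^ n * R n j s" using A s by blast
  have B: "\<bar>R n j (- s)\<bar> \<le> R n j s" if "0 \<le> s" "s < 1" for n j s
    using that
  proof (induction n arbitrary: j s)
    case 0
    thus ?case using mono[of "-s" s j] nonneg[of "-s" j] by (simp add: R_def)
  next
    case (Suc n)
    \<comment> \<open>The signs \<open>c = 1\<close> and \<open>c = -1\<close> give the two halves
      of the absolute value.\<close>
    have g: "R (Suc n) j 0 + c * R (Suc n) j (- 0) \<le> R (Suc n) j s + c * R (Suc n) j (- s)" if c: "c = 1 \<or> c = -1" for c :: real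
    proof (rule DERIV_nonneg_imp_nondecreasing[OF Suc.prems(1)])
      fix x assume x: "0 \<le> x" "x \<le> s"
      have x1: "\<bar>x\<bar> < 1" "\<bar>- x\<bar> < 1" using x Suc.prems by auto
      have "((\<lambda>x. R (Suc n) j (- x)) has_real_derivative R n (Suc j) (- x) * (-1)) (at x)"
        by (rule DERIV_chain2[where f = "R (Suc n) j" and g = uminus, OF derR[OF x1(2)]]) (auto intro!: derivative_eq_intros)
      hence "((\<lambda>x. R (Suc n) j x + c * R (Suc n) j (- x)) has_real_derivative R n (Suc j) x + c * (R n (Suc j) (- x) * (-1))) (at x)"
        by (intro DERIV_add DERIV_cmult derR x1(1))
      moreover have "R n (Suc j) x + c * (R n (Suc j) (- x) * (-1)) \<ge> 0"
        using Suc.IH[of x "Suc j"] x Suc.prems c by auto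
      ultimately show "\<exists>y. ((\<lambda>x. R (Suc n) j x + c * R (Suc n) j (- x)) has_real_derivative y) (at x) \<and> 0 \<le> y" by metis
    qed
    from g[of 1] g[of "-1"] show ?case by (simp add: R0)
  qed
  show "\<bar>R n j (- s)\<bar> \<le> R n j s" using B s by blast
qed

text \<open>Bernstein's theorem. For s strictly between |t| and 1, the remainder at t is at most
  (|t| / s)^n times the remainder at s, and the latter stays below \<open>D 0 s\<close> because the
  Taylor terms at s are nonnegative. A negative t is compared with |t|.\<close>

theorem absolutely_monotone_power_series:
  fixes D :: "nat \<Rightarrow> real \<Rightarrow> real"
  assumes der: "\<And>j t. \<bar>t\<bar> < 1 \<Longrightarrow> (D j has_real_derivative D (Suc j) t) (at t)"
    and nonneg: "\<And>j t. \<bar>t\<bar> < 1 \<Longrightarrow> 0 \<le> D j t"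
    and t: "\<bar>t\<bar> < 1"
  shows "(\<lambda>i. D i 0 / fact i * t ^ i) sums D 0 t"
proof -
  define R where "R = (\<lambda>n j t. D j t - (\<Sum>i<n. D (j + i) 0 * t ^ i / fact i))"
  define s where "s = (1 + \<bar>t\<bar>) / 2"
  have s: "0 < s" "s < 1" "\<bar>t\<bar> < s" using t by (auto simp: s_def)
  define l where "l = \<bar>t\<bar> / s"
  have l: "0 \<le> l" "l < 1" "l * s = \<bar>t\<bar>" using s by (auto simp: l_def)
  have "\<bar>R n 0 t\<bar> \<le> l ^ n * D 0 s" for n
  proof -
    have "\<bar>R n 0 (- \<bar>t\<bar>)\<bar> \<le> R n 0 \<bar>t\<bar>"
      using taylor_remainder_bounds(2)[where D = D and s = "\<bar>t\<bar>" and n = n and j = 0, OF der nonneg] t unfolding R_def by simp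
    hence "\<bar>R n 0 t\<bar> \<le> R n 0 \<bar>t\<bar>" by (cases "t \<ge> 0") auto
    also have "\<dots> \<le> l ^ n * R n 0 s"
      using taylor_remainder_bounds(1)[where D = D and s = s and l = l and n = n and j = 0, OF der nonneg] s l unfolding R_def by simp
    also have "\<dots> \<le> l ^ n * D 0 s"
    proof -
      have "(\<Sum>i<n. D (0 + i) 0 * s ^ i / fact i) \<ge> 0"
        using s nonneg[of 0] by (intro sum_nonneg) auto
      thus ?thesis using l by (intro mult_left_mono) (auto simp: R_def)
    qed
    finally show ?thesis .
  qed
  moreover have "(\<lambda>n. l ^ n * D 0 s) \<longlonglongrightarrow> 0"
    using l by (intro tendsto_mult_left_zero LIMSEQ_power_zero) auto
  ultimately have "(\<lambda>n. R n 0 t) \<longlonglongrightarrow> 0"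
    by (intro Lim_null_comparison[of "\<lambda>n. R n 0 t" "\<lambda>n. l ^ n * D 0 s"]) auto
  from tendsto_diff[OF tendsto_const[of "D 0 t"] this] show ?thesis
    by (simp add: R_def sums_def)
qed

text \<open>The sign hypothesis excludes sums of opposite infinities, where addition of extended
  reals is not continuous; the limits themselves may be infinite.\<close>

lemma tendsto_sum_ereal_nonneg:
  fixes f :: "'i \<Rightarrow> 'b \<Rightarrow> ereal"
  assumes "finite S" "\<And>i. i \<in> S \<Longrightarrow> (f i \<longlongrightarrow> a i) F" "\<And>i. i \<in> S \<Longrightarrow> 0 \<le> a i"
  shows "((\<lambda>x. \<Sum>i\<in>S. f i x) \<longlongrightarrow> (\<Sum>i\<in>S. a i)) F"
  using assms
proof (induction S rule: finite_induct)
  case (insert i S)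
  have "a i \<ge> 0" "(\<Sum>i\<in>S. a i) \<ge> 0" using insert by (auto intro: sum_nonneg)
  hence "((\<lambda>x. f i x + (\<Sum>i\<in>S. f i x)) \<longlongrightarrow> a i + (\<Sum>i\<in>S. a i)) F"
    using insert by (intro tendsto_add_ereal_nonneg) auto
  thus ?case using insert by simp
qed simp

text \<open>\<open>h\<close> may be infinite at 1, so power series are compared for
  \<open>h (r * t)\<close> with r < 1, where every value is finite; r -> 1 is taken in the extended
  reals by continuity of \<open>h\<close>. Odd power sums vanish by antipodality, which is why only
  powers of squares enter.\<close>

lemma min_at_listed_pointI:
  fixes C :: "('a::real_inner) set"
  assumes h: "absolutely_monotone h" and C: "finite C" "C \<subseteq> sphere 0 1" and xt: "xt \<in> sphere 0 1"
    and anti: "\<And>y. y \<in> C \<Longrightarrow> - y \<in> C"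
    and mult: "image_mset (\<lambda>y. xt \<bullet> y) (mset_set C) = M"
    and even: "\<And>x k. x \<in> sphere 0 1 \<Longrightarrow> (\<Sum>y\<in>C. ((xt \<bullet> y)\<^sup>2) ^ k) \<le> (\<Sum>y\<in>C. ((x \<bullet> y)\<^sup>2) ^ k)"
  shows "min_at_listed_point h C M"
proof -
  obtain D :: "nat \<Rightarrow> real \<Rightarrow> real" where D0: "\<And>t. t \<in> {-1..<1} \<Longrightarrow> D 0 t = real_of_ereal (h t)"
    and D1: "\<And>j t. t \<in> {-1..<1} \<Longrightarrow> (D j has_real_derivative D (Suc j) t) (at t within {-1..<1})"
    and D2: "\<And>j t. t \<in> {-1..<1} \<Longrightarrow> 0 \<le> D j t"
    and hc: "continuous_on {-1..1} h" and h0: "\<And>t. t \<in> {-1..1} \<Longrightarrow> 0 \<le> h t"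
    and hfin: "\<And>t. t \<in> {-1..<1} \<Longrightarrow> h t \<noteq> \<infinity>"
    using h unfolding absolutely_monotone_def by blast
  have der: "(D j has_real_derivative D (Suc j) t) (at t)" if "\<bar>t\<bar> < 1" for j t
  proof -
    have t: "t \<in> {-1..<1}" using that by auto
    have "t \<in> interior {-1..<1::real}" using that by (auto simp: interior_atLeastLessThan)
    hence "at t within {-1..<1} = at t" by (rule at_within_interior)
    thus ?thesis using D1[OF t, of j] by simp
  qed
  have nn: "0 \<le> D j t" if "\<bar>t\<bar> < 1" for j t
  proof -
    have "t \<in> {-1..<1}" using that by auto
    thus ?thesis by (rule D2)
  qed
  define c where "c = (\<lambda>i. D i 0 / fact i)"
  have c0: "c i \<ge> 0" for i using nn[of 0 i] by (simp add: c_def)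
  have hD: "h t = ereal (D 0 t)" if "\<bar>t\<bar> < 1" for t
  proof -
    have t: "t \<in> {-1..<1}" "t \<in> {-1..1}" using that by auto
    show ?thesis using D0[OF t(1)] hfin[OF t(1)] h0[OF t(2)] by (cases "h t") auto
  qed
  have inC: "\<bar>x \<bullet> y\<bar> \<le> 1" if "x \<in> sphere 0 1" "y \<in> C" for x y
    using Cauchy_Schwarz_ineq2[of x y] that C by auto
  have odd0: "(\<Sum>y\<in>C. (x \<bullet> y) ^ k) = 0" if "odd k" for x k
  proof -
    have "(\<Sum>y\<in>C. (x \<bullet> y) ^ k) = (\<Sum>y\<in>C. (x \<bullet> (- y)) ^ k)"
      by (rule sum.reindex_bij_witness[of _ uminus uminus]) (use anti in auto)
    also have "\<dots> = - (\<Sum>y\<in>C. (x \<bullet> y) ^ k)" using that by (simp add: sum_negf)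
    finally show ?thesis by simp
  qed
  have pow: "(\<Sum>y\<in>C. (xt \<bullet> y) ^ k) \<le> (\<Sum>y\<in>C. (x \<bullet> y) ^ k)" if "x \<in> sphere 0 1" for x k
  proof (cases "Parity.even k")
    case True
    then obtain j where "k = 2 * j" by (elim evenE)
    thus ?thesis using even[OF that, of j] by (simp add: power_mult)
  qed (simp add: odd0)
  have scaled: "(\<Sum>y\<in>C. h (r * (xt \<bullet> y))) \<le> (\<Sum>y\<in>C. h (r * (x \<bullet> y)))"
    if x: "x \<in> sphere 0 1" and r: "0 < r" "r < 1" for x r
  proof -
    have lt: "\<bar>r * (z \<bullet> y)\<bar> < 1" if "z \<in> sphere 0 1" "y \<in> C" for z y
    proof -
      have "r * \<bar>z \<bullet> y\<bar> \<le> r * 1" using inC[OF that] r by (intro mult_left_mono) auto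
      hence "r * \<bar>z \<bullet> y\<bar> < 1" using r by linarith
      thus ?thesis using r by (simp add: abs_mult)
    qed
    have sm: "(\<lambda>i. c i * r ^ i * (\<Sum>y\<in>C. (z \<bullet> y) ^ i)) sums (\<Sum>y\<in>C. D 0 (r * (z \<bullet> y)))"
      if z: "z \<in> sphere 0 1" for z
    proof -
      have "(\<lambda>i. \<Sum>y\<in>C. c i * (r * (z \<bullet> y)) ^ i) sums (\<Sum>y\<in>C. D 0 (r * (z \<bullet> y)))"
        unfolding c_def by (intro sums_sum absolutely_monotone_power_series[where D = D, OF der nn] lt z)
      thus ?thesis by (simp add: sum_distrib_left power_mult_distrib mult.assoc)
    qed
    have "(\<Sum>y\<in>C. D 0 (r * (xt \<bullet> y))) \<le> (\<Sum>y\<in>C. D 0 (r * (x \<bullet> y)))"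
      by (rule sums_le[OF _ sm[OF xt] sm[OF x]]) (use c0 r pow[OF x] in \<open>auto intro!: mult_left_mono\<close>)
    thus ?thesis using hD lt xt x by simp
  qed
  have main: "(\<Sum>y\<in>C. h (xt \<bullet> y)) \<le> (\<Sum>y\<in>C. h (x \<bullet> y))" if x: "x \<in> sphere 0 1" for x
  proof -
    define r where "r = (\<lambda>n::nat. 1 - 1 / (real n + 2))"
    have r: "0 < r n" "r n < 1" for n by (auto simp: r_def field_simps)
    have rlim: "r \<longlonglongrightarrow> 1" unfolding r_def by real_asymp
    have lim: "(\<lambda>n. \<Sum>y\<in>C. h (r n * (z \<bullet> y))) \<longlonglongrightarrow> (\<Sum>y\<in>C. h (z \<bullet> y))" if z: "z \<in> sphere 0 1" for z
    proof -
      have one: "(\<lambda>n. h (r n * (z \<bullet> y))) \<longlonglongrightarrow> h (z \<bullet> y)" and nn: "0 \<le> h (r n * (z \<bullet> y))" "0 \<le> h (z \<bullet> y)" if y: "y \<in> C" for y n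
      proof -
        have b: "r n * (z \<bullet> y) \<in> {-1..1}" for n
        proof -
          have "\<bar>r n * (z \<bullet> y)\<bar> \<le> 1 * 1" unfolding abs_mult
            using inC[OF z y] r[of n] by (intro mult_mono) auto
          thus ?thesis by (simp add: abs_le_iff)
        qed
        have "(\<lambda>n. r n * (z \<bullet> y)) \<longlonglongrightarrow> z \<bullet> y" using tendsto_mult_right[OF rlim, of "z \<bullet> y"] by simp
        thus "(\<lambda>n. h (r n * (z \<bullet> y))) \<longlonglongrightarrow> h (z \<bullet> y)"
          by (rule continuous_on_tendsto_compose[OF hc]) (use inC[OF z y] b in auto)
        show "0 \<le> h (r n * (z \<bullet> y))" "0 \<le> h (z \<bullet> y)" using h0 b inC[OF z y] by (auto simp: abs_le_iff)
      qed
      show ?thesis by (rule tendsto_sum_ereal_nonneg[OF C(1) one nn(2)])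
    qed
    show ?thesis using LIMSEQ_le[OF lim[OF xt] lim[OF x]] scaled[OF x r] by blast
  qed
  show ?thesis unfolding min_at_listed_point_def
  proof (intro bexI[OF _ xt] conjI mult antisym)
    show "(INF x\<in>sphere 0 1. \<Sum>y\<in>C. h (x \<bullet> y)) \<le> (\<Sum>y\<in>C. h (xt \<bullet> y))" by (rule INF_lower[OF xt])
    show "(\<Sum>y\<in>C. h (xt \<bullet> y)) \<le> (INF x\<in>sphere 0 1. \<Sum>y\<in>C. h (x \<bullet> y))" by (rule INF_greatest) (rule main)
  qed
qed

subsection \<open>Polynomial interpolation in the squared inner products\<close>

text \<open>Horner's scheme: the coefficients of the quotient are the values at \<open>c\<close> of
  the polynomials obtained from \<open>p\<close> by dropping low-order coefficients and shifting
  down.\<close>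

lemma synthetic_div_nonneg:
  fixes p :: "real poly"
  assumes "\<And>i. coeff p i \<ge> 0" "c \<ge> 0"
  shows "coeff (synthetic_div p c) i \<ge> 0" and "t \<ge> 0 \<Longrightarrow> poly p t \<ge> 0"
proof -
  have nn: "poly q s \<ge> 0" if "\<And>i. coeff q i \<ge> 0" "s \<ge> 0" for q :: "real poly" and s
    unfolding poly_altdef using that by (intro sum_nonneg) auto
  show "t \<ge> 0 \<Longrightarrow> poly p t \<ge> 0" using nn assms by blast
  show "coeff (synthetic_div p c) i \<ge> 0" using assms(1)
  proof (induction p arbitrary: i)
    case (pCons a p)
    have p: "coeff p i \<ge> 0" for i using pCons.prems[of "Suc i"] by simp
    show ?case using pCons.IH[OF p] nn[OF p assms(2)] by (cases i) (auto simp: synthetic_div_pCons)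
  qed auto
qed

text \<open>Repetition in the list encodes multiplicity, so that Hermite interpolation is Newton
  interpolation with repeated nodes.\<close>

definition node_poly :: "real list \<Rightarrow> real poly" where
  "node_poly as = (\<Prod>a\<leftarrow>as. [:- a, 1:])"

lemma node_poly_simps [simp]:
  "node_poly [] = 1" "node_poly (a # as) = [:- a, 1:] * node_poly as"
  by (simp_all add: node_poly_def)

lemma node_poly_monic: "degree (node_poly as) = length as \<and> coeff (node_poly as) (length as) = 1"
proof (induction as)
  case (Cons a as)
  have "node_poly as \<noteq> 0" using Cons by (metis coeff_0 zero_neq_one)
  hence "degree (node_poly (a # as)) = Suc (length as)"
    using Cons by (simp add: degree_mult_eq del: mult_pCons_left)
  moreover have "lead_coeff (node_poly (a # as)) = 1"
    using Cons by (simp add: lead_coeff_mult del: mult_pCons_left)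
  ultimately show ?case by (metis length_Cons)
qed auto

text \<open>Newton interpolation of \<open>u ^ k\<close>: since the nodes are nonnegative, every divided difference
  is a polynomial with nonnegative coefficients.\<close>
lemma monom_newton_decomposition:
  assumes "\<forall>a\<in>set as. a \<ge> 0"
  shows "\<exists>R q. monom 1 k = R + node_poly as * q \<and> (R = 0 \<or> degree R < length as) \<and> (\<forall>i. coeff q i \<ge> 0)"
  using assms
proof (induction as)
  case Nil
  show ?case by (rule exI[of _ 0], rule exI[of _ "monom 1 k"]) auto
next
  case (Cons a as)
  then obtain R q where 1: "monom 1 k = R + node_poly as * q" "R = 0 \<or> degree R < length as" "\<And>i. coeff q i \<ge> 0"
    by auto
  define q' where "q' = synthetic_div q a"
  have q: "q = [:- a, 1:] * q' + [:poly q a:]" unfolding q'_def by (rule synthetic_div_correct'[symmetric])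
  have "monom 1 k = R + node_poly as * ([:- a, 1:] * q' + [:poly q a:])" using 1(1) q by simp
  also have "\<dots> = (R + smult (poly q a) (node_poly as)) + node_poly (a # as) * q'"
    by (simp add: algebra_simps)
  finally have "monom 1 k = (R + smult (poly q a) (node_poly as)) + node_poly (a # as) * q'" .
  moreover have "degree (R + smult (poly q a) (node_poly as)) < length (a # as)"
  proof -
    have "degree R \<le> length as" using 1(2) by auto
    moreover have "degree (smult (poly q a) (node_poly as)) \<le> length as"
      using degree_smult_le node_poly_monic by metis
    ultimately show ?thesis by (simp add: degree_add_le less_Suc_eq_le)
  qed
  moreover have "\<forall>i. coeff q' i \<ge> 0" unfolding q'_def using synthetic_div_nonneg(1)[OF 1(3)] Cons.prems by auto
  ultimately show ?case by blast
qed

text \<open>\<open>t ^ k\<close> is an interpolant plus the full node polynomial times a polynomial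
  with nonnegative coefficients: at every \<open>v y\<close> the two agree, and at
  \<open>u y >= 0\<close> the interpolant lies below. It has degree at most
  \<open>length as\<close>, and its top coefficient is a divided difference, hence nonnegative. So
  the last power sum is the only one that may differ, and an inequality for it suffices.\<close>

theorem power_sums_minimal:
  fixes u v :: "'i \<Rightarrow> real"
  assumes nodes: "a \<ge> 0" "\<forall>b\<in>set as. b \<ge> 0"
    and u: "\<And>y. y \<in> C \<Longrightarrow> u y \<ge> 0"
    and eq: "\<And>i. i < length as \<Longrightarrow> (\<Sum>y\<in>C. v y ^ i) = (\<Sum>y\<in>C. u y ^ i)"
    and ge: "(\<Sum>y\<in>C. v y ^ length as) \<le> (\<Sum>y\<in>C. u y ^ length as)"
    and pos: "\<And>t. t \<ge> 0 \<Longrightarrow> poly (node_poly (a # as)) t \<ge> 0"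
    and zero: "\<And>y. y \<in> C \<Longrightarrow> poly (node_poly (a # as)) (v y) = 0"
  shows "(\<Sum>y\<in>C. v y ^ k) \<le> (\<Sum>y\<in>C. u y ^ k)"
proof -
  let ?m = "length as"
  have low: "(\<Sum>y\<in>C. poly p (u y)) - (\<Sum>y\<in>C. poly p (v y)) =
        coeff p ?m * ((\<Sum>y\<in>C. u y ^ ?m) - (\<Sum>y\<in>C. v y ^ ?m))" if "degree p \<le> ?m" for p
  proof -
    have *: "poly p t = (\<Sum>i\<le>?m. coeff p i * t ^ i)" for t
      unfolding poly_altdef by (rule sum.mono_neutral_left) (use that in \<open>auto simp: coeff_eq_0\<close>)
    have "(\<Sum>y\<in>C. poly p (u y)) - (\<Sum>y\<in>C. poly p (v y)) =
          (\<Sum>i\<le>?m. coeff p i * ((\<Sum>y\<in>C. u y ^ i) - (\<Sum>y\<in>C. v y ^ i)))"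
      unfolding * by (subst (1 2) sum.swap) (simp add: sum_distrib_left right_diff_distrib sum_subtractf)
    also have "\<dots> = (\<Sum>i\<in>{?m}. coeff p i * ((\<Sum>y\<in>C. u y ^ i) - (\<Sum>y\<in>C. v y ^ i)))"
      by (rule sum.mono_neutral_right) (use eq in auto)
    finally show ?thesis by simp
  qed
  obtain R q where 1: "monom 1 k = R + node_poly as * q" "R = 0 \<or> degree R < length as" "\<And>i. coeff q i \<ge> 0"
    using monom_newton_decomposition[OF nodes(2)] by blast
  define q' where "q' = synthetic_div q a"
  have q: "q = [:- a, 1:] * q' + [:poly q a:]" unfolding q'_def by (rule synthetic_div_correct'[symmetric])
  define I where "I = R + smult (poly q a) (node_poly as)"
  have dec: "t ^ k = poly I t + poly (node_poly (a # as)) t * poly q' t" for t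
  proof -
    have "t ^ k = poly (monom 1 k) t" by (simp add: poly_monom)
    also have "\<dots> = poly R t + poly (node_poly as) t * poly q t" by (simp add: 1(1))
    also have "poly q t = (t - a) * poly q' t + poly q a" by (subst q) (simp add: algebra_simps)
    finally show ?thesis by (simp add: I_def algebra_simps)
  qed
  have dI: "degree I \<le> ?m" unfolding I_def
    by (rule degree_add_le) (use 1(2) node_poly_monic degree_smult_le in \<open>auto intro: order.trans[OF degree_smult_le]\<close>)
  have "coeff R ?m = 0" using 1(2) by (auto simp: coeff_eq_0)
  hence cI: "coeff I ?m = poly q a" using node_poly_monic[of as] by (simp add: I_def)
  have "poly q a \<ge> 0" using synthetic_div_nonneg(2)[OF 1(3)] nodes by blast
  hence "0 \<le> coeff I ?m * ((\<Sum>y\<in>C. u y ^ ?m) - (\<Sum>y\<in>C. v y ^ ?m))" using ge cI by simp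
  also have "\<dots> = (\<Sum>y\<in>C. poly I (u y)) - (\<Sum>y\<in>C. poly I (v y))" using low[OF dI] by simp
  finally have "(\<Sum>y\<in>C. poly I (v y)) \<le> (\<Sum>y\<in>C. poly I (u y))" by simp
  moreover have "(\<Sum>y\<in>C. v y ^ k) = (\<Sum>y\<in>C. poly I (v y))"
    by (rule sum.cong) (use zero dec in auto)
  moreover have "(\<Sum>y\<in>C. poly I (u y)) \<le> (\<Sum>y\<in>C. u y ^ k)"
  proof (rule sum_mono)
    fix y assume y: "y \<in> C"
    have "poly q' (u y) \<ge> 0"
      using synthetic_div_nonneg(2)[of q' 0] synthetic_div_nonneg(1)[OF 1(3) nodes(1)] u[OF y] by (simp add: q'_def)
    hence "poly (node_poly (a # as)) (u y) * poly q' (u y) \<ge> 0" using pos[OF u[OF y]] by (rule mult_nonneg_nonneg[rotated])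
    thus "poly I (u y) \<le> u y ^ k" using dec[of "u y"] by linarith
  qed
  ultimately show ?thesis by linarith
qed

subsection \<open>The icosahedron and the dodecahedron\<close>

lemma golden: "golden\<^sup>2 = golden + 1" "golden > 1" "golden \<noteq> 0" "sqrt 5 = 2 * golden - 1"
proof -
  show "golden\<^sup>2 = golden + 1" by (simp add: golden_def power2_eq_square field_simps)
  show "golden > 1" by (simp add: golden_def)
  thus "golden \<noteq> 0" by simp
  show "sqrt 5 = 2 * golden - 1" by (simp add: golden_def field_simps)
qed

text \<open>Tailored to the coefficient \<open>18 - 11 * golden\<close> in
  \<open>icosahedron_sextic\<close>; it also covers \<open>5 - 3 * golden\<close> for the
  dodecahedron.\<close>

lemma golden_lt: "golden < 18 / 11"
proof -
  have "sqrt 5 < 25 / 11" by (rule real_less_lsqrt) (auto simp: power2_eq_square)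
  thus ?thesis by (simp add: golden_def)
qed

lemma golden_powers: "golden ^ 4 = 3 * golden + 2" "golden ^ 6 = 8 * golden + 5" "1 / golden = golden - 1"
proof -
  have g2: "golden * golden = golden + 1" using golden(1) by (simp add: power2_eq_square)
  have g2c: "golden * (golden * c) = golden * c + c" for c
    by (simp add: mult.assoc[symmetric] g2 distrib_right)
  have "golden ^ 4 = (golden\<^sup>2)\<^sup>2" by simp
  also have "\<dots> = (golden + 1)\<^sup>2" by (simp only: golden(1))
  also have "\<dots> = 3 * golden + 2" by (simp add: power2_eq_square algebra_simps g2 g2c)
  finally show g4: "golden ^ 4 = 3 * golden + 2" .
  have "golden ^ 6 = golden ^ 4 * golden\<^sup>2" by (simp flip: power_add)
  also have "\<dots> = 8 * golden + 5" unfolding g4 golden(1) by (simp add: algebra_simps g2 g2c)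
  finally show "golden ^ 6 = 8 * golden + 5" .
  show "1 / golden = golden - 1" using golden(3) g2 by (simp add: field_simps)
qed

text \<open>The solids are given up to an isometry, while the computations refer to one position.
  The energy depends on inner products only, and \<open>f\<close> permutes the sphere.\<close>

lemma min_at_listed_point_orthogonal:
  fixes f :: "'a::euclidean_space \<Rightarrow> 'a"
  assumes f: "orthogonal_transformation f" and C: "min_at_listed_point h C M"
  shows "min_at_listed_point h (f ` C) M"
proof -
  have inj: "inj f" using f by (rule orthogonal_transformation_inj)
  have surj: "surj f" using f by (rule orthogonal_transformation_surj)
  have inner: "f x \<bullet> f y = x \<bullet> y" for x y using f by (simp add: orthogonal_transformation_def)
  have norm: "norm (f x) = norm x" for x by (simp add: norm_eq_sqrt_inner inner)
  have sph: "f ` sphere 0 1 = sphere 0 1"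
  proof (intro equalityI subsetI)
    fix y :: 'a assume y: "y \<in> sphere 0 1"
    obtain x where "y = f x" using surj by blast
    thus "y \<in> f ` sphere 0 1" using y norm[of x] by auto
  qed (auto simp: norm)
  have sums: "(\<Sum>y\<in>f ` C. h (f x \<bullet> y)) = (\<Sum>y\<in>C. h (x \<bullet> y))" for x
    by (subst sum.reindex) (auto simp: inner intro: inj_on_subset[OF inj])
  obtain xt where xt: "xt \<in> sphere 0 1" "image_mset (\<lambda>y. xt \<bullet> y) (mset_set C) = M"
      "(INF x\<in>sphere 0 1. \<Sum>y\<in>C. h (x \<bullet> y)) = (\<Sum>y\<in>C. h (xt \<bullet> y))"
    using C unfolding min_at_listed_point_def by blast
  show ?thesis unfolding min_at_listed_point_def
  proof (intro bexI[of _ "f xt"] conjI)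
    show "f xt \<in> sphere 0 1" using xt(1) norm by simp
    have "mset_set (f ` C) = image_mset f (mset_set C)"
      by (rule image_mset_mset_set[symmetric]) (rule inj_on_subset[OF inj], simp)
    thus "image_mset (\<lambda>y. f xt \<bullet> y) (mset_set (f ` C)) = M"
      using xt(2) by (simp add: multiset.map_comp o_def inner)
    have "(INF x\<in>sphere 0 1. \<Sum>y\<in>f ` C. h (x \<bullet> y)) = (INF x\<in>f ` sphere 0 1. \<Sum>y\<in>f ` C. h (x \<bullet> y))" by (simp only: sph)
    also have "\<dots> = (INF x\<in>sphere 0 1. \<Sum>y\<in>C. h (x \<bullet> y))" by (simp add: image_image sums)
    finally show "(INF x\<in>sphere 0 1. \<Sum>y\<in>f ` C. h (x \<bullet> y)) = (\<Sum>y\<in>f ` C. h (f xt \<bullet> y))"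
      using xt(3) by (simp add: sums)
  qed
qed

section \<open>Sums over the vertices of the two solids\<close>

lemma image_mset_conv_sum: "finite C \<Longrightarrow> image_mset g (mset_set C) = (\<Sum>y\<in>C. {#g y#})"
  by (induction C rule: finite_induct) auto

text \<open>Summation over a sign in any commutative monoid: the same expansion of a vertex sum
  serves the real power sums and the multiset of inner products.\<close>

definition pmsum :: "(real \<Rightarrow> 'a::comm_monoid_add) \<Rightarrow> 'a" where "pmsum f = f (-1) + f 1"

lemma sum_param2:
  assumes "\<And>a b a' b'. f a b = f a' b' \<Longrightarrow> a \<in> {-1,1} \<Longrightarrow> b \<in> {-1,1::real} \<Longrightarrow> a' \<in> {-1,1} \<Longrightarrow> b' \<in> {-1,1::real} \<Longrightarrow> a = a' \<and> b = b'"
  shows "finite {f a b | a b. a \<in> {-1,1} \<and> b \<in> {-1,1}}"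
    and "sum F {f a b | a b. a \<in> {-1,1} \<and> b \<in> {-1,1}} = pmsum (\<lambda>a. pmsum (\<lambda>b. F (f a b)))"
proof -
  have e: "{f a b | a b. a \<in> {-1,1} \<and> b \<in> {-1,1}} = (\<lambda>(a, b). f a b) ` ({-1,1} \<times> {-1,1})" by force
  have inj: "inj_on (\<lambda>(a, b). f a b) ({-1,1} \<times> {-1,1})"
    by (rule inj_onI) (use assms in fast)
  show "finite {f a b | a b. a \<in> {-1,1} \<and> b \<in> {-1,1}}" unfolding e by simp
  show "sum F {f a b | a b. a \<in> {-1,1} \<and> b \<in> {-1,1}} = pmsum (\<lambda>a. pmsum (\<lambda>b. F (f a b)))"
    unfolding e sum.reindex[OF inj] by (simp add: o_def case_prod_unfold pmsum_def add_ac flip: sum.cartesian_product)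
qed

lemma sum_param3:
  assumes "\<And>a b c a' b' c'. f a b c = f a' b' c' \<Longrightarrow> a = a' \<and> b = b' \<and> c = c'"
  shows "finite {f a b c | a b c. a \<in> {-1,1::real} \<and> b \<in> {-1,1::real} \<and> c \<in> {-1,1::real}}"
    and "sum F {f a b c | a b c. a \<in> {-1,1::real} \<and> b \<in> {-1,1::real} \<and> c \<in> {-1,1::real}} =
      pmsum (\<lambda>a. pmsum (\<lambda>b. pmsum (\<lambda>c. F (f a b c))))"
proof -
  have e: "{f a b c | a b c. a \<in> {-1,1::real} \<and> b \<in> {-1,1::real} \<and> c \<in> {-1,1::real}} = (\<lambda>(a, b, c). f a b c) ` ({-1,1} \<times> {-1,1} \<times> {-1,1})"
    by force
  have inj: "inj_on (\<lambda>(a, b, c). f a b c) ({-1,1} \<times> {-1,1} \<times> {-1,1})"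
    by (rule inj_onI) (use assms in fast)
  show "finite {f a b c | a b c. a \<in> {-1,1::real} \<and> b \<in> {-1,1::real} \<and> c \<in> {-1,1::real}}" unfolding e by simp
  show "sum F {f a b c | a b c. a \<in> {-1,1::real} \<and> b \<in> {-1,1::real} \<and> c \<in> {-1,1::real}} =
      pmsum (\<lambda>a. pmsum (\<lambda>b. pmsum (\<lambda>c. F (f a b c))))"
    unfolding e sum.reindex[OF inj] by (simp add: o_def case_prod_unfold pmsum_def add_ac flip: sum.cartesian_product)
qed

lemma vector3_eq: "vector [a, b, c] = (vector [a', b', c'] :: real^3) \<longleftrightarrow> a = a' \<and> b = b' \<and> c = c'"
  by (simp add: vec_eq_iff forall_3)

lemma sum_icosahedron:
  "finite icosahedron_std"
  "sum F icosahedron_std = (let k = 1 / sqrt (1 + golden\<^sup>2) in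
     pmsum (\<lambda>a. pmsum (\<lambda>b. F (k *\<^sub>R vector [0, a, b * golden]))) +
     pmsum (\<lambda>a. pmsum (\<lambda>b. F (k *\<^sub>R vector [a, b * golden, 0]))) +
     pmsum (\<lambda>a. pmsum (\<lambda>b. F (k *\<^sub>R vector [b * golden, 0, a]))))"
proof -
  define k where "k = 1 / sqrt (1 + golden\<^sup>2)"
  have "1 + golden\<^sup>2 > 0" by (simp add: add_pos_nonneg)
  hence k: "k \<noteq> 0" by (simp add: k_def)
  have inj: "inj_on (\<lambda>v::real^3. k *\<^sub>R v) A" for A using k by (auto simp: inj_on_def)
  let ?X = "{vector [0, a, b * golden] | a b. a \<in> {-1, 1} \<and> b \<in> {-1, 1}} :: (real^3) set"
  let ?Y = "{vector [a, b * golden, 0] | a b. a \<in> {-1, 1} \<and> b \<in> {-1, 1}} :: (real^3) set"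
  let ?Z = "{vector [b * golden, 0, a] | a b. a \<in> {-1, 1} \<and> b \<in> {-1, 1}} :: (real^3) set"
  have X: "finite ?X" "sum G ?X = pmsum (\<lambda>a. pmsum (\<lambda>b. G (vector [0, a, b * golden])))" for G :: "real^3 \<Rightarrow> 'a"
    by (rule sum_param2[of "\<lambda>a b. vector [0, a, b * golden]"]; use golden(3) in \<open>auto simp: vector3_eq\<close>)+
  have Y: "finite ?Y" "sum G ?Y = pmsum (\<lambda>a. pmsum (\<lambda>b. G (vector [a, b * golden, 0])))" for G :: "real^3 \<Rightarrow> 'a"
    by (rule sum_param2[of "\<lambda>a b. vector [a, b * golden, 0]"]; use golden(3) in \<open>auto simp: vector3_eq\<close>)+
  have Z: "finite ?Z" "sum G ?Z = pmsum (\<lambda>a. pmsum (\<lambda>b. G (vector [b * golden, 0, a])))" for G :: "real^3 \<Rightarrow> 'a"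
    by (rule sum_param2[of "\<lambda>a b. vector [b * golden, 0, a]"]; use golden(3) in \<open>auto simp: vector3_eq\<close>)+
  have d: "?X \<inter> ?Y = {}" "(?X \<union> ?Y) \<inter> ?Z = {}" by (auto simp: vector3_eq)
  show "finite icosahedron_std" unfolding icosahedron_std_def using X(1) Y(1) Z(1) by blast
  have "sum F icosahedron_std = sum (\<lambda>v. F (k *\<^sub>R v)) ((?X \<union> ?Y) \<union> ?Z)"
    unfolding icosahedron_std_def k_def[symmetric] by (subst sum.reindex[OF inj]) (simp add: o_def)
  also have "\<dots> = sum (\<lambda>v. F (k *\<^sub>R v)) ?X + sum (\<lambda>v. F (k *\<^sub>R v)) ?Y + sum (\<lambda>v. F (k *\<^sub>R v)) ?Z"
    using X(1) Y(1) Z(1) d by (subst sum.union_disjoint, blast, blast, blast, subst sum.union_disjoint) auto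
  finally show "sum F icosahedron_std = (let k = 1 / sqrt (1 + golden\<^sup>2) in
     pmsum (\<lambda>a. pmsum (\<lambda>b. F (k *\<^sub>R vector [0, a, b * golden]))) +
     pmsum (\<lambda>a. pmsum (\<lambda>b. F (k *\<^sub>R vector [a, b * golden, 0]))) +
     pmsum (\<lambda>a. pmsum (\<lambda>b. F (k *\<^sub>R vector [b * golden, 0, a]))))"
    unfolding X(2) Y(2) Z(2) Let_def k_def .
qed

lemma sum_dodecahedron:
  "finite dodecahedron_std"
  "sum F dodecahedron_std = (let k = 1 / sqrt 3 in
     pmsum (\<lambda>a. pmsum (\<lambda>b. pmsum (\<lambda>c. F (k *\<^sub>R vector [a, b, c])))) +
     pmsum (\<lambda>a. pmsum (\<lambda>b. F (k *\<^sub>R vector [0, a / golden, b * golden]))) +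
     pmsum (\<lambda>a. pmsum (\<lambda>b. F (k *\<^sub>R vector [a / golden, b * golden, 0]))) +
     pmsum (\<lambda>a. pmsum (\<lambda>b. F (k *\<^sub>R vector [b * golden, 0, a / golden]))))"
proof -
  define k where "k = 1 / sqrt (3::real)"
  have k: "k \<noteq> 0" by (simp add: k_def)
  have inj: "inj_on (\<lambda>v::real^3. k *\<^sub>R v) A" for A using k by (auto simp: inj_on_def)
  let ?W = "{vector [a, b, c] | a b c. a \<in> {-1, 1} \<and> b \<in> {-1, 1} \<and> c \<in> {-1, 1}} :: (real^3) set"
  let ?X = "{vector [0, a / golden, b * golden] | a b. a \<in> {-1, 1} \<and> b \<in> {-1, 1}} :: (real^3) set"
  let ?Y = "{vector [a / golden, b * golden, 0] | a b. a \<in> {-1, 1} \<and> b \<in> {-1, 1}} :: (real^3) set"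
  let ?Z = "{vector [b * golden, 0, a / golden] | a b. a \<in> {-1, 1} \<and> b \<in> {-1, 1}} :: (real^3) set"
  have W: "finite ?W" "sum G ?W = pmsum (\<lambda>a. pmsum (\<lambda>b. pmsum (\<lambda>c. G (vector [a, b, c]))))" for G :: "real^3 \<Rightarrow> 'a"
    by (rule sum_param3[of "\<lambda>a b c. vector [a, b, c]"]; auto simp: vector3_eq)+
  have X: "finite ?X" "sum G ?X = pmsum (\<lambda>a. pmsum (\<lambda>b. G (vector [0, a / golden, b * golden])))" for G :: "real^3 \<Rightarrow> 'a"
    by (rule sum_param2[of "\<lambda>a b. vector [0, a / golden, b * golden]"]; use golden(3) in \<open>auto simp: vector3_eq\<close>)+
  have Y: "finite ?Y" "sum G ?Y = pmsum (\<lambda>a. pmsum (\<lambda>b. G (vector [a / golden, b * golden, 0])))" for G :: "real^3 \<Rightarrow> 'a"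
    by (rule sum_param2[of "\<lambda>a b. vector [a / golden, b * golden, 0]"]; use golden(3) in \<open>auto simp: vector3_eq\<close>)+
  have Z: "finite ?Z" "sum G ?Z = pmsum (\<lambda>a. pmsum (\<lambda>b. G (vector [b * golden, 0, a / golden])))" for G :: "real^3 \<Rightarrow> 'a"
    by (rule sum_param2[of "\<lambda>a b. vector [b * golden, 0, a / golden]"]; use golden(3) in \<open>auto simp: vector3_eq\<close>)+
  have d: "?W \<inter> ?X = {}" "(?W \<union> ?X) \<inter> ?Y = {}" "(?W \<union> ?X \<union> ?Y) \<inter> ?Z = {}"
    using golden(3) by (auto simp: vector3_eq)
  show "finite dodecahedron_std" unfolding dodecahedron_std_def using W(1) X(1) Y(1) Z(1) by blast
  have "sum F dodecahedron_std = sum (\<lambda>v. F (k *\<^sub>R v)) (((?W \<union> ?X) \<union> ?Y) \<union> ?Z)"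
    unfolding dodecahedron_std_def k_def[symmetric] by (subst sum.reindex[OF inj]) (simp add: o_def)
  also have "\<dots> = sum (\<lambda>v. F (k *\<^sub>R v)) ?W + sum (\<lambda>v. F (k *\<^sub>R v)) ?X + sum (\<lambda>v. F (k *\<^sub>R v)) ?Y + sum (\<lambda>v. F (k *\<^sub>R v)) ?Z"
    using W(1) X(1) Y(1) Z(1) d
    by (subst sum.union_disjoint, blast, blast, blast, subst sum.union_disjoint, blast, blast, blast, subst sum.union_disjoint) auto
  finally show "sum F dodecahedron_std = (let k = 1 / sqrt 3 in
     pmsum (\<lambda>a. pmsum (\<lambda>b. pmsum (\<lambda>c. F (k *\<^sub>R vector [a, b, c])))) +
     pmsum (\<lambda>a. pmsum (\<lambda>b. F (k *\<^sub>R vector [0, a / golden, b * golden]))) +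
     pmsum (\<lambda>a. pmsum (\<lambda>b. F (k *\<^sub>R vector [a / golden, b * golden, 0]))) +
     pmsum (\<lambda>a. pmsum (\<lambda>b. F (k *\<^sub>R vector [b * golden, 0, a / golden]))))"
    unfolding W(2) X(2) Y(2) Z(2) Let_def k_def .
qed

text \<open>The coordinates of the vertices are symmetric under cyclic permutations only. These can
  move the least of three numbers to the front but cannot also order the other two.\<close>

lemma cyclic_min:
  fixes P :: "real \<Rightarrow> real \<Rightarrow> real \<Rightarrow> bool"
  assumes cyc: "\<And>p q r. P p q r \<Longrightarrow> P q r p" and min: "\<And>p s t. 0 \<le> p \<Longrightarrow> 0 \<le> s \<Longrightarrow> 0 \<le> t \<Longrightarrow> P p (p + s) (p + t)"
    and "0 \<le> p" "0 \<le> q" "0 \<le> r"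
  shows "P p q r"
proof -
  consider "p \<le> q" "p \<le> r" | "q \<le> p" "q \<le> r" | "r \<le> p" "r \<le> q" by linarith
  thus ?thesis
  proof cases
    case 1
    thus ?thesis using min[of p "q - p" "r - p"] assms by simp
  next
    case 2
    thus ?thesis using cyc[OF cyc[OF min[of q "r - q" "p - q"]]] assms by simp
  next
    case 3
    thus ?thesis using cyc[OF min[of r "p - r" "q - r"]] assms by simp
  qed
qed

text \<open>The mean of \<open>(\<plusminus> x p \<plusminus> y q)\<^sup>6\<close> over the signs, in terms of the squares of \<open>x\<close>, \<open>y\<close>, \<open>p\<close>, \<open>q\<close>.\<close>
definition sextic_mean :: "real \<Rightarrow> real \<Rightarrow> real \<Rightarrow> real \<Rightarrow> real" where
  "sextic_mean u v a b = u ^ 3 * a ^ 3 + 15 * u\<^sup>2 * v * a\<^sup>2 * b + 15 * u * v\<^sup>2 * a * b\<^sup>2 + v ^ 3 * b ^ 3"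

text \<open>The variables are squared coordinates, and the constant is the value of the right side
  at p = q = r = 1/3, a face centre. The difference of the sides must vanish at the other face
  centres too, among them p = 0 and q = golden^4 r; this forces the square in the decomposition, as
  \<open>golden ^ 4 = 3 * golden + 2\<close>. What multiplies the least coordinate is a definite
  form.\<close>

lemma icosahedron_sextic:
  assumes "0 \<le> p" "0 \<le> q" "0 \<le> r"
  shows "(17 / 3 + 68 / 9 * golden) * (p + q + r) ^ 3 \<le>
    sextic_mean 1 (golden + 1) q r + sextic_mean 1 (golden + 1) p q + sextic_mean 1 (golden + 1) r p"
  using assms(1-3)
proof (rule cyclic_min[rotated 2])
  fix p s t :: real assume pst: "0 \<le> p" "0 \<le> s" "0 \<le> t"
  have g2: "golden * golden = golden + 1" using golden(1) by (simp add: power2_eq_square)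
  have "sextic_mean 1 (golden + 1) (p + s) (p + t) + sextic_mean 1 (golden + 1) p (p + s) + sextic_mean 1 (golden + 1) (p + t) p -
      (17 / 3 + 68 / 9 * golden) * (p + (p + s) + (p + t)) ^ 3 =
      p * ((12 + 16 * golden) * (s\<^sup>2 - s * t + t\<^sup>2)) +
      (s - (3 * golden + 2) * t)\<^sup>2 * ((3 + 4 * golden) / 9 * s + (18 - 11 * golden) / 9 * t)"
    using g2 unfolding sextic_mean_def power_one mult_1 by algebra
  moreover have "0 \<le> p * ((12 + 16 * golden) * (s\<^sup>2 - s * t + t\<^sup>2))"
  proof -
    have "s\<^sup>2 - s * t + t\<^sup>2 = (s - t / 2)\<^sup>2 + 3 / 4 * t\<^sup>2" by (simp add: power2_eq_square field_simps)
    hence "0 \<le> s\<^sup>2 - s * t + t\<^sup>2" by simp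
    thus ?thesis using pst golden(2) by simp
  qed
  moreover have "0 \<le> (s - (3 * golden + 2) * t)\<^sup>2 * ((3 + 4 * golden) / 9 * s + (18 - 11 * golden) / 9 * t)"
    using pst golden(2) golden_lt by (intro mult_nonneg_nonneg add_nonneg_nonneg) auto
  ultimately show "(17 / 3 + 68 / 9 * golden) * (p + (p + s) + (p + t)) ^ 3 \<le>
    sextic_mean 1 (golden + 1) (p + s) (p + t) + sextic_mean 1 (golden + 1) p (p + s) + sextic_mean 1 (golden + 1) (p + t) p" by linarith
qed (simp add: add_ac)

text \<open>As for the icosahedron, but the minimum 17 (for p + q + r = 1) is attained at p = 0 and
  q = golden^2 r, with golden^2 = golden + 1: the squared coordinates of a face centre of the
  dodecahedron. All terms that contain the least coordinate have nonnegative coefficients.\<close>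

lemma dodecahedron_sextic:
  assumes "0 \<le> p" "0 \<le> q" "0 \<le> r"
  shows "17 * (p + q + r) ^ 3 \<le>
    2 * (p ^ 3 + q ^ 3 + r ^ 3 + 15 * (p\<^sup>2 * q + p\<^sup>2 * r + q\<^sup>2 * p + q\<^sup>2 * r + r\<^sup>2 * p + r\<^sup>2 * q) + 90 * p * q * r) +
    sextic_mean (2 - golden) (golden + 1) q r + sextic_mean (2 - golden) (golden + 1) p q + sextic_mean (2 - golden) (golden + 1) r p"
  using assms(1-3)
proof (rule cyclic_min[rotated 2])
  fix p s t :: real assume pst: "0 \<le> p" "0 \<le> s" "0 \<le> t"
  have g2: "golden * golden = golden + 1" using golden(1) by (simp add: power2_eq_square)
  have "2 * (p ^ 3 + (p + s) ^ 3 + (p + t) ^ 3 + 15 * (p\<^sup>2 * (p + s) + p\<^sup>2 * (p + t) + (p + s)\<^sup>2 * p + (p + s)\<^sup>2 * (p + t) + (p + t)\<^sup>2 * p + (p + t)\<^sup>2 * (p + s)) + 90 * p * (p + s) * (p + t)) +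
    sextic_mean (2 - golden) (golden + 1) (p + s) (p + t) + sextic_mean (2 - golden) (golden + 1) p (p + s) + sextic_mean (2 - golden) (golden + 1) (p + t) p
     - 17 * (p + (p + s) + (p + t)) ^ 3 =
      p * (12 * s\<^sup>2 + 84 * s * t + 12 * t\<^sup>2) + 96 * p\<^sup>2 * (s + t) + 96 * p ^ 3 +
      (s - (golden + 1) * t)\<^sup>2 * (3 * s + 3 * (5 - 3 * golden) * t)"
    using g2 unfolding sextic_mean_def power_one mult_1 by algebra
  moreover have "0 \<le> p * (12 * s\<^sup>2 + 84 * s * t + 12 * t\<^sup>2) + 96 * p\<^sup>2 * (s + t) + 96 * p ^ 3"
    using pst by simp
  moreover have "0 \<le> (s - (golden + 1) * t)\<^sup>2 * (3 * s + 3 * (5 - 3 * golden) * t)"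
    using pst golden_lt by (intro mult_nonneg_nonneg add_nonneg_nonneg) auto
  ultimately show "17 * (p + (p + s) + (p + t)) ^ 3 \<le>
    2 * (p ^ 3 + (p + s) ^ 3 + (p + t) ^ 3 + 15 * (p\<^sup>2 * (p + s) + p\<^sup>2 * (p + t) + (p + s)\<^sup>2 * p + (p + s)\<^sup>2 * (p + t) + (p + t)\<^sup>2 * p + (p + t)\<^sup>2 * (p + s)) + 90 * p * (p + s) * (p + t)) +
    sextic_mean (2 - golden) (golden + 1) (p + s) (p + t) + sextic_mean (2 - golden) (golden + 1) p (p + s) + sextic_mean (2 - golden) (golden + 1) (p + t) p" by linarith
qed (simp add: add_ac mult_ac)

lemma pm_power_sums:
  "pmsum (\<lambda>a. pmsum (\<lambda>b. (a * x + b * y)\<^sup>2 ^ 1)) = 4 * (x\<^sup>2 + y\<^sup>2)"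
  "pmsum (\<lambda>a. pmsum (\<lambda>b. (a * x + b * y)\<^sup>2 ^ 2)) = 4 * ((x\<^sup>2)\<^sup>2 + 6 * x\<^sup>2 * y\<^sup>2 + (y\<^sup>2)\<^sup>2)"
  "pmsum (\<lambda>a. pmsum (\<lambda>b. (a * x + b * y)\<^sup>2 ^ 3)) = 4 * sextic_mean 1 1 (x\<^sup>2) (y\<^sup>2)"
  unfolding pmsum_def sextic_mean_def power_one mult_1 by algebra+

lemma pm_power_sums3:
  "pmsum (\<lambda>a. pmsum (\<lambda>b. pmsum (\<lambda>c. (a * x + b * y + c * z)\<^sup>2 ^ 1))) = 8 * (x\<^sup>2 + y\<^sup>2 + z\<^sup>2)"
  "pmsum (\<lambda>a. pmsum (\<lambda>b. pmsum (\<lambda>c. (a * x + b * y + c * z)\<^sup>2 ^ 2))) =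
     8 * ((x\<^sup>2)\<^sup>2 + (y\<^sup>2)\<^sup>2 + (z\<^sup>2)\<^sup>2 + 6 * (x\<^sup>2 * y\<^sup>2 + x\<^sup>2 * z\<^sup>2 + y\<^sup>2 * z\<^sup>2))"
  "pmsum (\<lambda>a. pmsum (\<lambda>b. pmsum (\<lambda>c. (a * x + b * y + c * z)\<^sup>2 ^ 3))) =
     8 * ((x\<^sup>2)^3 + (y\<^sup>2)^3 + (z\<^sup>2)^3 + 15 * ((x\<^sup>2)\<^sup>2 * y\<^sup>2 + (x\<^sup>2)\<^sup>2 * z\<^sup>2 + (y\<^sup>2)\<^sup>2 * x\<^sup>2 + (y\<^sup>2)\<^sup>2 * z\<^sup>2 + (z\<^sup>2)\<^sup>2 * x\<^sup>2 + (z\<^sup>2)\<^sup>2 * y\<^sup>2) + 90 * x\<^sup>2 * y\<^sup>2 * z\<^sup>2)"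
  unfolding pmsum_def by algebra+

lemma pmsum_cmult: "pmsum (\<lambda>a. c * f a) = (c::real) * pmsum f"
  by (simp add: pmsum_def distrib_left)

lemma sphere3: "x \<in> sphere 0 1 \<Longrightarrow> (x$1)\<^sup>2 + (x$2)\<^sup>2 + (x$3)\<^sup>2 = (1::real)" for x :: "real^3"
  by (simp add: norm_eq_1 inner_vec_def sum_3 power2_eq_square)

lemma inner_vector3: "x \<bullet> (k *\<^sub>R vector [a, b, c]) = k * (x$1 * a + x$2 * b + x$3 * c)" for x :: "real^3"
  by (simp add: inner_vec_def sum_3 algebra_simps)

lemma uminus_vector3: "- vector [a, b, c] = (vector [- a, - b, - c] :: real^3)"
  by (simp add: vec_eq_iff forall_3)

section \<open>Moments and inner products of the two solids\<close>

definition ico_scale :: real where "ico_scale = 1 / sqrt (1 + golden\<^sup>2)"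

lemma ico_scale: "ico_scale > 0" "ico_scale\<^sup>2 * (1 + golden\<^sup>2) = 1"
proof -
  have "1 + golden\<^sup>2 > 0" by (simp add: add_pos_nonneg)
  thus "ico_scale > 0" "ico_scale\<^sup>2 * (1 + golden\<^sup>2) = 1" by (simp_all add: ico_scale_def power_divide)
qed

definition value_a :: real where "value_a = sqrt ((1 + 2 / sqrt 5) / 3)"
definition value_b :: real where "value_b = sqrt ((1 - 2 / sqrt 5) / 3)"

text \<open>The listed radicals in the form in which a face centre produces them. Icosahedron and
  dodecahedron are dual, which is why the same four numbers are listed for both.\<close>

lemma value_eqs:
  "value_a = ico_scale / sqrt 3 * (golden + 1)" "value_b = ico_scale / sqrt 3 * (golden - 1)"
proof -
  have g2: "golden * golden = golden + 1" using golden(1) by (simp add: power2_eq_square)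
  have g: "golden > 1" "2 * golden - 1 > 0" "golden + 2 > 0" using golden(2) by auto
  have k2: "ico_scale\<^sup>2 = 1 / (golden + 2)" using ico_scale(2) g(3) by (simp add: golden(1) field_simps)
  have "(ico_scale / sqrt 3 * (golden + 1))\<^sup>2 = (golden + 1)\<^sup>2 / (3 * (golden + 2))"
    by (simp add: power_mult_distrib power_divide k2)
  also have "\<dots> = (1 + 2 / sqrt 5) / 3" unfolding golden(4)
    using g g2 by (simp add: field_simps power2_eq_square)
  finally have "sqrt ((1 + 2 / sqrt 5) / 3) = \<bar>ico_scale / sqrt 3 * (golden + 1)\<bar>" by (metis real_sqrt_abs)
  thus "value_a = ico_scale / sqrt 3 * (golden + 1)" using ico_scale(1) g by (simp add: value_a_def)
  have "(ico_scale / sqrt 3 * (golden - 1))\<^sup>2 = (golden - 1)\<^sup>2 / (3 * (golden + 2))"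
    by (simp add: power_mult_distrib power_divide k2)
  also have "\<dots> = (1 - 2 / sqrt 5) / 3" unfolding golden(4)
    using g g2 by (simp add: field_simps power2_eq_square)
  finally have "sqrt ((1 - 2 / sqrt 5) / 3) = \<bar>ico_scale / sqrt 3 * (golden - 1)\<bar>" by (metis real_sqrt_abs)
  thus "value_b = ico_scale / sqrt 3 * (golden - 1)" using ico_scale(1) g by (simp add: value_b_def)
qed

text \<open>Two double nodes give an interpolant of degree 3 in the squares. With constant second
  and fourth moments, the sixth is the one left to compare.\<close>

lemma min_at_listed_point_four_values:
  fixes C :: "('a::real_inner) set"
  assumes h: "absolutely_monotone h" and C: "finite C" "C \<subseteq> sphere 0 1" and xt: "xt \<in> sphere 0 1"
    and anti: "\<And>y. y \<in> C \<Longrightarrow> - y \<in> C"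
    and mult: "image_mset (\<lambda>y. xt \<bullet> y) (mset_set C) = replicate_mset n (- \<alpha>) + replicate_mset n (- \<beta>) + replicate_mset n \<beta> + replicate_mset n \<alpha>"
    and m1: "\<And>x. x \<in> sphere 0 1 \<Longrightarrow> (\<Sum>y\<in>C. (x \<bullet> y)\<^sup>2 ^ 1) = c1"
    and m2: "\<And>x. x \<in> sphere 0 1 \<Longrightarrow> (\<Sum>y\<in>C. (x \<bullet> y)\<^sup>2 ^ 2) = c2"
    and m3: "\<And>x. x \<in> sphere 0 1 \<Longrightarrow> (\<Sum>y\<in>C. (xt \<bullet> y)\<^sup>2 ^ 3) \<le> (\<Sum>y\<in>C. (x \<bullet> y)\<^sup>2 ^ 3)"
  shows "min_at_listed_point h C (replicate_mset n (- \<alpha>) + replicate_mset n (- \<beta>) + replicate_mset n \<beta> + replicate_mset n \<alpha>)"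
proof (rule min_at_listed_pointI[OF h C xt anti mult])
  have pol: "poly (node_poly [\<beta>\<^sup>2, \<beta>\<^sup>2, \<alpha>\<^sup>2, \<alpha>\<^sup>2]) t = ((t - \<beta>\<^sup>2) * (t - \<alpha>\<^sup>2))\<^sup>2" for t :: real
    by (simp add: power2_eq_square algebra_simps)
  fix x :: 'a and k :: nat
  assume x: "x \<in> sphere 0 1"
  show "(\<Sum>y\<in>C. (xt \<bullet> y)\<^sup>2 ^ k) \<le> (\<Sum>y\<in>C. (x \<bullet> y)\<^sup>2 ^ k)"
  proof (rule power_sums_minimal[where a = "\<beta>\<^sup>2" and as = "[\<beta>\<^sup>2, \<alpha>\<^sup>2, \<alpha>\<^sup>2]"])
    fix i assume "i < length [\<beta>\<^sup>2, \<alpha>\<^sup>2, \<alpha>\<^sup>2]"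
    hence "i = 0 \<or> i = 1 \<or> i = 2" by auto
    thus "(\<Sum>y\<in>C. (xt \<bullet> y)\<^sup>2 ^ i) = (\<Sum>y\<in>C. (x \<bullet> y)\<^sup>2 ^ i)"
      using m1[OF x] m1[OF xt] m2[OF x] m2[OF xt] by (elim disjE) (simp_all only: power_0)
  next
    show "(\<Sum>y\<in>C. (xt \<bullet> y)\<^sup>2 ^ length [\<beta>\<^sup>2, \<alpha>\<^sup>2, \<alpha>\<^sup>2]) \<le> (\<Sum>y\<in>C. (x \<bullet> y)\<^sup>2 ^ length [\<beta>\<^sup>2, \<alpha>\<^sup>2, \<alpha>\<^sup>2])"
      using m3[OF x] by (simp add: numeral_3_eq_3)
  next
    fix t :: real assume "0 \<le> t"
    show "0 \<le> poly (node_poly [\<beta>\<^sup>2, \<beta>\<^sup>2, \<alpha>\<^sup>2, \<alpha>\<^sup>2]) t" unfolding pol by simp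
  next
    fix y assume y: "y \<in> C"
    have "xt \<bullet> y \<in># image_mset (\<lambda>y. xt \<bullet> y) (mset_set C)" using y C by simp
    hence "xt \<bullet> y \<in> {- \<alpha>, - \<beta>, \<beta>, \<alpha>}" unfolding mult by (auto split: if_splits)
    hence "(xt \<bullet> y)\<^sup>2 = \<alpha>\<^sup>2 \<or> (xt \<bullet> y)\<^sup>2 = \<beta>\<^sup>2" by auto
    thus "poly (node_poly [\<beta>\<^sup>2, \<beta>\<^sup>2, \<alpha>\<^sup>2, \<alpha>\<^sup>2]) ((xt \<bullet> y)\<^sup>2) = 0" unfolding pol by auto
  qed auto
qed

lemma icosahedron_power_sums:
  fixes x :: "real^3"
  shows "(\<Sum>y\<in>icosahedron_std. (x \<bullet> y)\<^sup>2 ^ 1) = 4 * ((x$1)\<^sup>2 + (x$2)\<^sup>2 + (x$3)\<^sup>2)"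
    and "(\<Sum>y\<in>icosahedron_std. (x \<bullet> y)\<^sup>2 ^ 2) = ico_scale ^ 4 * 12 * (golden + 1) * ((x$1)\<^sup>2 + (x$2)\<^sup>2 + (x$3)\<^sup>2)\<^sup>2"
    and "(\<Sum>y\<in>icosahedron_std. (x \<bullet> y)\<^sup>2 ^ 3) = ico_scale ^ 6 * 4 *
      (sextic_mean 1 (golden + 1) ((x$2)\<^sup>2) ((x$3)\<^sup>2) + sextic_mean 1 (golden + 1) ((x$1)\<^sup>2) ((x$2)\<^sup>2) + sextic_mean 1 (golden + 1) ((x$3)\<^sup>2) ((x$1)\<^sup>2))"
proof -
  have g2: "golden * golden = golden + 1" using golden(1) by (simp add: power2_eq_square)
  let ?S = "\<lambda>j. pmsum (\<lambda>a. pmsum (\<lambda>b. (a * x$2 + b * (golden * x$3))\<^sup>2 ^ j)) +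
      pmsum (\<lambda>a. pmsum (\<lambda>b. (a * x$1 + b * (golden * x$2))\<^sup>2 ^ j)) +
      pmsum (\<lambda>a. pmsum (\<lambda>b. (a * x$3 + b * (golden * x$1))\<^sup>2 ^ j))"
  have S: "(\<Sum>y\<in>icosahedron_std. (x \<bullet> y)\<^sup>2 ^ j) = (ico_scale\<^sup>2) ^ j * ?S j" for j
  proof -
    have "(\<Sum>y\<in>icosahedron_std. (x \<bullet> y)\<^sup>2 ^ j) =
      pmsum (\<lambda>a. pmsum (\<lambda>b. (ico_scale\<^sup>2) ^ j * (a * x$2 + b * (golden * x$3))\<^sup>2 ^ j)) +
      pmsum (\<lambda>a. pmsum (\<lambda>b. (ico_scale\<^sup>2) ^ j * (a * x$1 + b * (golden * x$2))\<^sup>2 ^ j)) +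
      pmsum (\<lambda>a. pmsum (\<lambda>b. (ico_scale\<^sup>2) ^ j * (a * x$3 + b * (golden * x$1))\<^sup>2 ^ j))"
      unfolding sum_icosahedron(2) Let_def ico_scale_def[symmetric] inner_vector3 power_mult_distrib
      by (simp add: mult_ac add_ac)
    thus ?thesis by (simp only: pmsum_cmult distrib_left)
  qed
  show "(\<Sum>y\<in>icosahedron_std. (x \<bullet> y)\<^sup>2 ^ 1) = 4 * ((x$1)\<^sup>2 + (x$2)\<^sup>2 + (x$3)\<^sup>2)"
  proof -
    have "(\<Sum>y\<in>icosahedron_std. (x \<bullet> y)\<^sup>2 ^ 1) = (ico_scale\<^sup>2 * (1 + golden\<^sup>2)) * (4 * ((x$1)\<^sup>2 + (x$2)\<^sup>2 + (x$3)\<^sup>2))"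
      unfolding S pm_power_sums by (simp add: power_mult_distrib algebra_simps)
    thus ?thesis unfolding ico_scale(2) by simp
  qed
  have k4: "ico_scale ^ 4 = (ico_scale\<^sup>2)\<^sup>2" "ico_scale ^ 6 = (ico_scale\<^sup>2) ^ 3" by (simp_all flip: power_mult)
  show "(\<Sum>y\<in>icosahedron_std. (x \<bullet> y)\<^sup>2 ^ 2) = ico_scale ^ 4 * 12 * (golden + 1) * ((x$1)\<^sup>2 + (x$2)\<^sup>2 + (x$3)\<^sup>2)\<^sup>2"
    unfolding S pm_power_sums k4 power_mult_distrib golden(1) using g2 by algebra
  show "(\<Sum>y\<in>icosahedron_std. (x \<bullet> y)\<^sup>2 ^ 3) = ico_scale ^ 6 * 4 *
      (sextic_mean 1 (golden + 1) ((x$2)\<^sup>2) ((x$3)\<^sup>2) + sextic_mean 1 (golden + 1) ((x$1)\<^sup>2) ((x$2)\<^sup>2) + sextic_mean 1 (golden + 1) ((x$3)\<^sup>2) ((x$1)\<^sup>2))"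
  proof -
    have sx: "sextic_mean 1 1 a ((golden + 1) * b) = sextic_mean 1 (golden + 1) a b" for a b
      unfolding sextic_mean_def power_mult_distrib power_one mult_1 by (simp add: mult_ac)
    show ?thesis unfolding S pm_power_sums k4 power_mult_distrib golden(1) sx by (simp add: distrib_left)
  qed
qed

theorem icosahedron_minimum:
  assumes h: "absolutely_monotone h"
  shows "min_at_listed_point h icosahedron_std
     (replicate_mset 3 (- value_a) + replicate_mset 3 (- value_b) + replicate_mset 3 value_b + replicate_mset 3 value_a)"
proof -
  \<comment> \<open>A face centre of the icosahedron; the three vertices of the face account for the
    multiplicity 3.\<close>
  define xt where "xt = ((1 / sqrt 3) *\<^sub>R vector [1, 1, 1] :: real^3)"
  have xtc: "xt $ 1 = 1 / sqrt 3" "xt $ 2 = 1 / sqrt 3" "xt $ 3 = 1 / sqrt 3" by (simp_all add: xt_def)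
  have el: "- y \<in> icosahedron_std \<and> y \<in> sphere 0 1" if yC: "y \<in> icosahedron_std" for y
  proof -
    obtain v where v: "y = ico_scale *\<^sub>R v" "v \<in> {vector [0, a, b * golden] | a b. a \<in> {-1, 1} \<and> b \<in> {-1, 1}} \<union>
      {vector [a, b * golden, 0] | a b. a \<in> {-1, 1} \<and> b \<in> {-1, 1}} \<union>
      {vector [b * golden, 0, a] | a b. a \<in> {-1, 1} \<and> b \<in> {-1, 1}}"
      using yC unfolding icosahedron_std_def ico_scale_def[symmetric] by blast
    obtain a b where ab: "a \<in> {-1, 1}" "b \<in> {-1, 1}" "v = vector [0, a, b * golden] \<or> v = vector [a, b * golden, 0] \<or> v = vector [b * golden, 0, a]"
      using v(2) by blast
    have "v \<bullet> v = 1 + golden\<^sup>2" using ab by (auto simp: inner_vec_def sum_3 power2_eq_square)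
    hence "y \<bullet> y = 1" using ico_scale(2) by (simp add: v(1) power2_eq_square mult.assoc)
    moreover have "- v \<in> {vector [0, a, b * golden] | a b. a \<in> {-1, 1} \<and> b \<in> {-1, 1}} \<union>
      {vector [a, b * golden, 0] | a b. a \<in> {-1, 1} \<and> b \<in> {-1, 1}} \<union>
      {vector [b * golden, 0, a] | a b. a \<in> {-1, 1} \<and> b \<in> {-1, 1}}"
    proof -
      have "- v = vector [0, - a, (- b) * golden] \<or> - v = vector [- a, (- b) * golden, 0] \<or> - v = vector [(- b) * golden, 0, - a]"
        using ab(3) by (auto simp: uminus_vector3)
      moreover have "- a \<in> {-1, 1}" "- b \<in> {-1, 1}" using ab by auto
      ultimately show ?thesis by blast
    qed
    hence "ico_scale *\<^sub>R (- v) \<in> icosahedron_std" unfolding icosahedron_std_def ico_scale_def[symmetric] by blast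
    hence "- y \<in> icosahedron_std" by (simp add: v(1))
    ultimately show ?thesis using norm_eq_1[of y] by simp
  qed
  show ?thesis
  proof (rule min_at_listed_point_four_values[OF h sum_icosahedron(1), where xt = xt])
    show "icosahedron_std \<subseteq> sphere 0 1" using el by blast
    show "xt \<in> sphere 0 1" by (simp add: norm_eq_1 inner_vec_def sum_3 xtc)
    show "- y \<in> icosahedron_std" if "y \<in> icosahedron_std" for y using el that by blast
    have val: "xt \<bullet> (ico_scale *\<^sub>R vector [a, b, c]) = ico_scale / sqrt 3 * (a + b + c)" for a b c
      unfolding inner_vector3 xtc by (simp add: field_simps)
    have v4: "ico_scale / sqrt 3 * (- 1 + - 1 * golden) = - value_a" "ico_scale / sqrt 3 * (- 1 + 1 * golden) = value_b"
       "ico_scale / sqrt 3 * (1 + - 1 * golden) = - value_b" "ico_scale / sqrt 3 * (1 + 1 * golden) = value_a"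
      unfolding value_eqs by (simp_all add: field_simps)
    show "image_mset (\<lambda>y. xt \<bullet> y) (mset_set icosahedron_std) =
       replicate_mset 3 (- value_a) + replicate_mset 3 (- value_b) + replicate_mset 3 value_b + replicate_mset 3 value_a"
    proof -
      have comm: "ico_scale / sqrt 3 * (0 + a + b * golden) = ico_scale / sqrt 3 * (a + b * golden)"
        "ico_scale / sqrt 3 * (a + b * golden + 0) = ico_scale / sqrt 3 * (a + b * golden)"
        "ico_scale / sqrt 3 * (b * golden + 0 + a) = ico_scale / sqrt 3 * (a + b * golden)" for a b by simp_all
      show ?thesis
        unfolding image_mset_conv_sum[OF sum_icosahedron(1)] sum_icosahedron(2) Let_def ico_scale_def[symmetric] val comm
        unfolding pmsum_def v4 by (simp add: numeral_3_eq_3)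
    qed
    show "(\<Sum>y\<in>icosahedron_std. (x \<bullet> y)\<^sup>2 ^ 1) = 4" if "x \<in> sphere 0 1" for x
      unfolding icosahedron_power_sums sphere3[OF that] by simp
    show "(\<Sum>y\<in>icosahedron_std. (x \<bullet> y)\<^sup>2 ^ 2) = ico_scale ^ 4 * 12 * (golden + 1)" if "x \<in> sphere 0 1" for x
      unfolding icosahedron_power_sums sphere3[OF that] by simp
    show "(\<Sum>y\<in>icosahedron_std. (xt \<bullet> y)\<^sup>2 ^ 3) \<le> (\<Sum>y\<in>icosahedron_std. (x \<bullet> y)\<^sup>2 ^ 3)" if x: "x \<in> sphere 0 1" for x
    proof -
      have e: "(1 / sqrt 3)\<^sup>2 = (1 / 3 :: real)" by (simp add: power_divide)
      have g2: "golden * golden = golden + 1" using golden(1) by (simp add: power2_eq_square)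
      have "sextic_mean 1 (golden + 1) (1 / 3) (1 / 3) + sextic_mean 1 (golden + 1) (1 / 3) (1 / 3) + sextic_mean 1 (golden + 1) (1 / 3) (1 / 3) = 17 / 3 + 68 / 9 * golden"
        using g2 unfolding sextic_mean_def power_one mult_1 by algebra
      also have "\<dots> = (17 / 3 + 68 / 9 * golden) * ((x$1)\<^sup>2 + (x$2)\<^sup>2 + (x$3)\<^sup>2) ^ 3" unfolding sphere3[OF x] by simp
      also have "\<dots> \<le> sextic_mean 1 (golden + 1) ((x$2)\<^sup>2) ((x$3)\<^sup>2) + sextic_mean 1 (golden + 1) ((x$1)\<^sup>2) ((x$2)\<^sup>2) + sextic_mean 1 (golden + 1) ((x$3)\<^sup>2) ((x$1)\<^sup>2)"
        by (rule icosahedron_sextic) auto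
      finally show ?thesis unfolding icosahedron_power_sums xtc e using ico_scale(1) by (intro mult_left_mono) auto
    qed
  qed
qed

lemma dodecahedron_power_sums:
  fixes x :: "real^3"
  shows "(\<Sum>y\<in>dodecahedron_std. (x \<bullet> y)\<^sup>2 ^ 1) = 20 / 3 * ((x$1)\<^sup>2 + (x$2)\<^sup>2 + (x$3)\<^sup>2)"
    and "(\<Sum>y\<in>dodecahedron_std. (x \<bullet> y)\<^sup>2 ^ 2) = 4 * ((x$1)\<^sup>2 + (x$2)\<^sup>2 + (x$3)\<^sup>2)\<^sup>2"
    and "(\<Sum>y\<in>dodecahedron_std. (x \<bullet> y)\<^sup>2 ^ 3) = 4 / 27 * (2 * (((x$1)\<^sup>2) ^ 3 + ((x$2)\<^sup>2) ^ 3 + ((x$3)\<^sup>2) ^ 3 +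
      15 * (((x$1)\<^sup>2)\<^sup>2 * (x$2)\<^sup>2 + ((x$1)\<^sup>2)\<^sup>2 * (x$3)\<^sup>2 + ((x$2)\<^sup>2)\<^sup>2 * (x$1)\<^sup>2 + ((x$2)\<^sup>2)\<^sup>2 * (x$3)\<^sup>2 + ((x$3)\<^sup>2)\<^sup>2 * (x$1)\<^sup>2 + ((x$3)\<^sup>2)\<^sup>2 * (x$2)\<^sup>2) +
      90 * (x$1)\<^sup>2 * (x$2)\<^sup>2 * (x$3)\<^sup>2) +
      sextic_mean (2 - golden) (golden + 1) ((x$2)\<^sup>2) ((x$3)\<^sup>2) + sextic_mean (2 - golden) (golden + 1) ((x$1)\<^sup>2) ((x$2)\<^sup>2) + sextic_mean (2 - golden) (golden + 1) ((x$3)\<^sup>2) ((x$1)\<^sup>2))"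
proof -
  have g2: "golden * golden = golden + 1" using golden(1) by (simp add: power2_eq_square)
  define k where "k = 1 / sqrt (3::real)"
  have k2: "k\<^sup>2 = 1 / 3" by (simp add: k_def power_divide)
  let ?S = "\<lambda>j. pmsum (\<lambda>a. pmsum (\<lambda>b. pmsum (\<lambda>c. (a * x$1 + b * x$2 + c * x$3)\<^sup>2 ^ j))) +
      pmsum (\<lambda>a. pmsum (\<lambda>b. (a * ((golden - 1) * x$2) + b * (golden * x$3))\<^sup>2 ^ j)) +
      pmsum (\<lambda>a. pmsum (\<lambda>b. (a * ((golden - 1) * x$1) + b * (golden * x$2))\<^sup>2 ^ j)) +
      pmsum (\<lambda>a. pmsum (\<lambda>b. (a * ((golden - 1) * x$3) + b * (golden * x$1))\<^sup>2 ^ j))"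
  have gd: "a / golden = a * (golden - 1)" for a unfolding golden_powers(3)[symmetric] by simp
  have S: "(\<Sum>y\<in>dodecahedron_std. (x \<bullet> y)\<^sup>2 ^ j) = (1 / 3) ^ j * ?S j" for j
  proof -
    have "(\<Sum>y\<in>dodecahedron_std. (x \<bullet> y)\<^sup>2 ^ j) =
      pmsum (\<lambda>a. pmsum (\<lambda>b. pmsum (\<lambda>c. (k\<^sup>2) ^ j * (a * x$1 + b * x$2 + c * x$3)\<^sup>2 ^ j))) +
      pmsum (\<lambda>a. pmsum (\<lambda>b. (k\<^sup>2) ^ j * (a * ((golden - 1) * x$2) + b * (golden * x$3))\<^sup>2 ^ j)) +
      pmsum (\<lambda>a. pmsum (\<lambda>b. (k\<^sup>2) ^ j * (a * ((golden - 1) * x$1) + b * (golden * x$2))\<^sup>2 ^ j)) +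
      pmsum (\<lambda>a. pmsum (\<lambda>b. (k\<^sup>2) ^ j * (a * ((golden - 1) * x$3) + b * (golden * x$1))\<^sup>2 ^ j))"
      unfolding sum_dodecahedron(2) Let_def k_def[symmetric] inner_vector3 power_mult_distrib gd
      by (simp add: mult_ac add_ac)
    thus ?thesis by (simp only: pmsum_cmult distrib_left k2)
  qed
  have gm: "(golden - 1)\<^sup>2 = 2 - golden" by (simp add: power2_eq_square algebra_simps g2)
  show "(\<Sum>y\<in>dodecahedron_std. (x \<bullet> y)\<^sup>2 ^ 1) = 20 / 3 * ((x$1)\<^sup>2 + (x$2)\<^sup>2 + (x$3)\<^sup>2)"
    unfolding S pm_power_sums pm_power_sums3 power_mult_distrib gm golden(1) by (simp add: algebra_simps)
  show "(\<Sum>y\<in>dodecahedron_std. (x \<bullet> y)\<^sup>2 ^ 2) = 4 * ((x$1)\<^sup>2 + (x$2)\<^sup>2 + (x$3)\<^sup>2)\<^sup>2"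
    unfolding S pm_power_sums pm_power_sums3 power_mult_distrib gm golden(1) using g2 by algebra
  have sx: "sextic_mean 1 1 ((2 - golden) * a) ((golden + 1) * b) = sextic_mean (2 - golden) (golden + 1) a b" for a b
    unfolding sextic_mean_def power_mult_distrib power_one mult_1 by (simp add: mult_ac)
  show "(\<Sum>y\<in>dodecahedron_std. (x \<bullet> y)\<^sup>2 ^ 3) = 4 / 27 * (2 * (((x$1)\<^sup>2) ^ 3 + ((x$2)\<^sup>2) ^ 3 + ((x$3)\<^sup>2) ^ 3 +
      15 * (((x$1)\<^sup>2)\<^sup>2 * (x$2)\<^sup>2 + ((x$1)\<^sup>2)\<^sup>2 * (x$3)\<^sup>2 + ((x$2)\<^sup>2)\<^sup>2 * (x$1)\<^sup>2 + ((x$2)\<^sup>2)\<^sup>2 * (x$3)\<^sup>2 + ((x$3)\<^sup>2)\<^sup>2 * (x$1)\<^sup>2 + ((x$3)\<^sup>2)\<^sup>2 * (x$2)\<^sup>2) +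
      90 * (x$1)\<^sup>2 * (x$2)\<^sup>2 * (x$3)\<^sup>2) +
      sextic_mean (2 - golden) (golden + 1) ((x$2)\<^sup>2) ((x$3)\<^sup>2) + sextic_mean (2 - golden) (golden + 1) ((x$1)\<^sup>2) ((x$2)\<^sup>2) + sextic_mean (2 - golden) (golden + 1) ((x$3)\<^sup>2) ((x$1)\<^sup>2))"
    unfolding S pm_power_sums pm_power_sums3 power_mult_distrib[of _ "_ $ _"] gm golden(1) sx by (simp add: power3_eq_cube)
qed

theorem dodecahedron_minimum:
  assumes h: "absolutely_monotone h"
  shows "min_at_listed_point h dodecahedron_std
     (replicate_mset 5 (- value_a) + replicate_mset 5 (- value_b) + replicate_mset 5 value_b + replicate_mset 5 value_a)"
proof -
  have g2: "golden * golden = golden + 1" using golden(1) by (simp add: power2_eq_square)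
  \<comment> \<open>A face centre of the dodecahedron, in the direction of a vertex of the dual
    icosahedron; the five vertices of the face account for the multiplicity 5.\<close>
  define xt where "xt = (ico_scale *\<^sub>R vector [0, golden, 1] :: real^3)"
  have xtc: "xt $ 1 = 0" "xt $ 2 = ico_scale * golden" "xt $ 3 = ico_scale" by (simp_all add: xt_def)
  have gd: "a / golden = a * (golden - 1)" for a unfolding golden_powers(3)[symmetric] by simp
  have el: "- y \<in> dodecahedron_std \<and> y \<in> sphere 0 1" if yC: "y \<in> dodecahedron_std" for y
  proof -
    obtain v where v: "y = (1 / sqrt 3) *\<^sub>R v" "v \<in> {vector [a, b, c] | a b c. a \<in> {-1, 1} \<and> b \<in> {-1, 1} \<and> c \<in> {-1, 1}} \<union>
      {vector [0, a / golden, b * golden] | a b. a \<in> {-1, 1} \<and> b \<in> {-1, 1}} \<union>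
      {vector [a / golden, b * golden, 0] | a b. a \<in> {-1, 1} \<and> b \<in> {-1, 1}} \<union>
      {vector [b * golden, 0, a / golden] | a b. a \<in> {-1, 1} \<and> b \<in> {-1, 1}}"
      using yC unfolding dodecahedron_std_def by blast
    obtain a b c where ab: "a \<in> {-1, 1}" "b \<in> {-1, 1}" "c \<in> {-1, 1}" "v = vector [a, b, c] \<or> v = vector [0, a / golden, b * golden] \<or> v = vector [a / golden, b * golden, 0] \<or> v = vector [b * golden, 0, a / golden]"
      using v(2) by blast
    have "v \<bullet> v = 3" using ab by (auto simp: inner_vec_def sum_3 gd algebra_simps g2)
    hence "y \<bullet> y = 1" by (simp add: v(1))
    moreover have "- v \<in> {vector [a, b, c] | a b c. a \<in> {-1, 1} \<and> b \<in> {-1, 1} \<and> c \<in> {-1, 1}} \<union>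
      {vector [0, a / golden, b * golden] | a b. a \<in> {-1, 1} \<and> b \<in> {-1, 1}} \<union>
      {vector [a / golden, b * golden, 0] | a b. a \<in> {-1, 1} \<and> b \<in> {-1, 1}} \<union>
      {vector [b * golden, 0, a / golden] | a b. a \<in> {-1, 1} \<and> b \<in> {-1, 1}}"
    proof -
      have "- v = vector [- a, - b, - c] \<or> - v = vector [0, (- a) / golden, (- b) * golden] \<or> - v = vector [(- a) / golden, (- b) * golden, 0] \<or> - v = vector [(- b) * golden, 0, (- a) / golden]"
        using ab(4) by (auto simp: uminus_vector3)
      moreover have "- a \<in> {-1, 1}" "- b \<in> {-1, 1}" "- c \<in> {-1, 1}" using ab by auto
      ultimately show ?thesis by blast
    qed
    hence "(1 / sqrt 3) *\<^sub>R (- v) \<in> dodecahedron_std" unfolding dodecahedron_std_def by blast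
    hence "- y \<in> dodecahedron_std" by (simp add: v(1))
    ultimately show ?thesis using norm_eq_1[of y] by simp
  qed
  show ?thesis
  proof (rule min_at_listed_point_four_values[OF h sum_dodecahedron(1), where xt = xt])
    show "dodecahedron_std \<subseteq> sphere 0 1" using el by blast
    show "xt \<in> sphere 0 1" using ico_scale(2) by (simp add: norm_eq_1 inner_vec_def sum_3 xtc power2_eq_square algebra_simps)
    show "- y \<in> dodecahedron_std" if "y \<in> dodecahedron_std" for y using el that by blast
    have val: "xt \<bullet> ((1 / sqrt 3) *\<^sub>R vector [a, b, c]) = ico_scale / sqrt 3 * (golden * b + c)" for a b c
      unfolding inner_vector3 xtc by (simp add: field_simps)
    have v4: "ico_scale / sqrt 3 * (golden * (- 1) + - 1) = - value_a" "ico_scale / sqrt 3 * (golden * (- 1) + 1) = - value_b"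
       "ico_scale / sqrt 3 * (golden * 1 + - 1) = value_b" "ico_scale / sqrt 3 * (golden * 1 + 1) = value_a"
       "ico_scale / sqrt 3 * (golden * (- 1 / golden) + (- 1) * golden) = - value_a"
       "ico_scale / sqrt 3 * (golden * (- 1 / golden) + 1 * golden) = value_b"
       "ico_scale / sqrt 3 * (golden * (1 / golden) + (- 1) * golden) = - value_b"
       "ico_scale / sqrt 3 * (golden * (1 / golden) + 1 * golden) = value_a"
       "ico_scale / sqrt 3 * (golden * ((- 1) * golden) + 0) = - value_a"
       "ico_scale / sqrt 3 * (golden * (1 * golden) + 0) = value_a"
       "ico_scale / sqrt 3 * (golden * 0 + - 1 / golden) = - value_b"
       "ico_scale / sqrt 3 * (golden * 0 + 1 / golden) = value_b"
      unfolding value_eqs using golden(3) by (simp_all add: algebra_simps g2 gd golden_powers(3) add_divide_distrib diff_divide_distrib)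
    show "image_mset (\<lambda>y. xt \<bullet> y) (mset_set dodecahedron_std) =
       replicate_mset 5 (- value_a) + replicate_mset 5 (- value_b) + replicate_mset 5 value_b + replicate_mset 5 value_a"
      unfolding image_mset_conv_sum[OF sum_dodecahedron(1)] sum_dodecahedron(2) Let_def val
      unfolding pmsum_def v4 by (simp add: numeral_eq_Suc)
    show "(\<Sum>y\<in>dodecahedron_std. (x \<bullet> y)\<^sup>2 ^ 1) = 20 / 3" if "x \<in> sphere 0 1" for x
      unfolding dodecahedron_power_sums sphere3[OF that] by simp
    show "(\<Sum>y\<in>dodecahedron_std. (x \<bullet> y)\<^sup>2 ^ 2) = 4" if "x \<in> sphere 0 1" for x
      unfolding dodecahedron_power_sums sphere3[OF that] by simp
    show "(\<Sum>y\<in>dodecahedron_std. (xt \<bullet> y)\<^sup>2 ^ 3) \<le> (\<Sum>y\<in>dodecahedron_std. (x \<bullet> y)\<^sup>2 ^ 3)" if x: "x \<in> sphere 0 1" for x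
    proof -
      let ?D = "\<lambda>p q r. 2 * (p ^ 3 + q ^ 3 + r ^ 3 + 15 * (p\<^sup>2 * q + p\<^sup>2 * r + q\<^sup>2 * p + q\<^sup>2 * r + r\<^sup>2 * p + r\<^sup>2 * q) + 90 * p * q * r) +
         sextic_mean (2 - golden) (golden + 1) q r + sextic_mean (2 - golden) (golden + 1) p q + sextic_mean (2 - golden) (golden + 1) r p"
      define K where "K = ico_scale\<^sup>2"
      have K: "K * (golden + 2) = 1" using ico_scale(2) by (simp add: K_def golden(1) add.commute)
      have "?D 0 (K * (golden + 1)) K = 17 * (K * (golden + 2)) ^ 3"
      proof -
        have "(0::real) ^ 3 = 0" by simp
        thus ?thesis using g2 unfolding sextic_mean_def \<open>(0::real) ^ 3 = 0\<close> zero_power2 mult_zero_left mult_zero_right add_0_left add_0_right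
          by algebra
      qed
      also have "\<dots> = 17 * ((x$1)\<^sup>2 + (x$2)\<^sup>2 + (x$3)\<^sup>2) ^ 3" unfolding sphere3[OF x] K by simp
      also have "\<dots> \<le> ?D ((x$1)\<^sup>2) ((x$2)\<^sup>2) ((x$3)\<^sup>2)"
        by (rule dodecahedron_sextic) auto
      finally have *: "?D 0 (K * (golden + 1)) K \<le> ?D ((x$1)\<^sup>2) ((x$2)\<^sup>2) ((x$3)\<^sup>2)" .
      have e: "(xt$1)\<^sup>2 = 0" "(xt$2)\<^sup>2 = K * (golden + 1)" "(xt$3)\<^sup>2 = K"
        by (simp_all add: xtc K_def power_mult_distrib golden(1))
      show ?thesis unfolding dodecahedron_power_sums e using * by (intro mult_left_mono) auto
    qed
  qed
qed

subsection \<open>Gaussian integrals and Poisson summation\<close>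

lemma has_sum_integral_M_test:
  fixes f :: "'i \<Rightarrow> real \<Rightarrow> complex"
  assumes cont: "\<And>k. continuous_on {a..b} (f k)"
    and bd: "\<And>k y. k \<in> X \<Longrightarrow> y \<in> {a..b} \<Longrightarrow> norm (f k y) \<le> M k" and M: "M summable_on X"
  shows "continuous_on {a..b} (\<lambda>y. \<Sum>\<^sub>\<infinity>k\<in>X. f k y)"
    and "((\<lambda>k. integral {a..b} (f k)) has_sum integral {a..b} (\<lambda>y. \<Sum>\<^sub>\<infinity>k\<in>X. f k y)) X"
proof -
  have ul: "uniform_limit {a..b} (\<lambda>X y. \<Sum>k\<in>X. f k y) (\<lambda>y. \<Sum>\<^sub>\<infinity>k\<in>X. f k y) (finite_subsets_at_top X)"
    using Weierstrass_m_test_general[OF bd M] .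
  have c: "continuous_on {a..b} (\<lambda>y. \<Sum>k\<in>Y. f k y)" for Y
    by (intro continuous_on_sum cont)
  show "continuous_on {a..b} (\<lambda>y. \<Sum>\<^sub>\<infinity>k\<in>X. f k y)"
  proof (rule uniform_limit_theorem[OF _ ul])
    show "\<forall>\<^sub>F Y in finite_subsets_at_top X. continuous_on {a..b} (\<lambda>y. \<Sum>k\<in>Y. f k y)"
      using c by simp
  qed simp
  obtain I J where I: "\<And>Y. ((\<lambda>y. \<Sum>k\<in>Y. f k y) has_integral I Y) {a..b}"
    and J: "((\<lambda>y. \<Sum>\<^sub>\<infinity>k\<in>X. f k y) has_integral J) {a..b}" "(I \<longlongrightarrow> J) (finite_subsets_at_top X)"
    using uniform_limit_integral[OF ul c] by (metis finite_subsets_at_top_neq_bot)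
  have "I Y = (\<Sum>k\<in>Y. integral {a..b} (f k))" if "finite Y" for Y
    using integral_unique[OF I[of Y]] that
    by (subst (asm) integral_sum) (auto intro!: integrable_continuous_real cont)
  hence "\<forall>\<^sub>F Y in finite_subsets_at_top X. I Y = (\<Sum>k\<in>Y. integral {a..b} (f k))"
    by (intro eventually_finite_subsets_at_top_weakI) auto
  thus "((\<lambda>k. integral {a..b} (f k)) has_sum integral {a..b} (\<lambda>y. \<Sum>\<^sub>\<infinity>k\<in>X. f k y)) X"
    unfolding has_sum_def integral_unique[OF J(1)] using J(2) tendsto_cong by blast
qed

section \<open>Uniqueness of the Fourier coefficients of a periodic function\<close>

lemma periodic_int:
  fixes D :: "real \<Rightarrow> 'a"
  assumes "\<And>s. D (s + 1) = D s"
  shows "D (s + of_int n) = D s"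
proof (induction n rule: int_induct[where k=0])
  case (step1 i)
  thus ?case using assms[of "s + of_int i"] by (simp add: add.assoc)
next
  case (step2 i)
  thus ?case using assms[of "s + of_int (i - 1)"] by (simp add: add.assoc)
qed auto

lemma cis_2pi_eq_imp_int_diff:
  assumes "cis (2 * pi * a) = cis (2 * pi * b)"
  shows "\<exists>n::int. a = b + of_int n"
proof -
  have "sin (2 * pi * a) = sin (2 * pi * b)" "cos (2 * pi * a) = cos (2 * pi * b)"
    using assms by (auto simp: complex_eq_iff)
  then obtain n :: int where "2 * pi * a = 2 * pi * b + 2 * pi * n"
    using sin_cos_eq_iff by blast
  hence "2 * pi * a = 2 * pi * (b + n)" by (simp add: algebra_simps)
  thus ?thesis by auto
qed

text \<open>Moves a function of period 1 to the circle, where the Stone-Weierstrass theorem applies.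
  \<open>Arg\<close> jumps on the negative real axis; there \<open>Arg (- z)\<close>, shifted by
  half a period, is a continuous substitute.\<close>

lemma continuous_on_circle_of_periodic:
  fixes D :: "real \<Rightarrow> 'a::topological_space"
  assumes D: "continuous_on UNIV D" and per: "\<And>s. D (s + 1) = D s"
  shows "continuous_on (sphere 0 1) (\<lambda>z::complex. D (Arg z / (2 * pi)))"
    and "\<And>s. D (Arg (cis (2 * pi * s)) / (2 * pi)) = D s"
proof -
  have key: "D a = D b" if "cis (2 * pi * a) = cis (2 * pi * b)" for a b
    using cis_2pi_eq_imp_int_diff[OF that] periodic_int[of D, OF per] by metis
  show "D (Arg (cis (2 * pi * s)) / (2 * pi)) = D s" for s
    by (rule key) (simp add: cis_Arg)
  have eq: "D (Arg z / (2 * pi)) = D (Arg (- z) / (2 * pi) + 1 / 2)" if "z \<noteq> 0" for z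
  proof (rule key)
    have "cis (2 * pi * (Arg (- z) / (2 * pi) + 1 / 2)) = cis (Arg (-z) + pi)"
      by (rule arg_cong[of _ _ cis]) (simp add: distrib_left)
    also have "\<dots> = cis (Arg z)"
      using that by (simp add: cis_Arg sgn_minus flip: cis_mult)
    finally show "cis (2 * pi * (Arg z / (2 * pi))) = cis (2 * pi * (Arg (- z) / (2 * pi) + 1 / 2))"
      by simp
  qed
  have cD: "isCont D s" for s using D by (simp add: continuous_on_eq_continuous_at)
  have ci: "isCont (\<lambda>z. D (Arg z / (2 * pi))) z" if z: "z \<noteq> 0" for z
  proof (cases "z \<in> \<real>\<^sub>\<le>\<^sub>0")
    case False
    thus ?thesis
      by (intro isCont_o2[OF _ cD] continuous_intros continuous_at_Arg) auto
  next
    case True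
    hence nz: "- z \<notin> \<real>\<^sub>\<le>\<^sub>0" using z by (auto simp: complex_nonpos_Reals_iff complex_eq_iff)
    have "isCont (\<lambda>z. Arg (- z)) z"
      using isCont_o2[of z uminus Arg] continuous_at_Arg[OF nz] by (simp add: continuous_intros)
    hence *: "isCont (\<lambda>z. D (Arg (- z) / (2 * pi) + 1/2)) z"
      by (intro isCont_o2[OF _ cD] continuous_intros) auto
    have "\<forall>\<^sub>F w in nhds z. w \<noteq> 0" using z by (simp add: t1_space_nhds)
    hence "\<forall>\<^sub>F w in nhds z. D (Arg w / (2 * pi)) = D (Arg (- w) / (2 * pi) + 1/2)"
      by eventually_elim (rule eq)
    from isCont_cong[OF this] * show ?thesis by (rule iffD2)
  qed
  show "continuous_on (sphere 0 1) (\<lambda>z::complex. D (Arg z / (2 * pi)))"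
  proof (intro continuous_at_imp_continuous_on ballI)
    fix z :: complex assume "z \<in> sphere 0 1"
    hence "z \<noteq> 0" by auto
    thus "isCont (\<lambda>z. D (Arg z / (2 * pi))) z" by (rule ci)
  qed
qed

definition trig_poly :: "(real \<Rightarrow> complex) \<Rightarrow> bool" where
  "trig_poly p \<longleftrightarrow> (\<exists>A c. finite A \<and> (\<forall>s. p s = (\<Sum>m\<in>A. c m * cis (2 * pi * of_int m * s))))"

lemma trig_poly_monom: "trig_poly (\<lambda>s. c * cis (2 * pi * of_int m * s))"
  unfolding trig_poly_def by (intro exI[of _ "{m}"] exI[of _ "\<lambda>_. c"]) auto

lemma trig_poly_const: "trig_poly (\<lambda>s. c)"
  using trig_poly_monom[of c 0] by simp

lemma trig_poly_add:
  assumes "trig_poly p" "trig_poly q"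
  shows "trig_poly (\<lambda>s. p s + q s)"
proof -
  obtain A c where A: "finite A" "\<And>s. p s = (\<Sum>m\<in>A. c m * cis (2 * pi * of_int m * s))"
    using assms(1) unfolding trig_poly_def by blast
  obtain B d where B: "finite B" "\<And>s. q s = (\<Sum>m\<in>B. d m * cis (2 * pi * of_int m * s))"
    using assms(2) unfolding trig_poly_def by blast
  have eq: "p s + q s = (\<Sum>m\<in>A \<union> B. ((if m \<in> A then c m else 0) + (if m \<in> B then d m else 0))
          * cis (2 * pi * of_int m * s))" for s
  proof -
    have "p s = (\<Sum>m\<in>A \<union> B. (if m \<in> A then c m else 0) * cis (2 * pi * of_int m * s))"
      unfolding A by (rule sum.mono_neutral_cong_left) (use A B in auto)
    moreover have "q s = (\<Sum>m\<in>A \<union> B. (if m \<in> B then d m else 0) * cis (2 * pi * of_int m * s))"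
      unfolding B by (rule sum.mono_neutral_cong_left) (use A B in auto)
    ultimately show ?thesis by (simp add: algebra_simps sum.distrib)
  qed
  show ?thesis unfolding trig_poly_def
    by (rule exI[of _ "A \<union> B"], rule exI, rule conjI, use A B in simp, rule allI, rule eq)
qed

lemma trig_poly_sum: "(\<And>i. i \<in> A \<Longrightarrow> trig_poly (p i)) \<Longrightarrow> trig_poly (\<lambda>s. \<Sum>i\<in>A. p i s)"
  by (induction A rule: infinite_finite_induct) (auto intro: trig_poly_const trig_poly_add)

lemma trig_poly_mult:
  assumes "trig_poly p" "trig_poly q"
  shows "trig_poly (\<lambda>s. p s * q s)"
proof -
  obtain A c where A: "finite A" "\<And>s. p s = (\<Sum>m\<in>A. c m * cis (2 * pi * of_int m * s))"
    using assms(1) unfolding trig_poly_def by blast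
  obtain B d where B: "finite B" "\<And>s. q s = (\<Sum>m\<in>B. d m * cis (2 * pi * of_int m * s))"
    using assms(2) unfolding trig_poly_def by blast
  have "p s * q s = (\<Sum>m\<in>A. \<Sum>l\<in>B. (c m * d l) * cis (2 * pi * of_int (m + l) * s))" for s
    unfolding A B sum_product by (intro sum.cong refl) (simp add: cis_mult algebra_simps)
  thus ?thesis by (simp only:) (intro trig_poly_sum trig_poly_monom)
qed

text \<open>A real linear form on the circle is a combination of the frequencies 1 and -1, so the
  polynomials of Stone-Weierstrass restrict to trigonometric ones.\<close>

lemma trig_poly_polynomial:
  fixes p :: "complex \<Rightarrow> real"
  assumes "real_polynomial_function p"
  shows "trig_poly (\<lambda>s. of_real (p (cis (2 * pi * s))))"
  using assms
proof induction
  case (linear f)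
  interpret bounded_linear f by fact
  have "of_real (f (cis (2 * pi * s)))
      = (of_real (f 1) / 2 - \<i> * of_real (f \<i>) / 2) * cis (2 * pi * of_int 1 * s) +
        (of_real (f 1) / 2 + \<i> * of_real (f \<i>) / 2) * cis (2 * pi * of_int (-1) * s)" for s
  proof -
    have 1: "cis (2 * pi * s) = cos (2 * pi * s) *\<^sub>R 1 + sin (2 * pi * s) *\<^sub>R \<i>"
      by (auto simp: complex_eq_iff)
    have "f (cis (2 * pi * s)) = cos (2 * pi * s) * f 1 + sin (2 * pi * s) * f \<i>"
      by (subst 1) (simp only: add scaleR real_scaleR_def)
    thus ?thesis by (simp add: complex_eq_iff)
  qed
  thus ?case by (simp only:) (intro trig_poly_add trig_poly_monom)
next
  case (const c)
  show ?case by (rule trig_poly_const)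
next
  case (add f g)
  thus ?case using trig_poly_add by simp
next
  case (mult f g)
  thus ?case using trig_poly_mult by simp
qed

text \<open>If p is a trigonometric polynomial within e of \<open>D\<close>, then \<open>D\<close>
  is orthogonal to p, so the integral of D^2 equals that of D (D - p) and is at most e times the
  integral of |D|.\<close>

lemma fourier_unique_real:
  fixes D :: "real \<Rightarrow> real"
  assumes D: "continuous_on UNIV D" and per: "\<And>s. D (s + 1) = D s"
    and zero: "\<And>m::int. integral {0..1} (\<lambda>s. of_real (D s) * cis (2 * pi * of_int m * s)) = 0"
  shows "D s = 0"
proof -
  define f where "f = (\<lambda>z. D (Arg z / (2 * pi)))"
  have f: "continuous_on (sphere 0 1) f" "\<And>s. f (cis (2 * pi * s)) = D s"
    using continuous_on_circle_of_periodic[OF D per] by (auto simp: f_def)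
  have contD: "continuous_on A D" for A using D continuous_on_subset by blast
  define K where "K = integral {0..1} (\<lambda>s. \<bar>D s\<bar>)"
  have K0: "K \<ge> 0" unfolding K_def by (intro integral_nonneg integrable_continuous_real continuous_intros contD) auto
  have *: "integral {0..1} (\<lambda>s. (D s)^2) \<le> e * K" if e: "e > 0" for e
  proof -
    obtain p where p: "real_polynomial_function p" "\<And>z. z \<in> sphere 0 1 \<Longrightarrow> \<bar>f z - p z\<bar> < e"
      using Stone_Weierstrass_real_polynomial_function[OF compact_sphere f(1) e] by blast
    have "trig_poly (\<lambda>s. of_real (p (cis (2 * pi * s))))" using trig_poly_polynomial p by blast
    then obtain A c where A: "finite A"
        "\<And>s. of_real (p (cis (2 * pi * s))) = (\<Sum>m\<in>A. c m * cis (2 * pi * of_int m * s))"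
      unfolding trig_poly_def by blast
    have cp: "continuous_on {0..1} (\<lambda>s. p (cis (2 * pi * s)))"
    proof -
      have "continuous_on UNIV p" using p(1) continuous_on_polymonial_function real_polynomial_function_eq by blast
      thus ?thesis by (rule continuous_on_compose2) (auto intro!: continuous_intros simp: cis_conv_exp)
    qed
    have iDp: "(\<lambda>s. D s * p (cis (2 * pi * s))) integrable_on {0..1}"
      by (intro integrable_continuous_real continuous_intros contD cp)
    have cc: "continuous_on {0..1} (\<lambda>s. cis (2 * pi * of_int m * s))" for m
      by (auto intro!: continuous_intros simp: cis_conv_exp)
    have "of_real (integral {0..1} (\<lambda>s. D s * p (cis (2 * pi * s)))) =
          integral {0..1} (\<lambda>s. complex_of_real (D s * p (cis (2 * pi * s))))"
      using integral_linear[OF _ bounded_linear_of_real, of "\<lambda>s. D s * p (cis (2 * pi * s))" "{0..1}", where 'a1=complex]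
      by (simp only: o_def) (metis iDp)
    also have "\<dots> = integral {0..1} (\<lambda>s. \<Sum>m\<in>A. c m * (of_real (D s) * cis (2 * pi * of_int m * s)))"
      by (simp only: of_real_mult A sum_distrib_left mult.left_commute)
    also have "\<dots> = (\<Sum>m\<in>A. integral {0..1} (\<lambda>s. c m * (of_real (D s) * cis (2 * pi * of_int m * s))))"
      by (rule integral_sum[OF A(1)]) (intro integrable_continuous_real continuous_intros contD cc)+
    also have "\<dots> = 0" using zero by simp
    finally have 0: "integral {0..1} (\<lambda>s. D s * p (cis (2 * pi * s))) = 0" by simp
    have "integral {0..1} (\<lambda>s. (D s)^2) = integral {0..1} (\<lambda>s. (D s)^2) - integral {0..1} (\<lambda>s. D s * p (cis (2 * pi * s)))"
      using 0 by simp
    also have "\<dots> = integral {0..1} (\<lambda>s. (D s)^2 - D s * p (cis (2 * pi * s)))"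
      by (rule integral_diff[symmetric]) (intro integrable_continuous_real continuous_intros contD cp)+
    also have "\<dots> \<le> integral {0..1} (\<lambda>s. e * \<bar>D s\<bar>)"
    proof (rule integral_le)
      fix s :: real
      have "(D s)^2 - D s * p (cis (2 * pi * s)) = D s * (f (cis (2 * pi * s)) - p (cis (2 * pi * s)))"
        by (simp only: f power2_eq_square right_diff_distrib)
      also have "\<dots> \<le> \<bar>D s\<bar> * \<bar>f (cis (2 * pi * s)) - p (cis (2 * pi * s))\<bar>"
        by (metis abs_ge_self abs_mult)
      also have "\<dots> \<le> \<bar>D s\<bar> * e" using p(2)[of "cis (2 * pi * s)"] by (intro mult_left_mono) auto
      finally show "(D s)^2 - D s * p (cis (2 * pi * s)) \<le> e * \<bar>D s\<bar>" by (simp add: mult.commute)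
    qed (intro integrable_continuous_real continuous_intros contD cp)+
    also have "\<dots> = e * K" by (simp add: K_def)
    finally show ?thesis .
  qed
  have "integral {0..1} (\<lambda>s. (D s)^2) \<le> 0"
  proof (rule field_le_epsilon)
    fix e :: real assume e: "e > 0"
    have "integral {0..1} (\<lambda>s. (D s)^2) \<le> e / (K + 1) * K" by (rule *) (use e K0 in auto)
    also have "\<dots> \<le> e" using e K0 by (simp add: field_simps)
    finally show "integral {0..1} (\<lambda>s. (D s)^2) \<le> 0 + e" by simp
  qed
  moreover have "integral {0..1} (\<lambda>s. (D s)^2) \<ge> 0"
    by (intro integral_nonneg integrable_continuous_real continuous_intros contD) auto
  ultimately have i0: "integral {0..1} (\<lambda>s. (D s)^2) = 0" by linarith
  have z: "(D s)^2 = 0" if "s \<in> {0..1}" for s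
  proof -
    have "continuous_on {0..1} (\<lambda>s. (D s)^2)" by (intro continuous_intros contD)
    thus ?thesis using integral_eq_0_iff[of 0 1 "\<lambda>s. (D s)^2"] i0 that by simp
  qed
  have "D s = D (frac s + of_int \<lfloor>s\<rfloor>)" by (simp add: frac_def)
  also have "\<dots> = D (frac s)" by (rule periodic_int[of D, OF per])
  also have "\<dots> = 0" using z[of "frac s"] frac_lt_1[of s] frac_ge_0[of s] by auto
  finally show ?thesis .
qed

lemma fourier_unique:
  fixes D :: "real \<Rightarrow> complex"
  assumes D: "continuous_on UNIV D" and per: "\<And>s. D (s + 1) = D s"
    and zero: "\<And>m::int. integral {0..1} (\<lambda>s. D s * cis (2 * pi * of_int m * s)) = 0"
  shows "D s = 0"
proof -
  have contD: "continuous_on A D" for A using D continuous_on_subset by blast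
  have cc: "continuous_on A (\<lambda>s. cis (2 * pi * of_int m * s))" for m A
      by (auto intro!: continuous_intros simp: cis_conv_exp)
  have int: "(\<lambda>s. D s * cis (2 * pi * of_int m * s)) integrable_on {0..1}"
            "(\<lambda>s. cnj (D s) * cis (2 * pi * of_int m * s)) integrable_on {0..1}" for m
    by (intro integrable_continuous_real continuous_intros contD cc)+
  have zero': "integral {0..1} (\<lambda>s. cnj (D s) * cis (2 * pi * of_int m * s)) = 0" for m
  proof -
    have "integral {0..1} (\<lambda>s. cnj (D s) * cis (2 * pi * of_int m * s)) =
          integral {0..1} (\<lambda>s. cnj (D s * cis (2 * pi * of_int (-m) * s)))"
      by (simp add: cis_cnj)
    also have "\<dots> = cnj (integral {0..1} (\<lambda>s. D s * cis (2 * pi * of_int (-m) * s)))"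
      using integral_cnj by metis
    finally show ?thesis using zero[of "-m"] by simp
  qed
  have eqR: "(of_real (Re (D s)) * cis (2 * pi * of_int m * s)) =
       (1/2) * (D s * cis (2 * pi * of_int m * s)) + (1/2) * (cnj (D s) * cis (2 * pi * of_int m * s))" for m s
    by (simp add: complex_eq_iff field_simps)
  have eqI: "(of_real (Im (D s)) * cis (2 * pi * of_int m * s)) =
       (-\<i>/2) * (D s * cis (2 * pi * of_int m * s)) + (\<i>/2) * (cnj (D s) * cis (2 * pi * of_int m * s))" for m s
    by (simp add: complex_eq_iff field_simps)
  have "Re (D s) = 0"
  proof (rule fourier_unique_real[of "\<lambda>s. Re (D s)"])
    show "integral {0..1} (\<lambda>s. of_real (Re (D s)) * cis (2 * pi * of_int m * s)) = 0" for m
      unfolding eqR using zero zero' by (subst integral_add[OF integrable_on_mult_right[OF int(1)] integrable_on_mult_right[OF int(2)]]) auto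
  qed (use D per in \<open>auto intro!: continuous_intros\<close>)
  moreover have "Im (D s) = 0"
  proof (rule fourier_unique_real[of "\<lambda>s. Im (D s)"])
    show "integral {0..1} (\<lambda>s. of_real (Im (D s)) * cis (2 * pi * of_int m * s)) = 0" for m
      unfolding eqI using zero zero' by (subst integral_add[OF integrable_on_mult_right[OF int(1)] integrable_on_mult_right[OF int(2)]]) auto
  qed (use D per in \<open>auto intro!: continuous_intros\<close>)
  ultimately show ?thesis by (simp add: complex_eq_iff)
qed

section \<open>Gaussian sums over the integers\<close>

lemma summable_on_int_gauss:
  fixes c :: real
  assumes c: "c > 0"
  shows "(\<lambda>k::int. exp (- c * (of_int k)\<^sup>2)) summable_on UNIV"
proof -
  have geo: "(\<lambda>n::nat. exp (- c) ^ n) summable_on UNIV"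
  proof -
    have "summable (\<lambda>n. exp (- c) ^ n)" by (rule summable_geometric) (use c in auto)
    thus ?thesis by (auto intro: summable_nonneg_imp_summable_on)
  qed
  have nat: "(\<lambda>n::nat. exp (- c * (real n)\<^sup>2)) summable_on UNIV"
  proof (rule summable_on_comparison_test[OF geo])
    fix n :: nat
    have "real n \<le> (real n)\<^sup>2"
      unfolding power2_eq_square by (cases n) auto
    hence "c * real n \<le> c * (real n)\<^sup>2" using c by (intro mult_left_mono) auto
    thus "exp (- c * (real n)\<^sup>2) \<le> exp (- c) ^ n"
      by (simp add: exp_of_nat_mult[symmetric] mult.commute)
  qed auto
  have 1: "(\<lambda>k::int. exp (- c * (of_int k)\<^sup>2)) summable_on range int"
    by (subst summable_on_reindex) (use nat in \<open>auto simp: o_def inj_on_def\<close>)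
  have 2: "(\<lambda>k::int. exp (- c * (of_int k)\<^sup>2)) summable_on range (\<lambda>n. - int n)"
    by (subst summable_on_reindex) (use nat in \<open>auto simp: o_def inj_on_def\<close>)
  have "(UNIV :: int set) = range int \<union> range (\<lambda>n. - int n)"
    by (auto intro: int_cases2)
  thus ?thesis using summable_on_union[OF 1 2] by simp
qed

text \<open>From (k + 2 s)^2 >= 0. The majorant is uniform over bounded shifts, as the M-test
  requires.\<close>

lemma gauss_shift_le:
  fixes k s a N :: real
  assumes "a > 0" "\<bar>s\<bar> \<le> N"
  shows "exp (- (pi * a * (k + s)\<^sup>2)) \<le> exp (pi * a * N\<^sup>2) * exp (- (pi * a / 2) * k\<^sup>2)"
proof -
  have "s\<^sup>2 \<le> N\<^sup>2" using power_mono[of "\<bar>s\<bar>" N 2] assms(2) by simp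
  moreover have "(k + s)\<^sup>2 \<ge> k\<^sup>2 / 2 - s\<^sup>2"
    using zero_le_power2[of "k + 2 * s"] by (simp add: power2_eq_square algebra_simps)
  ultimately have "k\<^sup>2 / 2 - N\<^sup>2 \<le> (k + s)\<^sup>2" by linarith
  hence "pi * a * (k\<^sup>2 / 2 - N\<^sup>2) \<le> pi * a * (k + s)\<^sup>2"
    using assms by (intro mult_left_mono) auto
  thus ?thesis by (simp add: exp_add[symmetric] algebra_simps)
qed

lemma summable_on_int_gauss_shift:
  assumes "a > 0"
  shows "(\<lambda>k::int. exp (- (pi * a * (of_int k + s)\<^sup>2))) summable_on UNIV"
proof (rule summable_on_comparison_test)
  show "(\<lambda>k::int. exp (pi * a * \<bar>s\<bar>\<^sup>2) * exp (- (pi * a / 2) * (of_int k)\<^sup>2)) summable_on UNIV"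
    by (intro summable_on_cmult_right summable_on_int_gauss) (use assms in auto)
qed (use gauss_shift_le[OF assms order.refl] in auto)

definition gauss_wave :: "real \<Rightarrow> real \<Rightarrow> real \<Rightarrow> complex" where
  "gauss_wave a \<xi> x = of_real (exp (- (pi * a * x\<^sup>2))) * cis (2 * pi * \<xi> * x)"

lemma norm_gauss_wave: "norm (gauss_wave a \<xi> x) = exp (- (pi * a * x\<^sup>2))"
  by (simp add: gauss_wave_def norm_mult)

lemma continuous_gauss_wave: "continuous_on A (gauss_wave a \<xi>)"
  unfolding gauss_wave_def by (auto intro!: continuous_intros simp: cis_conv_exp)

lemma gauss_fourier_transform:
  assumes a: "a > 0"
  shows "integrable lborel (gauss_wave a \<xi>)"
    and "integral\<^sup>L lborel (gauss_wave a \<xi>) = of_real (exp (- (pi * \<xi>\<^sup>2 / a)) / sqrt a)"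
proof -
  \<comment> \<open>The substitution x -> c x turns the Gaussian into the standard normal density,
    whose characteristic function is known.\<close>
  define c where "c = sqrt (2 * pi * a)"
  have c: "c > 0" "c\<^sup>2 = 2 * pi * a" using a by (auto simp: c_def)
  define t where "t = 2 * pi * \<xi> / c"
  define F where "F = (\<lambda>x::real. std_normal_density x *\<^sub>R iexp (t * x))"
  have meas: "F \<in> borel_measurable borel" unfolding F_def by simp
  have intF: "integrable lborel F"
  proof (rule Bochner_Integration.integrable_bound)
    show "integrable lborel (\<lambda>x. std_normal_density x * \<bar>x\<bar>^0)" by (rule integrable_std_normal_moment_abs)
    show "F \<in> borel_measurable lborel" using meas by simp
    show "AE x in lborel. norm (F x) \<le> norm (std_normal_density x * \<bar>x\<bar>^0)"
      by (auto simp: F_def)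
  qed
  have "char std_normal_distribution t = integral\<^sup>L lborel F"
    unfolding char_def F_def by (subst integral_density) auto
  hence charF: "integral\<^sup>L lborel F = of_real (exp (- t\<^sup>2 / 2))"
    using char_std_normal_distribution by simp
  have eq: "F (0 + c * x) = of_real (1 / sqrt (2 * pi)) * gauss_wave a \<xi> x" for x
  proof -
    have e: "t * (c * x) = 2 * pi * \<xi> * x" using c by (simp add: t_def)
    have "iexp (t * (c * x)) = cis (2 * pi * \<xi> * x)" by (simp only: cis_conv_exp e)
    moreover have "(c * x)\<^sup>2 / 2 = pi * a * x\<^sup>2" by (simp add: power_mult_distrib c(2))
    ultimately show ?thesis
      by (simp add: F_def gauss_wave_def std_normal_density_def scaleR_conv_of_real del: of_real_mult)
  qed
  have pos: "1 / sqrt (2 * pi) \<noteq> 0" by simp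
  have "integrable lborel (\<lambda>x. F (0 + c * x))"
    using lborel_integrable_real_affine[OF intF, of c 0] c by simp
  hence "integrable lborel (\<lambda>x. of_real (sqrt (2 * pi)) * (of_real (1 / sqrt (2 * pi)) * gauss_wave a \<xi> x))"
    unfolding eq by (rule integrable_mult_right)
  thus "integrable lborel (gauss_wave a \<xi>)" by (simp add: mult.assoc[symmetric] flip: of_real_mult)
  have "integral\<^sup>L lborel F = c *\<^sub>R (LINT x|lborel. F (0 + c * x))"
    using lborel_integral_real_affine[of c F 0] c by simp
  also have "\<dots> = of_real (c / sqrt (2 * pi)) * integral\<^sup>L lborel (gauss_wave a \<xi>)"
    unfolding eq by (simp add: scaleR_conv_of_real)
  also have "c / sqrt (2 * pi) = sqrt a" by (simp add: c_def real_sqrt_mult)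
  finally have e: "of_real (exp (- t\<^sup>2 / 2)) = of_real (sqrt a) * integral\<^sup>L lborel (gauss_wave a \<xi>)"
    using charF by simp
  have tt: "- t\<^sup>2 / 2 = - (pi * \<xi>\<^sup>2 / a)"
    using a by (simp add: t_def power_divide c(2) power_mult_distrib) (simp add: field_simps power2_eq_square)
  show "integral\<^sup>L lborel (gauss_wave a \<xi>) = of_real (exp (- (pi * \<xi>\<^sup>2 / a)) / sqrt a)"
    using e[unfolded tt] a by simp
qed

lemma integral_gauss_wave_LIMSEQ:
  assumes a: "a > 0"
  shows "(\<lambda>N. integral {- real N..real N} (gauss_wave a \<xi>)) \<longlonglongrightarrow> integral\<^sup>L lborel (gauss_wave a \<xi>)"
proof -
  have int: "integrable lborel (gauss_wave a \<xi>)" by (rule gauss_fourier_transform[OF a])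
  have seti: "set_integrable lborel {- real N..real N} (gauss_wave a \<xi>)" for N
    using integrable_mult_indicator[OF _ int] unfolding set_integrable_def by simp
  have "(\<lambda>N. LINT x|lborel. indicator {- real N..real N} x *\<^sub>R gauss_wave a \<xi> x) \<longlonglongrightarrow> integral\<^sup>L lborel (gauss_wave a \<xi>)"
  proof (rule integral_dominated_convergence[where w = "\<lambda>x. norm (gauss_wave a \<xi> x)"])
    show "integrable lborel (\<lambda>x. norm (gauss_wave a \<xi> x))" using int by simp
    show "AE x in lborel. (\<lambda>N. indicator {- real N..real N} x *\<^sub>R gauss_wave a \<xi> x) \<longlonglongrightarrow> gauss_wave a \<xi> x"
    proof (rule AE_I2)
      fix x :: real
      have "\<forall>\<^sub>F N in sequentially. indicator {- real N..real N} x *\<^sub>R gauss_wave a \<xi> x = gauss_wave a \<xi> x"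
        using eventually_ge_at_top[of "nat \<lceil>\<bar>x\<bar>\<rceil>"]
        by eventually_elim (auto simp: indicator_def)
      thus "(\<lambda>N. indicator {- real N..real N} x *\<^sub>R gauss_wave a \<xi> x) \<longlonglongrightarrow> gauss_wave a \<xi> x"
        by (rule tendsto_eventually)
    qed
  qed (use int in \<open>auto simp: indicator_def\<close>)
  moreover have "(LINT x|lborel. indicator {- real N..real N} x *\<^sub>R gauss_wave a \<xi> x) = integral {- real N..real N} (gauss_wave a \<xi>)" for N
    using set_borel_integral_eq_integral(2)[OF seti[of N]] unfolding set_lebesgue_integral_def .
  ultimately show ?thesis by simp
qed

text \<open>The window is half-open so that the unit intervals from k to k + 1 tile the interval
  from -N to N exactly.\<close>

lemma has_sum_int_symmetric_limit:
  fixes I :: "int \<Rightarrow> complex"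
  assumes "(I has_sum S) UNIV"
  shows "(\<lambda>N. \<Sum>k\<in>{- int N..<int N}. I k) \<longlonglongrightarrow> S"
proof -
  have "filterlim (\<lambda>N. {- int N..<int N}) (finite_subsets_at_top UNIV) sequentially"
    unfolding filterlim_finite_subsets_at_top
  proof safe
    fix X :: "int set" assume X: "finite X"
    define B where "B = nat (Max (insert 0 (abs ` X))) + 1"
    have B: "\<bar>x\<bar> < int B" if "x \<in> X" for x
    proof -
      have "\<bar>x\<bar> \<le> Max (insert 0 (abs ` X))" using X that by (intro Max_ge) auto
      thus ?thesis unfolding B_def by linarith
    qed
    show "\<forall>\<^sub>F N in sequentially. finite {- int N..<int N} \<and> X \<subseteq> {- int N..<int N} \<and> {- int N..<int N} \<subseteq> UNIV"
      using eventually_ge_at_top[of B]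
    proof eventually_elim
      case (elim N)
      have "x \<in> {- int N..<int N}" if "x \<in> X" for x using B[OF that] elim by auto
      thus ?case by auto
    qed
  qed
  from filterlim_compose[OF assms[unfolded has_sum_def] this] show ?thesis .
qed

lemma integral_cis_period:
  "integral {0..1} (\<lambda>s. cis (2 * pi * of_int j * s)) = (if j = 0 then 1 else 0)"
proof (cases "j = 0")
  case False
  define w where "w = \<i> * of_real (2 * pi * of_int j)"
  have w: "w \<noteq> 0" using False by (simp add: w_def)
  have e: "cis (2 * pi * of_int j * s) = exp (w * of_real s)" for s
    by (simp add: cis_conv_exp w_def mult_ac)
  have "((\<lambda>s. exp (w * of_real s)) has_integral exp (w * of_real 1) / w - exp (w * of_real 0) / w) {0..1}"
  proof (rule fundamental_theorem_of_calculus)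
    fix x :: real
    have "((\<lambda>z. exp (w * z) / w) has_field_derivative exp (w * of_real x)) (at (of_real x))"
      by (auto intro!: derivative_eq_intros simp: w)
    thus "((\<lambda>s. exp (w * of_real s) / w) has_vector_derivative exp (w * of_real x)) (at x within {0..1})"
      using has_vector_derivative_real_field by blast
  qed simp
  moreover have "exp (w * of_real 1) = 1"
    using e[of 1] cis_multiple_2pi[of "of_int j"] by (simp add: mult_ac)
  ultimately have "((\<lambda>s. exp (w * of_real s)) has_integral 0) {0..1}" by simp
  thus ?thesis unfolding e using False by (simp add: integral_unique)
qed simp

text \<open>Both sides are continuous and periodic in \<open>s\<close> with the same Fourier coefficients, and trigonometric
  polynomials are dense.\<close>
theorem gauss_poisson:
  assumes a: "a > 0"
  shows "(\<Sum>\<^sub>\<infinity>k::int. gauss_wave a \<phi> (of_int k + s)) =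
         of_real (1 / sqrt a) * (\<Sum>\<^sub>\<infinity>m::int. of_real (exp (- (pi * (of_int m - \<phi>)\<^sup>2 / a))) * cis (2 * pi * of_int m * s))"
proof -
  define F where "F = (\<lambda>s. \<Sum>\<^sub>\<infinity>k::int. gauss_wave a \<phi> (of_int k + s))"
  define c where "c = (\<lambda>m::int. complex_of_real (exp (- (pi * (of_int m - \<phi>)\<^sup>2 / a)) / sqrt a))"
  define G where "G = (\<lambda>s. \<Sum>\<^sub>\<infinity>m::int. c m * cis (2 * pi * of_int m * s))"
  have cis_cont: "continuous_on A (\<lambda>s. cis (2 * pi * of_int m * s))" for m :: int and A
    by (auto intro!: continuous_intros simp: cis_conv_exp)
  have gcont: "continuous_on A (\<lambda>s. gauss_wave a \<phi> (of_int k + s))" for k :: int and A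
    by (rule continuous_on_compose2[OF continuous_gauss_wave[of UNIV]]) (auto intro!: continuous_intros)
  have Mg: "(\<lambda>k::int. exp (pi * a * N\<^sup>2) * exp (- (pi * a / 2) * (of_int k)\<^sup>2)) summable_on UNIV" for N
    by (intro summable_on_cmult_right summable_on_int_gauss) (use a in auto)
  have bg: "norm (gauss_wave a \<phi> (of_int k + s)) \<le> exp (pi * a * N\<^sup>2) * exp (- (pi * a / 2) * (of_int k)\<^sup>2)"
    if "\<bar>s\<bar> \<le> N" for k :: int and s N
    unfolding norm_gauss_wave using gauss_shift_le[OF a that] .
  have nc: "norm (c m * cis (2 * pi * of_int m * s)) = norm (c m)" for m s by (simp add: norm_mult)
  have Mc: "(\<lambda>m. norm (c m)) summable_on UNIV"
  proof -
    have "(\<lambda>m::int. exp (- (pi * (1 / a) * (of_int m + - \<phi>)\<^sup>2)) * (1 / sqrt a)) summable_on UNIV"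
      by (intro summable_on_cmult_left summable_on_int_gauss_shift) (use a in auto)
    thus ?thesis using a by (simp add: c_def norm_divide)
  qed
  have contF0: "continuous_on {-N..N} F" for N
    unfolding F_def by (rule has_sum_integral_M_test(1)[OF gcont bg[of _ N] Mg]) auto
  have contF: "continuous_on UNIV F"
  proof (intro continuous_at_imp_continuous_on ballI)
    fix x :: real
    show "isCont F x"
      by (rule continuous_on_interior[OF contF0[of "\<bar>x\<bar> + 1"]]) (auto simp: interior_atLeastAtMost_real)
  qed
  have contG0: "continuous_on {-N..N} G" for N
    unfolding G_def by (rule has_sum_integral_M_test(1)[OF _ _ Mc]) (auto simp only: nc intro!: continuous_intros cis_cont)
  have contG: "continuous_on UNIV G"
  proof (intro continuous_at_imp_continuous_on ballI)
    fix x :: real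
    show "isCont G x"
      by (rule continuous_on_interior[OF contG0[of "\<bar>x\<bar> + 1"]]) (auto simp: interior_atLeastAtMost_real)
  qed
  have perF: "F (s + 1) = F s" for s
  proof -
    have "F s = (\<Sum>\<^sub>\<infinity>k::int. gauss_wave a \<phi> (of_int (k + 1) + s))" unfolding F_def
      by (rule infsum_reindex_bij_betw[symmetric, of "\<lambda>k. k + 1"]) (rule bij_plus_right)
    thus ?thesis by (simp add: F_def add_ac)
  qed
  have perG: "G (s + 1) = G s" for s
  proof -
    have "cis (2 * pi * of_int m * (s + 1)) = cis (2 * pi * of_int m * s)" for m :: int
      using cis_multiple_2pi[of "of_int m"] by (simp add: distrib_left mult_ac flip: cis_mult)
    thus ?thesis by (simp add: G_def)
  qed
  have shift: "gauss_wave a \<phi> (of_int k + s) * cis (2 * pi * of_int m * s) = gauss_wave a (\<phi> + of_int m) (s + of_int k)"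
    for k m :: int and s
  proof -
    have "cis (2 * pi * (\<phi> + of_int m) * (s + of_int k)) =
          cis (2 * pi * \<phi> * (of_int k + s)) * cis (2 * pi * of_int m * s) * cis (2 * pi * of_int (m * k))"
      by (simp add: cis_mult algebra_simps)
    also have "cis (2 * pi * of_int (m * k)) = 1" by (rule cis_multiple_2pi) auto
    finally show ?thesis by (simp add: gauss_wave_def add.commute)
  qed
  \<comment> \<open>Integrating the periodisation over one period unrolls to an integral over the
    line. The character is absorbed into the frequency of the Gaussian, because m k is an
    integer.\<close>
  have coefF: "integral {0..1} (\<lambda>s. F s * cis (2 * pi * of_int m * s)) = c (- m)" for m
  proof -
    let ?q = "gauss_wave a (\<phi> + of_int m)"
    have "((\<lambda>k. integral {0..1} (\<lambda>s. gauss_wave a \<phi> (of_int k + s) * cis (2 * pi * of_int m * s))) has_sum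
            integral {0..1} (\<lambda>s. \<Sum>\<^sub>\<infinity>k. gauss_wave a \<phi> (of_int k + s) * cis (2 * pi * of_int m * s))) (UNIV::int set)"
    proof (rule has_sum_integral_M_test(2)[OF _ _ Mg[of 1]])
      show "continuous_on {0..1} (\<lambda>s. gauss_wave a \<phi> (of_int k + s) * cis (2 * pi * of_int m * s))" for k
        by (intro continuous_intros gcont cis_cont)
      show "norm (gauss_wave a \<phi> (of_int k + y) * cis (2 * pi * of_int m * y)) \<le> exp (pi * a * 1\<^sup>2) * exp (- (pi * a / 2) * (of_int k)\<^sup>2)"
        if "y \<in> {0..1}" for k y
        using bg[of y 1 k] that by (simp only: norm_mult norm_cis mult_1_right) auto
    qed
    also have "(\<lambda>s. \<Sum>\<^sub>\<infinity>k::int. gauss_wave a \<phi> (of_int k + s) * cis (2 * pi * of_int m * s)) = (\<lambda>s. F s * cis (2 * pi * of_int m * s))"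
      by (simp add: F_def infsum_cmult_left')
    also have "(\<lambda>k::int. integral {0..1} (\<lambda>s. gauss_wave a \<phi> (of_int k + s) * cis (2 * pi * of_int m * s))) =
               (\<lambda>k. integral {of_int k..of_int k + 1} ?q)"
    proof
      fix k :: int
      show "integral {0..1} (\<lambda>s. gauss_wave a \<phi> (of_int k + s) * cis (2 * pi * of_int m * s)) = integral {of_int k..of_int k + 1} ?q"
        unfolding shift using integral_shift_real_ivl[of "of_int k" "of_int k" "of_int k + 1" ?q] by simp
    qed
    finally have lim: "(\<lambda>N. \<Sum>k\<in>{- int N..<int N}. integral {of_int k..of_int k + 1} ?q) \<longlonglongrightarrow> integral {0..1} (\<lambda>s. F s * cis (2 * pi * of_int m * s))"
      by (rule has_sum_int_symmetric_limit)
    have sum: "(\<Sum>k\<in>{- int N..<int N}. integral {of_int k..of_int k + 1} ?q) = integral {- real N..real N} ?q" for N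
    proof (induction N)
      case (Suc N)
      have io: "?q integrable_on {u..v}" for u v
        by (intro integrable_continuous_real continuous_gauss_wave)
      have "{- int (Suc N)..<int (Suc N)} = insert (- int (Suc N)) (insert (int N) {- int N..<int N})" by auto
      hence "(\<Sum>k\<in>{- int (Suc N)..<int (Suc N)}. integral {of_int k..of_int k + 1} ?q) =
             integral {- real (Suc N)..- real N} ?q + (integral {real N..real (Suc N)} ?q + integral {- real N..real N} ?q)"
        using Suc by (simp add: add_ac)
      also have "\<dots> = integral {- real (Suc N)..- real N} ?q + integral {- real N..real (Suc N)} ?q"
        using Henstock_Kurzweil_Integration.integral_combine[OF _ _ io, of "- real N" "real N" "real (Suc N)"] by (simp add: add.commute)
      also have "\<dots> = integral {- real (Suc N)..real (Suc N)} ?q"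
        using Henstock_Kurzweil_Integration.integral_combine[OF _ _ io, of "- real (Suc N)" "- real N" "real (Suc N)"] by (simp add: add.commute)
      finally show ?case .
    qed auto
    have "integral {0..1} (\<lambda>s. F s * cis (2 * pi * of_int m * s)) = integral\<^sup>L lborel ?q"
      using LIMSEQ_unique[OF lim[unfolded sum] integral_gauss_wave_LIMSEQ[OF a]] .
    also have "\<dots> = c (- m)"
      unfolding gauss_fourier_transform(2)[OF a] c_def
      by (simp add: power2_commute[of "- of_int m" \<phi>])
    finally show ?thesis .
  qed
  have coefG: "integral {0..1} (\<lambda>s. G s * cis (2 * pi * of_int m * s)) = c (- m)" for m
  proof -
    have "((\<lambda>l. integral {0..1} (\<lambda>s. c l * cis (2 * pi * of_int l * s) * cis (2 * pi * of_int m * s))) has_sum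
            integral {0..1} (\<lambda>s. \<Sum>\<^sub>\<infinity>l. c l * cis (2 * pi * of_int l * s) * cis (2 * pi * of_int m * s))) (UNIV::int set)"
      by (rule has_sum_integral_M_test(2)[OF _ _ Mc])
         (auto simp: norm_mult intro!: continuous_intros cis_cont)
    also have "(\<lambda>s. \<Sum>\<^sub>\<infinity>l::int. c l * cis (2 * pi * of_int l * s) * cis (2 * pi * of_int m * s)) = (\<lambda>s. G s * cis (2 * pi * of_int m * s))"
      by (simp add: G_def infsum_cmult_left')
    also have "(\<lambda>l::int. integral {0..1} (\<lambda>s. c l * cis (2 * pi * of_int l * s) * cis (2 * pi * of_int m * s))) =
               (\<lambda>l. c l * (if l + m = 0 then 1 else 0))"
    proof
      fix l :: int
      have "(\<lambda>s. c l * cis (2 * pi * of_int l * s) * cis (2 * pi * of_int m * s)) = (\<lambda>s. c l * cis (2 * pi * of_int (l + m) * s))"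
        by (simp add: cis_mult algebra_simps)
      thus "integral {0..1} (\<lambda>s. c l * cis (2 * pi * of_int l * s) * cis (2 * pi * of_int m * s)) = c l * (if l + m = 0 then 1 else 0)"
        by (simp add: integral_cis_period del: of_int_add)
    qed
    finally have "((\<lambda>l. c l * (if l + m = 0 then 1 else 0)) has_sum integral {0..1} (\<lambda>s. G s * cis (2 * pi * of_int m * s))) UNIV" .
    moreover have "((\<lambda>l. c l * (if l + m = 0 then 1 else 0)) has_sum c (- m)) UNIV"
      by (rule has_sum_finite_neutralI[of "{- m}"]) auto
    ultimately show ?thesis by (rule has_sum_unique)
  qed
  have "F s - G s = 0"
  proof (rule fourier_unique[of "\<lambda>s. F s - G s"])
    show "continuous_on UNIV (\<lambda>s. F s - G s)" by (intro continuous_intros contF contG)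
    show "F (s + 1) - G (s + 1) = F s - G s" for s by (simp add: perF perG)
    fix m :: int
    have "integral {0..1} (\<lambda>s. (F s - G s) * cis (2 * pi * of_int m * s)) =
          integral {0..1} (\<lambda>s. F s * cis (2 * pi * of_int m * s) - G s * cis (2 * pi * of_int m * s))"
      by (simp add: left_diff_distrib)
    also have "\<dots> = integral {0..1} (\<lambda>s. F s * cis (2 * pi * of_int m * s)) - integral {0..1} (\<lambda>s. G s * cis (2 * pi * of_int m * s))"
      by (intro integral_diff integrable_continuous_real continuous_intros cis_cont
          continuous_on_subset[OF contF] continuous_on_subset[OF contG]) auto
    finally show "integral {0..1} (\<lambda>s. (F s - G s) * cis (2 * pi * of_int m * s)) = 0"
      by (simp add: coefF coefG)
  qed
  hence "F s = G s" by simp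
  also have "G s = of_real (1 / sqrt a) * (\<Sum>\<^sub>\<infinity>m::int. of_real (exp (- (pi * (of_int m - \<phi>)\<^sup>2 / a))) * cis (2 * pi * of_int m * s))"
  proof -
    have "c m * cis (2 * pi * of_int m * s) =
        of_real (1 / sqrt a) * (of_real (exp (- (pi * (of_int m - \<phi>)\<^sup>2 / a))) * cis (2 * pi * of_int m * s))" for m
      by (simp add: c_def)
    thus ?thesis unfolding G_def by (simp only: infsum_cmult_right')
  qed
  finally show ?thesis by (simp add: F_def)
qed

subsection \<open>Poisson summation for lattices\<close>

text \<open>Without summability both sides are the default value 0.\<close>

lemma infsum_of_real: "(\<Sum>\<^sub>\<infinity>x\<in>A. complex_of_real (f x)) = of_real (\<Sum>\<^sub>\<infinity>x\<in>A. f x)"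
proof (cases "f summable_on A")
  case True
  thus ?thesis by (intro infsumI) (simp add: has_sum_of_real_iff)
next
  case False
  hence "\<not> (\<lambda>x. complex_of_real (f x)) summable_on A" using summable_on_Re by fastforce
  thus ?thesis using False by (simp add: infsum_not_exists)
qed

text \<open>Poisson summation writes the left side as a series of characters in s with positive
  coefficients, which is largest at s = 0.\<close>

lemma infsum_gauss_shift_le:
  assumes a: "a > 0"
  shows "(\<Sum>\<^sub>\<infinity>k::int. exp (- (pi * a * (of_int k + s)\<^sup>2))) \<le> (\<Sum>\<^sub>\<infinity>k::int. exp (- (pi * a * (of_int k)\<^sup>2)))"
proof -
  define c where "c = (\<lambda>m::int. exp (- (pi * (1 / a) * (of_int m + 0)\<^sup>2)))"
  have c: "c summable_on UNIV" unfolding c_def by (rule summable_on_int_gauss_shift) (use a in simp)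
  define S where "S = (\<lambda>s. \<Sum>\<^sub>\<infinity>k::int. exp (- (pi * a * (of_int k + s)\<^sup>2)))"
  have p: "complex_of_real (S s) = of_real (1 / sqrt a) * (\<Sum>\<^sub>\<infinity>m::int. of_real (c m) * cis (2 * pi * of_int m * s))" for s
    using gauss_poisson[OF a, of 0 s] by (simp add: gauss_wave_def c_def S_def infsum_of_real)
  have "\<bar>S s\<bar> = norm (complex_of_real (S s))" by simp
  also have "\<dots> = 1 / sqrt a * norm (\<Sum>\<^sub>\<infinity>m::int. complex_of_real (c m) * cis (2 * pi * of_int m * s))"
    unfolding p norm_mult using a by (simp add: norm_divide)
  also have "norm (\<Sum>\<^sub>\<infinity>m::int. complex_of_real (c m) * cis (2 * pi * of_int m * s)) \<le> (\<Sum>\<^sub>\<infinity>m. norm (complex_of_real (c m) * cis (2 * pi * of_int m * s)))"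
    by (rule norm_infsum_bound) (use c in \<open>simp add: norm_mult c_def\<close>)
  also have "\<dots> = (\<Sum>\<^sub>\<infinity>m. c m)" by (simp add: norm_mult c_def)
  finally have 1: "\<bar>S s\<bar> \<le> 1 / sqrt a * (\<Sum>\<^sub>\<infinity>m. c m)" using a by (simp add: divide_right_mono)
  have "complex_of_real (S 0) = of_real (1 / sqrt a * (\<Sum>\<^sub>\<infinity>m. c m))" unfolding p by (simp add: infsum_of_real)
  hence "S 0 = 1 / sqrt a * (\<Sum>\<^sub>\<infinity>m. c m)" by (simp only: of_real_eq_iff)
  thus ?thesis using 1 by (simp add: S_def)
qed

text \<open>Poisson summation for a lattice \<open>L\<close> spanning \<open>S\<close> with dual lattice \<open>M\<close>; the shift \<open>s\<close> and the
  character \<open>y\<close> are what makes an induction over the basis possible.\<close>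
definition poisson_pair :: "('a::euclidean_space) set \<Rightarrow> 'a set \<Rightarrow> 'a set \<Rightarrow> (real \<Rightarrow> real) \<Rightarrow> bool" where
  "poisson_pair S L M C \<longleftrightarrow> subspace S \<and> L \<subseteq> S \<and> M \<subseteq> S \<and>
     (\<forall>t>0. C t > 0 \<and> (\<forall>s\<in>S.
        (\<lambda>v. exp (- (pi * t * (norm (v + s))\<^sup>2))) summable_on L \<and>
        (\<lambda>w. exp (- (pi * t * (norm (w + s))\<^sup>2))) summable_on M \<and>
        (\<forall>y\<in>S. (\<Sum>\<^sub>\<infinity>v\<in>L. of_real (exp (- (pi * t * (norm (v + s))\<^sup>2))) * cis (2 * pi * (y \<bullet> (v + s)))) =
           of_real (C t) * (\<Sum>\<^sub>\<infinity>w\<in>M. of_real (exp (- (pi * (norm (w - y))\<^sup>2 / t))) * cis (2 * pi * (w \<bullet> s))))))"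

lemma poisson_pair_0: "poisson_pair {0} {0} {0} (\<lambda>_. 1)"
  by (simp add: poisson_pair_def)

text \<open>The positivity argument of \<open>infsum_gauss_shift_le\<close> in the lattice. The
  bound is uniform in the shift, as \<open>summable_on_times_bounded\<close> needs when layers with
  different shifts are summed.\<close>

lemma poisson_pair_bounds:
  assumes P: "poisson_pair S L M C" and t: "t > 0" and s: "s \<in> S"
  shows "(\<Sum>\<^sub>\<infinity>v\<in>L. exp (- (pi * t * (norm (v + s))\<^sup>2))) \<le> (\<Sum>\<^sub>\<infinity>v\<in>L. exp (- (pi * t * (norm v)\<^sup>2)))"
proof -
  have 0: "0 \<in> S" using P by (simp add: poisson_pair_def subspace_def)
  define A where "A = (\<lambda>s. \<Sum>\<^sub>\<infinity>v\<in>L. exp (- (pi * t * (norm (v + s))\<^sup>2)))"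
  define c where "c = (\<lambda>w::'a. exp (- (pi * (norm w)\<^sup>2 / t)))"
  have "\<forall>s\<in>S. (\<lambda>w. exp (- (pi * (1 / t) * (norm (w + s))\<^sup>2))) summable_on M"
    using P t unfolding poisson_pair_def by (metis zero_less_divide_1_iff)
  from this[rule_format, OF 0] have c: "c summable_on M" by (simp add: c_def)
  have p: "complex_of_real (A s) = of_real (C t) * (\<Sum>\<^sub>\<infinity>w\<in>M. of_real (c w) * cis (2 * pi * (w \<bullet> s)))" if "s \<in> S" for s
  proof -
    have "(\<Sum>\<^sub>\<infinity>v\<in>L. complex_of_real (exp (- (pi * t * (norm (v + s))\<^sup>2))) * cis (2 * pi * (0 \<bullet> (v + s)))) =
           of_real (C t) * (\<Sum>\<^sub>\<infinity>w\<in>M. of_real (exp (- (pi * (norm (w - 0))\<^sup>2 / t))) * cis (2 * pi * (w \<bullet> s)))"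
      using P t that 0 unfolding poisson_pair_def by blast
    thus ?thesis by (simp add: c_def A_def infsum_of_real)
  qed
  have Ct: "C t > 0" using P t by (simp add: poisson_pair_def)
  have "\<bar>A s\<bar> = norm (complex_of_real (A s))" by simp
  also have "\<dots> = C t * norm (\<Sum>\<^sub>\<infinity>w\<in>M. complex_of_real (c w) * cis (2 * pi * (w \<bullet> s)))"
    unfolding p[OF s] norm_mult using Ct by simp
  also have "norm (\<Sum>\<^sub>\<infinity>w\<in>M. complex_of_real (c w) * cis (2 * pi * (w \<bullet> s))) \<le> (\<Sum>\<^sub>\<infinity>w\<in>M. norm (complex_of_real (c w) * cis (2 * pi * (w \<bullet> s))))"
    by (rule norm_infsum_bound) (use c in \<open>simp add: norm_mult c_def\<close>)
  also have "\<dots> = (\<Sum>\<^sub>\<infinity>w\<in>M. c w)" by (simp add: norm_mult c_def)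
  finally have 1: "\<bar>A s\<bar> \<le> C t * (\<Sum>\<^sub>\<infinity>w\<in>M. c w)" using Ct by simp
  have "complex_of_real (A 0) = of_real (C t * (\<Sum>\<^sub>\<infinity>w\<in>M. c w))" unfolding p[OF 0] by (simp add: infsum_of_real)
  hence "A 0 = C t * (\<Sum>\<^sub>\<infinity>w\<in>M. c w)" by (simp only: of_real_eq_iff)
  thus ?thesis using 1 by (simp add: A_def)
qed

lemma summable_on_times_bounded:
  fixes f :: "'i \<Rightarrow> real" and g :: "'i \<Rightarrow> 'j \<Rightarrow> real"
  assumes f: "f summable_on A" "\<And>x. x \<in> A \<Longrightarrow> f x \<ge> 0"
    and g: "\<And>x. x \<in> A \<Longrightarrow> g x summable_on B" "\<And>x y. g x y \<ge> 0"
    and K: "\<And>x. x \<in> A \<Longrightarrow> infsum (g x) B \<le> K"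
  shows "(\<lambda>(x, y). f x * g x y) summable_on A \<times> B"
proof -
  have "(\<lambda>z. norm (case z of (x, y) \<Rightarrow> f x * g x y)) summable_on A \<times> B"
  proof (subst Infinite_Sum.abs_summable_on_Sigma_iff, intro conjI ballI)
    fix x assume x: "x \<in> A"
    show "(\<lambda>y. norm (case (x, y) of (x, y) \<Rightarrow> f x * g x y)) summable_on B"
      using summable_on_cmult_right[OF g(1)[OF x], of "f x"] f(2)[OF x] g(2) by (simp add: abs_mult)
  next
    have e: "(\<Sum>\<^sub>\<infinity>y\<in>B. norm (case (x, y) of (x, y) \<Rightarrow> f x * g x y)) = f x * infsum (g x) B" if x: "x \<in> A" for x
      using f(2)[OF x] g(2) by (simp add: abs_mult infsum_cmult_right')
    have "(\<lambda>x. f x * infsum (g x) B) summable_on A"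
    proof (rule summable_on_comparison_test[OF summable_on_cmult_left[OF f(1), of K]])
      fix x assume x: "x \<in> A"
      show "f x * infsum (g x) B \<le> f x * K" by (intro mult_left_mono K f(2) x)
      show "0 \<le> f x * infsum (g x) B" using f(2)[OF x] g(2) by (simp add: infsum_nonneg)
    qed
    moreover have "f x * infsum (g x) B \<ge> 0" if "x \<in> A" for x using f(2)[OF that] g(2) by (simp add: infsum_nonneg)
    ultimately have "(\<lambda>x. norm (f x * infsum (g x) B)) summable_on A"
      by (subst summable_on_cong[of _ _ "\<lambda>x. f x * infsum (g x) B"]) auto
    thus "(\<lambda>x. norm (\<Sum>\<^sub>\<infinity>y\<in>B. norm (case (x, y) of (x, y) \<Rightarrow> f x * g x y))) summable_on A"
      by (subst summable_on_cong[of _ _ "\<lambda>x. norm (f x * infsum (g x) B)"]) (simp_all only: e)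
  qed
  thus ?thesis by (rule abs_summable_summable)
qed

text \<open>Adds the basis vector \<open>p + e\<close>, with \<open>p\<close> its projection to
  \<open>S\<close>. The new lattice is a stack of copies of \<open>L\<close>, the k-th one moved by
  k p and raised by k e; the new dual vectors above w are those whose product with
  \<open>p + e\<close> is an integer l. The hypothesis is applied in each layer, the sums are
  exchanged, and one-dimensional Poisson summation over k does the rest, with width
  \<open>t * (e \<bullet> e)\<close>.\<close>

lemma poisson_pair_step:
  fixes e :: "'a::euclidean_space"
  assumes P: "poisson_pair S L M C" and p: "p \<in> S" and e: "e \<noteq> 0" "\<And>u. u \<in> S \<Longrightarrow> u \<bullet> e = 0"
  shows "poisson_pair {u + r *\<^sub>R e | u r. u \<in> S}
           ((\<lambda>(k, v). v + of_int k *\<^sub>R (p + e)) ` (UNIV \<times> L))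
           ((\<lambda>(l, w). w + ((of_int l - w \<bullet> p) / (e \<bullet> e)) *\<^sub>R e) ` (UNIV \<times> M))
           (\<lambda>t. C t / sqrt (t * (e \<bullet> e)))"
proof -
  define E where "E = e \<bullet> e"
  have E: "E > 0" using e by (simp add: E_def)
  have sub: "subspace S" and LS: "L \<subseteq> S" and MS: "M \<subseteq> S" using P by (auto simp: poisson_pair_def)
  let ?S' = "{u + r *\<^sub>R e | u r. u \<in> S}"
  define F where "F = (\<lambda>(k::int, v). v + of_int k *\<^sub>R (p + e))"
  define G where "G = (\<lambda>(l::int, w). w + ((of_int l - w \<bullet> p) / E) *\<^sub>R e)"
  have orth: "u1 = u2 \<and> r1 = r2" if "u1 + r1 *\<^sub>R e = u2 + r2 *\<^sub>R e" "u1 \<in> S" "u2 \<in> S" for u1 u2 r1 r2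
  proof -
    have "(u1 + r1 *\<^sub>R e) \<bullet> e = (u2 + r2 *\<^sub>R e) \<bullet> e" using that by simp
    hence "r1 * (e \<bullet> e) = r2 * (e \<bullet> e)"
      using e(2)[OF that(2)] e(2)[OF that(3)] by (simp add: inner_add_left)
    hence "r1 = r2" using e by simp
    thus ?thesis using that by simp
  qed
  have normsq: "(norm (u + r *\<^sub>R e))\<^sup>2 = (norm u)\<^sup>2 + r\<^sup>2 * E" if "u \<in> S" for u r
    unfolding power2_norm_eq_inner E_def
    using e(2)[OF that] by (simp add: inner_add_left inner_add_right inner_commute power2_eq_square)
  have inn: "(u + r *\<^sub>R e) \<bullet> (u' + r' *\<^sub>R e) = u \<bullet> u' + r * r' * E" if "u \<in> S" "u' \<in> S" for u u' r r'
    using e(2)[OF that(1)] e(2)[OF that(2)] by (simp add: inner_add_left inner_add_right inner_commute E_def)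
  have Feq: "F (k, v) = (v + of_int k *\<^sub>R p) + of_int k *\<^sub>R e" for k v by (simp add: F_def algebra_simps)
  have FS: "v + of_int k *\<^sub>R p \<in> S" if "v \<in> L" for k v using that LS p sub by (auto intro: subspace_add subspace_scale)
  have injF: "inj_on F (UNIV \<times> L)"
  proof (intro inj_onI, clarify)
    fix k1 v1 k2 v2 assume *: "F (k1, v1) = F (k2, v2)" "v1 \<in> L" "v2 \<in> L"
    from orth[OF *(1)[unfolded Feq] FS[OF *(2)] FS[OF *(3)]] show "k1 = k2 \<and> v1 = v2" by auto
  qed
  have injG: "inj_on G (UNIV \<times> M)"
  proof (intro inj_onI, clarify)
    fix k1 v1 k2 v2 assume *: "G (k1, v1) = G (k2, v2)" "v1 \<in> M" "v2 \<in> M"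
    from orth[OF *(1)[unfolded G_def prod.case]] MS * have "v1 = v2" "(of_int k1 - v1 \<bullet> p) / E = (of_int k2 - v2 \<bullet> p) / E" by auto
    thus "k1 = k2 \<and> v1 = v2" using E by auto
  qed
  have sub': "subspace ?S'"
  proof -
    have "?S' = {x + y | x y. x \<in> S \<and> y \<in> span {e}}" by (auto simp: span_singleton)
    thus ?thesis using subspace_sums[OF sub subspace_span] by simp
  qed
  have LS': "F ` (UNIV \<times> L) \<subseteq> ?S'" using FS by (force simp: Feq)
  have MS': "G ` (UNIV \<times> M) \<subseteq> ?S'" using MS by (force simp: G_def)
  have sumL: "(\<lambda>v. exp (- (pi * t * (norm (v + s))\<^sup>2))) summable_on L" if "t > 0" "s \<in> S" for t s
    using P that unfolding poisson_pair_def by blast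
  have sumM: "(\<lambda>v. exp (- (pi * t * (norm (v + s))\<^sup>2))) summable_on M" if "t > 0" "s \<in> S" for t s
    using P that unfolding poisson_pair_def by blast
  have expF: "exp (- (pi * t * (norm (F (k, v) + (s0 + \<sigma> *\<^sub>R e)))\<^sup>2)) =
      exp (- (pi * (t * E) * (of_int k + \<sigma>)\<^sup>2)) * exp (- (pi * t * (norm (v + (of_int k *\<^sub>R p + s0)))\<^sup>2))"
    if "v \<in> L" "s0 \<in> S" for k v s0 \<sigma> t
  proof -
    have "F (k, v) + (s0 + \<sigma> *\<^sub>R e) = (v + (of_int k *\<^sub>R p + s0)) + (of_int k + \<sigma>) *\<^sub>R e" by (simp add: Feq algebra_simps)
    moreover have "v + (of_int k *\<^sub>R p + s0) \<in> S" using that LS p sub by (auto intro: subspace_add subspace_scale)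
    ultimately have "(norm (F (k, v) + (s0 + \<sigma> *\<^sub>R e)))\<^sup>2 = (norm (v + (of_int k *\<^sub>R p + s0)))\<^sup>2 + (of_int k + \<sigma>)\<^sup>2 * E"
      by (simp only: normsq)
    thus ?thesis by (simp add: exp_add[symmetric] algebra_simps)
  qed
  have expG: "exp (- (pi * t * (norm (G (l, w) + (s0 + \<sigma> *\<^sub>R e)))\<^sup>2)) =
      exp (- (pi * t * (norm (w + s0))\<^sup>2)) * exp (- (pi * (t / E) * (of_int l + (\<sigma> * E - w \<bullet> p))\<^sup>2))"
    if "w \<in> M" "s0 \<in> S" for l w s0 \<sigma> t
  proof -
    have "G (l, w) + (s0 + \<sigma> *\<^sub>R e) = (w + s0) + ((of_int l - w \<bullet> p) / E + \<sigma>) *\<^sub>R e" by (simp add: G_def algebra_simps)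
    moreover have "w + s0 \<in> S" using that MS sub by (auto intro: subspace_add)
    ultimately have "(norm (G (l, w) + (s0 + \<sigma> *\<^sub>R e)))\<^sup>2 = (norm (w + s0))\<^sup>2 + ((of_int l - w \<bullet> p) / E + \<sigma>)\<^sup>2 * E"
      by (simp only: normsq)
    also have "((of_int l - w \<bullet> p) / E + \<sigma>)\<^sup>2 * E = (of_int l + (\<sigma> * E - w \<bullet> p))\<^sup>2 / E"
    proof -
      have "(of_int l - w \<bullet> p) / E + \<sigma> = (of_int l + (\<sigma> * E - w \<bullet> p)) / E" using E by (simp add: field_simps)
      thus ?thesis using E by (simp add: power_divide power2_eq_square)
    qed
    finally show ?thesis by (simp add: exp_add[symmetric] algebra_simps)
  qed
  have summF: "(\<lambda>(k, v). exp (- (pi * (t * E) * (of_int k + \<sigma>)\<^sup>2)) * exp (- (pi * t * (norm (v + (of_int k *\<^sub>R p + s0)))\<^sup>2))) summable_on (UNIV::int set) \<times> L"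
    if t: "t > 0" and s0: "s0 \<in> S" for t s0 \<sigma>
  proof (rule summable_on_times_bounded)
    show "(\<lambda>k::int. exp (- (pi * (t * E) * (of_int k + \<sigma>)\<^sup>2))) summable_on UNIV"
      by (rule summable_on_int_gauss_shift) (use t E in simp)
    fix k :: int
    have in_S: "of_int k *\<^sub>R p + s0 \<in> S" using s0 p sub by (auto intro: subspace_add subspace_scale)
    show "(\<lambda>v. exp (- (pi * t * (norm (v + (of_int k *\<^sub>R p + s0)))\<^sup>2))) summable_on L" by (rule sumL[OF t in_S])
    show "(\<Sum>\<^sub>\<infinity>v\<in>L. exp (- (pi * t * (norm (v + (of_int k *\<^sub>R p + s0)))\<^sup>2))) \<le> (\<Sum>\<^sub>\<infinity>v\<in>L. exp (- (pi * t * (norm v)\<^sup>2)))"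
      by (rule poisson_pair_bounds[OF P t in_S])
  qed auto
  have summG: "(\<lambda>(w, l). exp (- (pi * t * (norm (w + s0))\<^sup>2)) * exp (- (pi * (t / E) * (of_int l + (\<sigma> * E - w \<bullet> p))\<^sup>2))) summable_on M \<times> (UNIV::int set)"
    if t: "t > 0" and s0: "s0 \<in> S" for t s0 \<sigma>
  proof (rule summable_on_times_bounded)
    show "(\<lambda>v. exp (- (pi * t * (norm (v + s0))\<^sup>2))) summable_on M" by (rule sumM[OF t s0])
    fix w
    show "(\<lambda>l::int. exp (- (pi * (t / E) * (of_int l + (\<sigma> * E - w \<bullet> p))\<^sup>2))) summable_on UNIV"
      by (rule summable_on_int_gauss_shift) (use t E in simp)
    show "(\<Sum>\<^sub>\<infinity>l::int. exp (- (pi * (t / E) * (of_int l + (\<sigma> * E - w \<bullet> p))\<^sup>2))) \<le> (\<Sum>\<^sub>\<infinity>l::int. exp (- (pi * (t / E) * (of_int l)\<^sup>2)))"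
      by (rule infsum_gauss_shift_le) (use t E in simp)
  qed auto
  have "C t / sqrt (t * E) > 0 \<and>
        (\<lambda>v. exp (- (pi * t * (norm (v + s))\<^sup>2))) summable_on F ` (UNIV \<times> L) \<and>
        (\<lambda>w. exp (- (pi * t * (norm (w + s))\<^sup>2))) summable_on G ` (UNIV \<times> M) \<and>
        (\<Sum>\<^sub>\<infinity>v\<in>F ` (UNIV \<times> L). of_real (exp (- (pi * t * (norm (v + s))\<^sup>2))) * cis (2 * pi * (y \<bullet> (v + s)))) =
           of_real (C t / sqrt (t * E)) * (\<Sum>\<^sub>\<infinity>w\<in>G ` (UNIV \<times> M). of_real (exp (- (pi * (norm (w - y))\<^sup>2 / t))) * cis (2 * pi * (w \<bullet> s)))"
    if t: "t > 0" and s: "s \<in> ?S'" and y: "y \<in> ?S'" for t s y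
  proof (intro conjI)
    obtain s0 \<sigma> where s0: "s0 \<in> S" "s = s0 + \<sigma> *\<^sub>R e" using s by blast
    obtain y0 \<eta> where y0: "y0 \<in> S" "y = y0 + \<eta> *\<^sub>R e" using y by blast
    show "C t / sqrt (t * E) > 0" using P t E by (simp add: poisson_pair_def)
    show "(\<lambda>v. exp (- (pi * t * (norm (v + s))\<^sup>2))) summable_on F ` (UNIV \<times> L)"
      unfolding summable_on_reindex[OF injF] s0(2)
    proof -
      have "(\<lambda>v. exp (- (pi * t * (norm (v + (s0 + \<sigma> *\<^sub>R e)))\<^sup>2))) \<circ> F summable_on UNIV \<times> L \<longleftrightarrow>
         (\<lambda>(k::int, v). exp (- (pi * (t * E) * (of_int k + \<sigma>)\<^sup>2)) * exp (- (pi * t * (norm (v + (of_int k *\<^sub>R p + s0)))\<^sup>2))) summable_on UNIV \<times> L"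
        by (rule summable_on_cong) (use expF[OF _ s0(1)] in auto)
      thus "(\<lambda>v. exp (- (pi * t * (norm (v + (s0 + \<sigma> *\<^sub>R e)))\<^sup>2))) \<circ> F summable_on UNIV \<times> L"
        using summF[OF t s0(1), of \<sigma>] by simp
    qed
    show "(\<lambda>w. exp (- (pi * t * (norm (w + s))\<^sup>2))) summable_on G ` (UNIV \<times> M)"
    proof -
      have "(\<lambda>(l, w). exp (- (pi * t * (norm (w + s0))\<^sup>2)) * exp (- (pi * (t / E) * (of_int l + (\<sigma> * E - w \<bullet> p))\<^sup>2))) summable_on (UNIV::int set) \<times> M"
        using summG[OF t s0(1), of \<sigma>] by (subst summable_on_swap) (simp add: case_prod_unfold prod.swap_def)
      moreover have "(\<lambda>v. exp (- (pi * t * (norm (v + (s0 + \<sigma> *\<^sub>R e)))\<^sup>2))) \<circ> G summable_on UNIV \<times> M \<longleftrightarrow>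
         (\<lambda>(l::int, w). exp (- (pi * t * (norm (w + s0))\<^sup>2)) * exp (- (pi * (t / E) * (of_int l + (\<sigma> * E - w \<bullet> p))\<^sup>2))) summable_on UNIV \<times> M"
        by (rule summable_on_cong) (use expG[OF _ s0(1)] in auto)
      ultimately show ?thesis unfolding summable_on_reindex[OF injG] s0(2) by simp
    qed
    define a where "a = t * E"
    have a: "a > 0" using t E by (simp add: a_def)
    define \<phi> where "\<phi> = \<eta> * E"
    define c where "c = (\<lambda>w. complex_of_real (exp (- (pi * (norm (w - y0))\<^sup>2 / t))))"
    have csum: "(\<lambda>w. norm (c w)) summable_on M"
    proof -
      have "- y0 \<in> S" using y0 sub by (simp add: subspace_neg)
      thus ?thesis using sumM[of "1 / t" "- y0"] t by (simp add: c_def)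
    qed
    define T where "T = (\<lambda>(k::int) v. gauss_wave a \<phi> (of_int k + \<sigma>) *
         (complex_of_real (exp (- (pi * t * (norm (v + (of_int k *\<^sub>R p + s0)))\<^sup>2))) * cis (2 * pi * (y0 \<bullet> (v + (of_int k *\<^sub>R p + s0))))))"
    have termeq: "of_real (exp (- (pi * t * (norm (F (k, v) + s))\<^sup>2))) * cis (2 * pi * (y \<bullet> (F (k, v) + s))) = T k v"
      if v: "v \<in> L" for k v
    proof -
      have vs: "v + (of_int k *\<^sub>R p + s0) \<in> S" using v LS p s0 sub by (auto intro!: subspace_add subspace_scale)
      have Fs: "F (k, v) + s = (v + (of_int k *\<^sub>R p + s0)) + (of_int k + \<sigma>) *\<^sub>R e" by (simp add: Feq s0 algebra_simps)
      have "y \<bullet> (F (k, v) + s) = y0 \<bullet> (v + (of_int k *\<^sub>R p + s0)) + \<phi> * (of_int k + \<sigma>)"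
        unfolding Fs y0(2) inn[OF y0(1) vs] by (simp add: \<phi>_def)
      hence "cis (2 * pi * (y \<bullet> (F (k, v) + s))) = cis (2 * pi * \<phi> * (of_int k + \<sigma>)) * cis (2 * pi * (y0 \<bullet> (v + (of_int k *\<^sub>R p + s0))))"
        by (simp add: cis_mult algebra_simps)
      thus ?thesis using expF[OF v s0(1), of t k \<sigma>] by (simp add: T_def gauss_wave_def s0(2) a_def)
    qed
    have Tsum: "(\<lambda>(k, v). T k v) summable_on UNIV \<times> L"
    proof (rule abs_summable_summable)
      show "(\<lambda>z. norm (case z of (k, v) \<Rightarrow> T k v)) summable_on UNIV \<times> L"
        using summF[OF t s0(1), of \<sigma>] by (simp add: case_prod_unfold T_def norm_mult norm_gauss_wave a_def)
    qed
    have inner1: "(\<Sum>\<^sub>\<infinity>v\<in>L. T k v) = of_real (C t) * (\<Sum>\<^sub>\<infinity>w\<in>M. gauss_wave a \<phi> (of_int k + \<sigma>) * (c w * cis (2 * pi * (w \<bullet> (of_int k *\<^sub>R p + s0)))))" for k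
    proof -
      have in_S: "of_int k *\<^sub>R p + s0 \<in> S" using s0 p sub by (auto intro!: subspace_add subspace_scale)
      have "(\<Sum>\<^sub>\<infinity>v\<in>L. T k v) = gauss_wave a \<phi> (of_int k + \<sigma>) * (\<Sum>\<^sub>\<infinity>v\<in>L. (complex_of_real (exp (- (pi * t * (norm (v + (of_int k *\<^sub>R p + s0)))\<^sup>2))) * cis (2 * pi * (y0 \<bullet> (v + (of_int k *\<^sub>R p + s0))))))"
        unfolding T_def by (rule infsum_cmult_right')
      also have "(\<Sum>\<^sub>\<infinity>v\<in>L. (complex_of_real (exp (- (pi * t * (norm (v + (of_int k *\<^sub>R p + s0)))\<^sup>2))) * cis (2 * pi * (y0 \<bullet> (v + (of_int k *\<^sub>R p + s0)))))) =
          of_real (C t) * (\<Sum>\<^sub>\<infinity>w\<in>M. c w * cis (2 * pi * (w \<bullet> (of_int k *\<^sub>R p + s0))))"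
        using P t in_S y0(1) unfolding poisson_pair_def c_def by blast
      finally show ?thesis by (simp only: infsum_cmult_right' mult.left_commute[of "gauss_wave a \<phi> (of_int k + \<sigma>)" "of_real (C t)"])
    qed
    define U where "U = (\<lambda>(k::int) w. gauss_wave a \<phi> (of_int k + \<sigma>) * (c w * cis (2 * pi * (w \<bullet> (of_int k *\<^sub>R p + s0)))))"
    have Usum: "(\<lambda>(k, w). U k w) summable_on UNIV \<times> M"
    proof (rule abs_summable_summable)
      have "(\<lambda>(k::int, w). exp (- (pi * a * (of_int k + \<sigma>)\<^sup>2)) * norm (c w)) summable_on UNIV \<times> M"
        by (rule summable_on_times_bounded[OF summable_on_int_gauss_shift[OF a] _ csum]) auto
      thus "(\<lambda>z. norm (case z of (k, w) \<Rightarrow> U k w)) summable_on UNIV \<times> M"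
        by (simp add: case_prod_unfold U_def norm_mult norm_gauss_wave)
    qed
    define V where "V = (\<lambda>w (l::int). of_real (exp (- (pi * (norm (G (l, w) - y))\<^sup>2 / t))) * cis (2 * pi * (G (l, w) \<bullet> s)))"
    \<comment> \<open>The layer shift k p leaves a phase linear in k. It adds
      \<open>\<omega> = w \<bullet> p\<close> to the frequency of the one-dimensional sum, and this
      produces the offset of the dual points along e.\<close>
    have inner2: "(\<Sum>\<^sub>\<infinity>k. U k w) = of_real (1 / sqrt a) * (\<Sum>\<^sub>\<infinity>l. V w l)" if w: "w \<in> M" for w
    proof -
      define \<omega> where "\<omega> = w \<bullet> p"
      have wS: "w \<in> S" using w MS by blast
      have "U k w = (c w * cis (2 * pi * (w \<bullet> s0)) * cis (- (2 * pi * \<sigma> * \<omega>))) * gauss_wave a (\<phi> + \<omega>) (of_int k + \<sigma>)" for k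
      proof -
        have "cis (2 * pi * \<phi> * (of_int k + \<sigma>)) * cis (2 * pi * (w \<bullet> (of_int k *\<^sub>R p + s0))) =
              cis (2 * pi * (w \<bullet> s0)) * cis (- (2 * pi * \<sigma> * \<omega>)) * cis (2 * pi * (\<phi> + \<omega>) * (of_int k + \<sigma>))"
          by (simp add: cis_mult \<omega>_def inner_add_right algebra_simps)
        thus ?thesis by (simp add: U_def gauss_wave_def mult_ac)
      qed
      hence "(\<Sum>\<^sub>\<infinity>k. U k w) = (c w * cis (2 * pi * (w \<bullet> s0)) * cis (- (2 * pi * \<sigma> * \<omega>))) * (\<Sum>\<^sub>\<infinity>k::int. gauss_wave a (\<phi> + \<omega>) (of_int k + \<sigma>))"
        by (simp only: infsum_cmult_right')
      also have "\<dots> = of_real (1 / sqrt a) * (\<Sum>\<^sub>\<infinity>l::int. (c w * cis (2 * pi * (w \<bullet> s0)) * cis (- (2 * pi * \<sigma> * \<omega>))) *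
            (of_real (exp (- (pi * (of_int l - (\<phi> + \<omega>))\<^sup>2 / a))) * cis (2 * pi * of_int l * \<sigma>)))"
        unfolding gauss_poisson[OF a] infsum_cmult_right' by (rule mult.left_commute)
      also have "(\<lambda>l::int. (c w * cis (2 * pi * (w \<bullet> s0)) * cis (- (2 * pi * \<sigma> * \<omega>))) *
            (of_real (exp (- (pi * (of_int l - (\<phi> + \<omega>))\<^sup>2 / a))) * cis (2 * pi * of_int l * \<sigma>))) = V w"
      proof
        fix l :: int
        have "exp (- (pi * (norm (G (l, w) - y))\<^sup>2 / t)) = exp (- (pi * (norm (w - y0))\<^sup>2 / t)) * exp (- (pi * (of_int l - (\<phi> + \<omega>))\<^sup>2 / a))"
        proof -
          have "- y0 \<in> S" using y0 sub by (simp add: subspace_neg)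
          from expG[OF w this, of "1 / t" l "- \<eta>"] show ?thesis
            by (simp add: y0(2) a_def \<phi>_def \<omega>_def algebra_simps)
        qed
        moreover have "cis (2 * pi * (G (l, w) \<bullet> s)) = cis (2 * pi * (w \<bullet> s0)) * cis (- (2 * pi * \<sigma> * \<omega>)) * cis (2 * pi * of_int l * \<sigma>)"
        proof -
          have Gs: "G (l, w) \<bullet> s = w \<bullet> s0 + (of_int l - \<omega>) * \<sigma>"
            unfolding G_def prod.case s0(2) inn[OF wS s0(1)] using E by (simp add: \<omega>_def)
          show ?thesis unfolding Gs cis_mult by (rule arg_cong[of _ _ cis]) (simp add: algebra_simps)
        qed
        ultimately show "(c w * cis (2 * pi * (w \<bullet> s0)) * cis (- (2 * pi * \<sigma> * \<omega>))) *
            (of_real (exp (- (pi * (of_int l - (\<phi> + \<omega>))\<^sup>2 / a))) * cis (2 * pi * of_int l * \<sigma>)) = V w l"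
          by (simp add: V_def c_def mult_ac)
      qed
      finally show ?thesis .
    qed
    have Vsum: "(\<lambda>(w, l). V w l) summable_on M \<times> UNIV"
    proof (rule abs_summable_summable)
      have m: "- y0 \<in> S" using y0 sub by (simp add: subspace_neg)
      have t': "1 / t > 0" using t by simp
      have eq: "exp (- (pi * (1 / t) * (norm (w + - y0))\<^sup>2)) * exp (- (pi * (1 / t / E) * (of_int l + (- \<eta> * E - w \<bullet> p))\<^sup>2)) = norm (V w l)"
        if "w \<in> M" for w l
        using expG[OF that m, of "1 / t" l "- \<eta>"] by (simp add: V_def norm_mult y0(2) algebra_simps)
      have "(\<lambda>x. norm (case x of (w, l) \<Rightarrow> V w l)) summable_on M \<times> UNIV \<longleftrightarrow>
        (\<lambda>(w, l). exp (- (pi * (1 / t) * (norm (w + - y0))\<^sup>2)) * exp (- (pi * (1 / t / E) * (of_int l + (- \<eta> * E - w \<bullet> p))\<^sup>2))) summable_on M \<times> UNIV"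
        by (rule summable_on_cong) (use eq in auto)
      thus "(\<lambda>z. norm (case z of (w, l) \<Rightarrow> V w l)) summable_on M \<times> UNIV"
        using summG[OF t' m, of "- \<eta>"] by simp
    qed
    have "(\<Sum>\<^sub>\<infinity>v\<in>F ` (UNIV \<times> L). of_real (exp (- (pi * t * (norm (v + s))\<^sup>2))) * cis (2 * pi * (y \<bullet> (v + s)))) = (\<Sum>\<^sub>\<infinity>(k, v)\<in>UNIV \<times> L. T k v)"
      unfolding infsum_reindex[OF injF] by (rule infsum_cong) (auto simp: termeq)
    also have "\<dots> = (\<Sum>\<^sub>\<infinity>k. \<Sum>\<^sub>\<infinity>v\<in>L. T k v)" by (rule infsum_Sigma'_banach[symmetric, OF Tsum])
    also have "\<dots> = of_real (C t) * (\<Sum>\<^sub>\<infinity>k. \<Sum>\<^sub>\<infinity>w\<in>M. U k w)" unfolding inner1 U_def by (rule infsum_cmult_right')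
    also have "(\<Sum>\<^sub>\<infinity>k. \<Sum>\<^sub>\<infinity>w\<in>M. U k w) = (\<Sum>\<^sub>\<infinity>w\<in>M. \<Sum>\<^sub>\<infinity>k. U k w)" by (rule infsum_swap_banach[OF Usum])
    also have "\<dots> = (\<Sum>\<^sub>\<infinity>w\<in>M. of_real (1 / sqrt a) * (\<Sum>\<^sub>\<infinity>l. V w l))" by (rule infsum_cong) (rule inner2)
    also have "\<dots> = of_real (1 / sqrt a) * (\<Sum>\<^sub>\<infinity>w\<in>M. \<Sum>\<^sub>\<infinity>l. V w l)" by (rule infsum_cmult_right')
    also have "(\<Sum>\<^sub>\<infinity>w\<in>M. \<Sum>\<^sub>\<infinity>l. V w l) = (\<Sum>\<^sub>\<infinity>(w, l)\<in>M \<times> UNIV. V w l)" by (rule infsum_Sigma'_banach[OF Vsum])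
    also have "\<dots> = (\<Sum>\<^sub>\<infinity>(l, w)\<in>UNIV \<times> M. V w l)"
      by (rule infsum_reindex_bij_witness[of _ prod.swap prod.swap]) auto
    also have "\<dots> = (\<Sum>\<^sub>\<infinity>w\<in>G ` (UNIV \<times> M). of_real (exp (- (pi * (norm (w - y))\<^sup>2 / t))) * cis (2 * pi * (w \<bullet> s)))"
      unfolding infsum_reindex[OF injG] by (rule infsum_cong) (auto simp: V_def)
    finally show "(\<Sum>\<^sub>\<infinity>v\<in>F ` (UNIV \<times> L). of_real (exp (- (pi * t * (norm (v + s))\<^sup>2))) * cis (2 * pi * (y \<bullet> (v + s)))) =
           of_real (C t / sqrt (t * E)) * (\<Sum>\<^sub>\<infinity>w\<in>G ` (UNIV \<times> M). of_real (exp (- (pi * (norm (w - y))\<^sup>2 / t))) * cis (2 * pi * (w \<bullet> s)))"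
      by (simp add: a_def mult.assoc)
  qed
  note main = this
  have 0: "0 \<in> ?S'" using subspace_0[OF sub'] .
  show ?thesis
    unfolding poisson_pair_def F_def[symmetric] G_def[symmetric] E_def[symmetric]
    using sub' LS' MS' main 0 by blast
qed

subsection \<open>Modular functions for the full modular group\<close>

lemma upper_half_plane_props: "open {\<tau>. 0 < Im \<tau>}" "connected {\<tau>. 0 < Im \<tau>}" "convex {\<tau>. 0 < Im \<tau>}"
  using convex_halfspace_Im_gt[of 0] by (auto simp: open_halfspace_Im_gt intro: convex_connected)

lemma Im_neg_inverse: "Im (- 1 / \<tau>) = Im \<tau> / (cmod \<tau>)\<^sup>2"
  by (simp add: Im_divide cmod_power2)

lemma upper_half_inverse: "0 < Im \<tau> \<Longrightarrow> 0 < Im (- 1 / \<tau>)" 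
  unfolding Im_neg_inverse by (intro divide_pos_pos zero_less_power) auto

text \<open>The identities for theta series and for eta come from real Gaussian sums, hence only for
  \<tau> = i t; this extends them to the half plane.\<close>

lemma holomorphic_eq_on_upper_half:
  assumes f: "f holomorphic_on {\<tau>. 0 < Im \<tau>}" and g: "g holomorphic_on {\<tau>. 0 < Im \<tau>}"
    and eq: "\<And>t. t > 0 \<Longrightarrow> f (\<i> * of_real t) = g (\<i> * of_real t)" and \<tau>: "0 < Im \<tau>"
  shows "f \<tau> = g \<tau>"
proof -
  let ?U = "(\<lambda>t. \<i> * complex_of_real t) ` {0<..}"
  have lim: "\<i> islimpt ?U"
  proof (rule islimptI)
    fix T :: "complex set" assume T: "\<i> \<in> T" "open T"
    then obtain e where e: "e > 0" "ball \<i> e \<subseteq> T" using open_contains_ball by blast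
    define y where "y = \<i> * complex_of_real (1 + e / 2)"
    have "dist \<i> y = e / 2" using e(1) by (simp add: y_def dist_norm algebra_simps norm_mult)
    hence "y \<in> T" "y \<noteq> \<i>" using e by auto
    moreover have "y \<in> ?U" unfolding y_def by (rule imageI) (use e(1) in simp)
    ultimately show "\<exists>y\<in>?U. y \<in> T \<and> y \<noteq> \<i>" by blast
  qed
  have "f \<tau> - g \<tau> = 0"
    by (rule analytic_continuation[OF holomorphic_on_diff[OF f g] upper_half_plane_props(1,2) _ _ lim])
       (use eq \<tau> in auto)
  thus ?thesis by simp
qed

text \<open>The strip with Im \<ge> 1/2 replaces the exact fundamental domain: a point with |Re|
  \<le> 1/2 and Im < 1/2 has |\<tau>|^2 \<le> 1/2, so inversion at least doubles its height. The
  type of values is arbitrary because the lemma is applied to invariant functions as well as to the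
  predicate of being a zero.\<close>

lemma modular_reduction:
  fixes \<phi> :: "complex \<Rightarrow> 'b"
  assumes T: "\<And>\<tau>. 0 < Im \<tau> \<Longrightarrow> \<phi> (\<tau> + 1) = \<phi> \<tau>" and S: "\<And>\<tau>. 0 < Im \<tau> \<Longrightarrow> \<phi> (- 1 / \<tau>) = \<phi> \<tau>"
    and \<tau>: "0 < Im \<tau>"
  obtains \<tau>' where "\<phi> \<tau>' = \<phi> \<tau>" "1 / 2 \<le> Im \<tau>'" "\<bar>Re \<tau>'\<bar> \<le> 1 / 2"
proof -
  have shift: "\<phi> (\<tau> + of_int n) = \<phi> \<tau>" if "0 < Im \<tau>" for n \<tau>
  proof (induction n rule: int_induct[where k=0])
    case (step1 i)
    have "\<phi> (\<tau> + of_int i + 1) = \<phi> (\<tau> + of_int i)" by (rule T) (use that in simp)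
    thus ?case using step1 by (simp add: add.assoc)
  next
    case (step2 i)
    have "\<phi> (\<tau> + of_int (i - 1) + 1) = \<phi> (\<tau> + of_int (i - 1))" by (rule T) (use that in simp)
    thus ?case using step2 by (simp add: add.assoc)
  qed auto
  have centre: "\<exists>\<tau>'. \<phi> \<tau>' = \<phi> \<tau> \<and> Im \<tau>' = Im \<tau> \<and> \<bar>Re \<tau>'\<bar> \<le> 1 / 2" if "0 < Im \<tau>" for \<tau>
  proof (intro exI[of _ "\<tau> + of_int (- round (Re \<tau>))"] conjI shift that)
    show "\<bar>Re (\<tau> + of_int (- round (Re \<tau>)))\<bar> \<le> 1 / 2"
      using of_int_round_abs_le[of "Re \<tau>"] by (simp add: abs_minus_commute)
  qed auto
  have "\<exists>\<tau>'. \<phi> \<tau>' = \<phi> \<tau> \<and> 1 / 2 \<le> Im \<tau>' \<and> \<bar>Re \<tau>'\<bar> \<le> 1 / 2" if "1 / 2 \<le> 2 ^ n * Im \<tau>" for n \<tau>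
    using that
  proof (induction n arbitrary: \<tau>)
    case 0
    thus ?case using centre[of \<tau>] by force
  next
    case (Suc n)
    have pos: "0 < Im \<tau>"
    proof (rule ccontr)
      assume "\<not> 0 < Im \<tau>"
      hence "2 ^ Suc n * Im \<tau> \<le> 0" by (simp add: mult_nonneg_nonpos)
      thus False using Suc.prems by linarith
    qed
    obtain \<tau>1 where 1: "\<phi> \<tau>1 = \<phi> \<tau>" "Im \<tau>1 = Im \<tau>" "\<bar>Re \<tau>1\<bar> \<le> 1 / 2" using centre[OF pos] by blast
    show ?case
    proof (cases "1 / 2 \<le> Im \<tau>")
      case True
      thus ?thesis using 1 by auto
    next
      case False
      have "(Re \<tau>1)\<^sup>2 \<le> (1 / 2)\<^sup>2" using power_mono[OF 1(3), of 2] by simp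
      moreover have "(Im \<tau>1)\<^sup>2 \<le> (1 / 2)\<^sup>2" using False pos 1(2) by (intro power_mono) auto
      ultimately have c: "(cmod \<tau>1)\<^sup>2 \<le> 1 / 2" unfolding cmod_power2 by (simp add: power_divide)
      have c0: "0 < (cmod \<tau>1)\<^sup>2" using pos 1(2) by (intro zero_less_power) auto
      have "2 * Im \<tau> \<le> Im (- 1 / \<tau>1)"
      proof -
        have "2 * Im \<tau> * (cmod \<tau>1)\<^sup>2 \<le> 2 * Im \<tau> * (1 / 2)" using c pos by (intro mult_left_mono) auto
        thus ?thesis unfolding Im_neg_inverse using c0 1(2) by (simp add: pos_le_divide_eq)
      qed
      hence "2 ^ n * (2 * Im \<tau>) \<le> 2 ^ n * Im (- 1 / \<tau>1)" by (intro mult_left_mono) auto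
      hence "1 / 2 \<le> 2 ^ n * Im (- 1 / \<tau>1)" using Suc.prems by (simp add: mult_ac)
      from Suc.IH[OF this] show ?thesis using S[of \<tau>1] 1 pos by simp
    qed
  qed
  moreover obtain n where "1 / 2 \<le> 2 ^ n * Im \<tau>"
  proof -
    obtain n where "1 / (2 * Im \<tau>) < 2 ^ n" using real_arch_pow[of 2] by auto
    hence "1 / 2 < 2 ^ n * Im \<tau>" using \<tau> by (simp add: field_simps)
    thus ?thesis using that[of n] by simp
  qed
  ultimately show ?thesis using that by blast
qed

section \<open>Forms of negative weight, of weight zero and of weight two\<close>

lemma mult_exp_neg_le: "(u::real) * exp (- u) \<le> exp (- 1)"
proof -
  have "u \<le> exp (u - 1)" using exp_ge_add_one_self[of "u - 1"] by simp
  hence "u * exp (- u) \<le> exp (u - 1) * exp (- u)" by (intro mult_right_mono) auto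
  thus ?thesis by (simp add: exp_add[symmetric])
qed

text \<open>The invariant |h|^2 / Im^m tends to 0 at the cusp, so it has a maximum, at
  \<open>\<tau>0\<close> of height \<open>y0\<close>. Multiplying \<open>h\<close> by exp (i
  \<alpha> \<tau>) with \<alpha> = m / (2 y0) turns the squared modulus into the invariant times the
  m-th power of y exp (- y / y0), a function which is largest at y0. So the product has maximal
  modulus at \<open>\<tau>0\<close> and is constant; \<open>h\<close> then grows exponentially in
  Im, against the bound.\<close>

lemma modular_negative_weight:
  assumes hol: "h holomorphic_on {\<tau>. 0 < Im \<tau>}"
    and T: "\<And>\<tau>. 0 < Im \<tau> \<Longrightarrow> h (\<tau> + 1) = h \<tau>"
    and S: "\<And>\<tau>. 0 < Im \<tau> \<Longrightarrow> h (- 1 / \<tau>) * \<tau> ^ m = h \<tau>"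
    and m: "m > 0"
    and B: "\<And>\<tau>. 1 / 2 \<le> Im \<tau> \<Longrightarrow> cmod (h \<tau>) \<le> B"
    and \<tau>: "0 < Im \<tau>"
  shows "h \<tau> = 0"
proof (rule ccontr)
  assume nz: "h \<tau> \<noteq> 0"
  define \<phi> where "\<phi> = (\<lambda>\<tau>. (cmod (h \<tau>))\<^sup>2 / Im \<tau> ^ m)"
  have \<phi>T: "\<phi> (\<tau> + 1) = \<phi> \<tau>" if "0 < Im \<tau>" for \<tau> using T[OF that] by (simp add: \<phi>_def)
  have \<phi>S: "\<phi> (- 1 / \<tau>) = \<phi> \<tau>" if "0 < Im \<tau>" for \<tau>
  proof -
    have c0: "cmod \<tau> > 0" using that by auto
    have "(cmod (h \<tau>))\<^sup>2 = (cmod (h (- 1 / \<tau>)))\<^sup>2 * ((cmod \<tau>)\<^sup>2) ^ m"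
      unfolding S[OF that, symmetric] norm_mult norm_power power_mult_distrib by (simp add: power_mult[symmetric] mult.commute)
    thus ?thesis using c0 that unfolding \<phi>_def Im_neg_inverse by (simp add: power_divide)
  qed
  have red: "\<exists>\<tau>'. \<phi> \<tau>' = \<phi> \<tau> \<and> 1 / 2 \<le> Im \<tau>' \<and> \<bar>Re \<tau>'\<bar> \<le> 1 / 2" if "0 < Im \<tau>" for \<tau>
    using modular_reduction[of \<phi>, OF \<phi>T \<phi>S that] by metis
  have B0: "B \<ge> 0" using B[of "\<i>"] norm_ge_zero[of "h \<i>"] by (smt (verit) imaginary_unit.simps field_sum_of_halves)
  define p where "p = \<phi> \<tau>"
  have p: "p > 0" using nz \<tau> by (simp add: p_def \<phi>_def)
  define Y where "Y = B\<^sup>2 / p + 1"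
  have Y: "Y \<ge> 1" using p by (simp add: Y_def)
  have small: "\<phi> \<tau>' < p" if "Im \<tau>' > Y" for \<tau>'
  proof -
    have "(cmod (h \<tau>'))\<^sup>2 \<le> B\<^sup>2" using B[of \<tau>'] that Y by (intro power_mono) auto
    moreover have "Y \<le> Im \<tau>' ^ m" using that Y m self_le_power[of "Im \<tau>'" m] by linarith
    ultimately have "\<phi> \<tau>' \<le> B\<^sup>2 / Y" unfolding \<phi>_def using Y by (intro frac_le) auto
    also have "\<dots> < p"
    proof -
      have "B\<^sup>2 < p * Y" using p by (simp add: Y_def distrib_left)
      thus ?thesis using Y by (simp add: pos_divide_less_eq)
    qed
    finally show ?thesis .
  qed
  define K where "K = cbox (Complex (-1/2) (1/2)) (Complex (1/2) Y)"
  have Kmem: "\<tau>' \<in> K \<longleftrightarrow> \<bar>Re \<tau>'\<bar> \<le> 1/2 \<and> 1/2 \<le> Im \<tau>' \<and> Im \<tau>' \<le> Y" for \<tau>'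
    by (auto simp: K_def in_cbox_complex_iff)
  obtain \<tau>1 where 1: "\<phi> \<tau>1 = p" "1 / 2 \<le> Im \<tau>1" "\<bar>Re \<tau>1\<bar> \<le> 1 / 2" using red[OF \<tau>] unfolding p_def by blast
  have 1: "\<tau>1 \<in> K" "\<phi> \<tau>1 = p" using 1 small[of \<tau>1] Kmem by force+
  have "continuous_on K \<phi>" unfolding \<phi>_def
  proof (intro continuous_intros)
    show "continuous_on K h"
      by (rule continuous_on_subset[OF holomorphic_on_imp_continuous_on[OF hol]]) (auto simp: Kmem)
    show "\<forall>x\<in>K. Im x ^ m \<noteq> 0" by (auto simp: Kmem)
  qed
  then obtain \<tau>0 where \<tau>0: "\<tau>0 \<in> K" "\<And>\<tau>. \<tau> \<in> K \<Longrightarrow> \<phi> \<tau> \<le> \<phi> \<tau>0"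
    using continuous_attains_sup[of K \<phi>] 1(1) by (auto simp: K_def)
  have max: "\<phi> \<tau> \<le> \<phi> \<tau>0" if pos: "0 < Im \<tau>" for \<tau>
  proof -
    obtain \<tau>' where "\<phi> \<tau>' = \<phi> \<tau>" "1 / 2 \<le> Im \<tau>'" "\<bar>Re \<tau>'\<bar> \<le> 1 / 2" using red[OF pos] by blast
    thus ?thesis using small[of \<tau>'] \<tau>0(2)[of \<tau>'] \<tau>0(2)[OF 1(1)] 1(2) Kmem[of \<tau>'] by force
  qed
  define y0 where "y0 = Im \<tau>0"
  have y0: "y0 > 0" using \<tau>0(1) by (auto simp: Kmem y0_def)
  define \<alpha> where "\<alpha> = real m / (2 * y0)"
  have \<alpha>: "\<alpha> > 0" using m y0 by (simp add: \<alpha>_def)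
  define F where "F = (\<lambda>\<tau>. h \<tau> * exp (\<i> * of_real \<alpha> * \<tau>))"
  have normF: "cmod (F \<tau>) = cmod (h \<tau>) * exp (- \<alpha> * Im \<tau>)" for \<tau> by (simp add: F_def norm_mult)
  have normF2: "(cmod (F \<tau>))\<^sup>2 = \<phi> \<tau> * (y0 * (Im \<tau> / y0 * exp (- (Im \<tau> / y0)))) ^ m" if "0 < Im \<tau>" for \<tau>
  proof -
    have "(exp (- \<alpha> * Im \<tau>))\<^sup>2 = exp (- (Im \<tau> / y0)) ^ m"
      using y0 by (simp add: exp_of_nat_mult[symmetric] exp_double[symmetric] \<alpha>_def)
    thus ?thesis using that y0 by (simp add: normF power_mult_distrib \<phi>_def)
  qed
  have "F constant_on {\<tau>. 0 < Im \<tau>}"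
  proof (rule maximum_modulus_principle[OF _ upper_half_plane_props(1,2) upper_half_plane_props(1) order.refl])
    show "F holomorphic_on {\<tau>. 0 < Im \<tau>}" unfolding F_def by (intro holomorphic_intros hol)
    show "\<tau>0 \<in> {\<tau>. 0 < Im \<tau>}" using y0 by (simp add: y0_def)
    fix z assume z: "z \<in> {\<tau>. 0 < Im \<tau>}"
    have "0 \<le> \<phi> \<tau>0" using y0 by (simp add: \<phi>_def y0_def)
    hence "(cmod (F z))\<^sup>2 \<le> \<phi> \<tau>0 * (y0 * exp (- 1)) ^ m"
      using z y0 mult_exp_neg_le[of "Im z / y0"] max[of z]
      by (subst normF2, simp, intro mult_mono power_mono mult_left_mono) auto
    also have "\<dots> = (cmod (F \<tau>0))\<^sup>2" using y0 by (subst normF2) (auto simp: y0_def[symmetric])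
    finally show "cmod (F z) \<le> cmod (F \<tau>0)" by (rule power2_le_imp_le) simp
  qed
  then obtain c where c: "\<And>\<tau>. 0 < Im \<tau> \<Longrightarrow> F \<tau> = c" unfolding constant_on_def by blast
  have c0: "cmod c > 0" using c[OF \<tau>] nz by (auto simp: F_def)
  \<comment> \<open>As \<open>exp (\<alpha> * y)\<close> is at least
    \<open>1 + \<alpha> * y\<close>, this height pushes |h| above \<open>B\<close>.\<close>
  define y where "y = 1 + B / (\<alpha> * cmod c)"
  have y: "y \<ge> 1" using B0 \<alpha> c0 by (simp add: y_def)
  have "cmod c * exp (\<alpha> * y) = cmod (h (\<i> * of_real y))"
    using c[of "\<i> * of_real y"] y normF[of "\<i> * of_real y"] by (simp add: exp_minus field_simps)
  also have "\<dots> \<le> B" by (rule B) (use y in simp)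
  finally have "cmod c * exp (\<alpha> * y) \<le> B" .
  moreover have "cmod c * (1 + \<alpha> * y) \<le> cmod c * exp (\<alpha> * y)" using c0 exp_ge_add_one_self by (intro mult_left_mono) auto
  moreover have "cmod c * (1 + \<alpha> * y) = cmod c + cmod c * \<alpha> + B" using c0 \<alpha> by (simp add: y_def field_simps)
  ultimately show False using c0 \<alpha> by (smt (verit) mult_pos_pos)
qed

definition nome :: "complex \<Rightarrow> complex" where "nome \<tau> = exp (2 * of_real pi * \<i> * \<tau>)"

lemma norm_nome: "cmod (nome \<tau>) = exp (- 2 * pi * Im \<tau>)" by (simp add: nome_def)

lemma nome_plus_1: "nome (\<tau> + 1) = nome \<tau>" 
  by (simp add: nome_def distrib_left exp_add exp_eq_1 flip: exp_add) (simp add: exp_add distrib_left)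

lemma nome_in_ball: "0 < Im \<tau> \<Longrightarrow> nome \<tau> \<in> ball 0 1" by (simp add: norm_nome)

lemma nome_nonzero: "nome \<tau> \<noteq> 0" by (simp add: nome_def)

lemma nome_surj: 
  assumes "q \<noteq> 0" "cmod q < 1"
  obtains \<tau> where "0 < Im \<tau>" "nome \<tau> = q"
proof
  define \<tau> where "\<tau> = Ln q / (2 * of_real pi * \<i>)"
  show "nome \<tau> = q" using assms by (simp add: nome_def \<tau>_def)
  hence "exp (- 2 * pi * Im \<tau>) < exp 0" using norm_nome[of \<tau>] assms by simp
  hence "- 2 * pi * Im \<tau> < 0" by (simp only: exp_less_cancel_iff)
  thus "0 < Im \<tau>" by (simp add: zero_less_mult_iff)
qed

lemma nome_small: "1 / 2 \<le> Im \<tau> \<Longrightarrow> nome \<tau> \<in> cball 0 (exp (- pi))"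
  by (simp add: norm_nome field_simps)

lemma holomorphic_nome_compose:
  assumes "G holomorphic_on ball 0 1"
  shows "(\<lambda>\<tau>. G (nome \<tau>)) holomorphic_on {\<tau>. 0 < Im \<tau>}"
proof -
  have "nome holomorphic_on {\<tau>. 0 < Im \<tau>}" unfolding nome_def by (intro holomorphic_intros)
  moreover have "nome ` {\<tau>. 0 < Im \<tau>} \<subseteq> ball 0 1" using nome_in_ball by blast
  ultimately show ?thesis using holomorphic_on_compose_gen[OF _ assms] by (force simp: o_def)
qed

text \<open>By reduction the modulus is bounded by its maximum over the compact disc of radius exp
  (- pi), which corresponds to Im \<ge> 1/2 together with the cusp. This is a maximum at an interior
  point of the unit disc.\<close>

lemma modular_weight_zero:
  assumes G: "G holomorphic_on ball 0 1"
    and S: "\<And>\<tau>. 0 < Im \<tau> \<Longrightarrow> G (nome (- 1 / \<tau>)) = G (nome \<tau>)"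
  shows "G constant_on ball 0 1"
proof -
  have sub: "cball 0 (exp (- pi)) \<subseteq> ball (0::complex) 1"
  proof
    fix z :: complex assume "z \<in> cball 0 (exp (- pi))"
    moreover have "exp (- pi) < 1" by simp
    ultimately have "cmod z < 1" by (simp only: mem_cball dist_0_norm)
    thus "z \<in> ball 0 1" by simp
  qed
  have "continuous_on (cball 0 (exp (- pi))) (\<lambda>q. cmod (G q))"
    by (intro continuous_intros continuous_on_subset[OF holomorphic_on_imp_continuous_on[OF G] sub])
  then obtain q0 where q0: "q0 \<in> cball 0 (exp (- pi))" "\<And>q. q \<in> cball 0 (exp (- pi)) \<Longrightarrow> cmod (G q) \<le> cmod (G q0)"
    using continuous_attains_sup[of "cball 0 (exp (- pi))" "\<lambda>q. cmod (G q)"] by (auto simp: ball_def)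
  show ?thesis
  proof (rule maximum_modulus_principle[OF G open_ball connected_ball open_ball order.refl])
    show "q0 \<in> ball 0 1" using q0(1) sub by blast
    fix q :: complex assume q: "q \<in> ball 0 1"
    show "cmod (G q) \<le> cmod (G q0)"
    proof (cases "q = 0")
      case False
      then obtain \<tau> where \<tau>: "0 < Im \<tau>" "nome \<tau> = q" using nome_surj q by auto
      obtain \<tau>' where "G (nome \<tau>') = G (nome \<tau>)" "1 / 2 \<le> Im \<tau>'"
        using modular_reduction[of "\<lambda>\<tau>. G (nome \<tau>)", OF _ S \<tau>(1)] nome_plus_1 by metis
      thus ?thesis using q0(2)[OF nome_small] \<tau>(2) by metis
    qed (use q0(2)[of 0] in simp)
  qed
qed

text \<open>A primitive of the form is invariant under \<open>\<tau> \<mapsto> - 1 / \<tau>\<close> and periodic up to a multiple of \<open>\<tau>\<close>,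
  which reduces the claim to weight zero.\<close>
lemma modular_weight_two:
  assumes g: "g holomorphic_on ball 0 1"
    and S: "\<And>\<tau>. 0 < Im \<tau> \<Longrightarrow> g (nome (- 1 / \<tau>)) = \<tau>\<^sup>2 * g (nome \<tau>)"
    and q: "q \<in> ball 0 1"
  shows "g q = 0"
proof -
  \<comment> \<open>In the variable q, integration over \<tau> divides by q. The constant term of g
    cannot be integrated this way; it becomes the linear term \<open>g 0 * \<tau>\<close> of the
    primitive.\<close>
  define g1 where "g1 = (\<lambda>z. if z = 0 then deriv g 0 else (g z - g 0) / (z - 0))"
  have g1: "g1 holomorphic_on ball 0 1" unfolding g1_def by (rule pole_lemma[OF g]) auto
  have gg1: "g z = g 0 + z * g1 z" for z by (simp add: g1_def)
  obtain G where G: "\<And>z. z \<in> ball 0 1 \<Longrightarrow> (G has_field_derivative g1 z) (at z within ball 0 1)"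
    using holomorphic_convex_primitive'[OF convex_ball open_ball g1] by auto
  have G': "(G has_field_derivative g1 z) (at z)" if "z \<in> ball 0 1" for z
    using G[OF that] that by (metis at_within_open open_ball)
  define P where "P = (\<lambda>\<tau>. g 0 * \<tau> + G (nome \<tau>) / (2 * of_real pi * \<i>))"
  have P': "(P has_field_derivative g (nome \<tau>)) (at \<tau>)" if "0 < Im \<tau>" for \<tau>
  proof -
    have "(nome has_field_derivative nome \<tau> * (2 * of_real pi * \<i>)) (at \<tau>)"
      unfolding nome_def by (auto intro!: derivative_eq_intros)
    from DERIV_chain2[OF G'[OF nome_in_ball[OF that]] this]
    have "((\<lambda>\<tau>. G (nome \<tau>)) has_field_derivative g1 (nome \<tau>) * (nome \<tau> * (2 * of_real pi * \<i>))) (at \<tau>)" .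
    hence "(P has_field_derivative g 0 * 1 + g1 (nome \<tau>) * (nome \<tau> * (2 * of_real pi * \<i>)) / (2 * of_real pi * \<i>)) (at \<tau>)"
      unfolding P_def by (intro DERIV_add DERIV_cmult DERIV_ident DERIV_cdivide)
    thus ?thesis by (simp add: gg1[of "nome \<tau>"] mult.commute)
  qed
  have PS: "P (- 1 / \<tau>) = P \<tau>" if \<tau>: "0 < Im \<tau>" for \<tau>
  proof -
    have "((\<lambda>\<tau>. P (- 1 / \<tau>) - P \<tau>) has_field_derivative 0) (at z within {\<tau>. 0 < Im \<tau>})" if "z \<in> {\<tau>. 0 < Im \<tau>}" for z
    proof -
      have z: "0 < Im z" "z \<noteq> 0" using that by auto
      have "((\<lambda>\<tau>. - 1 / \<tau>) has_field_derivative 1 / z\<^sup>2) (at z)"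
        using z(2) by (auto intro!: derivative_eq_intros simp: power2_eq_square)
      from DERIV_diff[OF DERIV_chain2[OF P'[OF upper_half_inverse[OF z(1)]] this] P'[OF z(1)]]
      have "((\<lambda>\<tau>. P (- 1 / \<tau>) - P \<tau>) has_field_derivative g (nome (- 1 / z)) * (1 / z\<^sup>2) - g (nome z)) (at z)" .
      thus ?thesis using S[OF z(1)] z(2) by (simp add: has_field_derivative_at_within)
    qed
    from has_field_derivative_zero_constant[OF upper_half_plane_props(3) this]
    obtain c where c: "\<And>z. 0 < Im z \<Longrightarrow> P (- 1 / z) - P z = c" by auto
    \<comment> \<open>i is the fixed point of the inversion.\<close>
    have "c = 0" using c[of \<i>] by simp
    thus ?thesis using c[OF \<tau>] by simp
  qed
  \<comment> \<open>The primitive cube root of unity, where inversion and translation by 1 agree.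
    Invariance under the former and the period \<open>g 0\<close> of the latter give
    \<open>g 0 = 0\<close>.\<close>
  define \<rho> where "\<rho> = Complex (- 1 / 2) (sqrt 3 / 2)"
  have "- 1 / \<rho> = \<rho> + 1"
  proof -
    have "\<rho> \<noteq> 0" by (auto simp: \<rho>_def complex_eq_iff)
    moreover have "(\<rho> + 1) * \<rho> = - 1" by (simp add: \<rho>_def complex_eq_iff)
    ultimately show ?thesis by (simp add: field_simps)
  qed
  hence "P (\<rho> + 1) = P \<rho>" using PS[of \<rho>] by (simp add: \<rho>_def)
  hence g0: "g 0 = 0" by (simp add: P_def nome_plus_1 distrib_left)
  have hG: "G holomorphic_on ball 0 1" unfolding holomorphic_on_def field_differentiable_def using G by blast
  have "G constant_on ball 0 1"
    by (rule modular_weight_zero[OF hG]) (use PS g0 in \<open>simp add: P_def\<close>)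
  then obtain c where c: "\<And>z. z \<in> ball 0 1 \<Longrightarrow> G z = c" unfolding constant_on_def by blast
  have "(G has_field_derivative 0) (at q)"
    by (rule has_field_derivative_transform_within_open[of "\<lambda>_. c" _ _ "ball 0 1"]) (use c q in auto)
  hence "g1 q = 0" using G'[OF q] DERIV_unique by blast
  thus ?thesis using gg1[of q] g0 by simp
qed

subsection \<open>The discriminant form\<close>

text \<open>Sorts an unordered sum by exponents; the families are the pentagonal series over the
  integers and the theta series over a lattice.\<close>

lemma power_series_of_family:
  fixes N :: "'i \<Rightarrow> nat" and c :: "'i \<Rightarrow> complex"
  assumes sm: "\<And>r. 0 < r \<Longrightarrow> r < 1 \<Longrightarrow> (\<lambda>i. norm (c i) * r ^ N i) summable_on I"
    and q: "norm q < 1"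
  shows "(\<lambda>i. c i * q ^ N i) summable_on I"
    and "(\<lambda>n. (\<Sum>\<^sub>\<infinity>i\<in>{i\<in>I. N i = n}. c i) * q ^ n) sums (\<Sum>\<^sub>\<infinity>i\<in>I. c i * q ^ N i)"
proof -
  define r where "r = (1 + norm q) / 2"
  have r: "0 < r" "r < 1" "norm q \<le> r" using q by (auto simp: r_def add_pos_nonneg)
  have abs: "(\<lambda>i. norm (c i * q ^ N i)) summable_on I"
    by (rule summable_on_comparison_test[OF sm[OF r(1,2)]])
       (auto simp: norm_mult norm_power intro!: mult_left_mono power_mono r(3))
  thus summ: "(\<lambda>i. c i * q ^ N i) summable_on I" by (rule abs_summable_summable)
  define A where "A = (\<lambda>n. {i\<in>I. N i = n})"
  have inner: "((\<lambda>i. c i * q ^ n) has_sum (\<Sum>\<^sub>\<infinity>i\<in>A n. c i) * q ^ n) (A n)" for n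
  proof -
    have "(\<lambda>i. norm (c i) * (1 / 2) ^ N i) summable_on A n"
      by (rule summable_on_subset_banach[OF sm[of "1/2"]]) (auto simp: A_def)
    hence "(\<lambda>i. norm (c i) * (1 / 2) ^ n) summable_on A n"
      by (rule summable_on_cong[THEN iffD1, rotated]) (auto simp: A_def)
    hence "(\<lambda>i. norm (c i) * (1 / 2) ^ n * 2 ^ n) summable_on A n" by (rule summable_on_cmult_left)
    hence "(\<lambda>i. norm (c i)) summable_on A n" by (simp add: mult.assoc flip: power_mult_distrib)
    hence "c summable_on A n" by (rule abs_summable_summable)
    thus ?thesis by (intro has_sum_cmult_left has_sum_infsum)
  qed
  have "((\<lambda>i. c i * q ^ N i) has_sum (\<Sum>\<^sub>\<infinity>i\<in>I. c i * q ^ N i)) I" using summ by (rule has_sum_infsum)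
  also have "?this \<longleftrightarrow> ((\<lambda>(n, i). c i * q ^ n) has_sum (\<Sum>\<^sub>\<infinity>i\<in>I. c i * q ^ N i)) (Sigma UNIV A)"
    by (rule has_sum_reindex_bij_witness[of _ snd "\<lambda>i. (N i, i)"]) (auto simp: A_def)
  finally have "((\<lambda>n. (\<Sum>\<^sub>\<infinity>i\<in>A n. c i) * q ^ n) has_sum (\<Sum>\<^sub>\<infinity>i\<in>I. c i * q ^ N i)) UNIV"
    by (rule has_sum_SigmaD) (use inner in simp)
  thus "(\<lambda>n. (\<Sum>\<^sub>\<infinity>i\<in>{i\<in>I. N i = n}. c i) * q ^ n) sums (\<Sum>\<^sub>\<infinity>i\<in>I. c i * q ^ N i)"
    unfolding A_def by (rule has_sum_imp_sums)
qed

lemma power_series_of_family_holomorphic: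
  fixes N :: "'i \<Rightarrow> nat" and c :: "'i \<Rightarrow> complex"
  assumes sm: "\<And>r. 0 < r \<Longrightarrow> r < 1 \<Longrightarrow> (\<lambda>i. norm (c i) * r ^ N i) summable_on I"
  shows "(\<lambda>q. \<Sum>\<^sub>\<infinity>i\<in>I. c i * q ^ N i) holomorphic_on ball 0 1"
  by (rule power_series_holomorphic[where a = "\<lambda>n. \<Sum>\<^sub>\<infinity>i\<in>{i\<in>I. N i = n}. c i"])
     (use power_series_of_family(2)[where c = c, OF sm] in auto)

text \<open>Generalised pentagonal numbers. The division is exact and the number is never negative,
  so \<open>nat\<close> cuts nothing off.\<close>

definition pent :: "int \<Rightarrow> nat" where "pent k = nat (k * (3 * k - 1) div 2)"

lemma pent: "2 * real (pent k) = of_int k * (3 * of_int k - 1)" "nat \<bar>k\<bar> \<le> pent k"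
proof -
  have ev: "even (k * (3 * k - 1))" by auto
  have "\<bar>k\<bar> * 2 \<le> k * (3 * k - 1)"
  proof (cases "k \<ge> 1")
    case True
    hence "k * 2 \<le> k * (3 * k - 1)" by (intro mult_left_mono) auto
    thus ?thesis using True by simp
  next
    case False
    hence "(- k) * 2 \<le> (- k) * (1 - 3 * k)" if "k \<noteq> 0" using that by (intro mult_left_mono) auto
    moreover have "k * (3 * k - 1) = (- k) * (1 - 3 * k)" by (simp add: algebra_simps)
    ultimately show ?thesis using False by (cases "k = 0") auto
  qed
  hence "\<bar>k\<bar> \<le> k * (3 * k - 1) div 2" by linarith
  moreover from this have "int (pent k) = k * (3 * k - 1) div 2" unfolding pent_def by simp
  ultimately show "nat \<bar>k\<bar> \<le> pent k" by linarith
  have "2 * int (pent k) = k * (3 * k - 1)" using \<open>int (pent k) = _\<close> ev by simp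
  hence "of_int (2 * int (pent k)) = real_of_int (k * (3 * k - 1))" by (simp only:)
  thus "2 * real (pent k) = of_int k * (3 * of_int k - 1)" by simp
qed

text \<open>The pentagonal number series of the Euler function: with it the inversion formula of \<open>\<eta>\<close> is an
  instance of Poisson summation.\<close>
definition euler_fun :: "complex \<Rightarrow> complex" where
  "euler_fun q = (\<Sum>\<^sub>\<infinity>k. (if even k then 1 else -1) * q ^ pent k)"

lemma summable_on_int_power_abs:
  assumes "0 < r" "r < (1::real)"
  shows "(\<lambda>k::int. r ^ nat \<bar>k\<bar>) summable_on UNIV"
    and "(\<Sum>\<^sub>\<infinity>k\<in>UNIV - {0::int}. r ^ nat \<bar>k\<bar>) = 2 * r / (1 - r)"
proof -
  have g: "((\<lambda>n. r ^ n) has_sum r / (1 - r)) {1..}"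
    using has_sum_geometric_from_1[of r] assms by simp
  have 1: "((\<lambda>k::int. r ^ nat \<bar>k\<bar>) has_sum r / (1 - r)) {1..}"
    by (subst has_sum_reindex_bij_witness[of _ int nat, where h = "\<lambda>n. r ^ n"]) (use g in auto)
  have 2: "((\<lambda>k::int. r ^ nat \<bar>k\<bar>) has_sum r / (1 - r)) {..-1}"
    by (subst has_sum_reindex_bij_witness[of _ "\<lambda>n. - int n" "\<lambda>k. nat (- k)", where h = "\<lambda>n. r ^ n"]) (use g in auto)
  have un: "{1..} \<union> {..-1} = UNIV - {0::int}" by auto
  have 3: "((\<lambda>k::int. r ^ nat \<bar>k\<bar>) has_sum (2 * r / (1 - r))) (UNIV - {0})"
  proof -
    have "{1..} \<inter> {..-1::int} = {}" by auto
    from has_sum_Un_disjoint[OF 1 2 this] show ?thesis unfolding un by simp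
  qed
  thus "(\<Sum>\<^sub>\<infinity>k\<in>UNIV - {0::int}. r ^ nat \<bar>k\<bar>) = 2 * r / (1 - r)" by (rule infsumI)
  have "(\<lambda>k::int. r ^ nat \<bar>k\<bar>) summable_on insert 0 (UNIV - {0})"
    using 3 by (subst summable_on_insert_iff) (auto simp: has_sum_imp_summable)
  thus "(\<lambda>k::int. r ^ nat \<bar>k\<bar>) summable_on UNIV" by (simp add: insert_UNIV)
qed

lemma summable_on_pent:
  assumes "0 < r" "r < (1::real)"
  shows "(\<lambda>k. norm ((if even k then 1 else -1)::complex) * r ^ pent k) summable_on UNIV"
  by (rule summable_on_comparison_test[OF summable_on_int_power_abs(1)[OF assms]])
     (use assms pent(2) in \<open>auto intro!: power_decreasing\<close>)

lemma euler_fun_holomorphic: "euler_fun holomorphic_on ball 0 1"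
  unfolding euler_fun_def by (rule power_series_of_family_holomorphic[OF summable_on_pent])

text \<open>The constant term is 1, and \<open>pent k\<close> being at least |k| bounds the
  remaining terms by 2 r / (1 - r), which is below 1 because exp (- pi) < 1/4.\<close>

lemma euler_fun_nonzero_small:
  assumes "norm q \<le> exp (- pi)"
  shows "euler_fun q \<noteq> 0"
proof (cases "q = 0")
  case True
  have "pent k = 0 \<longleftrightarrow> k = 0" for k using pent(2)[of k] by (auto simp: pent_def)
  hence "euler_fun 0 = (\<Sum>\<^sub>\<infinity>k\<in>{0::int}. 1)" unfolding euler_fun_def
    by (intro infsum_cong_neutral) (auto simp: power_0_left)
  thus ?thesis using True by simp
next
  case False
  define r where "r = norm q"
  have "exp (3::real) \<ge> 1 + 3" by (rule exp_ge_add_one_self)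
  moreover have "exp 3 < exp pi" using pi_gt3 by simp
  ultimately have "exp pi > 4" by linarith
  hence "exp (- pi) < 1 / 4" by (simp add: exp_minus field_simps)
  hence r: "0 < r" "r < 1 / 4" using assms False by (auto simp: r_def)
  let ?f = "\<lambda>k. (if even k then 1 else -1) * q ^ pent k"
  have sa: "(\<lambda>k. norm (?f k)) summable_on UNIV"
    using summable_on_pent[of r] r by (simp add: norm_mult norm_power r_def cong: if_cong)
  have "euler_fun q = (\<Sum>\<^sub>\<infinity>k\<in>insert 0 (UNIV - {0::int}). ?f k)" by (simp add: euler_fun_def insert_UNIV)
  also have "\<dots> = ?f 0 + (\<Sum>\<^sub>\<infinity>k\<in>UNIV - {0}. ?f k)"
    by (rule infsum_insert) (auto intro: summable_on_subset_banach[OF abs_summable_summable[OF sa]])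
  finally have e: "euler_fun q = 1 + (\<Sum>\<^sub>\<infinity>k\<in>UNIV - {0}. ?f k)" by (simp add: pent_def)
  have "norm (\<Sum>\<^sub>\<infinity>k\<in>UNIV - {0}. ?f k) \<le> (\<Sum>\<^sub>\<infinity>k\<in>UNIV - {0}. norm (?f k))"
    by (rule norm_infsum_bound) (rule summable_on_subset_banach[OF sa], simp)
  also have "\<dots> \<le> (\<Sum>\<^sub>\<infinity>k\<in>UNIV - {0::int}. r ^ nat \<bar>k\<bar>)"
  proof (rule infsum_mono)
    show "(\<lambda>k. norm (?f k)) summable_on UNIV - {0}" by (rule summable_on_subset_banach[OF sa]) simp
    show "(\<lambda>k::int. r ^ nat \<bar>k\<bar>) summable_on UNIV - {0}"
      by (rule summable_on_subset_banach[OF summable_on_int_power_abs(1)]) (use r in auto)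
    show "norm (?f k) \<le> r ^ nat \<bar>k\<bar>" for k
      using pent(2)[of k] r by (auto simp: norm_mult norm_power r_def[symmetric] intro!: power_decreasing)
  qed
  also have "\<dots> = 2 * r / (1 - r)" by (rule summable_on_int_power_abs(2)) (use r in auto)
  also have "\<dots> < 1" using r by (simp add: field_simps)
  finally have "norm (\<Sum>\<^sub>\<infinity>k\<in>UNIV - {0}. ?f k) < 1" .
  thus ?thesis unfolding e by (metis add_eq_0_iff norm_minus_cancel norm_one order_less_irrefl)
qed

text \<open>The Dedekind eta function at i t. Completing the square gives 3 (k - 1/6)^2 = 2
  \<open>pent k\<close> + 1/12, and the 1/12 accounts for the factor q^(1/24).\<close>

definition eta_it :: "real \<Rightarrow> complex" where
  "eta_it t = (\<Sum>\<^sub>\<infinity>k::int. (if even k then 1 else -1) * of_real (exp (- (3 * pi * t * (of_int k - 1 / 6)\<^sup>2))))"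

lemma cis_pi_int: "cis (pi * of_int k) = (if even k then 1 else -1)"
proof -
  have "cos (pi * of_int k) = (if even k then 1 else -1)" using cos_int_times_real[of k pi] sin_npi_int[of k]
    by (metis cos_npi_int mult.commute)
  moreover have "sin (pi * of_int k) = 0" by (rule sin_npi_int)
  ultimately show ?thesis by (auto simp: complex_eq_iff)
qed

lemma eta_it_summable:
  assumes "t > 0"
  shows "(\<lambda>k::int. (if even k then 1 else -1) * complex_of_real (exp (- (3 * pi * t * (of_int k + s)\<^sup>2)))) summable_on UNIV"
proof (rule abs_summable_summable)
  have "(\<lambda>k::int. exp (- (pi * (3 * t) * (of_int k + s)\<^sup>2))) summable_on UNIV"
    by (rule summable_on_int_gauss_shift) (use assms in simp)
  moreover have "cmod (if even k then 1 else - 1) = 1" for k :: int by simp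
  ultimately show "(\<lambda>k::int. norm ((if even k then 1 else -1) * complex_of_real (exp (- (3 * pi * t * (of_int k + s)\<^sup>2))))) summable_on UNIV"
    by (simp only: norm_mult norm_of_real mult_1) (simp add: mult_ac)
qed

text \<open>Poisson summation with width 3 t, frequency 1/2 (for the signs) and shift -1/6. The dual
  sum is split by residues modulo 3: the classes 0 and 1 each return eta at 1 / t, while class 2 is
  odd under j -> -1 - j and cancels. The phases then combine to cis (pi/6) (1 + cis (- pi/3)) = sqrt
  3.\<close>

lemma eta_inversion:
  assumes t: "t > 0"
  shows "eta_it (1 / t) = of_real (sqrt t) * eta_it t"
proof -
  define sg where "sg = (\<lambda>k::int. if even k then 1 else - 1 :: complex)"
  define g where "g = (\<lambda>s (j::int). sg j * complex_of_real (exp (- (3 * pi * (1 / t) * (of_int j + s)\<^sup>2))))"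
  have gsum: "g s summable_on UNIV" for s unfolding g_def sg_def by (rule eta_it_summable) (use t in simp)
  have sgu: "sg (- j) = sg j" for j by (simp add: sg_def)
  have g1: "infsum (g (1 / 6)) UNIV = eta_it (1 / t)"
  proof -
    have "infsum (g (1 / 6)) UNIV = (\<Sum>\<^sub>\<infinity>j. g (1 / 6) (- j))"
      by (rule infsum_reindex_bij_witness[of _ uminus uminus]) auto
    also have "(\<lambda>j. g (1 / 6) (- j)) = (\<lambda>j. sg j * of_real (exp (- (3 * pi * (1 / t) * (of_int j - 1 / 6)\<^sup>2))))"
      unfolding g_def sgu using power2_commute[of "1 / 6" "real_of_int _"] by simp
    finally show ?thesis by (simp add: eta_it_def sg_def)
  qed
  have g0: "infsum (g (- 1 / 6)) UNIV = eta_it (1 / t)" by (simp add: g_def eta_it_def sg_def)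
  have g2: "infsum (g (1 / 2)) UNIV = 0"
  proof -
    have "infsum (g (1 / 2)) UNIV = (\<Sum>\<^sub>\<infinity>j. g (1 / 2) (- 1 - j))"
      by (rule infsum_reindex_bij_witness[of _ "\<lambda>j. - 1 - j" "\<lambda>j. - 1 - j"]) auto
    also have "(\<lambda>j. g (1 / 2) (- 1 - j)) = (\<lambda>j. - g (1 / 2) j)"
    proof
      fix j
      have "(real_of_int (- 1 - j) + 1 / 2)\<^sup>2 = (real_of_int j + 1 / 2)\<^sup>2" by (simp add: power2_eq_square algebra_simps)
      moreover have "sg (- 1 - j) = - sg j" by (simp add: sg_def)
      ultimately show "g (1 / 2) (- 1 - j) = - g (1 / 2) j" by (simp only: g_def) simp
    qed
    finally show ?thesis by (simp add: infsum_uminus)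
  qed
  define h where "h = (\<lambda>m::int. complex_of_real (exp (- (pi * (of_int m - 1 / 2)\<^sup>2 / (3 * t)))) * cis (2 * pi * of_int m * (- 1 / 6)))"
  have h: "h (3 * j + r) = cis (- (pi * of_int r / 3)) * g ((of_int r - 1 / 2) / 3) j" for j r
  proof -
    have "cis (2 * pi * of_int (3 * j + r) * (- 1 / 6)) = cis (- (pi * of_int r / 3)) * cis (pi * of_int (- j))"
      by (simp add: cis_mult algebra_simps)
    also have "cis (pi * of_int (- j)) = sg j" unfolding cis_pi_int by (simp add: sg_def)
    finally have 1: "cis (2 * pi * of_int (3 * j + r) * (- 1 / 6)) = cis (- (pi * of_int r / 3)) * sg j" .
    have "of_int (3 * j + r) - 1 / 2 = 3 * (real_of_int j + (of_int r - 1 / 2) / 3)" by simp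
    hence 2: "pi * (of_int (3 * j + r) - 1 / 2)\<^sup>2 / (3 * t) = 3 * pi * (1 / t) * (real_of_int j + (of_int r - 1 / 2) / 3)\<^sup>2"
      by (simp only: power_mult_distrib) (simp add: field_simps)
    show ?thesis unfolding h_def 1 2 g_def by (simp add: mult_ac)
  qed
  have "infsum h UNIV = cis (- (pi * 0 / 3)) * infsum (g (- 1 / 6)) UNIV + (cis (- (pi * 1 / 3)) * infsum (g (1 / 6)) UNIV + cis (- (pi * 2 / 3)) * infsum (g (1 / 2)) UNIV)"
  proof (rule infsumI)
    have hs: "(h has_sum cis (- (pi * of_int r / 3)) * infsum (g ((of_int r - 1 / 2) / 3)) UNIV) (range (\<lambda>j. 3 * j + r))" for r
    proof -
      have "((\<lambda>j. cis (- (pi * of_int r / 3)) * g ((of_int r - 1 / 2) / 3) j) has_sum cis (- (pi * of_int r / 3)) * infsum (g ((of_int r - 1 / 2) / 3)) UNIV) UNIV"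
        by (intro has_sum_cmult_right has_sum_infsum gsum)
      thus ?thesis by (subst has_sum_reindex) (auto simp: inj_on_def o_def h)
    qed
    have d: "range (\<lambda>j. 3 * j + 1) \<inter> range (\<lambda>j. 3 * j + 2) = ({} :: int set)"
            "range (\<lambda>j. 3 * j + 0) \<inter> (range (\<lambda>j. 3 * j + 1) \<union> range (\<lambda>j. 3 * j + 2)) = ({} :: int set)"
      by (auto; presburger)+
    have u: "range (\<lambda>j. 3 * j + 0) \<union> (range (\<lambda>j. 3 * j + 1) \<union> range (\<lambda>j. 3 * j + 2)) = (UNIV :: int set)"
    proof -
      have "k \<in> range (\<lambda>j. 3 * j + 0) \<union> (range (\<lambda>j. 3 * j + 1) \<union> range (\<lambda>j. 3 * j + 2))" for k :: int
      proof -
        have "k = 3 * (k div 3) + 0 \<or> k = 3 * (k div 3) + 1 \<or> k = 3 * (k div 3) + 2" by presburger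
        thus ?thesis by blast
      qed
      thus ?thesis by blast
    qed
    from has_sum_Un_disjoint[OF hs[of 0] has_sum_Un_disjoint[OF hs[of 1] hs[of 2] d(1)] d(2)]
    show "(h has_sum cis (- (pi * 0 / 3)) * infsum (g (- 1 / 6)) UNIV + (cis (- (pi * 1 / 3)) * infsum (g (1 / 6)) UNIV + cis (- (pi * 2 / 3)) * infsum (g (1 / 2)) UNIV)) UNIV"
      unfolding u by simp
  qed
  hence hsum: "infsum h UNIV = (1 + cis (- (pi / 3))) * eta_it (1 / t)" unfolding g0 g1 g2 by (simp add: algebra_simps)
  have "(\<Sum>\<^sub>\<infinity>k::int. gauss_wave (3 * t) (1 / 2) (of_int k + (- 1 / 6))) = of_real (1 / sqrt (3 * t)) * infsum h UNIV"
    unfolding h_def by (rule gauss_poisson) (use t in simp)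
  also have "(\<lambda>k::int. gauss_wave (3 * t) (1 / 2) (of_int k + (- 1 / 6))) = (\<lambda>k. cis (- (pi / 6)) * (sg k * of_real (exp (- (3 * pi * t * (of_int k - 1 / 6)\<^sup>2)))))"
  proof
    fix k :: int
    have "cis (2 * pi * (1 / 2) * (of_int k + (- 1 / 6))) = cis (- (pi / 6)) * cis (pi * of_int k)"
      by (simp add: cis_mult algebra_simps)
    thus "gauss_wave (3 * t) (1 / 2) (of_int k + (- 1 / 6)) = cis (- (pi / 6)) * (sg k * of_real (exp (- (3 * pi * t * (of_int k - 1 / 6)\<^sup>2))))"
      unfolding gauss_wave_def cis_pi_int sg_def by (simp add: mult_ac)
  qed
  finally have "cis (- (pi / 6)) * eta_it t = of_real (1 / sqrt (3 * t)) * ((1 + cis (- (pi / 3))) * eta_it (1 / t))"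
    unfolding hsum infsum_cmult_right' sg_def eta_it_def .
  hence "cis (pi / 6) * (cis (- (pi / 6)) * eta_it t) = of_real (1 / sqrt (3 * t)) * ((cis (pi / 6) * (1 + cis (- (pi / 3)))) * eta_it (1 / t))"
    by simp
  moreover have "cis (pi / 6) * (1 + cis (- (pi / 3))) = of_real (sqrt 3)"
    by (simp add: distrib_left cis_mult) (simp add: complex_eq_iff cos_30 sin_30)
  moreover have "cis (pi / 6) * (cis (- (pi / 6)) * eta_it t) = eta_it t" by (simp add: cis_mult flip: mult.assoc)
  ultimately have "eta_it t = of_real (1 / sqrt (3 * t)) * (of_real (sqrt 3) * eta_it (1 / t))" by simp
  also have "\<dots> = of_real (1 / sqrt t) * eta_it (1 / t)" by (simp add: real_sqrt_mult)
  finally show ?thesis using t by simp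
qed

text \<open>The modular discriminant, as the 24th power of eta.\<close>

definition Delta :: "complex \<Rightarrow> complex" where "Delta \<tau> = nome \<tau> * euler_fun (nome \<tau>) ^ 24"

lemma Delta_imaginary:
  assumes t: "t > 0"
  shows "Delta (\<i> * of_real t) = eta_it t ^ 24"
proof -
  define q where "q = exp (- 2 * pi * t)"
  have nome: "nome (\<i> * of_real t) = of_real q"
    by (simp add: nome_def q_def exp_of_real[symmetric] algebra_simps)
  have "eta_it t = of_real (exp (- (pi * t / 12))) * euler_fun (of_real q)"
    unfolding eta_it_def euler_fun_def infsum_cmult_right'[symmetric]
  proof (rule infsum_cong)
    fix k :: int
    have "q ^ pent k = exp (- (pi * t * (2 * real (pent k))))"
      by (simp add: q_def exp_of_nat_mult[symmetric] algebra_simps)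
    hence "exp (- (pi * t / 12)) * q ^ pent k = exp (- (3 * pi * t * (of_int k - 1 / 6)\<^sup>2))"
      unfolding pent(1) by (simp add: exp_add[symmetric] power2_eq_square algebra_simps)
    hence "complex_of_real (exp (- (3 * pi * t * (of_int k - 1 / 6)\<^sup>2))) = of_real (exp (- (pi * t / 12))) * of_real q ^ pent k"
      by (metis of_real_mult of_real_power)
    thus "(if even k then 1 else -1) * complex_of_real (exp (- (3 * pi * t * (of_int k - 1 / 6)\<^sup>2))) =
       of_real (exp (- (pi * t / 12))) * ((if even k then 1 else -1) * of_real q ^ pent k)" by simp
  qed
  moreover have "exp (- (pi * t / 12)) ^ 24 = q" by (simp add: q_def exp_of_nat_mult[symmetric])
  ultimately show ?thesis by (simp add: Delta_def nome power_mult_distrib flip: of_real_power)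
qed

lemma Delta_holomorphic: "Delta holomorphic_on {\<tau>. 0 < Im \<tau>}"
  unfolding Delta_def
  using holomorphic_nome_compose[of "\<lambda>q. q * euler_fun q ^ 24"] 
  by (simp add: holomorphic_intros euler_fun_holomorphic)

text \<open>On the imaginary axis this is the 24th power of \<open>eta_inversion\<close>, where t^12
  = (i t)^12.\<close>

lemma Delta_S:
  assumes "0 < Im \<tau>"
  shows "Delta (- 1 / \<tau>) = \<tau> ^ 12 * Delta \<tau>"
proof (rule holomorphic_eq_on_upper_half[OF _ _ _ assms])
  have "(\<lambda>\<tau>. - 1 / \<tau>) holomorphic_on {\<tau>. 0 < Im \<tau>}" by (auto intro!: holomorphic_intros)
  moreover have "(\<lambda>\<tau>. - 1 / \<tau>) ` {\<tau>. 0 < Im \<tau>} \<subseteq> {\<tau>. 0 < Im \<tau>}" using upper_half_inverse by blast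
  ultimately show "(\<lambda>\<tau>. Delta (- 1 / \<tau>)) holomorphic_on {\<tau>. 0 < Im \<tau>}"
    using holomorphic_on_compose_gen[OF _ Delta_holomorphic] by (force simp: o_def)
  show "(\<lambda>\<tau>. \<tau> ^ 12 * Delta \<tau>) holomorphic_on {\<tau>. 0 < Im \<tau>}" by (intro holomorphic_intros Delta_holomorphic)
  fix t :: real assume t: "t > 0"
  have "- 1 / (\<i> * of_real t) = \<i> * of_real (1 / t)" using t by (simp add: field_simps)
  hence "Delta (- 1 / (\<i> * of_real t)) = eta_it (1 / t) ^ 24" using Delta_imaginary[of "1 / t"] t by simp
  also have "\<dots> = of_real (sqrt t ^ 24) * eta_it t ^ 24" unfolding eta_inversion[OF t] by (simp add: power_mult_distrib)
  also have "sqrt t ^ 24 = t ^ 12" using t power_mult[of "sqrt t" 2 12] by simp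
  also have "complex_of_real (t ^ 12) = (\<i> * of_real t) ^ 12" using power_mult[of "\<i>" 4 3] by (simp add: power_mult_distrib)
  finally show "Delta (- 1 / (\<i> * of_real t)) = (\<i> * of_real t) ^ 12 * Delta (\<i> * of_real t)" unfolding Delta_imaginary[OF t] .
qed

text \<open>The zeros of \<open>Delta\<close> are invariant under the modular group, and every orbit
  meets Im \<ge> 1/2, where the constant term of the series dominates.\<close>

lemma euler_fun_nonzero:
  assumes q: "q \<in> ball 0 1"
  shows "euler_fun q \<noteq> 0"
proof (cases "q = 0")
  case True
  thus ?thesis using euler_fun_nonzero_small[of 0] by simp
next
  case False
  then obtain \<tau> where \<tau>: "0 < Im \<tau>" "nome \<tau> = q" using nome_surj q by auto
  have S: "(Delta (- 1 / \<tau>) = 0) = (Delta \<tau> = 0)" if "0 < Im \<tau>" for \<tau>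
    unfolding Delta_S[OF that] using that by auto
  obtain \<tau>' where "(Delta \<tau>' = 0) = (Delta \<tau> = 0)" "1 / 2 \<le> Im \<tau>'"
    by (rule modular_reduction[of "\<lambda>\<tau>. Delta \<tau> = 0", OF _ S \<tau>(1)]) (auto simp: Delta_def nome_plus_1)
  thus ?thesis using euler_fun_nonzero_small[of "nome \<tau>'"] nome_small[of \<tau>'] \<tau>(2)
    by (auto simp: Delta_def nome_nonzero)
qed

text \<open>Since \<open>euler_fun\<close> has no zeros, the quotient by \<open>Delta ^ r\<close> is
  holomorphic on the disc, cusp included, and has weight K - 12 r. This is negative or 2, the cases
  in which there is no nonzero form; weight 0 would leave the constants.\<close>

theorem modular_vanishing:
  assumes F: "F holomorphic_on ball 0 1"
    and S: "\<And>\<tau>. 0 < Im \<tau> \<Longrightarrow> nome (- 1 / \<tau>) ^ r * F (nome (- 1 / \<tau>)) = \<tau> ^ K * (nome \<tau> ^ r * F (nome \<tau>))"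
    and K: "K < 12 * r \<or> K = 12 * r + 2" and q: "q \<in> ball 0 1"
  shows "F q = 0"
proof -
  define g where "g = (\<lambda>q. F q / (euler_fun q ^ 24) ^ r)"
  have g: "g holomorphic_on ball 0 1" unfolding g_def
    by (intro holomorphic_intros F euler_fun_holomorphic) (use euler_fun_nonzero in auto)
  have gD: "nome \<tau> ^ r * F (nome \<tau>) = g (nome \<tau>) * Delta \<tau> ^ r" if "0 < Im \<tau>" for \<tau>
    using euler_fun_nonzero[OF nome_in_ball[OF that]] by (simp add: g_def Delta_def power_mult_distrib)
  have Dnz: "Delta \<tau> \<noteq> 0" if "0 < Im \<tau>" for \<tau>
    using euler_fun_nonzero[OF nome_in_ball[OF that]] by (simp add: Delta_def nome_nonzero)
  have gS: "g (nome (- 1 / \<tau>)) * \<tau> ^ (12 * r) = \<tau> ^ K * g (nome \<tau>)" if \<tau>: "0 < Im \<tau>" for \<tau>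
  proof -
    have "g (nome (- 1 / \<tau>)) * (\<tau> ^ 12 * Delta \<tau>) ^ r = \<tau> ^ K * (g (nome \<tau>) * Delta \<tau> ^ r)"
      using S[OF \<tau>] unfolding gD[OF \<tau>] gD[OF upper_half_inverse[OF \<tau>]] Delta_S[OF \<tau>] .
    thus ?thesis using Dnz[OF \<tau>] by (simp add: power_mult_distrib power_mult)
  qed
  have "g q = 0"
  proof (cases "K = 12 * r + 2")
    case True
    show ?thesis
    proof (rule modular_weight_two[OF g _ q])
      fix \<tau> :: complex assume \<tau>: "0 < Im \<tau>"
      have "g (nome (- 1 / \<tau>)) * \<tau> ^ (12 * r) = (\<tau>\<^sup>2 * g (nome \<tau>)) * \<tau> ^ (12 * r)"
        using gS[OF \<tau>] unfolding True power_add by (simp add: mult_ac)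
      moreover have "\<tau> \<noteq> 0" using \<tau> by auto
      ultimately show "g (nome (- 1 / \<tau>)) = \<tau>\<^sup>2 * g (nome \<tau>)" by simp
    qed
  next
    case False
    define m where "m = 12 * r - K"
    have m: "m > 0" "12 * r = K + m" using False K by (auto simp: m_def)
    have sub: "cball 0 (exp (- pi)) \<subseteq> ball (0::complex) 1"
    proof
      fix z :: complex assume "z \<in> cball 0 (exp (- pi))"
      moreover have "exp (- pi) < 1" by simp
      ultimately have "cmod z < 1" by (simp only: mem_cball dist_0_norm)
      thus "z \<in> ball 0 1" by simp
    qed
    have "compact (g ` cball 0 (exp (- pi)))"
      by (intro compact_continuous_image continuous_on_subset[OF holomorphic_on_imp_continuous_on[OF g] sub]) auto
    then obtain B where B: "\<And>z. z \<in> cball 0 (exp (- pi)) \<Longrightarrow> cmod (g z) \<le> B"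
      using compact_imp_bounded bounded_iff by (metis image_eqI)
    have z: "g (nome \<tau>) = 0" if \<tau>: "0 < Im \<tau>" for \<tau>
    proof (rule modular_negative_weight[of "\<lambda>\<tau>. g (nome \<tau>)", OF holomorphic_nome_compose[OF g] _ _ m(1) _ \<tau>])
      fix \<tau> :: complex assume \<tau>: "0 < Im \<tau>"
      show "g (nome (\<tau> + 1)) = g (nome \<tau>)" by (simp add: nome_plus_1)
      have "\<tau> ^ K * (g (nome (- 1 / \<tau>)) * \<tau> ^ m) = \<tau> ^ K * g (nome \<tau>)"
        using gS[OF \<tau>] unfolding m(2) power_add by (simp add: mult_ac)
      moreover have "\<tau> \<noteq> 0" using \<tau> by auto
      ultimately show "g (nome (- 1 / \<tau>)) * \<tau> ^ m = g (nome \<tau>)" by simp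
    next
      fix \<tau> :: complex assume "1 / 2 \<le> Im \<tau>"
      thus "cmod (g (nome \<tau>)) \<le> B" by (intro B nome_small)
    qed
    have z': "g w = 0" if "w \<in> ball 0 1" "w \<noteq> 0" for w
      using z nome_surj[of w] that by (metis dist_0_norm mem_ball)
    show ?thesis
    proof (cases "q = 0")
      case True
      have "g 0 = 0"
      proof (rule analytic_continuation[OF g open_ball connected_ball, of "ball 0 1 - {0}" 0])
        have "(0::complex) islimpt ball 0 1" by (simp add: islimpt_ball)
        thus "(0::complex) islimpt ball 0 1 - {0}" by (metis islimpt_insert insert_Diff centre_in_ball zero_less_one)
      qed (use z' in auto)
      thus ?thesis using True by simp
    qed (use z' q in auto)
  qed
  thus ?thesis using euler_fun_nonzero[OF q] by (simp add: g_def)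
qed

subsection \<open>Theta functions of even unimodular lattices\<close>

definition lattice_part :: "('n::finite \<Rightarrow> real^'n) \<Rightarrow> 'n set \<Rightarrow> (real^'n) set" where
  "lattice_part b I = range (\<lambda>k :: 'n \<Rightarrow> int. \<Sum>i\<in>I. of_int (k i) *\<^sub>R b i)"

text \<open>The dual is taken inside the span of the partial basis: this is the dual lattice that
  Poisson summation meets at each stage of the induction.\<close>

definition dual_part :: "('n::finite \<Rightarrow> real^'n) \<Rightarrow> 'n set \<Rightarrow> (real^'n) set" where
  "dual_part b I = {w \<in> span (b ` I). \<forall>i\<in>I. w \<bullet> b i \<in> \<int>}"

lemma lattice_part_insert:
  assumes "j \<notin> I"
  shows "lattice_part b (insert j I) = (\<lambda>(k, v). v + of_int k *\<^sub>R b j) ` (UNIV \<times> lattice_part b I)"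
proof (intro equalityI subsetI)
  fix x assume "x \<in> lattice_part b (insert j I)"
  then obtain k :: "'a \<Rightarrow> int" where "x = (\<Sum>i\<in>insert j I. of_int (k i) *\<^sub>R b i)" by (auto simp: lattice_part_def)
  hence "x = (\<lambda>(k, v). v + of_int k *\<^sub>R b j) (k j, \<Sum>i\<in>I. of_int (k i) *\<^sub>R b i)" using assms by (simp add: add.commute)
  thus "x \<in> (\<lambda>(k, v). v + of_int k *\<^sub>R b j) ` (UNIV \<times> lattice_part b I)" unfolding lattice_part_def by blast
next
  fix x assume "x \<in> (\<lambda>(k, v). v + of_int k *\<^sub>R b j) ` (UNIV \<times> lattice_part b I)"
  then obtain l :: int and k :: "'a \<Rightarrow> int" where x: "x = (\<Sum>i\<in>I. of_int (k i) *\<^sub>R b i) + of_int l *\<^sub>R b j"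
    by (auto simp: lattice_part_def)
  have "(\<Sum>i\<in>I. of_int ((k(j := l)) i) *\<^sub>R b i) = (\<Sum>i\<in>I. of_int (k i) *\<^sub>R b i)"
    by (rule sum.cong) (use assms in auto)
  hence "x = (\<Sum>i\<in>insert j I. of_int ((k(j := l)) i) *\<^sub>R b i)" using assms x by (simp add: add.commute)
  thus "x \<in> lattice_part b (insert j I)" unfolding lattice_part_def by blast
qed

text \<open>\<open>c\<close> is the inverse covolume, a product of inverse heights of the basis
  vectors above the span of the earlier ones. It stays anonymous here; for a self-dual lattice the
  formula itself determines it.\<close>

lemma poisson_pair_lattice_part:
  fixes b :: "'n::finite \<Rightarrow> real^'n"
  assumes indep: "\<And>I j. j \<notin> I \<Longrightarrow> b j \<notin> span (b ` I)"
  shows "\<exists>c. poisson_pair (span (b ` I)) (lattice_part b I) (dual_part b I) (\<lambda>t. c * (1 / sqrt t) ^ card I)"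
  using finite[of I]
proof (induction I rule: finite_induct)
  case empty
  show ?case using poisson_pair_0 by (intro exI[of _ 1]) (simp add: lattice_part_def dual_part_def)
next
  case (insert j I)
  then obtain c where P: "poisson_pair (span (b ` I)) (lattice_part b I) (dual_part b I) (\<lambda>t. c * (1 / sqrt t) ^ card I)" by blast
  obtain p e where p: "p \<in> span (b ` I)" and e: "\<And>w. w \<in> span (b ` I) \<Longrightarrow> orthogonal e w" and bj: "b j = p + e"
  proof (rule orthogonal_subspace_decomp_exists[of "b ` I" "b j"])
    fix y z assume a: "y \<in> span (b ` I)" "\<And>w. w \<in> span (b ` I) \<Longrightarrow> orthogonal z w" "b j = y + z"
    show thesis by (rule that[OF a])
  qed
  have e0: "e \<noteq> 0" using indep[OF insert(2)] bj p by auto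
  have ue: "u \<bullet> e = 0" "e \<bullet> u = 0" if "u \<in> span (b ` I)" for u using e[OF that] by (auto simp: orthogonal_def inner_commute)
  let ?E = "e \<bullet> e"
  have E: "?E \<noteq> 0" using e0 by simp
  have S: "{u + r *\<^sub>R e | u r. u \<in> span (b ` I)} = span (b ` insert j I)"
  proof (intro equalityI subsetI)
    fix x assume "x \<in> {u + r *\<^sub>R e | u r. u \<in> span (b ` I)}"
    then obtain u r where x: "x = u + r *\<^sub>R e" "u \<in> span (b ` I)" by blast
    have "x - r *\<^sub>R b j = u - r *\<^sub>R p" by (simp add: x bj algebra_simps)
    also have "\<dots> \<in> span (b ` I)" using x p by (intro span_diff span_scale)
    finally show "x \<in> span (b ` insert j I)" by (auto simp: span_insert)
  next
    fix x assume "x \<in> span (b ` insert j I)"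
    then obtain r where r: "x - r *\<^sub>R b j \<in> span (b ` I)" by (auto simp: span_insert)
    have "x = ((x - r *\<^sub>R b j) + r *\<^sub>R p) + r *\<^sub>R e" by (simp add: bj algebra_simps)
    moreover have "(x - r *\<^sub>R b j) + r *\<^sub>R p \<in> span (b ` I)" using r p by (intro span_add span_scale)
    ultimately show "x \<in> {u + r *\<^sub>R e | u r. u \<in> span (b ` I)}" by blast
  qed
  have M: "(\<lambda>(l, w). w + ((of_int l - w \<bullet> p) / ?E) *\<^sub>R e) ` (UNIV \<times> dual_part b I) = dual_part b (insert j I)"
  proof (intro equalityI subsetI)
    fix x assume "x \<in> (\<lambda>(l, w). w + ((of_int l - w \<bullet> p) / ?E) *\<^sub>R e) ` (UNIV \<times> dual_part b I)"
    then obtain l :: int and w where w: "w \<in> dual_part b I" and x: "x = w + ((of_int l - w \<bullet> p) / ?E) *\<^sub>R e" by auto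
    have ws: "w \<in> span (b ` I)" using w by (simp add: dual_part_def)
    have "x \<in> span (b ` insert j I)" unfolding S[symmetric] x using ws by blast
    moreover have "x \<bullet> b j = of_int l" unfolding x bj using ue[OF ws] ue[OF p] E by (simp add: inner_add_left inner_add_right)
    moreover have "x \<bullet> b i \<in> \<int>" if "i \<in> I" for i
    proof -
      have "b i \<in> span (b ` I)" using that by (intro span_base) auto
      thus ?thesis unfolding x using ue w that by (simp add: inner_add_left dual_part_def)
    qed
    ultimately show "x \<in> dual_part b (insert j I)" by (auto simp: dual_part_def)
  next
    fix x assume x: "x \<in> dual_part b (insert j I)"
    hence "x \<in> span (b ` insert j I)" by (simp add: dual_part_def)
    then obtain u r where xu: "x = u + r *\<^sub>R e" "u \<in> span (b ` I)" unfolding S[symmetric] by blast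
    have "x \<bullet> b j \<in> \<int>" using x by (simp add: dual_part_def)
    then obtain l where l: "x \<bullet> b j = of_int l" by (elim Ints_cases)
    have "x \<bullet> b j = u \<bullet> p + r * ?E" unfolding xu bj using ue[OF xu(2)] ue[OF p] by (simp add: inner_add_left inner_add_right)
    hence r: "r = (of_int l - u \<bullet> p) / ?E" using l E by simp
    have "u \<in> dual_part b I"
    proof -
      have "u \<bullet> b i \<in> \<int>" if "i \<in> I" for i
      proof -
        have bs: "b i \<in> span (b ` I)" using that by (intro span_base) auto
        have "x \<bullet> b i = u \<bullet> b i" unfolding xu using ue[OF bs] by (simp add: inner_add_left)
        thus ?thesis using x that by (metis (lifting) dual_part_def insertI2 mem_Collect_eq)
      qed
      thus ?thesis using xu(2) by (simp add: dual_part_def)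
    qed
    thus "x \<in> (\<lambda>(l, w). w + ((of_int l - w \<bullet> p) / ?E) *\<^sub>R e) ` (UNIV \<times> dual_part b I)"
      unfolding xu(1) r by force
  qed
  have L: "(\<lambda>(k, v). v + of_int k *\<^sub>R (p + e)) ` (UNIV \<times> lattice_part b I) = lattice_part b (insert j I)"
    unfolding lattice_part_insert[OF insert(2)] bj ..
  have C: "c * (1 / sqrt t) ^ card I / sqrt (t * ?E) = c / sqrt ?E * (1 / sqrt t) ^ card (insert j I)" for t
    using insert by (simp add: real_sqrt_mult mult_ac)
  from poisson_pair_step[OF P p e0 ue(1)] show ?case unfolding S M L C by blast
qed

text \<open>What is kept of an even unimodular lattice. Writing the dimension as 8 h makes the
  exponent in \<open>inversion\<close> the integral weight 4 h and removes the root of unity, as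
  i^(4 h) = 1. The wave with direction y generates all moments of the shells.\<close>

locale theta_lattice =
  fixes L :: "'a::euclidean_space set" and h :: nat
  assumes DIM: "DIM('a) = 8 * h"
    and zero: "0 \<in> L" and neg: "v \<in> L \<Longrightarrow> - v \<in> L" and add: "v \<in> L \<Longrightarrow> w \<in> L \<Longrightarrow> v + w \<in> L"
    and even_norm: "v \<in> L \<Longrightarrow> \<exists>m::nat. v \<bullet> v = 2 * real m"
    and dual: "(\<And>v. v \<in> L \<Longrightarrow> w \<bullet> v \<in> \<int>) \<Longrightarrow> w \<in> L"
    and summable: "t > 0 \<Longrightarrow> (\<lambda>v. exp (- (pi * t * (norm v)\<^sup>2))) summable_on L"
    and inversion: "t > 0 \<Longrightarrow> (\<Sum>\<^sub>\<infinity>v\<in>L. of_real (exp (- (pi * t * (norm v)\<^sup>2))) * cis (2 * pi * (y \<bullet> v))) =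
        of_real ((1 / t) ^ (4 * h)) * (\<Sum>\<^sub>\<infinity>w\<in>L. complex_of_real (exp (- (pi * (norm (w - y))\<^sup>2 / t))))"

lemma det_Ints:
  fixes A :: "real^'n^'n"
  assumes "\<And>i j. A $ i $ j \<in> \<int>"
  shows "det A \<in> \<int>"
  unfolding det_def by (intro Ints_sum Ints_mult Ints_prod assms) auto

lemma theta_lattice_unimodular:
  fixes b :: "'n::finite \<Rightarrow> real^'n"
  assumes det: "det (\<chi> i j. b i \<bullet> b j) = 1" and ev: "\<And>v. v \<in> lattice_of b \<Longrightarrow> \<exists>m::int. v \<bullet> v = 2 * of_int m"
    and card: "CARD('n) = 8 * h"
  shows "theta_lattice (lattice_of b) h"
proof -
  let ?L = "lattice_of b"
  have L: "?L = range (\<lambda>k :: 'n \<Rightarrow> int. \<Sum>i\<in>UNIV. of_int (k i) *\<^sub>R b i)" by (auto simp: lattice_of_def)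
  have zero: "0 \<in> ?L" unfolding L by (rule range_eqI[of _ _ "\<lambda>_. 0"]) simp
  have add: "v + w \<in> ?L" if vw: "v \<in> ?L" "w \<in> ?L" for v w
  proof -
    obtain k l :: "'n \<Rightarrow> int" where "v = (\<Sum>i\<in>UNIV. of_int (k i) *\<^sub>R b i)" "w = (\<Sum>i\<in>UNIV. of_int (l i) *\<^sub>R b i)"
      using vw unfolding L by blast
    hence "v + w = (\<Sum>i\<in>UNIV. of_int (k i + l i) *\<^sub>R b i)" by (simp add: sum.distrib scaleR_add_left)
    thus ?thesis unfolding L by - (rule range_eqI)
  qed
  have neg: "- v \<in> ?L" if vL: "v \<in> ?L" for v
  proof -
    obtain k :: "'n \<Rightarrow> int" where "v = (\<Sum>i\<in>UNIV. of_int (k i) *\<^sub>R b i)" using vL unfolding L by blast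
    hence "- v = (\<Sum>i\<in>UNIV. of_int (- k i) *\<^sub>R b i)" by (simp add: sum_negf)
    thus ?thesis unfolding L by - (rule range_eqI)
  qed
  have bL: "b i \<in> ?L" for i
  proof -
    have "b i = (\<Sum>j\<in>{i}. of_int (if j = i then 1 else 0) *\<^sub>R b j)" by simp
    also have "\<dots> = (\<Sum>j\<in>UNIV. of_int (if j = i then 1 else 0) *\<^sub>R b j)" by (rule sum.mono_neutral_left) auto
    finally show ?thesis unfolding L by - (rule range_eqI)
  qed
  have int: "v \<bullet> w \<in> \<int>" if vw: "v \<in> ?L" "w \<in> ?L" for v w
  proof -
    obtain m1 m2 m3 :: int where "(v + w) \<bullet> (v + w) = 2 * of_int m1" "v \<bullet> v = 2 * of_int m2" "w \<bullet> w = 2 * of_int m3"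
      using ev[OF add[OF vw]] ev[OF vw(1)] ev[OF vw(2)] by blast
    hence "v \<bullet> w = of_int (m1 - m2 - m3)" by (simp add: inner_add_left inner_add_right inner_commute)
    thus ?thesis by simp
  qed
  define B where "B = (\<chi> i. b i)"
  have "B ** transpose B = (\<chi> i j. b i \<bullet> b j)"
    by (simp add: B_def matrix_matrix_mult_def transpose_def inner_vec_def vec_eq_iff)
  hence "det B * det B = 1" using det by (metis det_mul det_transpose)
  hence dB: "det B \<noteq> 0" by auto
  hence invB: "invertible B" "invertible (transpose B)" by (simp_all add: invertible_det_nz)
  have orth0: "x = 0" if "\<And>i. b i \<bullet> x = 0" for x
  proof -
    have "B *v x = 0" using that by (simp add: B_def matrix_vector_mult_def vec_eq_iff inner_vec_def)
    thus ?thesis using invB(1) by (metis inj_matrix_vector_mult injD matrix_vector_mult_0_right)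
  qed
  have comb0: "c i = 0" if "(\<Sum>i\<in>UNIV. c i *\<^sub>R b i) = 0" for c :: "'n \<Rightarrow> real" and i
  proof -
    have "transpose B *v (\<chi> i. c i) = (\<Sum>i\<in>UNIV. c i *\<^sub>R b i)"
      by (simp add: B_def matrix_vector_mult_def transpose_def vec_eq_iff mult.commute)
    hence "transpose B *v (\<chi> i. c i) = 0" using that by simp
    hence "(\<chi> i. c i) = 0" using invB(2) by (metis inj_matrix_vector_mult injD matrix_vector_mult_0_right)
    thus ?thesis by (simp add: vec_eq_iff)
  qed
  have spanI: "span (b ` I) \<subseteq> range (\<lambda>c. \<Sum>i\<in>I. c i *\<^sub>R b i)" for I
  proof (rule span_minimal)
    show "b ` I \<subseteq> range (\<lambda>c. \<Sum>i\<in>I. c i *\<^sub>R b i)"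
    proof
      fix x assume "x \<in> b ` I"
      then obtain i where i: "i \<in> I" "x = b i" by blast
      have "x = (\<Sum>j\<in>{i}. (if j = i then 1 else 0) *\<^sub>R b j)" using i by simp
      also have "\<dots> = (\<Sum>j\<in>I. (if j = i then 1 else 0) *\<^sub>R b j)" by (rule sum.mono_neutral_left) (use i in auto)
      finally show "x \<in> range (\<lambda>c. \<Sum>i\<in>I. c i *\<^sub>R b i)" by - (rule range_eqI)
    qed
    show "subspace (range (\<lambda>c. \<Sum>i\<in>I. c i *\<^sub>R b i))"
    proof (rule subspaceI)
      show "0 \<in> range (\<lambda>c. \<Sum>i\<in>I. c i *\<^sub>R b i)" by (rule range_eqI[of _ _ "\<lambda>_. 0"]) simp
      fix x y assume "x \<in> range (\<lambda>c. \<Sum>i\<in>I. c i *\<^sub>R b i)" "y \<in> range (\<lambda>c. \<Sum>i\<in>I. c i *\<^sub>R b i)"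
      then obtain c d where "x = (\<Sum>i\<in>I. c i *\<^sub>R b i)" "y = (\<Sum>i\<in>I. d i *\<^sub>R b i)" by blast
      hence "x + y = (\<Sum>i\<in>I. (c i + d i) *\<^sub>R b i)" by (simp add: sum.distrib scaleR_add_left)
      thus "x + y \<in> range (\<lambda>c. \<Sum>i\<in>I. c i *\<^sub>R b i)" by - (rule range_eqI)
    next
      fix a x assume "x \<in> range (\<lambda>c. \<Sum>i\<in>I. c i *\<^sub>R b i)"
      then obtain c where "x = (\<Sum>i\<in>I. c i *\<^sub>R b i)" by blast
      hence "a *\<^sub>R x = (\<Sum>i\<in>I. (a * c i) *\<^sub>R b i)" by (simp add: scaleR_sum_right)
      thus "a *\<^sub>R x \<in> range (\<lambda>c. \<Sum>i\<in>I. c i *\<^sub>R b i)" by - (rule range_eqI)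
    qed
  qed
  have indep: "b j \<notin> span (b ` I)" if "j \<notin> I" for I j
  proof
    assume "b j \<in> span (b ` I)"
    then obtain c where c: "b j = (\<Sum>i\<in>I. c i *\<^sub>R b i)" using spanI by blast
    define d where "d = (\<lambda>i. if i = j then -1 else if i \<in> I then c i else 0)"
    have "(\<Sum>i\<in>UNIV. d i *\<^sub>R b i) = (\<Sum>i\<in>insert j I. d i *\<^sub>R b i)"
      by (rule sum.mono_neutral_right) (auto simp: d_def)
    also have "\<dots> = - b j + (\<Sum>i\<in>I. d i *\<^sub>R b i)" using that by (simp add: d_def)
    also have "(\<Sum>i\<in>I. d i *\<^sub>R b i) = (\<Sum>i\<in>I. c i *\<^sub>R b i)" by (rule sum.cong) (use that in \<open>auto simp: d_def\<close>)
    finally have "(\<Sum>i\<in>UNIV. d i *\<^sub>R b i) = 0" using c by simp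
    from comb0[OF this, of j] show False by (simp add: d_def)
  qed
  have span: "span (range b) = UNIV"
  proof -
    have "x \<in> span (range b)" for x
    proof -
      obtain y z where yz: "y \<in> span (range b)" "\<And>w. w \<in> span (range b) \<Longrightarrow> orthogonal z w" "x = y + z"
      proof (rule orthogonal_subspace_decomp_exists[of "range b" x])
        fix y z assume a: "y \<in> span (range b)" "\<And>w. w \<in> span (range b) \<Longrightarrow> orthogonal z w" "x = y + z"
        show thesis by (rule that[OF a])
      qed
      have "z = 0"
      proof (rule orth0)
        fix i
        have "orthogonal z (b i)" by (rule yz(2)[OF span_base]) simp
        thus "b i \<bullet> z = 0" by (simp add: orthogonal_def inner_commute)
      qed
      thus ?thesis using yz by simp
    qed
    thus ?thesis by blast
  qed
  have dual: "dual_part b UNIV = ?L"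
  proof (intro equalityI subsetI)
    fix w assume "w \<in> ?L"
    thus "w \<in> dual_part b UNIV" using int bL by (simp add: dual_part_def span)
  next
    fix w assume w: "w \<in> dual_part b UNIV"
    define A where "A = (\<chi> i j. b i \<bullet> b j)"
    define d where "d = (\<chi> i. b i \<bullet> w)"
    \<comment> \<open>Cramer's rule for the Gram matrix: numerators are determinants of integer
      matrices and the denominator is 1, so a dual vector has integer coordinates in the
      basis.\<close>
    define c where "c = (\<chi> k. det (\<chi> i j. if j = k then d $ i else A $ i $ j) / det A)"
    have d: "d $ i \<in> \<int>" for i using w by (simp add: d_def dual_part_def inner_commute)
    have Aint: "A $ i $ j \<in> \<int>" for i j using int bL by (simp add: A_def)
    have c1: "c $ k \<in> \<int>" for k
    proof -
      have "c $ k = det (\<chi> i j. if j = k then d $ i else A $ i $ j)" using det by (simp add: c_def A_def)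
      also have "\<dots> \<in> \<int>" by (rule det_Ints) (use d Aint in auto)
      finally show ?thesis .
    qed
    have "A *v c = d" using cramer[of A c d] det by (simp add: c_def A_def)
    hence Ac: "(\<Sum>j\<in>UNIV. (b i \<bullet> b j) * c $ j) = b i \<bullet> w" for i
      by (simp add: A_def d_def matrix_vector_mult_def vec_eq_iff)
    have "w - (\<Sum>j\<in>UNIV. c $ j *\<^sub>R b j) = 0"
      by (rule orth0) (use Ac in \<open>simp add: inner_diff_right inner_sum_right mult.commute\<close>)
    moreover have "\<forall>j. \<exists>k::int. c $ j = of_int k" using c1 by (meson Ints_cases)
    then obtain k :: "'n \<Rightarrow> int" where "\<And>j. c $ j = of_int (k j)" by metis
    ultimately have "w = (\<Sum>j\<in>UNIV. of_int (k j) *\<^sub>R b j)" by simp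
    thus "w \<in> ?L" unfolding L by - (rule range_eqI)
  qed
  obtain c where P: "poisson_pair (span (range b)) (lattice_part b UNIV) (dual_part b UNIV) (\<lambda>t. c * (1 / sqrt t) ^ CARD('n))"
    using poisson_pair_lattice_part[OF indep, of UNIV] by blast
  have LP: "lattice_part b UNIV = ?L" by (simp add: lattice_part_def L)
  have P: "poisson_pair UNIV ?L ?L (\<lambda>t. c * (1 / sqrt t) ^ CARD('n))" using P unfolding span dual LP .
  have sm: "(\<lambda>v. exp (- (pi * t * (norm (v + s))\<^sup>2))) summable_on ?L" if "t > 0" for t s
    using P that unfolding poisson_pair_def by blast
  have inv: "(\<Sum>\<^sub>\<infinity>v\<in>?L. of_real (exp (- (pi * t * (norm v)\<^sup>2))) * cis (2 * pi * (y \<bullet> v))) =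
           of_real (c * (1 / sqrt t) ^ CARD('n)) * (\<Sum>\<^sub>\<infinity>w\<in>?L. complex_of_real (exp (- (pi * (norm (w - y))\<^sup>2 / t))))"
    if t: "t > 0" for t y
  proof -
    have "(\<Sum>\<^sub>\<infinity>v\<in>?L. of_real (exp (- (pi * t * (norm (v + 0))\<^sup>2))) * cis (2 * pi * (y \<bullet> (v + 0)))) =
           of_real (c * (1 / sqrt t) ^ CARD('n)) * (\<Sum>\<^sub>\<infinity>w\<in>?L. complex_of_real (exp (- (pi * (norm (w - y))\<^sup>2 / t))) * cis (2 * pi * (w \<bullet> 0)))"
      using P t unfolding poisson_pair_def by blast
    thus ?thesis by simp
  qed
  \<comment> \<open>At the self-dual point t = 1 with y = 0 both sides contain the same positive
    sum.\<close>
  have "c = 1"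
  proof -
    define \<theta> where "\<theta> = (\<Sum>\<^sub>\<infinity>v\<in>?L. exp (- (pi * (norm v)\<^sup>2)))"
    have "complex_of_real \<theta> = of_real (c * \<theta>)" using inv[of 1 0] by (simp add: \<theta>_def infsum_of_real)
    hence "\<theta> = c * \<theta>" by (simp only: of_real_eq_iff)
    moreover have "\<theta> > 0"
    proof -
      have "(\<Sum>v\<in>{0::real^'n}. exp (- (pi * (norm v)\<^sup>2))) \<le> \<theta>" unfolding \<theta>_def
        by (rule finite_sum_le_infsum) (use sm[of 1 0] zero in auto)
      thus ?thesis by simp
    qed
    ultimately show ?thesis by simp
  qed
  show ?thesis
  proof
    show "DIM(real^'n) = 8 * h" using card by simp
    show "0 \<in> ?L" by (rule zero)
    show "\<And>v. v \<in> ?L \<Longrightarrow> - v \<in> ?L" by (rule neg)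
    show "\<And>v w. v \<in> ?L \<Longrightarrow> w \<in> ?L \<Longrightarrow> v + w \<in> ?L" by (rule add)
    show "\<exists>m::nat. v \<bullet> v = 2 * real m" if vL: "v \<in> ?L" for v
    proof -
      obtain m :: int where m: "v \<bullet> v = 2 * of_int m" using ev[OF vL] by blast
      hence "m \<ge> 0" using inner_ge_zero[of v] by (simp add: m)
      hence "v \<bullet> v = 2 * real (nat m)" using m by simp
      thus ?thesis by blast
    qed
    show "w \<in> ?L" if "\<And>v. v \<in> ?L \<Longrightarrow> w \<bullet> v \<in> \<int>" for w
      unfolding dual[symmetric] dual_part_def using that bL span by simp
    show "(\<lambda>v. exp (- (pi * t * (norm v)\<^sup>2))) summable_on ?L" if "t > 0" for t using sm[OF that, of 0] by simp
    show "(\<Sum>\<^sub>\<infinity>v\<in>?L. of_real (exp (- (pi * t * (norm v)\<^sup>2))) * cis (2 * pi * (y \<bullet> v))) =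
        of_real ((1 / t) ^ (4 * h)) * (\<Sum>\<^sub>\<infinity>w\<in>?L. complex_of_real (exp (- (pi * (norm (w - y))\<^sup>2 / t))))" if t: "t > 0" for t y
    proof -
      have "(1 / sqrt t) ^ (8 * h) = ((1 / sqrt t)\<^sup>2) ^ (4 * h)" by (simp add: power_mult[symmetric])
      also have "(1 / sqrt t)\<^sup>2 = 1 / t" using t by (simp add: power_divide)
      finally show ?thesis using inv[OF t, of y] by (simp only: \<open>c = 1\<close> card mult_1)
    qed
  qed
qed

text \<open>If B starts in degree d, the factor exp (w s^2) leaves that coefficient alone and first
  shows two degrees later. This correction is the source of the quasimodular term.\<close>

lemma gauss_coeff_compare:
  fixes A B :: "complex \<Rightarrow> complex"
  assumes A: "\<And>s. (\<lambda>j. a j * s ^ j) sums A s" and B: "\<And>s. (\<lambda>j. b j * s ^ j) sums B s"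
    and AB: "\<And>s. A s = c * (exp (w * s\<^sup>2) * B s)" and b0: "\<And>j. j < d \<Longrightarrow> b j = 0"
  shows "a d = c * b d" and "b (d + 1) = 0 \<Longrightarrow> a (d + 2) = c * (b (d + 2) + w * b d)"
proof -
  define e where "e = (\<lambda>n. if even n then w ^ (n div 2) / fact (n div 2) else 0)"
  have E: "(\<lambda>n. e n * s ^ n) sums exp (w * s\<^sup>2)" for s
  proof -
    have "(\<lambda>n. (w * s\<^sup>2) ^ n /\<^sub>R fact n) sums exp (w * s\<^sup>2)" by (rule exp_converges)
    also have "(\<lambda>n. (w * s\<^sup>2) ^ n /\<^sub>R fact n) = (\<lambda>n. e (2 * n) * s ^ (2 * n))"
      by (simp add: e_def power_mult_distrib scaleR_conv_of_real field_simps flip: power_mult)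
    also have "\<dots> sums exp (w * s\<^sup>2) \<longleftrightarrow> (\<lambda>n. e n * s ^ n) sums exp (w * s\<^sup>2)"
      by (rule sums_mono_reindex[where g = "\<lambda>n. 2 * n", unfolded o_def])
         (auto simp: strict_mono_def e_def elim!: evenE)
    finally show ?thesis .
  qed
  have fA: "A has_fps_expansion Abs_fps a" by (rule has_fps_expansionI) (use A in simp)
  have fB: "B has_fps_expansion Abs_fps b" by (rule has_fps_expansionI) (use B in simp)
  have fE: "(\<lambda>s. exp (w * s\<^sup>2)) has_fps_expansion Abs_fps e" by (rule has_fps_expansionI) (use E in simp)
  have "A has_fps_expansion fps_const c * (Abs_fps e * Abs_fps b)"
    unfolding AB[abs_def] by (intro has_fps_expansion_mult has_fps_expansion_const fE fB)
  hence eq: "Abs_fps a = fps_const c * (Abs_fps e * Abs_fps b)" using fA fps_expansion_unique_complex by blast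
  have nth: "a n = c * (\<Sum>i=0..n. e i * b (n - i))" for n
    using arg_cong[OF eq, of "\<lambda>F. fps_nth F n"] by (simp add: fps_mult_nth[of "Abs_fps e"])
  have "(\<Sum>i=0..d. e i * b (d - i)) = (\<Sum>i\<in>{0}. e i * b (d - i))"
    by (rule sum.mono_neutral_right) (use b0 in auto)
  thus "a d = c * b d" unfolding nth[of d] by (simp add: e_def)
  assume b1: "b (d + 1) = 0"
  have "(\<Sum>i=0..d+2. e i * b (d + 2 - i)) = (\<Sum>i\<in>{0, 2}. e i * b (d + 2 - i))"
  proof (rule sum.mono_neutral_right)
    show "\<forall>i\<in>{0..d + 2} - {0, 2}. e i * b (d + 2 - i) = 0"
    proof
      fix i assume i: "i \<in> {0..d + 2} - {0, 2}"
      show "e i * b (d + 2 - i) = 0"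
      proof (cases "i = 1")
        case False
        hence "d + 2 - i < d \<or> d + 2 - i = d + 1" using i by auto
        thus ?thesis using b0 b1 by auto
      qed (simp add: e_def)
    qed
  qed auto
  thus "a (d + 2) = c * (b (d + 2) + w * b d)" unfolding nth[of "d + 2"] by (simp add: e_def)
qed

lemma everywhere_sums_holomorphic:
  assumes "\<And>s. (\<lambda>j. a j * s ^ j) sums A s"
  shows "A holomorphic_on UNIV"
proof -
  have "A field_differentiable at z" for z
  proof -
    have "A holomorphic_on ball 0 (cmod z + 1)"
      by (rule power_series_holomorphic[where a = a]) (use assms in simp)
    thus ?thesis by (rule holomorphic_on_imp_differentiable_at) auto
  qed
  thus ?thesis by (simp add: holomorphic_on_def field_differentiable_at_within)
qed

text \<open>Divides off q^r to reach \<open>modular_vanishing\<close>, and returns to coefficients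
  by uniqueness of power series.\<close>

lemma modular_coeffs_zero:
  assumes ps: "\<And>q. q \<in> ball 0 1 \<Longrightarrow> (\<lambda>m. a m * q ^ m) sums P q" and low: "\<And>m. m < r \<Longrightarrow> a m = 0"
    and S: "\<And>\<tau>. 0 < Im \<tau> \<Longrightarrow> P (nome (- 1 / \<tau>)) = \<tau> ^ K * P (nome \<tau>)"
    and K: "K < 12 * r \<or> K = 12 * r + 2"
  shows "a m = 0"
proof -
  define F where "F = (\<lambda>q. \<Sum>m. a (m + r) * q ^ m)"
  have sF: "(\<lambda>m. a (m + r) * q ^ m) sums F q" and PF: "P q = q ^ r * F q" if q: "q \<in> ball 0 1" for q
  proof -
    have "(\<lambda>m. a (m + r) * q ^ (m + r)) sums (P q - (\<Sum>m<r. a m * q ^ m))"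
      using ps[OF q] by (rule sums_split_initial_segment)
    also have "(\<Sum>m<r. a m * q ^ m) = 0" using low by simp
    finally have s: "(\<lambda>m. q ^ r * (a (m + r) * q ^ m)) sums P q" by (simp add: power_add mult_ac)
    have "summable (\<lambda>m. a (m + r) * q ^ m)"
    proof (cases "q = 0")
      case True
      have "summable (\<lambda>m. a (m + r) * 0 ^ m)" by (rule summable_finite[of "{0}"]) (auto simp: power_0_left)
      thus ?thesis using True by simp
    next
      case False
      thus ?thesis using sums_summable[OF s] summable_cmult_iff[of "q ^ r"] by simp
    qed
    thus sF: "(\<lambda>m. a (m + r) * q ^ m) sums F q" unfolding F_def by (rule summable_sums)
    from sums_mult[OF sF, of "q ^ r"] s show "P q = q ^ r * F q" by (rule sums_unique2[rotated])
  qed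
  have F: "F holomorphic_on ball 0 1"
    by (rule power_series_holomorphic[where a = "\<lambda>m. a (m + r)"]) (use sF in simp)
  have F0: "F q = 0" if q: "q \<in> ball 0 1" for q
  proof (rule modular_vanishing[OF F _ K q])
    fix \<tau> :: complex assume \<tau>: "0 < Im \<tau>"
    show "nome (- 1 / \<tau>) ^ r * F (nome (- 1 / \<tau>)) = \<tau> ^ K * (nome \<tau> ^ r * F (nome \<tau>))"
      using S[OF \<tau>] PF[OF nome_in_ball[OF \<tau>]] PF[OF nome_in_ball[OF upper_half_inverse[OF \<tau>]]] by simp
  qed
  have "(\<lambda>_. 0) has_fps_expansion Abs_fps a"
  proof (rule has_fps_expansionI)
    have "\<forall>\<^sub>F q in nhds 0. q \<in> ball (0::complex) 1" by (rule eventually_nhds_in_open) auto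
    thus "\<forall>\<^sub>F q in nhds 0. (\<lambda>n. fps_nth (Abs_fps a) n * q ^ n) sums (0::complex)"
      by eventually_elim (use ps PF F0 in force)
  qed
  moreover have "(\<lambda>_::complex. 0) has_fps_expansion 0" by (rule has_fps_expansion_0)
  ultimately have "Abs_fps a = 0" by (rule fps_expansion_unique_complex)
  thus ?thesis by (metis fps_nth_Abs_fps fps_zero_nth)
qed

section \<open>Plane waves, moments and their transformation under inversion\<close>

context theta_lattice
begin

text \<open>The exponent of q in the theta series, where a vector of norm 2 m contributes to
  q^m.\<close>

definition half_norm :: "'a \<Rightarrow> nat" where "half_norm v = nat \<lfloor>(v \<bullet> v) / 2\<rfloor>"

definition shell :: "nat \<Rightarrow> 'a set" where "shell m = {v \<in> L. v \<bullet> v = 2 * real m}"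

lemma half_norm: "v \<in> L \<Longrightarrow> v \<bullet> v = 2 * real (half_norm v)"
  using even_norm[of v] by (auto simp: half_norm_def)

lemma shell_ht: "{v \<in> L. half_norm v = m} = shell m"
  using half_norm by (auto simp: shell_def)

definition e :: "real \<Rightarrow> 'a \<Rightarrow> real" where "e t v = exp (- (pi * t * (norm v)\<^sup>2))"

lemma e_pos: "e t v > 0" by (simp add: e_def)

lemma e_ht: "v \<in> L \<Longrightarrow> e t v = exp (- 2 * pi * t) ^ half_norm v"
  using half_norm[of v] by (simp add: e_def power2_norm_eq_inner exp_of_nat_mult[symmetric] mult_ac)

text \<open>All vectors of a shell carry the same positive weight in a convergent Gaussian
  sum.\<close>

lemma finite_shell: "finite (shell m)"
proof (rule ccontr)
  assume inf: "infinite (shell m)"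
  define c where "c = exp (- (pi * 2 * real m))"
  have c: "c > 0" by (simp add: c_def)
  have ev: "e 1 v = c" if "v \<in> shell m" for v using that by (simp add: e_def c_def shell_def power2_norm_eq_inner mult_ac)
  have s: "e 1 summable_on shell m"
    by (rule summable_on_subset_banach[of _ L]) (use summable[of 1] in \<open>auto simp: e_def[abs_def] shell_def\<close>)
  obtain n :: nat where n: "infsum (e 1) (shell m) < real n * c" using c reals_Archimedean3 by blast
  obtain F where F: "F \<subseteq> shell m" "finite F" "card F = n" using infinite_arbitrarily_large[OF inf] by blast
  have "real n * c = (\<Sum>v\<in>F. e 1 v)" using F ev by (simp add: subset_iff)
  also have "\<dots> \<le> infsum (e 1) (shell m)" using finite_sum_le_infsum[OF s F(2,1)] e_pos by (simp add: less_imp_le)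
  finally show False using n by simp
qed

text \<open>Completing the square trades half of the Gaussian decay for the exponential
  factor.\<close>

lemma exp_weight_summable:
  assumes t: "t > 0"
  shows "(\<lambda>v. e t v * exp (a * norm v)) summable_on L"
proof (rule summable_on_comparison_test)
  show "(\<lambda>v. exp (a\<^sup>2 / (2 * pi * t)) * exp (- (pi * (t / 2) * (norm v)\<^sup>2))) summable_on L"
    by (intro summable_on_cmult_right summable) (use t in simp)
  show "e t v * exp (a * norm v) \<le> exp (a\<^sup>2 / (2 * pi * t)) * exp (- (pi * (t / 2) * (norm v)\<^sup>2))" for v
  proof -
    have "0 \<le> pi * t / 2 * (norm v - a / (pi * t))\<^sup>2" using t by simp
    also have "\<dots> = pi * t / 2 * (norm v)\<^sup>2 - a * norm v + a\<^sup>2 / (2 * pi * t)"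
      using t by (simp add: power2_eq_square field_simps)
    finally have "- (pi * t * (norm v)\<^sup>2) + a * norm v \<le> a\<^sup>2 / (2 * pi * t) + - (pi * (t / 2) * (norm v)\<^sup>2)"
      by (simp add: algebra_simps)
    thus ?thesis by (simp add: e_def exp_add[symmetric])
  qed
qed (simp add: e_def)

text \<open>The parameter z is complex because inversion exchanges the oscillating wave (imaginary
  z) with a real exponential.\<close>

definition theta_wave :: "real \<Rightarrow> 'a \<Rightarrow> complex \<Rightarrow> complex" where
  "theta_wave t x z = (\<Sum>\<^sub>\<infinity>v\<in>L. of_real (e t v) * exp (z * of_real (x \<bullet> v)))"

definition theta_moment :: "nat \<Rightarrow> real \<Rightarrow> 'a \<Rightarrow> complex" where
  "theta_moment j t x = (\<Sum>\<^sub>\<infinity>v\<in>L. of_real (e t v * (x \<bullet> v) ^ j))"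

lemma inner_le: "norm x = 1 \<Longrightarrow> \<bar>x \<bullet> v\<bar> \<le> norm v" for x v :: 'a
  using Cauchy_Schwarz_ineq2[of x v] by simp

lemma power_le_fact_exp: "(y::real) \<ge> 0 \<Longrightarrow> y ^ j \<le> fact j * exp y"
proof -
  assume y: "y \<ge> 0"
  have "(\<lambda>n. y ^ n /\<^sub>R fact n) sums exp y" by (rule exp_converges)
  hence "(\<Sum>n\<in>{j}. y ^ n /\<^sub>R fact n) \<le> exp y"
    using sum_le_suminf[of "\<lambda>n. y ^ n /\<^sub>R fact n" "{j}"] y by (simp add: sums_iff)
  thus ?thesis by (simp add: field_simps)
qed

lemma theta_moment_summable:
  assumes t: "t > 0" and x: "norm x = 1"
  shows "(\<lambda>v. norm (complex_of_real (e t v * (x \<bullet> v) ^ j))) summable_on L"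
proof (rule summable_on_comparison_test)
  show "(\<lambda>v. fact j * (e t v * exp (1 * norm v))) summable_on L"
    by (intro summable_on_cmult_right exp_weight_summable t)
  show "norm (complex_of_real (e t v * (x \<bullet> v) ^ j)) \<le> fact j * (e t v * exp (1 * norm v))" for v
  proof -
    have "\<bar>x \<bullet> v\<bar> ^ j \<le> fact j * exp (norm v)"
      using power_mono[OF inner_le[OF x, of v], of j] power_le_fact_exp[of "norm v" j] by simp
    hence "e t v * \<bar>x \<bullet> v\<bar> ^ j \<le> e t v * (fact j * exp (norm v))" using e_pos by (intro mult_left_mono) (auto simp: less_imp_le)
    thus ?thesis using e_pos[of t v] by (simp add: norm_mult norm_power mult_ac)
  qed
qed simp

lemma theta_wave_sums:
  assumes t: "t > 0" and x: "norm x = 1"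
  shows "(\<lambda>j. theta_moment j t x / fact j * z ^ j) sums theta_wave t x z"
proof -
  define T where "T = (\<lambda>v j. complex_of_real (e t v) * ((z * of_real (x \<bullet> v)) ^ j / fact j))"
  have ex: "((\<lambda>j. w ^ j / fact j) has_sum exp w) UNIV" "((\<lambda>j. norm (w ^ j / fact j)) has_sum exp (norm w)) UNIV" for w :: complex
  proof -
    have 1: "(\<lambda>n. w ^ n / fact n) sums exp w" using exp_converges[of w] by (simp add: scaleR_conv_of_real field_simps)
    have 2: "(\<lambda>n. norm (w ^ n / fact n)) sums exp (norm w)"
      using exp_converges[of "norm w"] by (simp add: norm_power norm_divide field_simps)
    show "((\<lambda>j. w ^ j / fact j) has_sum exp w) UNIV" by (rule norm_summable_imp_has_sum[OF sums_summable[OF 2] 1])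
    show "((\<lambda>j. norm (w ^ j / fact j)) has_sum exp (norm w)) UNIV"
      by (rule sums_nonneg_imp_has_sum[OF 2]) simp
  qed
  have inner: "(T v has_sum of_real (e t v) * exp (z * of_real (x \<bullet> v))) UNIV" for v
    unfolding T_def by (intro has_sum_cmult_right ex)
  have innern: "((\<lambda>j. norm (T v j)) has_sum e t v * exp (norm z * \<bar>x \<bullet> v\<bar>)) UNIV" for v
  proof -
    have "((\<lambda>j. e t v * norm ((z * of_real (x \<bullet> v)) ^ j / fact j)) has_sum e t v * exp (norm (z * complex_of_real (x \<bullet> v)))) UNIV"
      by (intro has_sum_cmult_right ex)
    thus ?thesis using e_pos[of t v] by (simp add: T_def norm_mult norm_divide norm_power)
  qed
  have sw: "(\<lambda>v. e t v * exp (norm z * \<bar>x \<bullet> v\<bar>)) summable_on L"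
  proof (rule summable_on_comparison_test[OF exp_weight_summable[OF t, of "norm z"]])
    show "e t v * exp (norm z * \<bar>x \<bullet> v\<bar>) \<le> e t v * exp (norm z * norm v)" for v
      using e_pos[of t v] inner_le[OF x] by (intro mult_left_mono) (auto intro: mult_left_mono)
  qed (use e_pos in \<open>auto simp: less_imp_le\<close>)
  have "(\<lambda>p. norm (case p of (v, j) \<Rightarrow> T v j)) summable_on L \<times> UNIV"
  proof (subst Infinite_Sum.abs_summable_on_Sigma_iff, intro conjI ballI)
    fix v
    show "(\<lambda>j. norm (case (v, j) of (v, j) \<Rightarrow> T v j)) summable_on UNIV" using innern[of v] by (auto simp: summable_on_def)
  next
    have "(\<Sum>\<^sub>\<infinity>j. norm (case (v, j) of (v, j) \<Rightarrow> T v j)) = e t v * exp (norm z * \<bar>x \<bullet> v\<bar>)" for v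
      using infsumI[OF innern[of v]] by simp
    thus "(\<lambda>v. norm (\<Sum>\<^sub>\<infinity>j. norm (case (v, j) of (v, j) \<Rightarrow> T v j))) summable_on L"
      using sw by (simp add: abs_mult abs_of_pos[OF e_pos])
  qed
  hence sT: "(\<lambda>(v, j). T v j) summable_on L \<times> UNIV" by (rule abs_summable_summable)
  define S where "S = infsum (\<lambda>(v, j). T v j) (L \<times> UNIV)"
  have hs: "((\<lambda>(v, j). T v j) has_sum S) (L \<times> UNIV)" unfolding S_def using sT by (rule has_sum_infsum)
  have "((\<lambda>v. of_real (e t v) * exp (z * of_real (x \<bullet> v))) has_sum S) L"
    by (rule has_sum_SigmaD[OF hs]) (use inner in simp)
  hence S: "theta_wave t x z = S" unfolding theta_wave_def by (rule infsumI)
  have "((\<lambda>(j, v). T v j) has_sum S) (UNIV \<times> L) \<longleftrightarrow> ((\<lambda>(v, j). T v j) has_sum S) (L \<times> UNIV)"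
    by (rule has_sum_reindex_bij_witness[of _ prod.swap prod.swap]) auto
  hence "((\<lambda>(j, v). T v j) has_sum S) (UNIV \<times> L)" using hs by simp
  hence "((\<lambda>j. theta_moment j t x / fact j * z ^ j) has_sum S) UNIV"
  proof (rule has_sum_SigmaD)
    fix j :: nat
    have "((\<lambda>v. complex_of_real (e t v * (x \<bullet> v) ^ j)) has_sum theta_moment j t x) L"
      unfolding theta_moment_def by (rule has_sum_infsum[OF abs_summable_summable[OF theta_moment_summable[OF t x]]])
    hence "((\<lambda>v. z ^ j / fact j * complex_of_real (e t v * (x \<bullet> v) ^ j)) has_sum (z ^ j / fact j * theta_moment j t x)) L"
      by (rule has_sum_cmult_right)
    thus "((\<lambda>v. case (j, v) of (j, v) \<Rightarrow> T v j) has_sum theta_moment j t x / fact j * z ^ j) L"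
      by (simp add: T_def power_mult_distrib mult_ac)
  qed
  thus ?thesis unfolding S by (rule has_sum_imp_sums)
qed

text \<open>Expanding |w - s x|^2 splits the shifted Gaussian into exp (- pi s^2 / t), the unshifted
  Gaussian, and a real exponential in x.w, which is again a wave.\<close>

lemma theta_wave_inversion_real:
  assumes t: "t > 0" and x: "norm x = 1"
  shows "theta_wave t x (2 * of_real pi * \<i> * of_real s) =
      of_real ((1 / t) ^ (4 * h)) * (exp (of_real (- pi / t) * (of_real s)\<^sup>2) * theta_wave (1 / t) x (of_real (2 * pi / t) * of_real s))"
proof -
  have "theta_wave t x (2 * of_real pi * \<i> * of_real s) = (\<Sum>\<^sub>\<infinity>v\<in>L. of_real (e t v) * cis (2 * pi * ((s *\<^sub>R x) \<bullet> v)))"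
    by (simp add: theta_wave_def cis_conv_exp mult_ac)
  also have "\<dots> = of_real ((1 / t) ^ (4 * h)) * (\<Sum>\<^sub>\<infinity>w\<in>L. complex_of_real (exp (- (pi * (norm (w - s *\<^sub>R x))\<^sup>2 / t))))"
    unfolding e_def by (rule inversion[OF t])
  also have "(\<Sum>\<^sub>\<infinity>w\<in>L. complex_of_real (exp (- (pi * (norm (w - s *\<^sub>R x))\<^sup>2 / t)))) =
     (\<Sum>\<^sub>\<infinity>w\<in>L. exp (of_real (- pi / t) * (of_real s)\<^sup>2) * (of_real (e (1 / t) w) * exp (of_real (2 * pi / t) * of_real s * of_real (x \<bullet> w))))"
  proof (rule infsum_cong)
    fix w
    have "x \<bullet> x = 1" using x by (simp add: norm_eq_1)
    hence "(norm (w - s *\<^sub>R x))\<^sup>2 = (norm w)\<^sup>2 - 2 * s * (x \<bullet> w) + s\<^sup>2"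
      by (simp only: power2_norm_eq_inner inner_diff_left inner_diff_right inner_scaleR_left inner_scaleR_right)
         (simp add: inner_commute power2_eq_square algebra_simps)
    hence "- (pi * (norm (w - s *\<^sub>R x))\<^sup>2 / t) = - pi / t * s\<^sup>2 + (- (pi * (1 / t) * (norm w)\<^sup>2) + 2 * pi / t * s * (x \<bullet> w))"
      using t by (simp only:) (simp add: field_simps)
    hence "exp (- (pi * (norm (w - s *\<^sub>R x))\<^sup>2 / t)) = exp (- pi / t * s\<^sup>2) * (e (1 / t) w * exp (2 * pi / t * s * (x \<bullet> w)))"
      by (simp only: e_def exp_add)
    show "complex_of_real (exp (- (pi * (norm (w - s *\<^sub>R x))\<^sup>2 / t))) =
       exp (of_real (- pi / t) * (of_real s)\<^sup>2) * (of_real (e (1 / t) w) * exp (of_real (2 * pi / t) * of_real s * of_real (x \<bullet> w)))"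
    proof -
      have "exp (of_real (- pi / t) * (of_real s)\<^sup>2) = complex_of_real (exp (- pi / t * s\<^sup>2))"
        by (simp only: of_real_mult[symmetric] of_real_power[symmetric] exp_of_real)
      moreover have "exp (of_real (2 * pi / t) * of_real s * of_real (x \<bullet> w)) = complex_of_real (exp (2 * pi / t * s * (x \<bullet> w)))"
        by (simp only: of_real_mult[symmetric] exp_of_real)
      ultimately show ?thesis
        using \<open>exp (- (pi * (norm (w - s *\<^sub>R x))\<^sup>2 / t)) = _\<close> by (simp only: of_real_mult)
    qed
  qed
  also have "\<dots> = exp (of_real (- pi / t) * (of_real s)\<^sup>2) * theta_wave (1 / t) x (of_real (2 * pi / t) * of_real s)"
    unfolding theta_wave_def by (rule infsum_cmult_right')
  finally show ?thesis .
qed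

text \<open>Both sides are entire in s and agree on the real axis; the complex version is what
  allows Taylor coefficients to be compared.\<close>

lemma theta_wave_inversion:
  assumes t: "t > 0" and x: "norm x = 1"
  shows "theta_wave t x (2 * of_real pi * \<i> * s) =
      of_real ((1 / t) ^ (4 * h)) * (exp (of_real (- pi / t) * s\<^sup>2) * theta_wave (1 / t) x (of_real (2 * pi / t) * s))"
proof -
  have hol: "theta_wave t x holomorphic_on UNIV" if "t > 0" for t
    by (rule everywhere_sums_holomorphic[OF theta_wave_sums[OF that x]])
  have hol2: "(\<lambda>s. theta_wave t x (c * s)) holomorphic_on UNIV" if "t > 0" for t c
    using holomorphic_on_compose_gen[of "\<lambda>s. c * s" UNIV "theta_wave t x" UNIV] hol[OF that] by (simp add: o_def holomorphic_intros)
  let ?D = "\<lambda>s. theta_wave t x (2 * of_real pi * \<i> * s) -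
      of_real ((1 / t) ^ (4 * h)) * (exp (of_real (- pi / t) * s\<^sup>2) * theta_wave (1 / t) x (of_real (2 * pi / t) * s))"
  have D: "?D holomorphic_on UNIV" by (intro holomorphic_intros hol2) (use t in auto)
  have lim: "(0::complex) islimpt \<real>"
  proof (rule islimptI)
    fix T :: "complex set" assume "0 \<in> T" "open T"
    then obtain d where d: "d > 0" "ball 0 d \<subseteq> T" using open_contains_ball by blast
    have "complex_of_real (d / 2) \<in> T" using d by (intro subsetD[OF d(2)]) simp
    thus "\<exists>y\<in>\<real>. y \<in> T \<and> y \<noteq> 0" using d(1) by (intro bexI[of _ "complex_of_real (d / 2)"]) auto
  qed
  have "?D s = 0"
    by (rule analytic_continuation[OF D open_UNIV connected_UNIV subset_UNIV UNIV_I lim])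
       (use theta_wave_inversion_real[OF t x] in \<open>auto elim!: Reals_cases\<close>)
  thus ?thesis by simp
qed

text \<open>Subtracting a second direction plays the part of projecting to harmonic polynomials:
  contributions that depend only on |x| cancel.\<close>

definition moment_diff :: "'a \<Rightarrow> 'a \<Rightarrow> nat \<Rightarrow> real \<Rightarrow> complex" where
  "moment_diff x x' j t = theta_moment j t x - theta_moment j t x'"

text \<open>Taylor coefficients of the inversion formula for two directions, subtracted. In the
  first degree d that survives, the powers of t and of i combine, by i^(4 h) = 1, to the law of
  weight 4 h + d at \<tau> = i t. In degree d + 2 the quadratic term of the Gaussian factor adds a
  multiple of the moment of degree d.\<close>

lemma moment_diff_transform:
  assumes t: "t > 0" and x: "norm x = 1" "norm x' = 1" and zero: "\<And>j t. j < d \<Longrightarrow> t > 0 \<Longrightarrow> moment_diff x x' j t = 0"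
  shows "moment_diff x x' d (1 / t) = (\<i> * of_real t) ^ (4 * h + d) * moment_diff x x' d t"
    and "(\<And>t. t > 0 \<Longrightarrow> moment_diff x x' (d + 1) t = 0) \<Longrightarrow>
      moment_diff x x' (d + 2) (1 / t) = (\<i> * of_real t) ^ (4 * h + d + 2) * moment_diff x x' (d + 2) t +
        of_real (real (d + 2) * real (d + 1) / (4 * pi) * t) * moment_diff x x' d (1 / t)"
proof -
  let ?f = "moment_diff x x'"
  define a where "a = (\<lambda>j. ?f j t / fact j * (2 * of_real pi * \<i>) ^ j)"
  define b where "b = (\<lambda>j. ?f j (1 / t) / fact j * (of_real (2 * pi / t)) ^ j)"
  define A where "A = (\<lambda>s. theta_wave t x (2 * of_real pi * \<i> * s) - theta_wave t x' (2 * of_real pi * \<i> * s))"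
  define B where "B = (\<lambda>s. theta_wave (1 / t) x (of_real (2 * pi / t) * s) - theta_wave (1 / t) x' (of_real (2 * pi / t) * s))"
  have t': "1 / t > 0" using t by simp
  have As: "(\<lambda>j. a j * s ^ j) sums A s" for s
    using sums_diff[OF theta_wave_sums[OF t x(1), of "2 * of_real pi * \<i> * s"] theta_wave_sums[OF t x(2), of "2 * of_real pi * \<i> * s"]]
    by (simp add: a_def A_def moment_diff_def power_mult_distrib diff_divide_distrib algebra_simps)
  have Bs: "(\<lambda>j. b j * s ^ j) sums B s" for s
    using sums_diff[OF theta_wave_sums[OF t' x(1), of "of_real (2 * pi / t) * s"] theta_wave_sums[OF t' x(2), of "of_real (2 * pi / t) * s"]]
    unfolding b_def B_def moment_diff_def power_mult_distrib diff_divide_distrib left_diff_distrib mult.assoc .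
  have AB: "A s = of_real ((1 / t) ^ (4 * h)) * (exp (of_real (- pi / t) * s\<^sup>2) * B s)" for s
    unfolding A_def B_def theta_wave_inversion[OF t x(1)] theta_wave_inversion[OF t x(2)] by (simp only: right_diff_distrib)
  have b0: "b j = 0" if "j < d" for j using zero[OF that t'] by (simp add: b_def)
  have tn: "complex_of_real t \<noteq> 0" using t by simp
  have "a d = of_real ((1 / t) ^ (4 * h)) * b d" by (rule gauss_coeff_compare(1)[OF As Bs AB b0])
  hence E1: "of_real t ^ (4 * h + d) * (a d * fact d / (2 * of_real pi) ^ d) = ?f d (1 / t)"
    using tn by (simp add: b_def power_add power_divide power_mult_distrib)
  have E2: "a d * fact d / (2 * of_real pi) ^ d = \<i> ^ d * ?f d t" by (simp add: a_def power_mult_distrib)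
  have i4: "\<i> ^ (4 * h) = 1" by (simp add: power_mult)
  show "?f d (1 / t) = (\<i> * of_real t) ^ (4 * h + d) * ?f d t"
    using E1[unfolded E2, symmetric] i4 by (simp add: power_mult_distrib power_add mult_ac)
  assume z1: "\<And>t. t > 0 \<Longrightarrow> moment_diff x x' (d + 1) t = 0"
  have b1: "b (d + 1) = 0" using z1[OF t'] by (simp add: b_def)
  have "a (d + 2) = of_real ((1 / t) ^ (4 * h)) * (b (d + 2) + of_real (- pi / t) * b d)"
    by (rule gauss_coeff_compare(2)[OF As Bs AB b0 b1])
  hence E3: "of_real t ^ (4 * h + d + 2) * (a (d + 2) * fact (d + 2) / (2 * of_real pi) ^ (d + 2)) =
     of_real t ^ (d + 2) * ((b (d + 2) + of_real (- pi / t) * b d) * fact (d + 2) / (2 * of_real pi) ^ (d + 2))"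
    using tn by (simp add: power_add power_divide)
  have E4: "a (d + 2) * fact (d + 2) / (2 * of_real pi) ^ (d + 2) = \<i> ^ (d + 2) * ?f (d + 2) t"
  proof -
    have gen: "x / F * (u * v) * F / u = v * x" if "F \<noteq> 0" "u \<noteq> 0" for x F u v :: complex using that by simp
    show ?thesis unfolding a_def power_mult_distrib[of "2 * of_real pi" "\<i>"] by (rule gen, rule fact_nonzero, simp)
  qed
  have E5: "of_real t ^ (d + 2) * ((b (d + 2) + of_real (- pi / t) * b d) * fact (d + 2) / (2 * of_real pi) ^ (d + 2)) =
     ?f (d + 2) (1 / t) - of_real (real (d + 2) * real (d + 1) / (4 * pi) * t) * ?f d (1 / t)"
  proof -
    define u where "u = (2 * complex_of_real pi) ^ d"
    have u: "u \<noteq> 0" by (simp add: u_def)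
    have pn: "complex_of_real pi \<noteq> 0" by simp
    have bb: "b j = ?f j (1 / t) / fact j * ((2 * of_real pi) ^ j / of_real t ^ j)" for j
      by (simp add: b_def power_divide)
    have gen: "T * (x / F * (u / T) * F / u) = x" if "F \<noteq> 0" "u \<noteq> 0" "T \<noteq> 0" for x F u T :: complex
      using that by simp
    have 1: "of_real t ^ (d + 2) * (b (d + 2) * fact (d + 2) / (2 * of_real pi) ^ (d + 2)) = ?f (d + 2) (1 / t)"
      unfolding bb by (rule gen, rule fact_nonzero, simp, use tn in simp)
    have gen2: "(T * t\<^sup>2) * ((- p / t) * (x / F * (u / T)) * (n * F) / (u * (2 * p)\<^sup>2)) = - (n / (4 * p) * t * x)"
      if "F \<noteq> 0" "u \<noteq> 0" "T \<noteq> 0" "t \<noteq> 0" "p \<noteq> 0" for x F u T t p n :: complex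
      using that by (simp add: field_simps power2_eq_square)
    define n where "n = complex_of_real (real (d + 2) * real (d + 1))"
    have "fact (d + 2) = (of_nat ((d + 2) * (d + 1)) * fact d :: complex)" by (simp add: algebra_simps)
    hence fc: "fact (d + 2) = n * fact d" by (simp only: n_def of_nat_mult of_real_mult of_real_of_nat_eq)
    have 2: "of_real t ^ (d + 2) * (of_real (- pi / t) * b d * fact (d + 2) / (2 * of_real pi) ^ (d + 2)) =
        - (of_real (real (d + 2) * real (d + 1) / (4 * pi) * t) * ?f d (1 / t))"
    proof -
      have 3: "of_real (- pi / t) = - complex_of_real pi / of_real t" by simp
      have 4: "complex_of_real (real (d + 2) * real (d + 1) / (4 * pi) * t) = n / (4 * of_real pi) * of_real t"
        by (simp only: n_def of_real_mult of_real_divide of_real_numeral)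
      show ?thesis unfolding bb fc power_add 3 4
        by (rule gen2[OF fact_nonzero u[unfolded u_def] power_not_zero[OF tn] tn pn])
    qed
    have gen3: "T * ((X + Y) * F / u) = T * (X * F / u) + T * (Y * F / u)" for T X Y F u :: complex
      by (simp add: distrib_right distrib_left add_divide_distrib)
    show ?thesis unfolding gen3 1 2 by simp
  qed
  have "of_real t ^ (4 * h + d + 2) * (\<i> ^ (d + 2) * ?f (d + 2) t) =
     ?f (d + 2) (1 / t) - of_real (real (d + 2) * real (d + 1) / (4 * pi) * t) * ?f d (1 / t)"
    using E3 unfolding E4 E5 .
  moreover have "(\<i> * of_real t) ^ (4 * h + d + 2) = of_real t ^ (4 * h + d + 2) * \<i> ^ (d + 2)"
  proof -
    have "\<i> ^ (4 * h + d + 2) = \<i> ^ (d + 2)" using i4 by (simp only: add.assoc power_add mult_1)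
    thus ?thesis by (simp only: power_mult_distrib mult.commute)
  qed
  ultimately show "?f (d + 2) (1 / t) = (\<i> * of_real t) ^ (4 * h + d + 2) * ?f (d + 2) t +
        of_real (real (d + 2) * real (d + 1) / (4 * pi) * t) * ?f d (1 / t)" by (simp add: mult.assoc)
qed

end

section \<open>Shells as spherical designs\<close>

context theta_lattice
begin

definition weighted_theta :: "('a \<Rightarrow> real) \<Rightarrow> complex \<Rightarrow> complex" where
  "weighted_theta p q = (\<Sum>\<^sub>\<infinity>v\<in>L. of_real (p v) * q ^ half_norm v)"

definition shell_sum :: "('a \<Rightarrow> real) \<Rightarrow> nat \<Rightarrow> complex" where
  "shell_sum p m = of_real (\<Sum>v\<in>shell m. p v)"

definition power_diff :: "'a \<Rightarrow> 'a \<Rightarrow> nat \<Rightarrow> 'a \<Rightarrow> real" where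
  "power_diff x x' j v = (x \<bullet> v) ^ j - (x' \<bullet> v) ^ j"

lemma power_diff_summable:
  assumes x: "norm x = 1" "norm x' = 1" and r: "0 < r" "r < 1"
  shows "(\<lambda>v. norm (complex_of_real (power_diff x x' j v)) * r ^ half_norm v) summable_on L"
proof -
  define t where "t = - ln r / (2 * pi)"
  have t: "t > 0" using r by (simp add: t_def ln_less_zero divide_neg_pos)
  have er: "exp (- 2 * pi * t) = r" using r by (simp add: t_def)
  show ?thesis
  proof (rule summable_on_comparison_test)
    show "(\<lambda>v. norm (complex_of_real (e t v * (x \<bullet> v) ^ j)) + norm (complex_of_real (e t v * (x' \<bullet> v) ^ j))) summable_on L"
      by (intro summable_on_add theta_moment_summable t x)
    fix v assume v: "v \<in> L"
    have "norm (complex_of_real (power_diff x x' j v)) * r ^ half_norm v = e t v * \<bar>(x \<bullet> v) ^ j - (x' \<bullet> v) ^ j\<bar>"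
    proof -
      have er': "r ^ half_norm v = e t v" using e_ht[OF v, of t] unfolding er by simp
      show ?thesis unfolding norm_of_real er' power_diff_def by (rule mult.commute)
    qed
    also have "\<dots> \<le> e t v * (\<bar>(x \<bullet> v) ^ j\<bar> + \<bar>(x' \<bullet> v) ^ j\<bar>)"
      using e_pos[of t v] by (intro mult_left_mono abs_triangle_ineq4) auto
    also have "\<dots> = norm (complex_of_real (e t v * (x \<bullet> v) ^ j)) + norm (complex_of_real (e t v * (x' \<bullet> v) ^ j))"
      unfolding norm_of_real abs_mult abs_of_pos[OF e_pos] by (simp add: distrib_left)
    finally show "norm (complex_of_real (power_diff x x' j v)) * r ^ half_norm v \<le> norm (complex_of_real (e t v * (x \<bullet> v) ^ j)) + norm (complex_of_real (e t v * (x' \<bullet> v) ^ j))" .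
  qed (use r in auto)
qed

lemma weighted_theta_sums:
  assumes x: "norm x = 1" "norm x' = 1" and q: "q \<in> ball 0 1"
  shows "(\<lambda>m. shell_sum (power_diff x x' j) m * q ^ m) sums weighted_theta (power_diff x x' j) q"
proof -
  have "(\<lambda>n. (\<Sum>\<^sub>\<infinity>v\<in>{v\<in>L. half_norm v = n}. complex_of_real (power_diff x x' j v)) * q ^ n) sums (\<Sum>\<^sub>\<infinity>v\<in>L. complex_of_real (power_diff x x' j v) * q ^ half_norm v)"
    by (rule power_series_of_family(2)[OF power_diff_summable[OF x]]) (use q in auto)
  thus ?thesis by (simp add: weighted_theta_def shell_sum_def shell_ht finite_shell)
qed

lemma weighted_theta_holomorphic:
  assumes x: "norm x = 1" "norm x' = 1"
  shows "weighted_theta (power_diff x x' j) holomorphic_on ball 0 1"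
  by (rule power_series_holomorphic[where a = "shell_sum (power_diff x x' j)"]) (use weighted_theta_sums[OF x] in simp)

lemma weighted_theta_imaginary:
  assumes x: "norm x = 1" "norm x' = 1" and t: "t > 0"
  shows "weighted_theta (power_diff x x' j) (nome (\<i> * of_real t)) = moment_diff x x' j t"
proof -
  have nome: "nome (\<i> * of_real t) = of_real (exp (- 2 * pi * t))"
    by (simp add: nome_def exp_of_real[symmetric] algebra_simps)
  have "weighted_theta (power_diff x x' j) (nome (\<i> * of_real t)) =
      (\<Sum>\<^sub>\<infinity>v\<in>L. complex_of_real (e t v * (x \<bullet> v) ^ j) + - complex_of_real (e t v * (x' \<bullet> v) ^ j))"
    unfolding weighted_theta_def
  proof (rule infsum_cong)
    fix v assume v: "v \<in> L"
    have "nome (\<i> * of_real t) ^ half_norm v = complex_of_real (e t v)" unfolding nome e_ht[OF v] by simp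
    thus "complex_of_real (power_diff x x' j v) * nome (\<i> * of_real t) ^ half_norm v = complex_of_real (e t v * (x \<bullet> v) ^ j) + - complex_of_real (e t v * (x' \<bullet> v) ^ j)"
      by (simp add: power_diff_def algebra_simps)
  qed
  also have "\<dots> = theta_moment j t x + (\<Sum>\<^sub>\<infinity>v\<in>L. - complex_of_real (e t v * (x' \<bullet> v) ^ j))"
  proof -
    have s: "(\<lambda>v. complex_of_real (e t v * (y \<bullet> v) ^ j)) summable_on L" if "norm y = 1" for y
      by (rule abs_summable_summable[OF theta_moment_summable[OF t that]])
    have s2: "(\<lambda>v. - complex_of_real (e t v * (x' \<bullet> v) ^ j)) summable_on L"
      using s[OF x(2)] by (simp only: summable_on_uminus)
    show ?thesis unfolding theta_moment_def by (rule infsum_add[OF s[OF x(1)] s2])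
  qed
  also have "\<dots> = moment_diff x x' j t" by (simp add: moment_diff_def theta_moment_def infsum_uminus)
  finally show ?thesis .
qed

lemma holomorphic_inverse_compose:
  assumes "f holomorphic_on {\<tau>. 0 < Im \<tau>}"
  shows "(\<lambda>\<tau>. f (- 1 / \<tau>)) holomorphic_on {\<tau>. 0 < Im \<tau>}"
proof -
  have "(\<lambda>\<tau>. - 1 / \<tau>) holomorphic_on {\<tau>. 0 < Im \<tau>}" by (auto intro!: holomorphic_intros)
  moreover have "(\<lambda>\<tau>. - 1 / \<tau>) ` {\<tau>. 0 < Im \<tau>} \<subseteq> {\<tau>. 0 < Im \<tau>}" using upper_half_inverse by blast
  ultimately show ?thesis using holomorphic_on_compose_gen[OF _ assms] by (force simp: o_def)
qed

lemma weighted_theta_S: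
  assumes x: "norm x = 1" "norm x' = 1" and zero: "\<And>j t. j < d \<Longrightarrow> t > 0 \<Longrightarrow> moment_diff x x' j t = 0" and \<tau>: "0 < Im \<tau>"
  shows "weighted_theta (power_diff x x' d) (nome (- 1 / \<tau>)) = \<tau> ^ (4 * h + d) * weighted_theta (power_diff x x' d) (nome \<tau>)"
proof (rule holomorphic_eq_on_upper_half[OF _ _ _ \<tau>])
  have hol: "(\<lambda>\<tau>. weighted_theta (power_diff x x' d) (nome \<tau>)) holomorphic_on {\<tau>. 0 < Im \<tau>}"
    by (rule holomorphic_nome_compose[OF weighted_theta_holomorphic[OF x]])
  show "(\<lambda>\<tau>. weighted_theta (power_diff x x' d) (nome (- 1 / \<tau>))) holomorphic_on {\<tau>. 0 < Im \<tau>}"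
    using holomorphic_inverse_compose[OF hol] .
  show "(\<lambda>\<tau>. \<tau> ^ (4 * h + d) * weighted_theta (power_diff x x' d) (nome \<tau>)) holomorphic_on {\<tau>. 0 < Im \<tau>}"
    by (intro holomorphic_intros hol)
  fix t :: real assume t: "t > 0"
  have "- 1 / (\<i> * of_real t) = \<i> * of_real (1 / t)" using t by (simp add: field_simps)
  hence "weighted_theta (power_diff x x' d) (nome (- 1 / (\<i> * of_real t))) = moment_diff x x' d (1 / t)" using weighted_theta_imaginary[OF x, of "1 / t"] t by simp
  also have "\<dots> = (\<i> * of_real t) ^ (4 * h + d) * moment_diff x x' d t" by (rule moment_diff_transform(1)[OF t x]) (auto intro: zero)
  finally show "weighted_theta (power_diff x x' d) (nome (- 1 / (\<i> * of_real t))) = (\<i> * of_real t) ^ (4 * h + d) * weighted_theta (power_diff x x' d) (nome (\<i> * of_real t))"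
    using weighted_theta_imaginary[OF x t] by simp
qed

lemma shell_0: "shell 0 = {0}"
  using zero by (auto simp: shell_def)

text \<open>Venkov's argument by strong induction on the degree: once all lower moments agree, the
  difference series has weight 4 h + d. It vanishes to order r, since the origin contributes 0 and
  the shells 1, ..., r - 1 are empty, and a weight below 12 r then forces it to be zero.\<close>

theorem shell_design:
  assumes x: "norm x = 1" "norm x' = 1" and min: "\<And>v. v \<in> L \<Longrightarrow> v \<noteq> 0 \<Longrightarrow> 2 * real r \<le> v \<bullet> v"
    and d: "4 * h + d < 12 * r"
  shows "(\<Sum>v\<in>shell m. (x \<bullet> v) ^ d) = (\<Sum>v\<in>shell m. (x' \<bullet> v) ^ d)"
    and "t > 0 \<Longrightarrow> moment_diff x x' d t = 0"
proof -
  have low: "shell_sum (power_diff x x' d) m = 0" if "m < r" for m d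
  proof (cases "m = 0 ")
    case True
    thus ?thesis by (simp add: shell_sum_def shell_0 power_diff_def power_0_left)
  next
    case False
    have "shell m = {}"
    proof -
      have False if "v \<in> shell m" for v
        using that min[of v] \<open>m < r\<close> False by (cases "v = 0") (auto simp: shell_def)
      thus ?thesis by blast
    qed
    thus ?thesis by (simp add: shell_sum_def)
  qed
  have main: "(\<forall>m. shell_sum (power_diff x x' d) m = 0) \<and> (\<forall>t>0. moment_diff x x' d t = 0)" using d
  proof (induction d rule: less_induct)
    case (less d)
    have z: "moment_diff x x' j t = 0" if "j < d" "t > 0" for j t using less.IH[of j] less.prems that by simp
    have c: "shell_sum (power_diff x x' d) m = 0" for m
    proof (rule modular_coeffs_zero[OF weighted_theta_sums[OF x] low])
      show "weighted_theta (power_diff x x' d) (nome (- 1 / \<tau>)) = \<tau> ^ (4 * h + d) * weighted_theta (power_diff x x' d) (nome \<tau>)" if "0 < Im \<tau>" for \<tau>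
        by (rule weighted_theta_S[OF x _ that]) (auto intro: z)
    qed (use less.prems in auto)
    have "moment_diff x x' d t = 0" if t: "t > 0" for t
    proof -
      have "nome (\<i> * of_real t) \<in> ball 0 1" by (rule nome_in_ball) (use t in simp)
      from weighted_theta_sums[OF x this, of d] have "weighted_theta (power_diff x x' d) (nome (\<i> * of_real t)) = 0"
        using c by (simp add: sums_iff)
      thus ?thesis using weighted_theta_imaginary[OF x t] by simp
    qed
    thus ?case using c by blast
  qed
  have "shell_sum (power_diff x x' d) m = 0" using main by blast
  thus "(\<Sum>v\<in>shell m. (x \<bullet> v) ^ d) = (\<Sum>v\<in>shell m. (x' \<bullet> v) ^ d)"
    unfolding shell_sum_def of_real_eq_0_iff by (simp add: power_diff_def sum_subtractf)
  show "t > 0 \<Longrightarrow> moment_diff x x' d t = 0" using main by blast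
qed

lemma moment_diff_odd: "odd j \<Longrightarrow> moment_diff x x' j t = 0"
proof -
  assume j: "odd j"
  have "theta_moment j t y = 0" for y
  proof -
    have "theta_moment j t y = (\<Sum>\<^sub>\<infinity>v\<in>L. complex_of_real (e t (- v) * (y \<bullet> (- v)) ^ j))"
      unfolding theta_moment_def by (rule infsum_reindex_bij_witness[of _ uminus uminus]) (use neg in auto)
    also have "\<dots> = (\<Sum>\<^sub>\<infinity>v\<in>L. - complex_of_real (e t v * (y \<bullet> v) ^ j))"
      using j by (simp add: e_def)
    also have "\<dots> = - theta_moment j t y" by (simp add: theta_moment_def infsum_uminus)
    finally show ?thesis by simp
  qed
  thus ?thesis by (simp add: moment_diff_def)
qed

text \<open>Here \<open>f\<close> (degree \<open>d\<close>) has weight \<open>12 r\<close>, while \<open>g\<close> (degree \<open>d + 2\<close>) is only quasimodular of weight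
  \<open>12 r + 2\<close>; its anomaly is a multiple of the one of \<open>q f'(q)\<close>, so a linear combination of both is
  modular and vanishes.\<close>
theorem shell_design_skip:
  assumes x: "norm x = 1" "norm x' = 1" and min: "\<And>v. v \<in> L \<Longrightarrow> v \<noteq> 0 \<Longrightarrow> 2 * real r \<le> v \<bullet> v"
    and d: "4 * h + d = 12 * r" and r: "r > 0"
  shows "(\<Sum>v\<in>shell m. (x \<bullet> v) ^ (d + 2)) - real ((d + 2) * (d + 1)) * real m / (24 * real r) * (\<Sum>v\<in>shell m. (x \<bullet> v) ^ d) =
         (\<Sum>v\<in>shell m. (x' \<bullet> v) ^ (d + 2)) - real ((d + 2) * (d + 1)) * real m / (24 * real r) * (\<Sum>v\<in>shell m. (x' \<bullet> v) ^ d)"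
proof -
  define W where "W = 12 * r"
  have W: "4 * h + d = W" "W > 0" using d r by (auto simp: W_def)
  have ed: "even d" using d by presburger
  have z: "moment_diff x x' j t = 0" if "j < d" "t > 0" for j t using shell_design(2)[OF x min] that d by simp
  have z1: "moment_diff x x' (d + 1) t = 0" for t by (rule moment_diff_odd) (use ed in simp)
  define f where "f = weighted_theta (power_diff x x' d)"
  define g where "g = weighted_theta (power_diff x x' (d + 2))"
  define \<kappa> where "\<kappa> = real (d + 2) * real (d + 1) / (4 * pi)"
  have fh: "f holomorphic_on ball 0 1" unfolding f_def by (rule weighted_theta_holomorphic[OF x])
  have gh: "g holomorphic_on ball 0 1" unfolding g_def by (rule weighted_theta_holomorphic[OF x])
  have fH: "(\<lambda>\<tau>. f (nome \<tau>)) holomorphic_on {\<tau>. 0 < Im \<tau>}" by (rule holomorphic_nome_compose[OF fh])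
  have gH: "(\<lambda>\<tau>. g (nome \<tau>)) holomorphic_on {\<tau>. 0 < Im \<tau>}" by (rule holomorphic_nome_compose[OF gh])
  have fS: "f (nome (- 1 / \<tau>)) = \<tau> ^ W * f (nome \<tau>)" if "0 < Im \<tau>" for \<tau>
    unfolding f_def W(1)[symmetric] by (rule weighted_theta_S[OF x _ that]) (auto intro: z)
  have gS: "g (nome (- 1 / \<tau>)) = \<tau> ^ (W + 2) * g (nome \<tau>) + (- \<i> * of_real \<kappa>) * \<tau> ^ (W + 1) * f (nome \<tau>)" if "0 < Im \<tau>" for \<tau>
  proof (rule holomorphic_eq_on_upper_half[OF holomorphic_inverse_compose[OF gH] _ _ that])
    show "(\<lambda>\<tau>. \<tau> ^ (W + 2) * g (nome \<tau>) + (- \<i> * of_real \<kappa>) * \<tau> ^ (W + 1) * f (nome \<tau>)) holomorphic_on {\<tau>. 0 < Im \<tau>}"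
      by (intro holomorphic_intros fH gH)
    fix t :: real assume t: "t > 0"
    have n: "- 1 / (\<i> * of_real t) = \<i> * of_real (1 / t)" using t by (simp add: field_simps)
    have "g (nome (- 1 / (\<i> * of_real t))) = moment_diff x x' (d + 2) (1 / t)" unfolding g_def n using weighted_theta_imaginary[OF x, of "1 / t"] t by simp
    also have "\<dots> = (\<i> * of_real t) ^ (4 * h + d + 2) * moment_diff x x' (d + 2) t +
        of_real (real (d + 2) * real (d + 1) / (4 * pi) * t) * moment_diff x x' d (1 / t)"
      by (rule moment_diff_transform(2)[OF t x _ z1]) (auto intro: z)
    also have "moment_diff x x' d (1 / t) = (\<i> * of_real t) ^ W * moment_diff x x' d t"
      unfolding W(1)[symmetric] by (rule moment_diff_transform(1)[OF t x]) (auto intro: z)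
    also have "of_real (real (d + 2) * real (d + 1) / (4 * pi) * t) * ((\<i> * of_real t) ^ W * moment_diff x x' d t) =
      (- \<i> * of_real \<kappa>) * (\<i> * of_real t) ^ (W + 1) * moment_diff x x' d t"
    proof -
      have "of_real (real (d + 2) * real (d + 1) / (4 * pi) * t) = (- \<i> * of_real \<kappa>) * (\<i> * complex_of_real t)"
        unfolding \<kappa>_def[symmetric] by (simp add: mult_ac)
      thus ?thesis by (simp only: power_add power_one_right mult_ac)
    qed
    finally show "g (nome (- 1 / (\<i> * of_real t))) = (\<i> * of_real t) ^ (W + 2) * g (nome (\<i> * of_real t)) +
       (- \<i> * of_real \<kappa>) * (\<i> * of_real t) ^ (W + 1) * f (nome (\<i> * of_real t))"
      unfolding f_def g_def weighted_theta_imaginary[OF x t] W(1) .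
  qed
  obtain f' where f': "\<And>q. q \<in> ball 0 1 \<Longrightarrow> (\<lambda>n. of_nat n * shell_sum (power_diff x x' d) n * q ^ (n - 1)) sums f' q"
     "\<And>q. q \<in> ball 0 1 \<Longrightarrow> (f has_field_derivative f' q) (at q)"
  proof -
    have "\<exists>f'. (\<lambda>n. of_nat n * shell_sum (power_diff x x' d) n * q ^ (n - 1)) sums f' \<and> (f has_field_derivative f') (at q)" if q: "q \<in> ball 0 1" for q
    proof -
      define \<rho> where "\<rho> = (1 + cmod q) / 2"
      have \<rho>: "cmod q < \<rho>" "\<rho> < 1" "0 < \<rho>" using q by (auto simp: \<rho>_def add_pos_nonneg)
      have "summable (\<lambda>n. shell_sum (power_diff x x' d) n * complex_of_real (\<rho> ^ n))"
        using weighted_theta_sums[OF x, of "of_real \<rho>"] \<rho> by (auto simp: sums_iff)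
      from power_series_and_derivative_0[OF this] obtain G G' where
        G: "\<And>z. cmod z < \<rho> \<Longrightarrow> (\<lambda>n. shell_sum (power_diff x x' d) n * z ^ n) sums G z \<and>
           (\<lambda>n. of_nat n * shell_sum (power_diff x x' d) n * z ^ (n - 1)) sums G' z \<and> (G has_field_derivative G' z) (at z)" by blast
      have "f z = G z" if "cmod z < \<rho>" for z
      proof -
        have "z \<in> ball 0 1" using that \<rho>(2) by simp
        from sums_unique2[OF weighted_theta_sums[OF x this, of d]] show ?thesis using G[OF that] unfolding f_def by blast
      qed
      hence fG: "G z = f z" if "z \<in> ball 0 \<rho>" for z using that by simp
      have "(f has_field_derivative G' q) (at q)"
      proof (rule has_field_derivative_transform_within_open[OF _ open_ball _ fG])
        show "(G has_field_derivative G' q) (at q)" using G[OF \<rho>(1)] by blast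
        show "q \<in> ball 0 \<rho>" using \<rho>(1) by simp
      qed
      thus ?thesis using G[OF \<rho>(1)] by blast
    qed
    hence "\<forall>q\<in>ball 0 1. \<exists>f'. (\<lambda>n. of_nat n * shell_sum (power_diff x x' d) n * q ^ (n - 1)) sums f' \<and> (f has_field_derivative f') (at q)"
      by blast
    from bchoice[OF this] obtain f' where "\<forall>q\<in>ball 0 1. (\<lambda>n. of_nat n * shell_sum (power_diff x x' d) n * q ^ (n - 1)) sums f' q \<and> (f has_field_derivative f' q) (at q)" ..
    thus thesis using that[of f'] by blast
  qed
  define R where "R = (\<lambda>q. q * f' q)"
  have Rs: "(\<lambda>n. of_nat n * shell_sum (power_diff x x' d) n * q ^ n) sums R q" if "q \<in> ball 0 1" for q
  proof -
    have "(\<lambda>n. q * (of_nat n * shell_sum (power_diff x x' d) n * q ^ (n - 1))) sums R q"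
      unfolding R_def by (rule sums_mult[OF f'(1)[OF that]])
    also have "(\<lambda>n. q * (of_nat n * shell_sum (power_diff x x' d) n * q ^ (n - 1))) = (\<lambda>n. of_nat n * shell_sum (power_diff x x' d) n * q ^ n)"
    proof
      fix n show "q * (of_nat n * shell_sum (power_diff x x' d) n * q ^ (n - 1)) = of_nat n * shell_sum (power_diff x x' d) n * q ^ n"
        by (cases n) (simp_all add: mult_ac)
    qed
    finally show ?thesis .
  qed
  have df: "((\<lambda>\<tau>. f (nome \<tau>)) has_field_derivative 2 * of_real pi * \<i> * R (nome \<tau>)) (at \<tau>)" if "0 < Im \<tau>" for \<tau>
  proof -
    have "(nome has_field_derivative nome \<tau> * (2 * of_real pi * \<i>)) (at \<tau>)"
      unfolding nome_def by (auto intro!: derivative_eq_intros)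
    from DERIV_chain2[OF f'(2)[OF nome_in_ball[OF that]] this] show ?thesis by (simp add: R_def mult_ac)
  qed
  \<comment> \<open>The law of f is differentiated; the derivative of \<tau>^W yields the term that
    breaks modularity, proportional to f as in \<open>gS\<close>.\<close>
  have RS: "R (nome (- 1 / \<tau>)) = \<tau> ^ (W + 2) * R (nome \<tau>) + of_nat W * \<tau> ^ (W + 1) * f (nome \<tau>) / (2 * of_real pi * \<i>)" if \<tau>: "0 < Im \<tau>" for \<tau>
  proof -
    have nz: "\<tau> \<noteq> 0" using \<tau> by auto
    have "((\<lambda>\<tau>. - 1 / \<tau>) has_field_derivative 1 / \<tau>\<^sup>2) (at \<tau>)"
      using nz by (auto intro!: derivative_eq_intros simp: power2_eq_square)
    from DERIV_chain2[OF df[OF upper_half_inverse[OF \<tau>]] this]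
    have 1: "((\<lambda>\<tau>. f (nome (- 1 / \<tau>))) has_field_derivative 2 * of_real pi * \<i> * R (nome (- 1 / \<tau>)) * (1 / \<tau>\<^sup>2)) (at \<tau>)" .
    have "((\<lambda>\<tau>. \<tau> ^ W * f (nome \<tau>)) has_field_derivative of_nat W * \<tau> ^ (W - 1) * f (nome \<tau>) + (2 * of_real pi * \<i> * R (nome \<tau>)) * \<tau> ^ W) (at \<tau>)"
      using DERIV_mult[OF DERIV_power[OF DERIV_ident, of W] df[OF \<tau>]] by simp
    hence "((\<lambda>\<tau>. f (nome (- 1 / \<tau>))) has_field_derivative of_nat W * \<tau> ^ (W - 1) * f (nome \<tau>) + (2 * of_real pi * \<i> * R (nome \<tau>)) * \<tau> ^ W) (at \<tau>)"
      by (rule has_field_derivative_transform_within_open[OF _ upper_half_plane_props(1)]) (use \<tau> fS in auto)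
    from DERIV_unique[OF 1 this]
    have "2 * of_real pi * \<i> * R (nome (- 1 / \<tau>)) * (1 / \<tau>\<^sup>2) * \<tau>\<^sup>2 = (of_nat W * \<tau> ^ (W - 1) * f (nome \<tau>) + (2 * of_real pi * \<i> * R (nome \<tau>)) * \<tau> ^ W) * \<tau>\<^sup>2"
      by simp
    hence "2 * of_real pi * \<i> * R (nome (- 1 / \<tau>)) = of_nat W * (\<tau> ^ (W - 1) * \<tau>\<^sup>2) * f (nome \<tau>) + (2 * of_real pi * \<i>) * (\<tau> ^ (W + 2) * R (nome \<tau>))"
      using nz by (simp add: power_add power2_eq_square algebra_simps)
    also have "\<tau> ^ (W - 1) * \<tau>\<^sup>2 = \<tau> ^ (W + 1)" using W(2) by (simp flip: power_add)
    finally show ?thesis by (simp add: field_simps)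
  qed
  \<comment> \<open>Solves c W / (2 pi i) = - i \<kappa>, so that the anomalies of g and of c R
    cancel.\<close>
  define c where "c = 2 * pi * \<kappa> / real W"
  define H where "H = (\<lambda>q. g q - of_real c * R q)"
  define a where "a = (\<lambda>m. shell_sum (power_diff x x' (d + 2)) m - of_real c * (of_nat m * shell_sum (power_diff x x' d) m))"
  have as: "(\<lambda>m. a m * q ^ m) sums H q" if "q \<in> ball 0 1" for q
  proof -
    have "(\<lambda>m. shell_sum (power_diff x x' (d + 2)) m * q ^ m - of_real c * (of_nat m * shell_sum (power_diff x x' d) m * q ^ m)) sums H q"
      unfolding H_def g_def by (intro sums_diff sums_mult Rs weighted_theta_sums[OF x] that)
    thus ?thesis by (simp add: a_def left_diff_distrib mult.assoc)
  qed
  have HS: "H (nome (- 1 / \<tau>)) = \<tau> ^ (W + 2) * H (nome \<tau>)" if "0 < Im \<tau>" for \<tau>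
  proof -
    have "of_real c * (of_nat W * \<tau> ^ (W + 1) * f (nome \<tau>) / (2 * of_real pi * \<i>)) = (- \<i> * of_real \<kappa>) * \<tau> ^ (W + 1) * f (nome \<tau>)"
      using W(2) by (simp add: c_def field_simps)
    thus ?thesis unfolding H_def gS[OF that] RS[OF that] by (simp add: algebra_simps)
  qed
  have low: "a k = 0" if "k < r" for k
  proof (cases "k = 0")
    case True
    thus ?thesis by (simp add: a_def shell_sum_def shell_0 power_diff_def)
  next
    case False
    have "shell k = {}"
    proof -
      have False if "v \<in> shell k" for v
        using that min[of v] \<open>k < r\<close> False by (cases "v = 0") (auto simp: shell_def)
      thus ?thesis by blast
    qed
    thus ?thesis by (simp add: a_def shell_sum_def)
  qed
  have "a m = 0" by (rule modular_coeffs_zero[OF as low HS]) (auto simp: W_def)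
  hence "complex_of_real ((\<Sum>v\<in>shell m. power_diff x x' (d + 2) v) - c * (real m * (\<Sum>v\<in>shell m. power_diff x x' d v))) = 0"
    by (simp add: a_def shell_sum_def)
  hence *: "(\<Sum>v\<in>shell m. power_diff x x' (d + 2) v) - c * (real m * (\<Sum>v\<in>shell m. power_diff x x' d v)) = 0"
    by (simp only: of_real_eq_0_iff)
  have "c = real ((d + 2) * (d + 1)) / (24 * real r)" unfolding c_def \<kappa>_def W_def of_nat_mult using r by (simp add: field_simps)
  thus ?thesis using * by (simp only:) (simp add: power_diff_def sum_subtractf right_diff_distrib mult_ac)
qed

end

subsection \<open>Inner product distributions of the shells\<close>

lemma coeff_quadratic_power:
  "coeff ([:1, 0, 1:] ^ k :: real poly) 0 = 1 \<and> coeff ([:1, 0, 1:] ^ k :: real poly) 1 = 0 \<and> coeff ([:1, 0, 1:] ^ k :: real poly) 2 = real k"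
proof (induction k)
  case (Suc k)
  have "coeff ([:1, 0, 1:] * p) 2 = coeff p 2 + coeff p 0" "coeff ([:1, 0, 1:] * p) 1 = coeff p 1" "coeff ([:1, 0, 1:] * p) 0 = coeff p 0"
    for p :: "real poly" by (simp_all add: numeral_2_eq_2 coeff_pCons)
  thus ?case using Suc by simp
qed (simp add: numeral_2_eq_2)

text \<open>For orthonormal x and z the moment of degree 2 k + 2 in direction x + s z is C (1 +
  s^2)^(k+1). Its coefficient of s^2 evaluates the mixed moment of (x.v)^(2 k) (z.v)^2 as C / (2 k +
  1). Summing the squares (z.v)^2 over an orthonormal basis that contains x gives R, hence the
  relation to B.\<close>

lemma moment_recursion:
  fixes S :: "'a::euclidean_space set"
  assumes C: "\<And>x. norm x = 1 \<Longrightarrow> (\<Sum>v\<in>S. (x \<bullet> v) ^ (2 * Suc k)) = C"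
    and B: "\<And>x. norm x = 1 \<Longrightarrow> (\<Sum>v\<in>S. (x \<bullet> v) ^ (2 * k)) = B"
    and R: "\<And>v. v \<in> S \<Longrightarrow> v \<bullet> v = R"
  shows "C * (real DIM('a) + 2 * real k) = B * R * (2 * real k + 1)"
proof -
  have orth: "(2 * real k + 1) * (\<Sum>v\<in>S. (x \<bullet> v) ^ (2 * k) * (z \<bullet> v)\<^sup>2) = C"
    if xz: "norm x = 1" "norm z = 1" "x \<bullet> z = 0" for x z :: 'a
  proof -
    have "poly (\<Sum>v\<in>S. [:x \<bullet> v, z \<bullet> v:] ^ (2 * Suc k)) s = poly (smult C ([:1, 0, 1:] ^ Suc k)) s" for s
    proof -
      define y where "y = (1 / sqrt (1 + s\<^sup>2)) *\<^sub>R (x + s *\<^sub>R z)"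
      have p: "1 + s\<^sup>2 > 0" by (simp add: add_pos_nonneg)
      have "(x + s *\<^sub>R z) \<bullet> (x + s *\<^sub>R z) = 1 + s\<^sup>2"
        using xz by (simp add: inner_add_left inner_add_right inner_commute norm_eq_1 power2_eq_square)
      hence "norm (x + s *\<^sub>R z) = sqrt (1 + s\<^sup>2)" by (simp add: norm_eq_sqrt_inner)
      hence "norm y = 1" using p by (simp add: y_def)
      from C[OF this] have "(1 / sqrt (1 + s\<^sup>2)) ^ (2 * Suc k) * (\<Sum>v\<in>S. (x \<bullet> v + s * (z \<bullet> v)) ^ (2 * Suc k)) = C"
        by (simp add: y_def inner_add_left power_divide sum_divide_distrib)
      moreover have "(1 / sqrt (1 + s\<^sup>2)) ^ (2 * Suc k) = 1 / (1 + s\<^sup>2) ^ Suc k"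
        unfolding power_mult using p by (simp add: power_divide)
      ultimately have "(\<Sum>v\<in>S. (x \<bullet> v + s * (z \<bullet> v)) ^ (2 * Suc k)) = C * (1 + s\<^sup>2) ^ Suc k"
        using p by (simp add: field_simps)
      moreover have "poly (\<Sum>v\<in>S. [:x \<bullet> v, z \<bullet> v:] ^ (2 * Suc k)) s = (\<Sum>v\<in>S. (x \<bullet> v + s * (z \<bullet> v)) ^ (2 * Suc k))"
        by (simp add: poly_sum del: power_Suc mult_Suc_right)
      moreover have "poly (smult C ([:1, 0, 1:] ^ Suc k)) s = C * (1 + s\<^sup>2) ^ Suc k"
        by (simp add: power2_eq_square del: power_Suc)
      ultimately show ?thesis by (simp only:)
    qed
    hence "(\<Sum>v\<in>S. [:x \<bullet> v, z \<bullet> v:] ^ (2 * Suc k)) = smult C ([:1, 0, 1:] ^ Suc k)" by (simp only: poly_eq_poly_eq_iff[symmetric] fun_eq_iff) simp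
    hence "coeff (\<Sum>v\<in>S. [:x \<bullet> v, z \<bullet> v:] ^ (2 * Suc k)) 2 = C * coeff ([:1, 0, 1:] ^ Suc k) 2" by simp
    also have "coeff ([:1, 0, 1:] ^ Suc k :: real poly) 2 = real (Suc k)" using coeff_quadratic_power by blast
    also have "coeff (\<Sum>v\<in>S. [:x \<bullet> v, z \<bullet> v:] ^ (2 * Suc k)) 2 = (\<Sum>v\<in>S. real (Suc k) * ((2 * real k + 1) * ((x \<bullet> v) ^ (2 * k) * (z \<bullet> v)\<^sup>2)))"
      unfolding coeff_sum
    proof (rule sum.cong[OF refl])
      fix v
      have "(2 * Suc k) choose 2 = Suc k * (2 * k + 1)" by (simp add: choose_two)
      thus "coeff ([:x \<bullet> v, z \<bullet> v:] ^ (2 * Suc k)) 2 = real (Suc k) * ((2 * real k + 1) * ((x \<bullet> v) ^ (2 * k) * (z \<bullet> v)\<^sup>2))"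
        by (subst coeff_linear_poly_power) (simp_all add: algebra_simps)
    qed
    finally have "real (Suc k) * ((2 * real k + 1) * (\<Sum>v\<in>S. (x \<bullet> v) ^ (2 * k) * (z \<bullet> v)\<^sup>2)) = real (Suc k) * C"
      by (simp only: sum_distrib_left mult.commute[of C])
    thus ?thesis by simp
  qed
  obtain x :: 'a where x: "x \<in> Basis" using nonempty_Basis by blast
  have nx: "norm x = 1" using x by simp
  have "(2 * real k + 1) * (B * R) = (2 * real k + 1) * (\<Sum>v\<in>S. (x \<bullet> v) ^ (2 * k) * (\<Sum>z\<in>Basis. (z \<bullet> v)\<^sup>2))"
  proof -
    have "(\<Sum>v\<in>S. (x \<bullet> v) ^ (2 * k) * (\<Sum>z\<in>Basis. (z \<bullet> v)\<^sup>2)) = (\<Sum>v\<in>S. (x \<bullet> v) ^ (2 * k) * R)"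
    proof (rule sum.cong[OF refl])
      fix v assume "v \<in> S"
      hence "R = v \<bullet> v" using R by simp
      also have "\<dots> = (\<Sum>z\<in>Basis. (v \<bullet> z) * (v \<bullet> z))" by (rule euclidean_inner)
      finally show "(x \<bullet> v) ^ (2 * k) * (\<Sum>z\<in>Basis. (z \<bullet> v)\<^sup>2) = (x \<bullet> v) ^ (2 * k) * R"
        by (simp add: power2_eq_square inner_commute)
    qed
    thus ?thesis using B[OF nx] by (simp flip: sum_distrib_right)
  qed
  also have "\<dots> = (\<Sum>z\<in>Basis. (2 * real k + 1) * (\<Sum>v\<in>S. (x \<bullet> v) ^ (2 * k) * (z \<bullet> v)\<^sup>2))"
    by (subst sum_distrib_left[symmetric]) (simp add: sum_distrib_left sum.swap[of _ S Basis])
  also have "\<dots> = (2 * real k + 1) * (\<Sum>v\<in>S. (x \<bullet> v) ^ (2 * k) * (x \<bullet> v)\<^sup>2) +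
      (\<Sum>z\<in>Basis - {x}. (2 * real k + 1) * (\<Sum>v\<in>S. (x \<bullet> v) ^ (2 * k) * (z \<bullet> v)\<^sup>2))"
    by (rule sum.remove[OF finite_Basis x])
  also have "(\<Sum>z\<in>Basis - {x}. (2 * real k + 1) * (\<Sum>v\<in>S. (x \<bullet> v) ^ (2 * k) * (z \<bullet> v)\<^sup>2)) = (\<Sum>z\<in>Basis - {x}. C)"
    by (rule sum.cong[OF refl], rule orth) (use x in \<open>auto simp: inner_Basis\<close>)
  also have "\<dots> = (real DIM('a) - 1) * C" using x by (simp add: of_nat_diff DIM_positive Suc_leI)
  also have "(\<Sum>v\<in>S. (x \<bullet> v) ^ (2 * k) * (x \<bullet> v)\<^sup>2) = C" using C[OF nx] by (simp add: power_add[symmetric] mult.commute)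
  finally show ?thesis by (simp add: algebra_simps)
qed

text \<open>Vieta's formula for the sum of the roots, to be weighed against the constant of the
  affine relation.\<close>

lemma coeff_node_poly_second: "coeff (node_poly (a # as)) (length as) = - (a + sum_list as)"
proof (induction as arbitrary: a)
  case (Cons b as)
  have "coeff (node_poly (a # b # as)) (Suc (length as)) = coeff (node_poly (b # as)) (length as) - a * coeff (node_poly (b # as)) (length (b # as))"
    unfolding node_poly_simps(2)[of a] by (simp only: mult_pCons_left) (simp add: coeff_pCons)
  also have "coeff (node_poly (b # as)) (length (b # as)) = 1" using node_poly_monic by blast
  finally show ?case using Cons[of b] by simp
qed simp

text \<open>The node polynomial sums to at least 0 over u and to 0 over v. All power sums cancel in
  the difference except the top two, and \<open>skip\<close> reduces these to c minus the sum of the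
  nodes, times the difference of the sums of exponent \<open>length as\<close>. As the factor is
  positive, the inequality required by \<open>power_sums_minimal\<close> follows.\<close>

theorem power_sums_minimal_skip:
  fixes u v :: "'i \<Rightarrow> real"
  assumes nodes: "a \<ge> 0" "\<forall>b\<in>set as. b \<ge> 0"
    and u: "\<And>y. y \<in> C \<Longrightarrow> u y \<ge> 0"
    and eq: "\<And>i. i < length as \<Longrightarrow> (\<Sum>y\<in>C. v y ^ i) = (\<Sum>y\<in>C. u y ^ i)"
    and skip: "(\<Sum>y\<in>C. v y ^ Suc (length as)) - c * (\<Sum>y\<in>C. v y ^ length as) = (\<Sum>y\<in>C. u y ^ Suc (length as)) - c * (\<Sum>y\<in>C. u y ^ length as)"
    and c: "a + sum_list as < c"
    and pos: "\<And>t. t \<ge> 0 \<Longrightarrow> poly (node_poly (a # as)) t \<ge> 0"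
    and zero: "\<And>y. y \<in> C \<Longrightarrow> poly (node_poly (a # as)) (v y) = 0"
  shows "(\<Sum>y\<in>C. v y ^ k) \<le> (\<Sum>y\<in>C. u y ^ k)"
proof (rule power_sums_minimal[OF nodes u eq _ pos zero])
  let ?p = "node_poly (a # as)" and ?m = "length as"
  have *: "(\<Sum>y\<in>C. poly ?p (f y)) = (\<Sum>i<?m. coeff ?p i * (\<Sum>y\<in>C. f y ^ i)) + coeff ?p ?m * (\<Sum>y\<in>C. f y ^ ?m) + (\<Sum>y\<in>C. f y ^ Suc ?m)" for f
  proof -
    have d: "degree ?p = Suc ?m" "coeff ?p (Suc ?m) = 1" using node_poly_monic[of "a # as"] by simp_all
    have "(\<Sum>y\<in>C. poly ?p (f y)) = (\<Sum>i\<le>Suc ?m. coeff ?p i * (\<Sum>y\<in>C. f y ^ i))"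
      unfolding poly_altdef d(1) by (subst sum.swap) (simp add: sum_distrib_left)
    also have "\<dots> = (\<Sum>i<?m. coeff ?p i * (\<Sum>y\<in>C. f y ^ i)) + coeff ?p ?m * (\<Sum>y\<in>C. f y ^ ?m) + coeff ?p (Suc ?m) * (\<Sum>y\<in>C. f y ^ Suc ?m)"
      by (simp only: lessThan_Suc_atMost[symmetric] sum.lessThan_Suc)
    finally show ?thesis by (simp only: d(2) mult_1)
  qed
  have "0 \<le> (\<Sum>y\<in>C. poly ?p (u y))" by (intro sum_nonneg pos u)
  moreover have "(\<Sum>y\<in>C. poly ?p (v y)) = 0" by (intro sum.neutral ballI zero)
  moreover have "(\<Sum>i<?m. coeff ?p i * (\<Sum>y\<in>C. v y ^ i)) = (\<Sum>i<?m. coeff ?p i * (\<Sum>y\<in>C. u y ^ i))"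
    by (rule sum.cong) (use eq in auto)
  ultimately have "0 \<le> coeff ?p ?m * ((\<Sum>y\<in>C. u y ^ ?m) - (\<Sum>y\<in>C. v y ^ ?m)) + ((\<Sum>y\<in>C. u y ^ Suc ?m) - (\<Sum>y\<in>C. v y ^ Suc ?m))"
    unfolding * by (simp add: right_diff_distrib)
  also have "\<dots> = (c - (a + sum_list as)) * ((\<Sum>y\<in>C. u y ^ ?m) - (\<Sum>y\<in>C. v y ^ ?m))"
    using skip unfolding coeff_node_poly_second by (simp add: algebra_simps)
  finally have "0 \<le> (\<Sum>y\<in>C. u y ^ ?m) - (\<Sum>y\<in>C. v y ^ ?m)" using c by (simp add: zero_le_mult_iff)
  thus "(\<Sum>y\<in>C. v y ^ ?m) \<le> (\<Sum>y\<in>C. u y ^ ?m)" by simp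
qed

lemma sum_int_fibers:
  fixes F :: "real \<Rightarrow> 'b::comm_monoid_add"
  assumes S: "finite S" and f: "\<And>w. w \<in> S \<Longrightarrow> f w \<in> \<int> \<and> \<bar>f w\<bar> \<le> of_int J"
  shows "(\<Sum>w\<in>S. F (f w)) = (\<Sum>j\<in>{-J..J}. \<Sum>w\<in>{w\<in>S. f w = of_int j}. F (of_int j))"
proof -
  have fl: "f w = of_int \<lfloor>f w\<rfloor>" if "w \<in> S" for w using f[OF that] by (auto elim: Ints_cases)
  have im: "(\<lambda>w. \<lfloor>f w\<rfloor>) ` S \<subseteq> {-J..J}"
  proof
    fix j assume "j \<in> (\<lambda>w. \<lfloor>f w\<rfloor>) ` S"
    then obtain w where w: "w \<in> S" "f w = of_int j" using fl by force
    have "\<bar>real_of_int j\<bar> \<le> of_int J" using f[OF w(1)] w(2) by simp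
    hence "\<bar>j\<bar> \<le> J" by linarith
    thus "j \<in> {-J..J}" by auto
  qed
  have "(\<Sum>w\<in>S. F (f w)) = (\<Sum>j\<in>{-J..J}. \<Sum>w\<in>{w\<in>S. \<lfloor>f w\<rfloor> = j}. F (f w))"
    by (rule sum.group[symmetric, OF S _ im]) simp
  also have "\<dots> = (\<Sum>j\<in>{-J..J}. \<Sum>w\<in>{w\<in>S. f w = of_int j}. F (of_int j))"
  proof (rule sum.cong[OF refl], rule sum.cong)
    fix j show "{w \<in> S. \<lfloor>f w\<rfloor> = j} = {w \<in> S. f w = of_int j}" using fl by force
  qed auto
  finally show ?thesis .
qed

lemma sum_singleton_mset_const: "(\<Sum>w\<in>A. {#c#}) = replicate_mset (card A) c"
  by (induction A rule: infinite_finite_induct) auto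

section \<open>Moments and inner product counts of a shell\<close>

context theta_lattice
begin

lemma inner_Ints: "v \<in> L \<Longrightarrow> w \<in> L \<Longrightarrow> v \<bullet> w \<in> \<int>"
proof -
  assume vw: "v \<in> L" "w \<in> L"
  have "v \<bullet> w = of_int (int (half_norm (v + w)) - int (half_norm v) - int (half_norm w))"
    using half_norm[OF add[OF vw]] half_norm[OF vw(1)] half_norm[OF vw(2)] by (simp add: inner_add_left inner_add_right inner_commute)
  thus ?thesis by simp
qed

text \<open>The even moments of a shell along a unit vector: \<open>moment_recursion\<close> solved
  for C, with dimension 8 h and norm 2 m. They are valid in the degrees in which the shell is a
  design.\<close>

fun moment_const :: "nat \<Rightarrow> nat \<Rightarrow> real" where
  "moment_const m 0 = real (card (shell m))"
| "moment_const m (Suc k) = moment_const m k * (2 * real m) * (2 * real k + 1) / (8 * real h + 2 * real k)"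

lemma h_pos: "h > 0"
  using DIM DIM_positive[where 'a='a] by (cases h) auto

lemma shell_moment_unit:
  assumes min: "\<And>v. v \<in> L \<Longrightarrow> v \<noteq> 0 \<Longrightarrow> 2 * real r \<le> v \<bullet> v" and k: "4 * h + 2 * k < 12 * r"
    and x: "norm x = 1"
  shows "(\<Sum>w\<in>shell m. (x \<bullet> w) ^ (2 * k)) = moment_const m k"
  using k x
proof (induction k arbitrary: x)
  case (Suc k)
  have "(\<Sum>w\<in>shell m. (x \<bullet> w) ^ (2 * Suc k)) * (real DIM('a) + 2 * real k) = moment_const m k * (2 * real m) * (2 * real k + 1)"
  proof (rule moment_recursion)
    show "(\<Sum>w\<in>shell m. (y \<bullet> w) ^ (2 * Suc k)) = (\<Sum>w\<in>shell m. (x \<bullet> w) ^ (2 * Suc k))" if "norm y = 1" for y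
      by (rule shell_design(1)[OF that Suc.prems(2) min]) (use Suc.prems in auto)
    show "(\<Sum>w\<in>shell m. (y \<bullet> w) ^ (2 * k)) = moment_const m k" if "norm y = 1" for y
      by (rule Suc.IH) (use Suc.prems that in auto)
    show "v \<bullet> v = 2 * real m" if "v \<in> shell m" for v using that by (simp add: shell_def)
  qed
  moreover have "8 * real h + 2 * real k > 0" using h_pos by simp
  ultimately show ?case by (simp add: DIM field_simps)
qed simp

lemma shell_moment:
  assumes min: "\<And>v. v \<in> L \<Longrightarrow> v \<noteq> 0 \<Longrightarrow> 2 * real r \<le> v \<bullet> v" and k: "4 * h + 2 * k < 12 * r"
    and v: "v \<noteq> 0"
  shows "(\<Sum>w\<in>shell m. (v \<bullet> w) ^ (2 * k)) = (v \<bullet> v) ^ k * moment_const m k"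
proof -
  have n: "norm ((1 / norm v) *\<^sub>R v) = 1" using v by simp
  have "(1 / norm v) ^ (2 * k) * (\<Sum>w\<in>shell m. (v \<bullet> w) ^ (2 * k)) = moment_const m k"
    using shell_moment_unit[OF min k n] by (simp add: power_divide sum_divide_distrib)
  moreover have "(1 / norm v) ^ (2 * k) = 1 / (v \<bullet> v) ^ k"
    unfolding power_mult power2_norm_eq_inner[symmetric] by (simp add: power_divide)
  ultimately show ?thesis using v by (simp add: field_simps)
qed

text \<open>For the zero lattice the inversion formula at t = 2 would read 1 = 2^(- 4 h).\<close>

lemma nonzero_vector: "\<exists>v\<in>L. v \<noteq> 0"
proof (rule ccontr)
  assume "\<not> (\<exists>v\<in>L. v \<noteq> 0)"
  hence L0: "L = {0}" using zero by blast
  have "complex_of_real 1 = of_real ((1 / 2) ^ (4 * h))" using inversion[of 2 0] unfolding L0 by simp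
  hence "(1::real) = (1 / 2) ^ (4 * h)" by (simp only: of_real_eq_iff)
  moreover have "(1 / 2 :: real) ^ (4 * h) \<le> (1 / 2) ^ 1" by (rule power_decreasing) (use h_pos in auto)
  ultimately show False by simp
qed

lemma shell_uminus: "w \<in> shell m \<Longrightarrow> - w \<in> shell m"
  using neg by (auto simp: shell_def)

lemma card_fiber_uminus: "card {w \<in> shell m. v \<bullet> w = - c} = card {w \<in> shell m. v \<bullet> w = c}"
  by (rule bij_betw_same_card[of uminus]) (rule bij_betwI[of _ _ _ uminus], use shell_uminus in auto)

definition inner_count :: "'a \<Rightarrow> nat \<Rightarrow> int \<Rightarrow> real" where
  "inner_count v m j = real (card {w \<in> shell m. v \<bullet> w = of_int j})"

lemma inner_count_uminus: "inner_count v m (- j) = inner_count v m j"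
  unfolding inner_count_def using card_fiber_uminus[of m v "of_int j"] by simp

lemma moment_cnt:
  assumes v: "v \<in> L" and J: "\<And>w. w \<in> shell m \<Longrightarrow> \<bar>v \<bullet> w\<bar> \<le> of_int J"
  shows "(\<Sum>w\<in>shell m. (v \<bullet> w) ^ k) = (\<Sum>j\<in>{-J..J}. inner_count v m j * of_int j ^ k)"
proof -
  have "(\<Sum>w\<in>shell m. (v \<bullet> w) ^ k) = (\<Sum>j\<in>{-J..J}. \<Sum>w\<in>{w\<in>shell m. v \<bullet> w = of_int j}. of_int j ^ k)"
    by (rule sum_int_fibers[OF finite_shell]) (use J inner_Ints[OF v] in \<open>auto simp: shell_def\<close>)
  thus ?thesis by (simp add: inner_count_def)
qed

text \<open>v + w and v - w are nonzero lattice vectors, so their norms are at least 2 r.\<close>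

lemma inner_bound:
  assumes min: "\<And>v. v \<in> L \<Longrightarrow> v \<noteq> 0 \<Longrightarrow> 2 * real r \<le> v \<bullet> v"
    and v: "v \<in> L" and w: "w \<in> shell m" and ne: "v \<noteq> w" "v \<noteq> - w"
  shows "\<bar>v \<bullet> w\<bar> \<le> (v \<bullet> v + 2 * real m - 2 * real r) / 2"
proof -
  have wL: "w \<in> L" and ww: "w \<bullet> w = 2 * real m" using w by (auto simp: shell_def)
  have "2 * real r \<le> (v + - w) \<bullet> (v + - w)" by (rule min[OF add[OF v neg[OF wL]]]) (use ne in auto)
  moreover have "2 * real r \<le> (v + w) \<bullet> (v + w)" by (rule min[OF add[OF v wL]]) (use ne in \<open>auto simp: add_eq_0_iff2\<close>)
  ultimately show ?thesis by (simp add: inner_add_left inner_add_right inner_diff_left inner_diff_right inner_commute ww abs_le_iff)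
qed

end

lemma poly_node_poly_Cons: "poly (node_poly (a # as)) t = (t - a) * poly (node_poly as) t"
  by (simp add: node_poly_simps algebra_simps)

section \<open>Determination of the counts, and the minima for shells of E8 and Leech type\<close>

context theta_lattice
begin

lemma moment_const_pos: "shell m \<noteq> {} \<Longrightarrow> m > 0 \<Longrightarrow> moment_const m k > 0"
proof (induction k)
  case 0
  thus ?case using finite_shell[of m] by (simp add: card_gt_0_iff)
next
  case (Suc k)
  thus ?case using h_pos by simp
qed

lemma inner_count_moment:
  assumes min: "\<And>v. v \<in> L \<Longrightarrow> v \<noteq> 0 \<Longrightarrow> 2 * real r \<le> v \<bullet> v" and k: "4 * h + 2 * k < 12 * r"
    and v: "v \<in> L" "v \<noteq> 0" and J: "\<And>w. w \<in> shell m \<Longrightarrow> \<bar>v \<bullet> w\<bar> \<le> of_int J"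
  shows "(\<Sum>j\<in>{-J..J}. inner_count v m j * of_int j ^ (2 * k)) = (v \<bullet> v) ^ k * moment_const m k"
proof -
  have "(\<Sum>w\<in>shell m. (v \<bullet> w) ^ (2 * k)) = (\<Sum>j\<in>{-J..J}. inner_count v m j * of_int j ^ (2 * k))"
    by (rule moment_cnt[OF v(1)]) (use J in simp)
  thus ?thesis using shell_moment[OF min k v(2), of m] by simp
qed

lemma inner_count_self:
  assumes v: "v \<in> shell m"
  shows "inner_count v m (2 * int m) = 1"
proof -
  have "{w \<in> shell m. v \<bullet> w = of_int (2 * int m)} = {v}"
  proof (intro equalityI subsetI)
    fix w assume "w \<in> {w \<in> shell m. v \<bullet> w = of_int (2 * int m)}"
    hence w: "w \<bullet> w = 2 * real m" "v \<bullet> w = 2 * real m" by (simp_all add: shell_def)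
    have "(w - v) \<bullet> (w - v) = 0"
      using v w by (simp add: inner_diff_left inner_diff_right inner_commute shell_def)
    thus "w \<in> {v}" by simp
  qed (use v in \<open>auto simp: shell_def\<close>)
  thus ?thesis by (simp add: inner_count_def)
qed

text \<open>Two minimal vectors that are not parallel have inner product at most r in absolute
  value. For the Leech lattice this removes the unknown count at 3.\<close>

lemma inner_count_gap:
  assumes min: "\<And>v. v \<in> L \<Longrightarrow> v \<noteq> 0 \<Longrightarrow> 2 * real r \<le> v \<bullet> v" and v: "v \<in> shell r" and j: "int r < j" "j < 2 * int r"
  shows "inner_count v r j = 0"
proof -
  have "v \<bullet> w \<noteq> of_int j" if w: "w \<in> shell r" for w
  proof
    assume vw: "v \<bullet> w = of_int j"
    have vv: "v \<in> L" "v \<bullet> v = 2 * real r" using v by (auto simp: shell_def)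
    have "real_of_int j < of_int (2 * int r)" "real_of_int j > of_int (int r)" using j by linarith+
    hence jr: "real_of_int j < 2 * real r" "real_of_int j > real r" by simp_all
    have "v \<noteq> w" "v \<noteq> - w" using vw vv(2) jr by auto
    from inner_bound[OF min vv(1) w this] show False using vw vv jr by simp
  qed
  hence "{w \<in> shell r. v \<bullet> w = of_int j} = {}" by blast
  thus ?thesis by (simp only: inner_count_def card.empty of_nat_0)
qed

lemma inner_shell_le:
  assumes v: "v \<in> shell m" and w: "w \<in> shell m"
  shows "\<bar>v \<bullet> w\<bar> \<le> of_int (2 * int m)"
proof -
  have "0 \<le> (v - w) \<bullet> (v - w)" "0 \<le> (v + w) \<bullet> (v + w)" by simp_all
  thus ?thesis using v w by (simp add: shell_def inner_add_left inner_add_right inner_diff_left inner_diff_right inner_commute abs_le_iff)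
qed

text \<open>This is why the listed point is taken in the direction of the next shell: only 2 r + 3
  inner products with the code are possible there, and their squares are the nodes.\<close>

lemma inner_next_shell_le:
  assumes min: "\<And>v. v \<in> L \<Longrightarrow> v \<noteq> 0 \<Longrightarrow> 2 * real r \<le> v \<bullet> v" and v: "v \<in> shell (Suc r)" and w: "w \<in> shell r"
  shows "\<bar>v \<bullet> w\<bar> \<le> of_int (int (Suc r))"
proof -
  have "v \<noteq> w" "v \<noteq> - w" using v w by (auto simp: shell_def)
  thus ?thesis using inner_bound[OF min _ w, of v] v by (simp add: shell_def)
qed

lemma image_mset_shell:
  assumes v: "v \<in> L" and J: "\<And>w. w \<in> shell m \<Longrightarrow> \<bar>v \<bullet> w\<bar> \<le> of_int J"
  shows "image_mset (\<lambda>w. F (v \<bullet> w)) (mset_set (shell m)) = (\<Sum>j\<in>{-J..J}. replicate_mset (nat \<lfloor>inner_count v m j\<rfloor>) (F (of_int j)))"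
proof -
  have "image_mset (\<lambda>w. F (v \<bullet> w)) (mset_set (shell m)) = (\<Sum>j\<in>{-J..J}. \<Sum>w\<in>{w\<in>shell m. v \<bullet> w = of_int j}. {#F (of_int j)#})"
    unfolding image_mset_conv_sum[OF finite_shell]
    by (rule sum_int_fibers[OF finite_shell]) (use J inner_Ints[OF v] in \<open>auto simp: shell_def\<close>)
  thus ?thesis by (simp add: sum_singleton_mset_const inner_count_def)
qed

text \<open>In the inner product the node polynomial has degree \<open>4 r + 6\<close>, while \<open>shell r\<close> is only a
  design of strength \<open>4 r + 3\<close>: \<open>shell_design_skip\<close> relates the moments of degrees \<open>4 r + 4\<close> and
  \<open>4 r + 6\<close>.\<close>
theorem min_at_listed_point_shell:
  assumes F: "absolutely_monotone F"
    and min: "\<And>v. v \<in> L \<Longrightarrow> v \<noteq> 0 \<Longrightarrow> 2 * real r \<le> v \<bullet> v" and r: "4 * h + (4 * r + 4) = 12 * r"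
    and v: "v \<in> shell (Suc r)"
    and nodes: "length as = 2 * r + 2" "\<forall>b\<in>set as. b \<ge> 0" "sum_list as < (4 * real r + 6) * (4 * real r + 5) / (48 * real r)"
    and pos: "\<And>t. t \<ge> 0 \<Longrightarrow> poly (node_poly (0 # as)) t \<ge> 0"
    and root: "\<And>j. \<bar>j\<bar> \<le> int (Suc r) \<Longrightarrow> poly (node_poly (0 # as)) ((of_int j)\<^sup>2 / (4 * real r * (real r + 1))) = 0"
    and mult: "image_mset (\<lambda>w. v \<bullet> w / sqrt (4 * real r * (real r + 1))) (mset_set (shell r)) = M"
  shows "min_at_listed_point F ((\<lambda>w. (1 / sqrt (2 * real r)) *\<^sub>R w) ` shell r) M"
proof -
  define s where "s = sqrt (2 * real r)"
  have r0: "r > 0" using r by simp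
  have s: "s > 0" "s\<^sup>2 = 2 * real r" using r0 by (simp_all add: s_def)
  define g where "g = (\<lambda>w::'a. (1 / s) *\<^sub>R w)"
  have inj: "inj_on g (shell r)" using s by (auto simp: g_def inj_on_def)
  define xt where "xt = (1 / sqrt (2 * (real r + 1))) *\<^sub>R v"
  have vv: "v \<in> L" "v \<bullet> v = 2 * (real r + 1)" using v by (auto simp: shell_def)
  have nxt: "norm xt = 1" using vv by (simp add: xt_def norm_eq_sqrt_inner)
  have xg: "xt \<bullet> g w = v \<bullet> w / sqrt (4 * real r * (real r + 1))" for w
  proof -
    have "sqrt (4 * real r * (real r + 1)) = sqrt ((2 * real r) * (2 * (real r + 1)))" by (simp add: algebra_simps)
    also have "\<dots> = s * sqrt (2 * (real r + 1))" by (simp only: s_def real_sqrt_mult)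
    finally show ?thesis by (simp add: xt_def g_def)
  qed
  have pw: "(\<Sum>w\<in>shell r. ((x \<bullet> g w)\<^sup>2) ^ i) = (1 / s) ^ (2 * i) * (\<Sum>w\<in>shell r. (x \<bullet> w) ^ (2 * i))" for x i
    by (simp add: g_def power_mult[symmetric] power_mult_distrib power_divide sum_divide_distrib)
  have low: "(\<Sum>w\<in>shell r. ((xt \<bullet> g w)\<^sup>2) ^ k) \<le> (\<Sum>w\<in>shell r. ((x \<bullet> g w)\<^sup>2) ^ k)" if x: "norm x = 1" for x k
  \<comment> \<open>\<open>c\<close> is the constant (d + 2) (d + 1) r / (24 r) of
    \<open>shell_design_skip\<close> for the shell m = r and d = 4 r + 4, divided by the norm 2 r
    because the code is scaled to unit length.\<close>
  proof (rule power_sums_minimal_skip[where a = 0 and as = as and c = "(4 * real r + 6) * (4 * real r + 5) / (48 * real r)"])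
    show "(\<Sum>w\<in>shell r. ((xt \<bullet> g w)\<^sup>2) ^ i) = (\<Sum>w\<in>shell r. ((x \<bullet> g w)\<^sup>2) ^ i)" if i: "i < length as" for i
      unfolding pw using shell_design(1)[OF nxt x min, of "2 * i" r] i nodes(1) r by simp
    let ?d = "4 * r + 4" and ?c = "(4 * real r + 6) * (4 * real r + 5) / (48 * real r)"
    have d: "2 * length as = ?d" "2 * Suc (length as) = ?d + 2" using nodes(1) by simp_all
    have sk: "(\<Sum>w\<in>shell r. ((y \<bullet> g w)\<^sup>2) ^ Suc (length as)) - ?c * (\<Sum>w\<in>shell r. ((y \<bullet> g w)\<^sup>2) ^ length as) =
        (1 / s) ^ (?d + 2) * ((\<Sum>w\<in>shell r. (y \<bullet> w) ^ (?d + 2)) - real ((?d + 2) * (?d + 1)) * real r / (24 * real r) * (\<Sum>w\<in>shell r. (y \<bullet> w) ^ ?d))" for y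
    proof -
      have "?c * (1 / s) ^ ?d = (1 / s) ^ (?d + 2) * (?c * s\<^sup>2)"
        using s(1) by (simp only: power_add) (simp add: power_divide)
      also have "?c * s\<^sup>2 = real ((?d + 2) * (?d + 1)) * real r / (24 * real r)" using r0 s(2) by (simp add: field_simps)
      finally have c: "?c * (1 / s) ^ ?d = (1 / s) ^ (?d + 2) * (real ((?d + 2) * (?d + 1)) * real r / (24 * real r))" .
      have "?c * ((1 / s) ^ ?d * T) = (1 / s) ^ (?d + 2) * (real ((?d + 2) * (?d + 1)) * real r / (24 * real r) * T)" for T
        using arg_cong[OF c, of "\<lambda>z. z * T"] by (simp only: mult.assoc)
      thus ?thesis unfolding pw d by (simp only: right_diff_distrib)
    qed
    show "(\<Sum>w\<in>shell r. ((xt \<bullet> g w)\<^sup>2) ^ Suc (length as)) - ?c * (\<Sum>w\<in>shell r. ((xt \<bullet> g w)\<^sup>2) ^ length as) =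
        (\<Sum>w\<in>shell r. ((x \<bullet> g w)\<^sup>2) ^ Suc (length as)) - ?c * (\<Sum>w\<in>shell r. ((x \<bullet> g w)\<^sup>2) ^ length as)"
      unfolding sk by (rule arg_cong[where f = "\<lambda>z. (1 / s) ^ (?d + 2) * z"], rule shell_design_skip[OF nxt x min r r0])
    show "poly (node_poly (0 # as)) ((xt \<bullet> g w)\<^sup>2) = 0" if w: "w \<in> shell r" for w
    proof -
      have "v \<bullet> w \<in> \<int>" using inner_Ints[OF vv(1)] w by (simp add: shell_def)
      then obtain j where j: "v \<bullet> w = of_int j" by (auto elim: Ints_cases)
      have "\<bar>real_of_int j\<bar> \<le> of_int (int (Suc r))" using inner_next_shell_le[OF min v w] j by simp
      hence "\<bar>j\<bar> \<le> int (Suc r)" by linarith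
      from root[OF this] show ?thesis unfolding xg by (simp add: power_divide j)
    qed
  qed (use nodes pos in auto)
  have gS: "(\<Sum>y\<in>g ` shell r. P y) = (\<Sum>w\<in>shell r. P (g w))" for P :: "'a \<Rightarrow> real"
    by (rule sum.reindex_cong[OF inj refl refl])
  have "min_at_listed_point F (g ` shell r) M"
  proof (rule min_at_listed_pointI[OF F _ _ _ _ _ _])
    show "finite (g ` shell r)" using finite_shell by simp
    show "g ` shell r \<subseteq> sphere 0 1" using s r0 by (auto simp: g_def shell_def norm_eq_sqrt_inner power2_eq_square)
    show "xt \<in> sphere 0 1" using nxt by simp
    show "- y \<in> g ` shell r" if y: "y \<in> g ` shell r" for y
    proof -
      obtain w where "w \<in> shell r" "y = g w" using y by blast
      hence "- y = g (- w)" "- w \<in> shell r" using shell_uminus by (simp_all add: g_def)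
      thus ?thesis by simp
    qed
    show "image_mset (\<lambda>y. xt \<bullet> y) (mset_set (g ` shell r)) = M"
      unfolding image_mset_mset_set[OF inj, symmetric] mult[symmetric] by (simp add: multiset.map_comp o_def xg)
    show "(\<Sum>y\<in>g ` shell r. ((xt \<bullet> y)\<^sup>2) ^ k) \<le> (\<Sum>y\<in>g ` shell r. ((x \<bullet> y)\<^sup>2) ^ k)" if "x \<in> sphere 0 1" for x k
      unfolding gS using low that by simp
  qed
  thus ?thesis by (simp add: g_def s_def)
qed

lemma atLeastAtMost_int_numeral:
  "{-2..2::int} = {-2,-1,0,1,2}" "{-3..3::int} = {-3,-2,-1,0,1,2,3}" "{-4..4::int} = {-4,-3,-2,-1,0,1,2,3,4}"
  by auto

text \<open>The direction is a minimal vector v itself: the counts at 2 and -2 are 1, so the three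
  moment equations determine the counts at 1 and 0 and the size of the shell. Some w is orthogonal
  to v, and v + w then has norm 4.\<close>

lemma E8_second_shell:
  assumes h: "h = 1" and v: "v \<in> shell 1"
  shows "moment_const 1 0 = 240" "shell 2 \<noteq> {}"
proof -
  have min: "2 * real 1 \<le> u \<bullet> u" if "u \<in> L" "u \<noteq> 0" for u
    using half_norm[OF that(1)] that(2) by (cases "half_norm u") auto
  have vv: "v \<in> L" "v \<noteq> 0" "v \<bullet> v = 2" using v by (auto simp: shell_def)
  have J: "\<bar>v \<bullet> w\<bar> \<le> of_int 2" if "w \<in> shell 1" for w using inner_shell_le[OF v that] by simp
  have c: "inner_count v 1 2 = 1" "inner_count v 1 (-2) = 1" "inner_count v 1 (-1) = inner_count v 1 1"
    using inner_count_self[OF v] inner_count_uminus[of v 1 2] inner_count_uminus[of v 1 1] by simp_all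
  have M: "(\<Sum>j\<in>{-2,-1,0,1,2}. inner_count v 1 j * of_int j ^ (2 * k)) = 2 ^ k * moment_const 1 k" if "k \<le> 2" for k
    using inner_count_moment[OF min _ vv(1,2), of k 1 2] J that h unfolding atLeastAtMost_int_numeral vv(3) by simp
  have hr: "real h = 1" using h by simp
  have mcs: "moment_const 1 1 = moment_const 1 0 / 4" "moment_const 1 2 = moment_const 1 0 * 3 / 20"
    by (simp_all add: eval_nat_numeral hr)
  have m0: "2 + 2 * inner_count v 1 1 + inner_count v 1 0 = moment_const 1 0" using M[of 0] by (simp add: c del: One_nat_def)
  have m1: "8 + 2 * inner_count v 1 1 = moment_const 1 0 / 2" using M[of 1] unfolding mcs by (simp add: c del: One_nat_def)
  have m2: "32 + 2 * inner_count v 1 1 = moment_const 1 0 * 3 / 5" using M[of 2] unfolding mcs by (simp add: c del: One_nat_def)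
  show "moment_const 1 0 = 240" using m1 m2 by simp
  have "inner_count v 1 0 > 0" using m0 m1 m2 by linarith
  hence "{w \<in> shell 1. v \<bullet> w = 0} \<noteq> {}" unfolding inner_count_def by (auto simp: card_gt_0_iff)
  then obtain w where w: "w \<in> shell 1" "v \<bullet> w = 0" by blast
  have "v + w \<in> shell 2" using w vv add[OF vv(1)]
    by (auto simp: shell_def inner_add_left inner_add_right inner_commute)
  thus "shell 2 \<noteq> {}" by blast
qed

theorem E8_minimum:
  assumes F: "absolutely_monotone F" and h: "h = 1" and ne: "shell 1 \<noteq> {}"
  shows "min_at_listed_point F ((\<lambda>w. (1 / sqrt 2) *\<^sub>R w) ` shell 1)
         (replicate_mset 14 (- sqrt 2 / 2) +
          replicate_mset 64 (- sqrt 2 / 4) +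
          replicate_mset 84 0 +
          replicate_mset 64 (sqrt 2 / 4) +
          replicate_mset 14 (sqrt 2 / 2))"
proof -
  have min: "2 * real 1 \<le> u \<bullet> u" if "u \<in> L" "u \<noteq> 0" for u
    using half_norm[OF that(1)] that(2) by (cases "half_norm u") auto
  obtain v0 where v0: "v0 \<in> shell 1" using ne by blast
  obtain v where v: "v \<in> shell 2" using E8_second_shell(2)[OF h v0] by blast
  have vv: "v \<in> L" "v \<noteq> 0" "v \<bullet> v = 4" using v by (auto simp: shell_def)
  have v': "v \<in> shell (Suc 1)" using v by (simp add: numeral_2_eq_2)
  have J: "\<bar>v \<bullet> w\<bar> \<le> of_int 2" if "w \<in> shell 1" for w using inner_next_shell_le[OF min v' that] by simp
  have c: "inner_count v 1 (-2) = inner_count v 1 2" "inner_count v 1 (-1) = inner_count v 1 1"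
    using inner_count_uminus[of v 1 2] inner_count_uminus[of v 1 1] by simp_all
  have M: "(\<Sum>j\<in>{-2,-1,0,1,2}. inner_count v 1 j * of_int j ^ (2 * k)) = 4 ^ k * moment_const 1 k" if "k \<le> 2" for k
    using inner_count_moment[OF min _ vv(1,2), of k 1 2] J that h unfolding atLeastAtMost_int_numeral vv(3) by simp
  have hr: "real h = 1" using h by simp
  have "moment_const 1 1 = moment_const 1 0 / 4" "moment_const 1 2 = moment_const 1 0 * 3 / 20"
    by (simp_all add: eval_nat_numeral hr)
  hence mcs: "moment_const 1 0 = 240" "moment_const 1 1 = 60" "moment_const 1 2 = 36"
    using E8_second_shell(1)[OF h v0] by (simp_all del: moment_const.simps One_nat_def)
  have m0: "2 * inner_count v 1 2 + 2 * inner_count v 1 1 + inner_count v 1 0 = 240" using M[of 0] unfolding mcs by (simp add: c del: One_nat_def)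
  have m1: "8 * inner_count v 1 2 + 2 * inner_count v 1 1 = 240" using M[of 1] unfolding mcs by (simp add: c del: One_nat_def)
  have m2: "32 * inner_count v 1 2 + 2 * inner_count v 1 1 = 576" using M[of 2] unfolding mcs by (simp add: c del: One_nat_def)
  have cs: "inner_count v 1 2 = 14" "inner_count v 1 1 = 64" "inner_count v 1 0 = 84" using m0 m1 m2 by linarith+
  have s8: "sqrt 8 = 2 * sqrt 2" using real_sqrt_mult[of 4 2] by simp
  have q: "2 / sqrt 8 = sqrt 2 / 2" "1 / sqrt 8 = sqrt 2 / 4" by (simp_all add: s8 field_simps)
  have "min_at_listed_point F ((\<lambda>w. (1 / sqrt (2 * real 1)) *\<^sub>R w) ` shell 1)
         (replicate_mset 14 (- sqrt 2 / 2) +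
          replicate_mset 64 (- sqrt 2 / 4) +
          replicate_mset 84 0 +
          replicate_mset 64 (sqrt 2 / 4) +
          replicate_mset 14 (sqrt 2 / 2))"
  \<comment> \<open>The squared products are j^2 / 8; the positive ones are double, and the simple
    node 0 is added by the rule. Their sum 5/4 is below 90/48.\<close>
  proof (rule min_at_listed_point_shell[OF F min _ v', where as = "[1/8, 1/8, 1/2, 1/2]"])
    show "poly (node_poly [0, 1/8, 1/8, 1/2, 1/2]) t \<ge> 0" if "t \<ge> 0" for t :: real
    proof -
      have eq: "poly (node_poly [0, 1/8, 1/8, 1/2, 1/2]) t = t * ((t - 1/8)\<^sup>2 * (t - 1/2)\<^sup>2)"
        by (simp only: poly_node_poly_Cons) (simp add: node_poly_simps power2_eq_square)
      show ?thesis unfolding eq by (intro mult_nonneg_nonneg that zero_le_power2)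
    qed
    show "poly (node_poly [0, 1/8, 1/8, 1/2, 1/2]) ((real_of_int j)\<^sup>2 / (4 * real 1 * (real 1 + 1))) = 0" if "\<bar>j\<bar> \<le> int (Suc 1)" for j
    proof -
      have "j \<in> {-2,-1,0,1,2}" using that by auto
      thus ?thesis unfolding poly_node_poly_Cons by auto
    qed
    have "image_mset (\<lambda>w. v \<bullet> w / sqrt 8) (mset_set (shell 1)) = (\<Sum>j\<in>{-2,-1,0,1,2}. replicate_mset (nat \<lfloor>inner_count v 1 j\<rfloor>) (of_int j / sqrt 8))"
      unfolding atLeastAtMost_int_numeral(1)[symmetric] by (rule image_mset_shell[OF vv(1)]) (use J in simp)
    also have "\<dots> = replicate_mset 14 (- sqrt 2 / 2) +
          replicate_mset 64 (- sqrt 2 / 4) +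
          replicate_mset 84 0 +
          replicate_mset 64 (sqrt 2 / 4) +
          replicate_mset 14 (sqrt 2 / 2)"
      by (simp add: c cs q del: One_nat_def)
    finally show "image_mset (\<lambda>w. v \<bullet> w / sqrt (4 * real 1 * (real 1 + 1))) (mset_set (shell 1)) = replicate_mset 14 (- sqrt 2 / 2) +
          replicate_mset 64 (- sqrt 2 / 4) +
          replicate_mset 84 0 +
          replicate_mset 64 (sqrt 2 / 4) +
          replicate_mset 14 (sqrt 2 / 2)" by simp
  qed (simp_all add: h)
  thus ?thesis by simp
qed

text \<open>If the least norm were \<open>2 m\<close> with \<open>m \<ge> 3\<close>, the polynomial \<open>s\<^sup>8 (s\<^sup>2 - m\<^sup>2) (s\<^sup>2 - 4 m\<^sup>2)\<close>
  would be nonnegative at all inner products \<open>s\<close> of minimal vectors, but its average is negative.\<close>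
lemma leech_first_shell:
  assumes h: "h = 3" and no2: "shell 1 = {}"
  shows "shell 2 \<noteq> {}" "v \<in> L \<Longrightarrow> v \<noteq> 0 \<Longrightarrow> 2 * real 2 \<le> v \<bullet> v"
proof -
  have "\<exists>m. m > 0 \<and> shell m \<noteq> {}"
  proof -
    obtain v where v: "v \<in> L" "v \<noteq> 0" using nonzero_vector by blast
    have "half_norm v > 0" using half_norm[OF v(1)] v(2) by (cases "half_norm v") auto
    moreover have "v \<in> shell (half_norm v)" using v(1) half_norm[OF v(1)] by (simp add: shell_def)
    ultimately show ?thesis by blast
  qed
  define m where "m = (LEAST m. m > 0 \<and> shell m \<noteq> {})"
  have m: "m > 0" "shell m \<noteq> {}"
    unfolding m_def using LeastI_ex[OF \<open>\<exists>m. m > 0 \<and> shell m \<noteq> {}\<close>] by auto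
  have min: "2 * real m \<le> v \<bullet> v" if v: "v \<in> L" "v \<noteq> 0" for v
  proof -
    have "half_norm v > 0" using half_norm[OF v(1)] v(2) by (cases "half_norm v") auto
    moreover have "v \<in> shell (half_norm v)" using v(1) half_norm[OF v(1)] by (simp add: shell_def)
    ultimately have "m \<le> half_norm v" unfolding m_def by (intro Least_le) blast
    thus ?thesis using half_norm[OF v(1)] by simp
  qed
  have "m < 3"
  proof (rule ccontr)
    assume "\<not> m < 3"
    hence m3: "m \<ge> 3" by simp
    obtain v where v: "v \<in> shell m" using m by blast
    have vv: "v \<in> L" "v \<bullet> v = 2 * real m" using v by (auto simp: shell_def)
    have v0: "v \<noteq> 0" using vv m by auto
    have tm: "(v \<bullet> w) ^ 12 - 5 * (real m)\<^sup>2 * (v \<bullet> w) ^ 10 + 4 * (real m) ^ 4 * (v \<bullet> w) ^ 8 \<ge> 0" if w: "w \<in> shell m" for w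
    proof -
      define a where "a = (v \<bullet> w)\<^sup>2"
      have "(a - (real m)\<^sup>2) * (a - 4 * (real m)\<^sup>2) \<ge> 0"
      proof (cases "v = w \<or> v = - w")
        case True
        hence "v \<bullet> w = 2 * real m \<or> v \<bullet> w = - (2 * real m)" using vv(2) by auto
        hence "a = 4 * (real m)\<^sup>2" unfolding a_def by (auto simp: power_mult_distrib)
        thus ?thesis by simp
      next
        case False
        have "\<bar>v \<bullet> w\<bar> \<le> real m" using inner_bound[OF min vv(1) w] False vv(2) by simp
        hence "a \<le> (real m)\<^sup>2" unfolding a_def using abs_le_square_iff[of "v \<bullet> w" "real m"] by simp
        thus ?thesis by (intro mult_nonpos_nonpos) (auto intro: order_trans)
      qed
      hence "a ^ 4 * ((a - (real m)\<^sup>2) * (a - 4 * (real m)\<^sup>2)) \<ge> 0" by simp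
      moreover have e: "a ^ 4 * ((a - (real m)\<^sup>2) * (a - 4 * (real m)\<^sup>2)) = a ^ 6 - 5 * (real m)\<^sup>2 * a ^ 5 + 4 * real m ^ 4 * a ^ 4"
        by (simp add: algebra_simps eval_nat_numeral)
      moreover have "(v \<bullet> w) ^ 12 = a ^ 6" "(v \<bullet> w) ^ 10 = a ^ 5" "(v \<bullet> w) ^ 8 = a ^ 4"
        unfolding a_def by (simp_all flip: power_mult)
      ultimately show ?thesis by (simp only:)
    qed
    have hr: "real h = 3" using h by simp
    \<comment> \<open>For m \<ge> 3 the weight 12 + 12 stays below 12 m, so moments up to degree 12
      are available.\<close>
    have P: "(\<Sum>w\<in>shell m. (v \<bullet> w) ^ (2 * k)) = (2 * real m) ^ k * moment_const m k" if "k \<le> 6" for k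
      using shell_moment[OF min _ v0, of k m] that m3 h vv(2) by simp
    have mc5: "moment_const m 5 = moment_const m 4 * (2 * real m) * 9 / 32"
      using moment_const.simps(2)[of m 4] by (simp add: hr del: moment_const.simps)
    have mc6: "moment_const m 6 = moment_const m 4 * (2 * real m)\<^sup>2 * 99 / 1088"
      using moment_const.simps(2)[of m 5] unfolding mc5 by (simp add: hr power2_eq_square del: moment_const.simps)
    have "0 \<le> (\<Sum>w\<in>shell m. (v \<bullet> w) ^ 12 - 5 * (real m)\<^sup>2 * (v \<bullet> w) ^ 10 + 4 * (real m) ^ 4 * (v \<bullet> w) ^ 8)"
      by (intro sum_nonneg tm)
    also have "\<dots> = (\<Sum>w\<in>shell m. (v \<bullet> w) ^ (2 * 6)) - 5 * (real m)\<^sup>2 * (\<Sum>w\<in>shell m. (v \<bullet> w) ^ (2 * 5)) + 4 * (real m) ^ 4 * (\<Sum>w\<in>shell m. (v \<bullet> w) ^ (2 * 4))"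
      by (simp add: sum.distrib sum_subtractf sum_distrib_left)
    also have "\<dots> = (2 * real m) ^ 6 * moment_const m 6 - 5 * (real m)\<^sup>2 * ((2 * real m) ^ 5 * moment_const m 5) + 4 * (real m) ^ 4 * ((2 * real m) ^ 4 * moment_const m 4)"
      by (subst (1 2 3) P) simp_all
    also have "\<dots> = (2 * real m) ^ 6 * (moment_const m 4 * (2 * real m)\<^sup>2 * 99 / 1088) - 5 * (real m)\<^sup>2 * ((2 * real m) ^ 5 * (moment_const m 4 * (2 * real m) * 9 / 32)) + 4 * (real m) ^ 4 * ((2 * real m) ^ 4 * moment_const m 4)"
      unfolding mc5 mc6 ..
    \<comment> \<open>The numerical factor is about -0.17.\<close>
    also have "\<dots> = (16 * 99 / 1088 - 20 * 9 / 32 + 4) * (16 * real m ^ 8 * moment_const m 4)"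
    proof -
      have "(2 * R) ^ 6 * (X * (2 * R)\<^sup>2 * 99 / 1088) - 5 * R\<^sup>2 * ((2 * R) ^ 5 * (X * (2 * R) * 9 / 32)) + 4 * R ^ 4 * ((2 * R) ^ 4 * X)
          = (16 * 99 / 1088 - 20 * 9 / 32 + 4) * (16 * R ^ 8 * X)" for R X :: real
        by algebra
      thus ?thesis .
    qed
    also have "\<dots> < 0" using moment_const_pos[OF m(2,1), of 4] m(1) by (intro mult_neg_pos) simp_all
    finally show False by simp
  qed
  moreover have "m \<noteq> 1" using m(2) no2 by auto
  ultimately have "m = 2" using m(1) by linarith
  thus "shell 2 \<noteq> {}" "v \<in> L \<Longrightarrow> v \<noteq> 0 \<Longrightarrow> 2 * real 2 \<le> v \<bullet> v" using m(2) min by auto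
qed

text \<open>Again the direction is a minimal vector: the counts at 4 and -4 are 1 and those at 3 and
  -3 vanish, so four moment equations determine the counts at 2, 1, 0 and the size of the shell. A
  vector w with v.w = 1 yields v - w of norm 6.\<close>

lemma leech_second_shell:
  assumes h: "h = 3" and no2: "shell 1 = {}"
  shows "moment_const 2 0 = 196560" "shell 3 \<noteq> {}"
proof -
  note min = leech_first_shell(2)[OF h no2]
  obtain v where v: "v \<in> shell 2" using leech_first_shell(1)[OF h no2] by blast
  have vv: "v \<in> L" "v \<noteq> 0" "v \<bullet> v = 4" using v by (auto simp: shell_def)
  have J: "\<bar>v \<bullet> w\<bar> \<le> of_int 4" if "w \<in> shell 2" for w using inner_shell_le[OF v that] by simp
  have c: "inner_count v 2 4 = 1" "inner_count v 2 (-4) = 1" "inner_count v 2 3 = 0" "inner_count v 2 (-3) = 0"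
      "inner_count v 2 (-2) = inner_count v 2 2" "inner_count v 2 (-1) = inner_count v 2 1"
    using inner_count_self[OF v] inner_count_gap[OF min v, of 3] inner_count_uminus[of v 2] by simp_all
  have M: "(\<Sum>j\<in>{-4,-3,-2,-1,0,1,2,3,4}. inner_count v 2 j * of_int j ^ (2 * k)) = 4 ^ k * moment_const 2 k" if "k \<le> 3" for k
    using inner_count_moment[OF min _ vv(1,2), of k 2 4] J that h unfolding atLeastAtMost_int_numeral vv(3) by simp
  have hr: "real h = 3" using h by simp
  have mcs: "moment_const 2 1 = moment_const 2 0 / 6" "moment_const 2 2 = moment_const 2 0 / 13" "moment_const 2 3 = moment_const 2 0 * 5 / 91"
    by (simp_all add: eval_nat_numeral hr)
  have m0: "2 + 2 * inner_count v 2 2 + 2 * inner_count v 2 1 + inner_count v 2 0 = moment_const 2 0" using M[of 0] by (simp add: c del: One_nat_def)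
  have m1: "32 + 8 * inner_count v 2 2 + 2 * inner_count v 2 1 = moment_const 2 0 * 2 / 3" using M[of 1] unfolding mcs by (simp add: c del: One_nat_def)
  have m2: "512 + 32 * inner_count v 2 2 + 2 * inner_count v 2 1 = moment_const 2 0 * 16 / 13" using M[of 2] unfolding mcs by (simp add: c del: One_nat_def)
  have m3: "8192 + 128 * inner_count v 2 2 + 2 * inner_count v 2 1 = moment_const 2 0 * 320 / 91" using M[of 3] unfolding mcs by (simp add: c del: One_nat_def)
  show "moment_const 2 0 = 196560" using m1 m2 m3 by linarith
  have "inner_count v 2 1 > 0" using m1 m2 m3 by linarith
  hence "{w \<in> shell 2. v \<bullet> w = 1} \<noteq> {}" unfolding inner_count_def by (auto simp: card_gt_0_iff)
  then obtain w where w: "w \<in> shell 2" "v \<bullet> w = 1" by blast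
  have "v + - w \<in> shell 3" using w vv add[OF vv(1) neg[of w]]
    by (auto simp: shell_def inner_diff_left inner_diff_right inner_commute)
  thus "shell 3 \<noteq> {}" by blast
qed

text \<open>In the direction of a vector of norm 6 the products are -3, ..., 3, and by symmetry
  there are four unknown counts for four moment equations. Scaling divides the products by sqrt (4 *
  6) = 2 sqrt 6.\<close>

theorem leech_minimum:
  assumes F: "absolutely_monotone F" and h: "h = 3" and no2: "shell 1 = {}"
  shows "min_at_listed_point F ((\<lambda>w. (1 / 2) *\<^sub>R w) ` shell 2)
         (replicate_mset 552 (- sqrt 6 / 4) +
          replicate_mset 11178 (- sqrt 6 / 6) +
          replicate_mset 48600 (- sqrt 6 / 12) +
          replicate_mset 75900 0 +
          replicate_mset 48600 (sqrt 6 / 12) +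
          replicate_mset 11178 (sqrt 6 / 6) +
          replicate_mset 552 (sqrt 6 / 4))" (is "min_at_listed_point _ _ ?M")
proof -
  note min = leech_first_shell(2)[OF h no2]
  obtain v where v: "v \<in> shell 3" using leech_second_shell(2)[OF h no2] by blast
  have vv: "v \<in> L" "v \<noteq> 0" "v \<bullet> v = 6" using v by (auto simp: shell_def)
  have v': "v \<in> shell (Suc 2)" using v by (simp add: numeral_3_eq_3)
  have J: "\<bar>v \<bullet> w\<bar> \<le> of_int 3" if "w \<in> shell 2" for w using inner_next_shell_le[OF min v' that] by simp
  have c: "inner_count v 2 (-3) = inner_count v 2 3" "inner_count v 2 (-2) = inner_count v 2 2" "inner_count v 2 (-1) = inner_count v 2 1"
    using inner_count_uminus[of v 2] by simp_all
  have M: "(\<Sum>j\<in>{-3,-2,-1,0,1,2,3}. inner_count v 2 j * of_int j ^ (2 * k)) = 6 ^ k * moment_const 2 k" if "k \<le> 3" for k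
    using inner_count_moment[OF min _ vv(1,2), of k 2 3] J that h unfolding atLeastAtMost_int_numeral vv(3) by simp
  have hr: "real h = 3" using h by simp
  have "moment_const 2 1 = moment_const 2 0 / 6" "moment_const 2 2 = moment_const 2 0 / 13" "moment_const 2 3 = moment_const 2 0 * 5 / 91"
    by (simp_all add: eval_nat_numeral hr)
  hence mcs: "moment_const 2 0 = 196560" "moment_const 2 1 = 32760" "moment_const 2 2 = 15120" "moment_const 2 3 = 10800"
    using leech_second_shell(1)[OF h no2] by (simp_all del: moment_const.simps)
  have m0: "2 * inner_count v 2 3 + 2 * inner_count v 2 2 + 2 * inner_count v 2 1 + inner_count v 2 0 = 196560" using M[of 0] unfolding mcs by (simp add: c del: One_nat_def)
  have m1: "18 * inner_count v 2 3 + 8 * inner_count v 2 2 + 2 * inner_count v 2 1 = 196560" using M[of 1] unfolding mcs by (simp add: c del: One_nat_def)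
  have m2: "162 * inner_count v 2 3 + 32 * inner_count v 2 2 + 2 * inner_count v 2 1 = 544320" using M[of 2] unfolding mcs by (simp add: c del: One_nat_def)
  have m3: "1458 * inner_count v 2 3 + 128 * inner_count v 2 2 + 2 * inner_count v 2 1 = 2332800" using M[of 3] unfolding mcs by (simp add: c del: One_nat_def)
  have cs: "inner_count v 2 3 = 552" "inner_count v 2 2 = 11178" "inner_count v 2 1 = 48600" "inner_count v 2 0 = 75900" using m0 m1 m2 m3 by linarith+
  have s24: "sqrt 24 = 2 * sqrt 6" using real_sqrt_mult[of 4 6] by simp
  have q: "3 / sqrt 24 = sqrt 6 / 4" "2 / sqrt 24 = sqrt 6 / 6" "1 / sqrt 24 = sqrt 6 / 12" by (simp_all add: s24 field_simps)
  have "min_at_listed_point F ((\<lambda>w. (1 / sqrt (2 * real 2)) *\<^sub>R w) ` shell 2) ?M"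
  \<comment> \<open>Here the squared products are j^2 / 24, and the nodes add up to 7/6, below
    182/96.\<close>
  proof (rule min_at_listed_point_shell[OF F min _ v', where as = "[1/24, 1/24, 1/6, 1/6, 3/8, 3/8]"])
    show "poly (node_poly [0, 1/24, 1/24, 1/6, 1/6, 3/8, 3/8]) t \<ge> 0" if "t \<ge> 0" for t :: real
    proof -
      have eq: "poly (node_poly [0, 1/24, 1/24, 1/6, 1/6, 3/8, 3/8]) t = t * ((t - 1/24)\<^sup>2 * ((t - 1/6)\<^sup>2 * (t - 3/8)\<^sup>2))"
        by (simp only: poly_node_poly_Cons) (simp add: node_poly_simps power2_eq_square)
      show ?thesis unfolding eq by (intro mult_nonneg_nonneg that zero_le_power2)
    qed
    show "poly (node_poly [0, 1/24, 1/24, 1/6, 1/6, 3/8, 3/8]) ((real_of_int j)\<^sup>2 / (4 * real 2 * (real 2 + 1))) = 0" if "\<bar>j\<bar> \<le> int (Suc 2)" for j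
    proof -
      have "j \<in> {-3,-2,-1,0,1,2,3}" using that by auto
      thus ?thesis unfolding poly_node_poly_Cons by auto
    qed
    have "image_mset (\<lambda>w. v \<bullet> w / sqrt 24) (mset_set (shell 2)) = (\<Sum>j\<in>{-3,-2,-1,0,1,2,3}. replicate_mset (nat \<lfloor>inner_count v 2 j\<rfloor>) (of_int j / sqrt 24))"
      unfolding atLeastAtMost_int_numeral(2)[symmetric] by (rule image_mset_shell[OF vv(1)]) (use J in simp)
    also have "\<dots> = ?M" by (simp add: c cs q del: One_nat_def)
    finally show "image_mset (\<lambda>w. v \<bullet> w / sqrt (4 * real 2 * (real 2 + 1))) (mset_set (shell 2)) = ?M" by simp
  qed (simp_all add: h)
  thus ?thesis by simp
qed

end

subsection \<open>The root lattice of type \<open>E\<^sub>8\<close>\<close>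

text \<open>The all-halves vector, the differences e_i - e_7 and 2 e_7: a basis of D8 enlarged by
  the glue vector of halves. Indices are the residues 0, ..., 7.\<close>

definition E8_basis :: "8 \<Rightarrow> real^8" where
  "E8_basis i = (\<chi> j. if i = 0 then 1/2 else if i = 7 then (if j = 7 then 2 else 0) else if j = i then 1 else if j = 7 then - 1 else 0)"

lemma UNIV_8: "(UNIV :: 8 set) = {0,1,2,3,4,5,6,7}"
  by (rule card_subset_eq[symmetric]) auto

lemma prod_8: "(\<Prod>i\<in>(UNIV :: 8 set). f i) = f 0 * f 1 * f 2 * f 3 * f 4 * f 5 * f 6 * f 7" for f :: "8 \<Rightarrow> 'a::comm_monoid_mult"
  unfolding UNIV_8 by (simp add: mult.assoc)

text \<open>In the Leibniz formula row 7 forces p 7 = 7, rows 1 to 6 then force p i = i, and only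
  the identity survives, with diagonal 1/2, six ones and 2.\<close>

lemma det_E8_basis: "det (\<chi> i j. E8_basis i $ j) = 1"
proof -
  let ?A = "(\<chi> i j. E8_basis i $ j) :: real^8^8"
  have only_id: "(\<Prod>i\<in>UNIV. ?A $ i $ p i) = 0" if p: "p permutes UNIV" "p \<noteq> id" for p
  proof (rule ccontr)
    assume "\<not> ?thesis"
    hence nz: "E8_basis i $ p i \<noteq> 0" for i by simp
    have p7: "p 7 = 7" using nz[of 7] by (simp add: E8_basis_def split: if_splits)
    have inj: "inj p" using p(1) by (rule permutes_inj)
    have pi: "p i = i" if "i \<noteq> 0" for i
    proof (cases "i = 7")
      case False
      hence "p i = i \<or> p i = 7" using nz[of i] that by (simp add: E8_basis_def split: if_splits)
      moreover have "p i \<noteq> 7" using injD[OF inj, of i 7] p7 False by auto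
      ultimately show ?thesis by blast
    qed (use p7 in simp)
    have "p 0 = 0" using pi[of "p 0"] injD[OF inj, of "p 0" 0] by auto
    hence "p x = id x" for x using pi[of x] by (cases "x = 0") simp_all
    hence "p = id" by (rule ext)
    thus False using p(2) by blast
  qed
  have "det ?A = (\<Sum>p\<in>{p :: 8 \<Rightarrow> 8. p permutes UNIV}. if p = id then (\<Prod>i\<in>UNIV. ?A $ i $ i) else 0)"
    unfolding det_def by (rule sum.cong[OF refl]) (use only_id in auto)
  also have "\<dots> = (\<Prod>i\<in>UNIV. ?A $ i $ i)"
    by (simp only: sum.delta finite_permutations finite mem_Collect_eq permutes_id if_True)
  also have "\<dots> = 1" by (simp only: prod_8) (simp add: E8_basis_def)
  finally show ?thesis .
qed

lemma gram_E8_basis: "det (\<chi> i j. E8_basis i \<bullet> E8_basis j) = 1"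
proof -
  let ?A = "(\<chi> i j. E8_basis i $ j) :: real^8^8"
  have "(\<chi> i j. E8_basis i \<bullet> E8_basis j) = ?A ** transpose ?A"
    by (simp add: vec_eq_iff matrix_matrix_mult_def transpose_def inner_vec_def)
  thus ?thesis by (simp only: det_mul det_transpose det_E8_basis mult_1)
qed

lemma sum_8: "(\<Sum>i\<in>(UNIV :: 8 set). f i) = f 0 + f 1 + f 2 + f 3 + f 4 + f 5 + f 6 + f 7" for f :: "8 \<Rightarrow> 'a::comm_monoid_add"
  unfolding UNIV_8 by (simp add: add.assoc)

text \<open>The union of D8 and its translate by the all-halves vector, told apart by the parity of
  k. Replacing k by k + 2 changes the sum of the n j by 8, so the evenness condition does not depend
  on the representation.\<close>

lemma E8_lattice:
  "v \<in> lattice_of E8_basis \<longleftrightarrow> (\<exists>(k::int) n. (\<forall>j. v $ j = of_int k / 2 + of_int (n j)) \<and> even (\<Sum>j\<in>UNIV. n j))"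
proof
  assume "v \<in> lattice_of E8_basis"
  then obtain k :: "8 \<Rightarrow> int" where v: "v = (\<Sum>i\<in>UNIV. of_int (k i) *\<^sub>R E8_basis i)" unfolding lattice_of_def by blast
  define n where "n = (\<lambda>j. if j = 0 then 0 else if j = 7 then 2 * k 7 - (k 1 + k 2 + k 3 + k 4 + k 5 + k 6) else k j)"
  have "v $ j = of_int (k 0) / 2 + of_int (n j)" for j
  proof -
    have "j \<in> {0,1,2,3,4,5,6,7}" unfolding UNIV_8[symmetric] by simp
    thus ?thesis unfolding v by (auto simp: sum_8 E8_basis_def n_def)
  qed
  moreover have "even (\<Sum>j\<in>UNIV. n j)" by (simp add: sum_8 n_def)
  ultimately show "\<exists>(k::int) n. (\<forall>j. v $ j = of_int k / 2 + of_int (n j)) \<and> even (\<Sum>j\<in>UNIV. n j)" by blast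
next
  assume "\<exists>(k::int) n. (\<forall>j. v $ j = of_int k / 2 + of_int (n j)) \<and> even (\<Sum>j\<in>UNIV. n j)"
  then obtain k :: int and n where v: "\<And>j. v $ j = of_int k / 2 + of_int (n j)" and ev: "even (\<Sum>j\<in>UNIV. n j)" by blast
  obtain s where s: "(\<Sum>j\<in>UNIV. n j) = 2 * s" using ev by blast
  \<comment> \<open>Solves the coordinate equations backwards; evenness of the coordinate sum is
    what makes the coefficient of 2 e_7 integral.\<close>
  define l where "l = (\<lambda>i. if i = 0 then k + 2 * n 0 else if i = 7 then s - 4 * n 0 else n i - n 0)"
  have rs: "real_of_int (2 * s) = of_int (n 0 + n 1 + n 2 + n 3 + n 4 + n 5 + n 6 + n 7)"
    using s by (simp only: sum_8)
  have "v = (\<Sum>i\<in>UNIV. of_int (l i) *\<^sub>R E8_basis i)"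
  proof (rule iffD2[OF vec_eq_iff], rule allI)
    fix j :: 8
    have "j \<in> {0,1,2,3,4,5,6,7}" unfolding UNIV_8[symmetric] by simp
    thus "v $ j = (\<Sum>i\<in>UNIV. of_int (l i) *\<^sub>R E8_basis i) $ j"
      using rs by (auto simp: v sum_8 E8_basis_def l_def field_simps)
  qed
  thus "v \<in> lattice_of E8_basis" unfolding lattice_of_def by blast
qed

lemma even_sum_power2: "finite A \<Longrightarrow> even (\<Sum>j\<in>A. (n j :: int)\<^sup>2) \<longleftrightarrow> even (\<Sum>j\<in>A. n j)"
  by (simp add: even_sum_iff)

lemma E8_even:
  assumes "v \<in> lattice_of E8_basis"
  shows "\<exists>m::int. v \<bullet> v = 2 * of_int m"
proof -
  obtain k :: int and n where v: "\<And>j. v $ j = of_int k / 2 + of_int (n j)" and ev: "even (\<Sum>j\<in>UNIV. n j)"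
    using assms unfolding E8_lattice by blast
  have "even (\<Sum>j\<in>UNIV. (n j)\<^sup>2)" using ev even_sum_power2[of UNIV n] by simp
  then obtain q where q: "(\<Sum>j\<in>UNIV. (n j)\<^sup>2) = 2 * q" by blast
  obtain s where s: "(\<Sum>j\<in>UNIV. n j) = 2 * s" using ev by blast
  have "v \<bullet> v = (\<Sum>j\<in>UNIV. (of_int k)\<^sup>2 / 4 + of_int k * of_int (n j) + of_int ((n j)\<^sup>2))"
    unfolding inner_vec_def by (rule sum.cong[OF refl]) (simp add: v power2_eq_square field_simps)
  also have "\<dots> = 2 * (of_int k)\<^sup>2 + of_int k * of_int (\<Sum>j\<in>UNIV. n j) + of_int (\<Sum>j\<in>UNIV. (n j)\<^sup>2)"
    by (simp add: sum.distrib sum_distrib_left)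
  also have "\<dots> = 2 * of_int (k\<^sup>2 + k * s + q)" unfolding q s by simp
  finally show ?thesis by blast
qed

text \<open>Relative to the all-halves vector the integer parts are 0 or -1, and -1 exactly at the
  negative coordinates; so the parity of their sum is the parity of the number of minus
  signs.\<close>

lemma E8_half_odd:
  assumes v: "\<forall>j. v $ j = 1/2 \<or> v $ j = - (1/2)"
  shows "(v \<in> lattice_of E8_basis \<longleftrightarrow> even (card {i. v $ i < 0})) \<and> v \<bullet> v = (2::real)"
proof
  have par: "even (\<Sum>j\<in>UNIV. n j) \<longleftrightarrow> even (card {i. v $ i < 0})" if n: "\<forall>j. v $ j = 1/2 + of_int (n j)" for n
  proof -
    have "odd (n j) \<longleftrightarrow> v $ j < 0" for j
    proof (cases "v $ j = 1/2")
      case True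
      thus ?thesis using n[rule_format, of j] by simp
    next
      case False
      hence "v $ j = - (1/2)" using v by blast
      moreover have "n j = -1" using calculation n[rule_format, of j] by simp
      ultimately show ?thesis by simp
    qed
    hence "even (\<Sum>j\<in>UNIV. n j) \<longleftrightarrow> even (card {j \<in> UNIV. v $ j < 0})" by (subst even_sum_iff) simp_all
    thus ?thesis by simp
  qed
  show "v \<in> lattice_of E8_basis \<longleftrightarrow> even (card {i. v $ i < 0})"
  proof
    assume "v \<in> lattice_of E8_basis"
    then obtain k :: int and n where vk: "\<And>j. v $ j = of_int k / 2 + of_int (n j)" and ev: "even (\<Sum>j\<in>UNIV. n j)"
      unfolding E8_lattice by blast
    have "odd k"
    proof
      assume "even k"
      then obtain l where "k = 2 * l" by blast
      hence "real_of_int (2 * (l + n 0)) = 1 \<or> real_of_int (2 * (l + n 0)) = -1" using v[rule_format, of 0] vk[of 0] by auto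
      hence "2 * (l + n 0) = 1 \<or> 2 * (l + n 0) = -1" by linarith
      thus False by presburger
    qed
    then obtain l where l: "k = 2 * l + 1" by (rule oddE)
    have "\<forall>j. v $ j = 1/2 + of_int (n j + l)" by (simp add: vk l field_simps)
    from par[OF this] show "even (card {i. v $ i < 0})" using ev by (simp add: sum.distrib)
  next
    assume e: "even (card {i. v $ i < 0})"
    define n :: "8 \<Rightarrow> int" where "n = (\<lambda>j. if v $ j = 1/2 then 0 else -1)"
    have n: "\<forall>j. v $ j = 1/2 + of_int (n j)"
    proof
      fix j show "v $ j = 1/2 + of_int (n j)" using v[rule_format, of j] by (auto simp: n_def)
    qed
    show "v \<in> lattice_of E8_basis" unfolding E8_lattice
      by (rule exI[of _ 1], rule exI[of _ n]) (use n par[OF n] e in simp)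
  qed
  have "v \<bullet> v = (\<Sum>j\<in>(UNIV::8 set). 1/4)" unfolding inner_vec_def
  proof (rule sum.cong[OF refl])
    fix j show "v $ j \<bullet> v $ j = 1/4" using v[rule_format, of j] by (elim disjE ssubst) simp_all
  qed
  thus "v \<bullet> v = 2" by simp
qed

lemma E8_two_units:
  fixes v :: "real^8"
  assumes v: "card {i. v $ i \<noteq> 0} = 2" "\<forall>i. v $ i = 0 \<or> v $ i = 1 \<or> v $ i = - 1"
  shows "v \<in> lattice_of E8_basis \<and> v \<bullet> v = (2::real)"
proof
  define n where "n = (\<lambda>j. if v $ j = 0 then 0 else if v $ j = 1 then 1 else - 1 :: int)"
  have n: "v $ j = of_int (n j)" for j using v(2)[rule_format, of j] by (auto simp: n_def)
  have o: "odd (n j) \<longleftrightarrow> v $ j \<noteq> 0" for j using v(2)[rule_format, of j] by (auto simp: n_def)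
  have "even (\<Sum>j\<in>UNIV. n j)" by (subst even_sum_iff) (simp_all add: o v(1))
  thus "v \<in> lattice_of E8_basis" unfolding E8_lattice
    by (intro exI[of _ 0] exI[of _ n]) (simp add: n)
  have "v \<bullet> v = (\<Sum>j\<in>UNIV. if v $ j \<noteq> 0 then 1 else 0)" unfolding inner_vec_def
  proof (rule sum.cong[OF refl])
    fix j show "v $ j \<bullet> v $ j = (if v $ j \<noteq> 0 then 1 else 0)" using v(2)[rule_format, of j] by auto
  qed
  also have "\<dots> = real (card {j. v $ j \<noteq> 0})" by (simp add: sum.If_cases)
  finally show "v \<bullet> v = 2" using v(1) by simp
qed

text \<open>For even k the vector is integral with square sum 2, which leaves two entries of
  absolute value 1. For odd k each square is 1/4 + m (m + 1) with m (m + 1) \<ge> 0, and the eight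
  quarters already exhaust the norm.\<close>

lemma E8_roots:
  "v \<in> lattice_of E8_basis \<and> v \<bullet> v = 2 \<longleftrightarrow>
     ((\<forall>i. v $ i = 1/2 \<or> v $ i = - (1/2)) \<and> even (card {i. v $ i < 0})) \<or>
     (card {i. v $ i \<noteq> 0} = 2 \<and> (\<forall>i. v $ i = 0 \<or> v $ i = 1 \<or> v $ i = - 1))" (is "?l \<longleftrightarrow> ?h \<or> ?i")
proof
  assume "?h \<or> ?i"
  thus ?l using E8_half_odd[of v] E8_two_units[of v] by blast
next
  assume l: ?l
  then obtain k :: int and n where v: "\<And>j. v $ j = of_int k / 2 + of_int (n j)" unfolding E8_lattice by blast
  have vv: "(\<Sum>j\<in>UNIV. (v $ j)\<^sup>2) = 2" using l by (simp add: inner_vec_def power2_eq_square)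
  show "?h \<or> ?i"
  proof (cases "even k")
    case True
    then obtain q where q: "k = 2 * q" by blast
    define m where "m = (\<lambda>j. q + n j)"
    have m: "v $ j = of_int (m j)" for j by (simp add: v q m_def)
    have "(\<Sum>j\<in>UNIV. (m j)\<^sup>2) = 2"
    proof -
      have "real_of_int (\<Sum>j\<in>UNIV. (m j)\<^sup>2) = of_int 2" using vv by (simp add: m)
      thus ?thesis by (simp only: of_int_eq_iff)
    qed
    have mu: "m j = 0 \<or> m j = 1 \<or> m j = - 1" for j
    proof -
      have "(m j)\<^sup>2 \<le> (\<Sum>j\<in>UNIV. (m j)\<^sup>2)" by (rule member_le_sum) simp_all
      hence "\<bar>m j\<bar>\<^sup>2 < 2\<^sup>2" using \<open>(\<Sum>j\<in>UNIV. (m j)\<^sup>2) = 2\<close> by simp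
      hence "\<bar>m j\<bar> < 2" by (rule power_less_imp_less_base) simp
      thus ?thesis by auto
    qed
    have "2 = (\<Sum>j\<in>UNIV. if v $ j \<noteq> 0 then 1 else 0 :: real)" unfolding vv[symmetric]
    proof (rule sum.cong[OF refl])
      fix j show "(v $ j)\<^sup>2 = (if v $ j \<noteq> 0 then 1 else 0)" using mu[of j] by (auto simp: m)
    qed
    also have "\<dots> = real (card {j. v $ j \<noteq> 0})" by (simp add: sum.If_cases)
    finally have "card {j. v $ j \<noteq> 0} = 2" by simp
    moreover have "v $ i = 0 \<or> v $ i = 1 \<or> v $ i = - 1" for i using mu[of i] by (auto simp: m)
    ultimately show ?thesis by blast
  next
    case False
    then obtain q where q: "k = 2 * q + 1" by (rule oddE)
    define m where "m = (\<lambda>j. q + n j)"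
    have m: "v $ j = 1/2 + of_int (m j)" for j by (simp add: v q m_def field_simps)
    have sq: "(v $ j)\<^sup>2 = 1/4 + of_int (m j * (m j + 1))" for j
      by (simp add: m power2_eq_square field_simps)
    have mm: "m j * (m j + 1) \<ge> 0" for j
      by (cases "m j \<ge> 0") (auto intro: mult_nonneg_nonneg mult_nonpos_nonpos)
    have "real_of_int (\<Sum>j\<in>UNIV. m j * (m j + 1)) = 0" using vv by (simp add: sq sum.distrib del: of_int_mult of_int_add)
    hence "(\<Sum>j\<in>UNIV. m j * (m j + 1)) = 0" by (simp only: of_int_eq_0_iff)
    hence m0: "m j * (m j + 1) = 0" for j using mm by (subst (asm) sum_nonneg_eq_0_iff) simp_all
    have "v $ j = 1/2 \<or> v $ j = - (1/2)" for j
    proof -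
      have "m j = 0 \<or> m j = - 1" using m0[of j] by (simp add: add_eq_0_iff2)
      thus ?thesis using m[of j] by auto
    qed
    hence h: "\<forall>j. v $ j = 1/2 \<or> v $ j = - (1/2)" by blast
    thus ?thesis using E8_half_odd[OF h] l by blast
  qed
qed

lemma E8_code_eq: "E8_code = (\<lambda>w. (1 / sqrt 2) *\<^sub>R w) ` {w \<in> lattice_of E8_basis. w \<bullet> w = 2}"
proof -
  have s8: "sqrt 8 = 2 * sqrt 2" using real_sqrt_mult[of 4 2] by simp
  have e: "(a = 1 / sqrt 8) = (sqrt 2 * a = 1/2)" "(a = - 1 / sqrt 8) = (sqrt 2 * a = - (1/2))"
     "(a = 1 / sqrt 2) = (sqrt 2 * a = 1)" "(a = - 1 / sqrt 2) = (sqrt 2 * a = - 1)" for a :: real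
    unfolding s8 by (auto simp: field_simps)
  have z: "(a = 0) = (sqrt 2 * a = 0)" "(a < 0) = (sqrt 2 * a < 0)" for a :: real by (auto simp: mult_less_0_iff)
  have "E8_code = {v. sqrt 2 *\<^sub>R v \<in> lattice_of E8_basis \<and> (sqrt 2 *\<^sub>R v) \<bullet> (sqrt 2 *\<^sub>R v) = 2}"
    unfolding E8_code_def E8_roots vector_scaleR_component real_scaleR_def
    unfolding e z[symmetric] by (rule Collect_disj_eq[symmetric])
  also have "\<dots> = (\<lambda>w. (1 / sqrt 2) *\<^sub>R w) ` {w \<in> lattice_of E8_basis. w \<bullet> w = 2}"
  proof (intro equalityI subsetI)
    fix v assume "v \<in> {v. sqrt 2 *\<^sub>R v \<in> lattice_of E8_basis \<and> (sqrt 2 *\<^sub>R v) \<bullet> (sqrt 2 *\<^sub>R v) = 2}"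
    thus "v \<in> (\<lambda>w. (1 / sqrt 2) *\<^sub>R w) ` {w \<in> lattice_of E8_basis. w \<bullet> w = 2}"
      by (intro image_eqI[of _ _ "sqrt 2 *\<^sub>R v"]) auto
  qed (auto simp del: inner_scaleR_left inner_scaleR_right)
  finally show ?thesis .
qed

theorem theorem5p1:
  fixes h :: "real \<Rightarrow> ereal"
  assumes "absolutely_monotone h"
  shows
   "(\<forall>f :: real^3 \<Rightarrow> real^3. orthogonal_transformation f \<longrightarrow>
       min_at_listed_point h (f ` icosahedron_std)
         (replicate_mset 3 (- sqrt ((1 + 2 / sqrt 5) / 3)) +
          replicate_mset 3 (- sqrt ((1 - 2 / sqrt 5) / 3)) +
          replicate_mset 3 (sqrt ((1 - 2 / sqrt 5) / 3)) +
          replicate_mset 3 (sqrt ((1 + 2 / sqrt 5) / 3)))) \<and>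
    (\<forall>f :: real^3 \<Rightarrow> real^3. orthogonal_transformation f \<longrightarrow>
       min_at_listed_point h (f ` dodecahedron_std)
         (replicate_mset 5 (- sqrt ((1 + 2 / sqrt 5) / 3)) +
          replicate_mset 5 (- sqrt ((1 - 2 / sqrt 5) / 3)) +
          replicate_mset 5 (sqrt ((1 - 2 / sqrt 5) / 3)) +
          replicate_mset 5 (sqrt ((1 + 2 / sqrt 5) / 3)))) \<and>
    min_at_listed_point h E8_code
         (replicate_mset 14 (- sqrt 2 / 2) +
          replicate_mset 64 (- sqrt 2 / 4) +
          replicate_mset 84 0 +
          replicate_mset 64 (sqrt 2 / 4) +
          replicate_mset 14 (sqrt 2 / 2)) \<and>
    (\<forall>b. leech_basis b \<longrightarrow>
       min_at_listed_point h (leech_code b)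
         (replicate_mset 552 (- sqrt 6 / 4) +
          replicate_mset 11178 (- sqrt 6 / 6) +
          replicate_mset 48600 (- sqrt 6 / 12) +
          replicate_mset 75900 0 +
          replicate_mset 48600 (sqrt 6 / 12) +
          replicate_mset 11178 (sqrt 6 / 6) +
          replicate_mset 552 (sqrt 6 / 4)))"
proof (intro conjI allI impI)
  interpret E8: theta_lattice "lattice_of E8_basis" 1
    by (rule theta_lattice_unimodular[OF gram_E8_basis E8_even]) simp_all
  have sh: "E8.shell 1 = {w \<in> lattice_of E8_basis. w \<bullet> w = 2}" by (simp add: E8.shell_def)
  \<comment> \<open>The all-halves vector has no minus sign, hence evenly many.\<close>
  have "(\<chi> j. 1/2) \<in> E8.shell 1" unfolding sh mem_Collect_eq E8_roots by simp
  hence "E8.shell 1 \<noteq> {}" by blast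
  from E8.E8_minimum[OF assms refl this]
  show "min_at_listed_point h E8_code
         (replicate_mset 14 (- sqrt 2 / 2) +
          replicate_mset 64 (- sqrt 2 / 4) +
          replicate_mset 84 0 +
          replicate_mset 64 (sqrt 2 / 4) +
          replicate_mset 14 (sqrt 2 / 2))"
    unfolding sh E8_code_eq .
next
  fix b :: "24 \<Rightarrow> real^24" assume b: "leech_basis b"
  interpret theta_lattice "lattice_of b" 3
    by (rule theta_lattice_unimodular) (use b in \<open>simp_all add: leech_basis_def\<close>)
  have no2: "shell 1 = {}" using b by (auto simp: shell_def leech_basis_def)
  have sh: "leech_code b = (\<lambda>w. (1 / 2) *\<^sub>R w) ` shell 2" by (simp add: leech_code_def shell_def)
  show "min_at_listed_point h (leech_code b)
         (replicate_mset 552 (- sqrt 6 / 4) +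
          replicate_mset 11178 (- sqrt 6 / 6) +
          replicate_mset 48600 (- sqrt 6 / 12) +
          replicate_mset 75900 0 +
          replicate_mset 48600 (sqrt 6 / 12) +
          replicate_mset 11178 (sqrt 6 / 6) +
          replicate_mset 552 (sqrt 6 / 4))"
    unfolding sh by (rule leech_minimum[OF assms refl no2])
qed (rule min_at_listed_point_orthogonal, assumption,
     rule icosahedron_minimum[OF assms, unfolded value_a_def value_b_def] dodecahedron_minimum[OF assms, unfolded value_a_def value_b_def])+

end
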